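(* Let $m\in\mathbb{N}$, $x_0\in\mathbb{R}$, $a>0$, and let $\phi_k\in L^1_{\mathrm{loc}}(\mathbb{R})^{m\times m}$ with $\phi_k(x)=\phi_k(x)^*$ for a.e. $x\in\mathbb{R}$, $k=1,2$. For $k=1,2$ let $H_{1,k}=A_k^*A_k$ be the generalized Schrödinger operator in $L^2(\mathbb{R})^m$ with coefficient $\phi_k$ and let $\widehat{\mathbf M}_{1,k}(z,x_0)$ be its $2m\times2m$ Weyl--Titchmarsh matrix (see context). Choose the branch of the square root with $\operatorname{Im}(z^{1/2})>0$ for $z\in\mathbb{C}\setminus[0,\infty)$. (1) If $\phi_1(x)=\phi_2(x)$ for a.e. $x\in(x_0-a,x_0+a)$, then $$\big\|\widehat{\mathbf M}_{1,1}(z,x_0)-\widehat{\mathbf M}_{1,2}(z,x_0)\big\|_{\mathbb{C}^{2m\times2m}}=O\big(z^{1/2}e^{-2\operatorname{Im}(z^{1/2})a}\big)\quad\text{as }|z|\to\infty,\ z\in\rho_\theta,$$ along any ray $\rho_\theta\subset\mathbb{C}$ given by $\arg(z)=\theta$ with $\theta\in(0,\pi)\cup(\pi,2\pi)$. (2) Conversely, suppose that for all $\varepsilon>0$, $$\big\|\widehat{\mathbf M}_{1,1}(z,x_0)-\widehat{\mathbf M}_{1,2}(z,x_0)\big\|_{\mathbb{C}^{2m\times2m}}=O\big(z^{1/2}e^{-2\operatorname{Im}(z^{1/2})(a-\varepsilon)}\big)\quad\text{as }|z|\to\infty,\ z\in\rho_{\theta_\ell},\ \ell=1,2,$$ along a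 ray $\rho_{\theta_1}$ given by $\arg(z)=\theta_1$ with $0<\theta_1<\pi$ and along a ray $\rho_{\theta_2}$ given by $\arg(z)=\theta_2$ with $\pi<\theta_2<2\pi$. If $m>1$, assume in addition that $\phi_k\in L^\infty([x_0-a,x_0+a])^{m\times m}$, $k=1,2$. Then $$\phi_1(x)=\phi_2(x)\quad\text{for a.e. }x\in[x_0-a,x_0+a].$$
   Context: For a coefficient $\phi=\phi^*\in L^1_{\mathrm{loc}}(\mathbb{R})^{m\times m}$: let $Au=u'+\phi u$ in $L^2(\mathbb{R})^m$ with domain $\{v\in L^2(\mathbb{R})^m: v$ locally absolutely continuous, $v'+\phi v\in L^2(\mathbb{R})^m\}$, and $H_1=A^*A$ ($A_k$ and $H_{1,k}$ denote $A$ and $H_1$ with $\phi=\phi_k$). Let $\mathcal{D}=\begin{pmatrix}0&-I_m\frac{d}{dx}+\phi\\ I_m\frac{d}{dx}+\phi&0\end{pmatrix}$ and let $\Psi(\zeta,\cdot,x_0)$ be the $2m\times2m$ locally absolutely continuous solution of $\mathcal{D}\Psi=\zeta\Psi$ a.e. with $\Psi(\zeta,x_0,x_0)=I_{2m}$. For $\zeta\in\mathbb{C}\setminus\mathbb{R}$ the space of solutions of $\mathcal{D}V=\zeta V$ that are in $L^2$ on the half-line from $x_0$ to $\pm\infty$ is known to have dimension $m$ (limit point case at $\pm\infty$), and $M^D_\pm(\zeta,x_0)\in\mathbb{C}^{m\times m}$ is determined by requiring that the $m$ columns of $\Psi(\zeta,\cdot,x_0)\begin{pmatrix}I_m\\ M^D_\pm(\zeta,x_0)\end{pmatrix}$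 span this space. For $z=\zeta^2$, $\zeta\in\mathbb{C}\setminus\mathbb{R}$, the generalized Dirichlet-type half-line Weyl--Titchmarsh matrices of $H_1$ are $\widehat M_\pm(z)=\widehat M_{\pm,0,1}(z,x_0)=\zeta M^D_\pm(\zeta,x_0)$ (independent of the choice of the root $\zeta$). With $W(z)=\widehat M_-(z)-\widehat M_+(z)$, the $2m\times2m$ Weyl--Titchmarsh matrix of $H_1$ is $$\widehat{\mathbf M}_1(z,x_0)=\begin{pmatrix}W(z)^{-1}&\tfrac12W(z)^{-1}[\widehat M_-(z)+\widehat M_+(z)]\\ \tfrac12[\widehat M_-(z)+\widehat M_+(z)]W(z)^{-1}&\widehat M_\pm(z)W(z)^{-1}\widehat M_\mp(z)\end{pmatrix},\quad z\in\mathbb{C}\setminus\mathbb{R}$$ (both sign choices in the lower right corner agree). $\widehat{\mathbf M}_{1,k}(z,x_0)$ denotes this matrix for $\phi=\phi_k$, $k=1,2$. *)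

theory Defs
  imports "HOL-Analysis.Analysis" "HOL-Library.Landau_Symbols"
begin

text \<open>
  The index type \<open>'m + 'm\<close> plays the role of \<open>{1,\<dots>,2m}\<close>, with \<open>Inl\<close> for the first and
  \<open>Inr\<close> for the last \<open>m\<close> indices.
\<close>

definition block ::
    "'a^'m^'m \<Rightarrow> 'a^'m^'m \<Rightarrow> 'a^'m^'m \<Rightarrow> 'a^'m^'m \<Rightarrow> 'a^('m::finite + 'm)^('m + 'm)" where
  "block P Q R S = (\<chi> i j.
     case i of
       Inl k \<Rightarrow> (case j of Inl l \<Rightarrow> P $ k $ l | Inr l \<Rightarrow> Q $ k $ l)
     | Inr k \<Rightarrow> (case j of Inl l \<Rightarrow> R $ k $ l | Inr l \<Rightarrow> S $ k $ l))"

definition stack :: "'a^'m^'m \<Rightarrow> 'a^'m^'m \<Rightarrow> 'a^'m^('m::finite + 'm)" where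
  "stack P Q = (\<chi> i. case i of Inl k \<Rightarrow> P $ k | Inr k \<Rightarrow> Q $ k)"

definition smult_matrix :: "complex \<Rightarrow> complex^'n^'k \<Rightarrow> complex^'n^'k" where
  "smult_matrix c = map_matrix ((*) c)"

definition adjoint_matrix :: "complex^'m^'m \<Rightarrow> complex^'m^'m" where
  "adjoint_matrix P = transpose (map_matrix cnj P)"

definition L1_loc :: "(real \<Rightarrow> 'b::euclidean_space) \<Rightarrow> bool" where
  "L1_loc f \<longleftrightarrow> (\<forall>a b. f absolutely_integrable_on {a..b})"

text \<open>
  Absolute continuity on \<open>[a,b]\<close>. A finite family of non-overlapping compact subintervals is a
  division \<open>\<K>\<close> of its union \<open>S\<close>; a member \<open>K\<close> is the interval from \<open>Inf K\<close> to \<open>Sup K\<close>.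
\<close>

definition abs_cont_on :: "real \<Rightarrow> real \<Rightarrow> (real \<Rightarrow> 'b::real_normed_vector) \<Rightarrow> bool" where
  "abs_cont_on a b f \<longleftrightarrow>
     (\<forall>\<epsilon>>0. \<exists>\<delta>>0. \<forall>\<K> S. \<K> division_of S \<and> S \<subseteq> {a..b} \<and> (\<Sum>K\<in>\<K>. Sup K - Inf K) < \<delta>
        \<longrightarrow> (\<Sum>K\<in>\<K>. norm (f (Sup K) - f (Inf K))) < \<epsilon>)"

definition loc_abs_cont :: "(real \<Rightarrow> 'b::real_normed_vector) \<Rightarrow> bool" where
  "loc_abs_cont f \<longleftrightarrow> (\<forall>a b. abs_cont_on a b f)"

text \<open>
  \<open>\<D> V = (0, -I; I, 0) V' + (0, \<phi>; \<phi>, 0) V\<close>.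
\<close>

definition dirac ::
    "(real \<Rightarrow> complex^'m^'m) \<Rightarrow> (real \<Rightarrow> complex^('m::finite + 'm)) \<Rightarrow> real \<Rightarrow> complex^('m + 'm)" where
  "dirac \<phi> V x =
     block 0 (- mat 1) (mat 1) 0 *v vector_derivative V (at x) + block 0 (\<phi> x) (\<phi> x) 0 *v V x"

definition dirac_solution ::
    "(real \<Rightarrow> complex^'m^'m) \<Rightarrow> complex \<Rightarrow> (real \<Rightarrow> complex^('m::finite + 'm)) \<Rightarrow> bool" where
  "dirac_solution \<phi> \<zeta> V \<longleftrightarrow>
     loc_abs_cont V \<and> (AE x in lebesgue. V differentiable (at x) \<and> dirac \<phi> V x = \<zeta> *s V x)"

definition dirac_fundamental ::
    "(real \<Rightarrow> complex^'m^'m) \<Rightarrow> complex \<Rightarrow> real \<Rightarrow> real \<Rightarrow> complex^('m::finite + 'm)^('m + 'm)" where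
  "dirac_fundamental \<phi> \<zeta> x\<^sub>0 =
     (THE \<Psi>. (\<forall>j. dirac_solution \<phi> \<zeta> (\<lambda>x. column j (\<Psi> x))) \<and> \<Psi> x\<^sub>0 = mat 1)"

definition L2_solutions ::
    "(real \<Rightarrow> complex^'m^'m) \<Rightarrow> complex \<Rightarrow> real set \<Rightarrow> (real \<Rightarrow> complex^('m::finite + 'm)) set" where
  "L2_solutions \<phi> \<zeta> J =
     {V. dirac_solution \<phi> \<zeta> V \<and> (\<lambda>x. (norm (V x))\<^sup>2) absolutely_integrable_on J}"

text \<open>
  \<open>J\<close> is one of the half-lines \<open>{x\<^sub>0..}\<close> (sign \<open>+\<close>) and \<open>{..x\<^sub>0}\<close> (sign \<open>-\<close>). The functions
  \<open>x \<mapsto> U x *v c\<close>, \<open>c \<in> \<complex>\<^sup>m\<close>, form the complex linear span of the columns of \<open>U\<close>.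
\<close>

definition weyl_dirac ::
    "(real \<Rightarrow> complex^'m^'m) \<Rightarrow> complex \<Rightarrow> real \<Rightarrow> real set \<Rightarrow> complex^'m^'m::finite" where
  "weyl_dirac \<phi> \<zeta> x\<^sub>0 J =
     (THE M. range (\<lambda>c x. (dirac_fundamental \<phi> \<zeta> x\<^sub>0 x ** stack (mat 1) M) *v c)
             = L2_solutions \<phi> \<zeta> J)"

text \<open>
  The square root with positive imaginary part on \<open>\<complex> - [0,\<infinity>)\<close>: \<^const>\<open>csqrt\<close> has positive real
  part off \<open>(-\<infinity>,0]\<close>.
\<close>

definition sqrt_up :: "complex \<Rightarrow> complex" where
  "sqrt_up z = \<i> * csqrt (- z)"

lemma sqrt_up_square: "(sqrt_up z)\<^sup>2 = z"
  by (simp add: sqrt_up_def power_mult_distrib)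

lemma Im_sqrt_up_pos:
  assumes "z \<notin> \<real>\<^sub>\<ge>\<^sub>0"
  shows "0 < Im (sqrt_up z)"
proof -
  have "Re (csqrt (- z)) \<noteq> 0"
  proof
    assume "Re (csqrt (- z)) = 0"
    then have "(csqrt (- z))\<^sup>2 = - complex_of_real ((Im (csqrt (- z)))\<^sup>2)"
      by (simp only: complex_eq_iff power2_eq_square) (simp del: csqrt.sel)
    then have "z = complex_of_real ((Im (csqrt (- z)))\<^sup>2)"
      by (simp del: csqrt.sel)
    moreover have "complex_of_real ((Im (csqrt (- z)))\<^sup>2) \<in> \<real>\<^sub>\<ge>\<^sub>0"
      by (subst nonneg_Reals_of_real_iff) (rule zero_le_power2)
    ultimately show False using assms by metis
  qed
  then show ?thesis
    using csqrt_principal[of "- z"] by (auto simp: sqrt_up_def simp del: csqrt.sel)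
qed

text \<open>
  \<open>\<zeta> M\<^sup>D(\<zeta>)\<close> with \<open>\<zeta>\<^sup>2 = z\<close> is the same for both roots: \<open>(V\<^sub>1,V\<^sub>2) \<mapsto> (V\<^sub>1,-V\<^sub>2)\<close> maps solutions
  for \<open>\<zeta>\<close> to solutions for \<open>-\<zeta>\<close>.
\<close>

definition weyl_half ::
    "(real \<Rightarrow> complex^'m^'m) \<Rightarrow> complex \<Rightarrow> real \<Rightarrow> real set \<Rightarrow> complex^'m^'m::finite" where
  "weyl_half \<phi> z x\<^sub>0 J = smult_matrix (sqrt_up z) (weyl_dirac \<phi> (sqrt_up z) x\<^sub>0 J)"

definition weyl_matrix ::
    "(real \<Rightarrow> complex^'m^'m) \<Rightarrow> complex \<Rightarrow> real \<Rightarrow> complex^('m::finite + 'm)^('m + 'm)" where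
  "weyl_matrix \<phi> z x\<^sub>0 =
     (let Mp = weyl_half \<phi> z x\<^sub>0 {x\<^sub>0..};
          Mm = weyl_half \<phi> z x\<^sub>0 {..x\<^sub>0};
          Wi = matrix_inv (Mm - Mp)
      in block Wi                                     (smult_matrix (1/2) (Wi ** (Mm + Mp)))
               (smult_matrix (1/2) ((Mm + Mp) ** Wi)) (Mp ** Wi ** Mm))"

definition ray_at_infinity :: "real \<Rightarrow> complex filter" where
  "ray_at_infinity \<theta> = inf at_infinity (principal {z. z \<noteq> 0 \<and> Arg2pi z = \<theta>})"

end

(*
  In the coordinates p = V1 + i V2, q = V1 - i V2 the Dirac system reads p' = -i z p - phi q, q' = i z q - phi p,
  and the energy |p|^2 - |q|^2 increases for Im z > 0. Hence a solution is square integrable at +infinity iff its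
  energy is never positive; a compactness argument gives an m-dimensional space of such solutions, which is the
  graph of M_+. Gronwall estimates for |p| and |q| show that Weyl solutions decay like exp(-Im z x), that solutions
  with nonnegative energy grow like exp(Im z x), and that M_+ tends to i along nonreal rays. This yields the direct
  part: the difference of two Weyl solutions with equal first component solves the common system and grows, while
  both solutions are exponentially small at x0 + a. The left half-line follows by reflection.

  For the converse let Psi_1, Psi_2 be the fundamental matrices and T(z) = Psi_1(z,d) Psi_2(z,d)^(-1) for
  x0 < d < x0 + a. It is entire of exponential type and bounded on the real axis, and the hypothesis makes it bounded
  on one nonreal ray; by Phragmen-Lindelof and Liouville it does not depend on z. The asymptotics of the Weyl
  solutions make the constant block diagonal, diag(c(d),c(d)). At z = 0 the system decouples into y' = -phi y and
  w' = phi w, so that c = Y1 W2^* = W1 Y2^* solves both c' = -phi_1 c + c phi_2 and c' = phi_1 c - c phi_2. Therefore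
  c' = 0, c = 1 and phi_1 = phi_2.
*)

theory Submission
  imports Defs "HOL-Complex_Analysis.Conformal_Mappings"
begin

section \<open>Absolutely continuous functions\<close>

text \<open>The coefficients are only locally integrable, so every estimate is a Gronwall argument
  for absolutely continuous functions, and analyticity in the spectral parameter is read off the
  Picard series. The Weyl matrices are definite descriptions: they mean nothing until existence and
  uniqueness are proved. p and q are the amplitudes that grow and decay freely; \<phi> only couples
  them, with total strength bounded by its integral. The obstacle in the converse is that the
  hypothesis concerns the large matrix. Its upper row consists of W^-1 and W^-1 (M_- + M_+) / 2,
  which determine both half-line matrices at the cost of powers of the spectral parameter; these are
  absorbed by the free \<epsilon>. T is bounded on the ray because data at d split into left and
  right Weyl data. Left data shrink towards x0 as much as they can grow again. For right data the
  mismatch of the two Weyl matrices at x0 is amplified at most by exp(2 Im z (d - x0)), up to a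
  constant, which the hypothesis beats because d < x0 + a. The bound reaches the lower half-plane
  through (V1, V2) -> (V1, -V2), which changes the sign of z.\<close>

lemma division_member_Inf_Sup:
  fixes a b :: real
  assumes "\<K> division_of S" "S \<subseteq> {a..b}" "K \<in> \<K>"
  shows "K = {Inf K..Sup K}" "Inf K \<le> Sup K" "Inf K \<in> {a..b}" "Sup K \<in> {a..b}"
proof -
  obtain u v where K: "K = cbox u v" using assms division_ofD(4) by blast
  have ne: "K \<noteq> {}" using assms division_ofD(3) by blast
  have sub: "K \<subseteq> {a..b}" using assms division_ofD(2) by blast
  have uv: "u \<le> v" using K ne by auto
  then show "K = {Inf K..Sup K}" "Inf K \<le> Sup K" "Inf K \<in> {a..b}" "Sup K \<in> {a..b}"
    using K sub by auto
qed

text \<open>Absolute continuity only sees increments, so a bound on the increments of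
  \<open>h\<close> transfers it. Linear images, sums, products and exponentials all go through this
  one estimate.\<close>

lemma abs_cont_on_dominated:
  fixes f :: "real \<Rightarrow> 'a::real_normed_vector" and g :: "real \<Rightarrow> 'b::real_normed_vector"
    and h :: "real \<Rightarrow> 'c::real_normed_vector"
  assumes f: "abs_cont_on a b f" and g: "abs_cont_on a b g"
    and le: "\<And>x y. \<lbrakk>x \<in> {a..b}; y \<in> {a..b}\<rbrakk> \<Longrightarrow> norm (h x - h y) \<le> C * (norm (f x - f y) + norm (g x - g y))"
  shows "abs_cont_on a b h"
  unfolding abs_cont_on_def
proof (intro allI impI)
  fix e :: real assume e: "e > 0"
  \<comment> \<open>\<open>D\<close> replaces \<open>C\<close> by a positive constant, so that the
    tolerance e / (2 D) makes sense for any sign of \<open>C\<close>.\<close>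
  define D where "D = \<bar>C\<bar> + 1"
  have D: "D > 0" "C \<le> D" by (auto simp: D_def)
  have e': "e / (2 * D) > 0" using e D by simp
  obtain d1 where d1: "d1 > 0" and F: "\<And>\<K> S. \<K> division_of S \<and> S \<subseteq> {a..b} \<and> (\<Sum>K\<in>\<K>. Sup K - Inf K) < d1
        \<longrightarrow> (\<Sum>K\<in>\<K>. norm (f (Sup K) - f (Inf K))) < e / (2 * D)"
    using f e' unfolding abs_cont_on_def by meson
  obtain d2 where d2: "d2 > 0" and G: "\<And>\<K> S. \<K> division_of S \<and> S \<subseteq> {a..b} \<and> (\<Sum>K\<in>\<K>. Sup K - Inf K) < d2
        \<longrightarrow> (\<Sum>K\<in>\<K>. norm (g (Sup K) - g (Inf K))) < e / (2 * D)"
    using g e' unfolding abs_cont_on_def by meson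
  show "\<exists>\<delta>>0. \<forall>\<K> S. \<K> division_of S \<and> S \<subseteq> {a..b} \<and> (\<Sum>K\<in>\<K>. Sup K - Inf K) < \<delta>
        \<longrightarrow> (\<Sum>K\<in>\<K>. norm (h (Sup K) - h (Inf K))) < e"
  proof (intro exI[of _ "min d1 d2"] conjI allI impI)
    show "min d1 d2 > 0" using d1 d2 by simp
    fix \<K> S assume A: "\<K> division_of S \<and> S \<subseteq> {a..b} \<and> (\<Sum>K\<in>\<K>. Sup K - Inf K) < min d1 d2"
    have "(\<Sum>K\<in>\<K>. norm (h (Sup K) - h (Inf K)))
        \<le> (\<Sum>K\<in>\<K>. D * (norm (f (Sup K) - f (Inf K)) + norm (g (Sup K) - g (Inf K))))"
    proof (rule sum_mono)
      fix K assume "K \<in> \<K>"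
      then have "norm (h (Sup K) - h (Inf K)) \<le> C * (norm (f (Sup K) - f (Inf K)) + norm (g (Sup K) - g (Inf K)))"
        using division_member_Inf_Sup(3,4)[of \<K> S a b K] A le by blast
      also have "\<dots> \<le> D * (norm (f (Sup K) - f (Inf K)) + norm (g (Sup K) - g (Inf K)))"
        using D by (intro mult_right_mono) auto
      finally show "norm (h (Sup K) - h (Inf K)) \<le> D * (norm (f (Sup K) - f (Inf K)) + norm (g (Sup K) - g (Inf K)))" .
    qed
    also have "\<dots> = D * ((\<Sum>K\<in>\<K>. norm (f (Sup K) - f (Inf K))) + (\<Sum>K\<in>\<K>. norm (g (Sup K) - g (Inf K))))"
      by (simp add: sum_distrib_left sum.distrib distrib_left)
    also have "\<dots> < D * (e / (2 * D) + e / (2 * D))"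
      using F[of \<K> S] G[of \<K> S] A D by (intro mult_strict_left_mono add_strict_mono) auto
    also have "\<dots> = e" using D by (simp add: field_simps)
    finally show "(\<Sum>K\<in>\<K>. norm (h (Sup K) - h (Inf K))) < e" .
  qed
qed

lemma abs_cont_on_continuous:
  assumes "abs_cont_on a b f" shows "continuous_on {a..b} f"
  unfolding continuous_on_iff
proof (intro ballI allI impI)
  fix x e :: real assume x: "x \<in> {a..b}" and e: "e > 0"
  obtain d where d: "d > 0" and F: "\<And>\<K> S. \<K> division_of S \<and> S \<subseteq> {a..b} \<and> (\<Sum>K\<in>\<K>. Sup K - Inf K) < d
        \<longrightarrow> (\<Sum>K\<in>\<K>. norm (f (Sup K) - f (Inf K))) < e"
    using assms e unfolding abs_cont_on_def by meson
  have *: "norm (f v - f u) < e" if "u \<le> v" "u \<in> {a..b}" "v \<in> {a..b}" "v - u < d" for u v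
  proof -
    have "{{u..v}} division_of {u..v}" using that by (metis box_real(2) division_of_self atLeastatMost_empty_iff2 not_le)
    then show ?thesis using F[of "{{u..v}}" "{u..v}"] that by auto
  qed
  show "\<exists>d>0. \<forall>y\<in>{a..b}. dist y x < d \<longrightarrow> dist (f y) (f x) < e"
  proof (intro exI[of _ d] conjI ballI impI d)
    fix y assume y: "y \<in> {a..b}" "dist y x < d"
    show "dist (f y) (f x) < e"
      using *[of x y] *[of y x] x y by (cases "x \<le> y") (auto simp: dist_norm norm_minus_commute)
  qed
qed

lemma abs_cont_on_const: "abs_cont_on a b (\<lambda>x. c)"
  unfolding abs_cont_on_def by (auto intro: exI[of _ 1])

lemma abs_cont_on_subset:
  assumes "abs_cont_on a b f" "{c..d} \<subseteq> {a..b}" shows "abs_cont_on c d f"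
  using assms unfolding abs_cont_on_def by (meson subset_trans)

section \<open>The fundamental theorem of calculus for absolutely continuous functions\<close>

lemma negligible_outer_open:
  fixes e :: real
  assumes N: "negligible N" and e: "e > 0"
  obtains U where "open U" "N \<subseteq> U" "U \<in> lmeasurable" "measure lebesgue U < e"
proof -
  have "N \<in> sets lebesgue" using N negligible_imp_sets by blast
  then obtain T where T: "open T" "N \<subseteq> T" "T - N \<in> lmeasurable" "emeasure lebesgue (T - N) < ennreal e"
    using sets_lebesgue_outer_open e by metis
  have eq: "T = (T - N) \<union> N" using T by blast
  have TM: "T \<in> lmeasurable"
    by (subst eq) (use T N negligible_imp_measurable in \<open>blast intro: fmeasurable.Un\<close>)
  have "measure lebesgue (T - N) < e"
    using T e by (simp add: emeasure_eq_measure2 ennreal_less_iff)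
  then have "measure lebesgue T < e"
    using N TM by (simp add: measure_Diff_null_set negligible_iff_null_sets fmeasurableD)
  then show ?thesis using that T TM by blast
qed

text \<open>A Henstock argument in which the exceptional null set gets its own gauge. Where the
  derivative exists, the gauge makes the Riemann terms follow the increments of \<open>f\<close>.
  Tags in the null set contribute nothing to the Riemann sum of \<open>g\<close>; their intervals
  lie in an open set of small measure, where absolute continuity makes the increments of
  \<open>f\<close> small as well.\<close>

lemma abs_cont_on_has_integral:
  fixes f :: "real \<Rightarrow> 'b::banach"
  assumes ab: "a \<le> b" and ac: "abs_cont_on a b f"
    and der: "AE x in lebesgue. x \<in> {a..b} \<longrightarrow> (f has_vector_derivative f' x) (at x)"
  shows "(f' has_integral (f b - f a)) {a..b}"
proof (cases "a = b")
  case True then show ?thesis by (simp add: has_integral_refl)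
next
  case False
  with ab have ab': "a < b" by simp
  define N where "N = {x \<in> {a..b}. \<not> (f has_vector_derivative f' x) (at x)}"
  have N: "negligible N"
  proof -
    obtain N' where "N' \<in> null_sets lebesgue"
      "{x \<in> space lebesgue. \<not> (x \<in> {a..b} \<longrightarrow> (f has_vector_derivative f' x) (at x))} \<subseteq> N'"
      using der unfolding eventually_ae_filter by blast
    then show ?thesis
      using negligible_iff_null_sets negligible_subset[of N' N] by (auto simp: N_def)
  qed
  define g where "g = (\<lambda>x. if x \<in> N then 0 else f' x)"
  have "(g has_integral (f b - f a)) {a..b}"
    unfolding has_integral_factor_content_real
  proof (intro allI impI)
    fix e :: real assume e: "e > 0"
    have e2: "e / 2 * (b - a) > 0" using e ab' by simp
    obtain \<delta> where \<delta>: "\<delta> > 0" and F: "\<And>\<K> S. \<K> division_of S \<and> S \<subseteq> {a..b} \<and> (\<Sum>K\<in>\<K>. Sup K - Inf K) < \<delta>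
        \<longrightarrow> (\<Sum>K\<in>\<K>. norm (f (Sup K) - f (Inf K))) < e / 2 * (b - a)"
      using ac e2 unfolding abs_cont_on_def by meson
    obtain U where U: "open U" "N \<subseteq> U" "U \<in> lmeasurable" "measure lebesgue U < \<delta>"
      using negligible_outer_open[OF N \<delta>] by blast
    \<comment> \<open>The gauge: at a bad point the ball must stay in \<open>U\<close>; at a good
      point of the interval it is a radius on which the linear approximation holds up to
      e/2.\<close>
    have "\<forall>x. \<exists>d>0. (x \<in> N \<longrightarrow> ball x d \<subseteq> U) \<and> (x \<in> {a..b} - N \<longrightarrow>
         (\<forall>y. norm (y-x) < d \<longrightarrow> norm (f y - f x - (y-x) *\<^sub>R f' x) \<le> e/2 * norm (y-x)))"
    proof
      fix x
      consider "x \<in> N" | "x \<in> {a..b} - N" | "x \<notin> {a..b}" "x \<notin> N" by blast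
      then show "\<exists>d>0. (x \<in> N \<longrightarrow> ball x d \<subseteq> U) \<and> (x \<in> {a..b} - N \<longrightarrow>
         (\<forall>y. norm (y-x) < d \<longrightarrow> norm (f y - f x - (y-x) *\<^sub>R f' x) \<le> e/2 * norm (y-x)))"
      proof cases
        case 1 then show ?thesis using U by (meson DiffD2 open_contains_ball subset_eq)
      next
        case 2
        then have "(f has_vector_derivative f' x) (at x)" by (auto simp: N_def)
        then show ?thesis using 2 e unfolding has_vector_derivative_def has_derivative_at_alt
          by (metis DiffD2 half_gt_zero)
      next
        case 3 then show ?thesis by (auto intro: exI[of _ 1])
      qed
    qed
    then obtain d where d: "\<And>x. d x > 0" "\<And>x. x \<in> N \<Longrightarrow> ball x (d x) \<subseteq> U"
      "\<And>x y. x \<in> {a..b} - N \<Longrightarrow> norm (y-x) < d x \<Longrightarrow> norm (f y - f x - (y-x) *\<^sub>R f' x) \<le> e/2 * norm (y-x)"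
      by metis
    show "\<exists>\<gamma>. gauge \<gamma> \<and> (\<forall>p. p tagged_division_of {a..b} \<and> \<gamma> fine p \<longrightarrow>
        norm ((\<Sum>(x, k)\<in>p. measure lborel k *\<^sub>R g x) - (f b - f a)) \<le> e * measure lborel {a..b})"
    proof (rule exI, safe)
      show "gauge (\<lambda>x. ball x (d x))" using d(1) gauge_ball_dependent by blast
    next
      fix p assume ptag: "p tagged_division_of {a..b}" and fine: "(\<lambda>x. ball x (d x)) fine p"
      have fin: "finite p" using ptag by blast
      have uv: "\<exists>u v. K = {u..v} \<and> u \<le> v \<and> x \<in> {u..v} \<and> {u..v} \<subseteq> {a..b} \<and> {u..v} \<subseteq> ball x (d x)" if "(x,K) \<in> p" for x K
      proof -
        obtain u v where "K = cbox u v" using ptag \<open>(x, K) \<in> p\<close> by (meson tagged_division_ofD(4))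
        moreover have "x \<in> K" "K \<subseteq> {a..b}" using ptag \<open>(x, K) \<in> p\<close> by blast+
        moreover have "K \<subseteq> ball x (d x)" using fine that by (meson fineD)
        ultimately show ?thesis by (intro exI[of _ u] exI[of _ v]) auto
      qed
      have ba: "b - a = (\<Sum>(x,K)\<in>p. Sup K - Inf K)" "f b - f a = (\<Sum>(x,K)\<in>p. f(Sup K) - f(Inf K))"
        using additive_tagged_division_1[where f= "\<lambda>x. x"] additive_tagged_division_1[where f= f]
            \<open>a \<le> b\<close> ptag by auto
      define p1 where "p1 = {(x,K) \<in> p. x \<in> N}"
      define p2 where "p2 = {(x,K) \<in> p. x \<notin> N}"
      have p12: "p = p1 \<union> p2" "p1 \<inter> p2 = {}" "finite p1" "finite p2" using fin
        by (auto simp: p1_def p2_def intro: finite_subset)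
      let ?t = "\<lambda>(x,K). measure lborel K *\<^sub>R g x - (f (Sup K) - f (Inf K))"
      have "(\<Sum>(x, k)\<in>p. measure lborel k *\<^sub>R g x) - (f b - f a) = sum ?t p"
        unfolding ba by (simp add: sum_subtractf case_prod_unfold)
      also have "\<dots> = sum ?t p1 + sum ?t p2"
        using p12 by (simp add: sum.union_disjoint)
      finally have eq: "(\<Sum>(x, k)\<in>p. measure lborel k *\<^sub>R g x) - (f b - f a) = sum ?t p1 + sum ?t p2" .
      have B2: "norm (sum ?t p2) \<le> e/2 * (b - a)"
      proof -
        have "norm (sum ?t p2) \<le> (\<Sum>(x,K)\<in>p2. e/2 * (Sup K - Inf K))"
        proof (rule sum_norm_le, safe)
          fix x K assume xK: "(x,K) \<in> p2"
          then obtain u v where K: "K = {u..v}" "u \<le> v" "x \<in> {u..v}" "{u..v} \<subseteq> {a..b}" "{u..v} \<subseteq> ball x (d x)"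
            using uv[of x K] unfolding p2_def by blast
          have xN: "x \<in> {a..b} - N" using xK K(3,4) by (auto simp only: p2_def)
          have "v \<in> ball x (d x)" "u \<in> ball x (d x)" using K(2,5) by (simp_all add: subset_eq)
          then have 1: "norm (f v - f x - (v-x) *\<^sub>R f' x) \<le> e/2 * (v - x)"
            "norm (f u - f x - (u-x) *\<^sub>R f' x) \<le> e/2 * (x - u)"
            using d(3)[OF xN, of v] d(3)[OF xN, of u] K(2,3) by (simp_all add: dist_norm norm_minus_commute)
          \<comment> \<open>The tag lies between the end points, so the two one-sided errors e/2 (x
            - u) and e/2 (v - x) add up to e/2 times the length of the interval.\<close>
          have "norm ((v - u) *\<^sub>R f' x - (f v - f u)) = norm ((f u - f x - (u-x) *\<^sub>R f' x) - (f v - f x - (v-x) *\<^sub>R f' x))"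
            by (simp add: algebra_simps)
          also have "\<dots> \<le> e/2 * (x - u) + e/2 * (v - x)"
            using 1 by (meson add_mono norm_triangle_ineq4 order_trans)
          also have "\<dots> = e/2 * (v - u)" by (simp add: field_simps)
          finally show "norm (measure lborel K *\<^sub>R g x - (f (Sup K) - f (Inf K))) \<le> e/2 * (Sup K - Inf K)"
            using K xN by (simp add: g_def)
        qed
        also have "\<dots> \<le> (\<Sum>(x,K)\<in>p. e/2 * (Sup K - Inf K))"
        proof (rule sum_mono2[OF fin])
          show "p2 \<subseteq> p" by (auto simp: p2_def)
          fix y assume "y \<in> p - p2"
          then show "0 \<le> (case y of (x, K) \<Rightarrow> e / 2 * (Sup K - Inf K))"
            using uv[of "fst y" "snd y"] e by (auto simp: case_prod_unfold)
        qed
        also have "\<dots> = e/2 * (b - a)" unfolding ba(1) by (simp add: sum_distrib_left case_prod_unfold)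
        finally show ?thesis .
      qed
      have B1: "norm (sum ?t p1) \<le> e/2 * (b - a)"
      proof -
        \<comment> \<open>The value 0 on the empty set, together with the zero increment over a
          single point, is what passing from a sum over tagged pairs to a sum over their intervals
          requires.\<close>
        define h where "h = (\<lambda>K::real set. if K = {} then 0 else norm (f (Sup K) - f (Inf K)))"
        have part: "p1 tagged_partial_division_of {a..b}"
          using ptag tagged_partial_division_subset[of p "{a..b}" p1]
          unfolding tagged_division_of_def by (auto simp: p1_def)
        note tag1 = tagged_partial_division_of_Union_self[OF part]
        have div: "snd ` p1 division_of (\<Union>(snd ` p1))"
          using division_of_tagged_division[OF tag1] .
        have mem1: "K \<in> snd ` p1 \<Longrightarrow> \<exists>u v. K = {u..v} \<and> u \<le> v \<and> K \<subseteq> {a..b} \<and> K \<subseteq> U" for K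
        proof -
          assume "K \<in> snd ` p1"
          then obtain x where xK: "(x,K) \<in> p" "x \<in> N" by (auto simp: p1_def)
          show ?thesis using uv[OF xK(1)] d(2)[OF xK(2)] by blast
        qed
        have sub: "\<Union>(snd ` p1) \<subseteq> {a..b}" "\<Union>(snd ` p1) \<subseteq> U" using mem1 by blast+
        have len: "(\<Sum>K\<in>snd ` p1. Sup K - Inf K) < \<delta>"
        proof -
          have "(\<Sum>K\<in>snd ` p1. Sup K - Inf K) = (\<Sum>K\<in>snd ` p1. measure lebesgue K)"
              using mem1 by (intro sum.cong refl) force
          also have "\<dots> = measure lebesgue (\<Union>(snd ` p1))"
            using content_division[OF div] by simp
          also have "\<dots> \<le> measure lebesgue U"
            using sub U lmeasurable_division[OF div]
            by (intro measure_mono_fmeasurable) (auto simp: fmeasurableD)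
          finally show ?thesis using U by simp
        qed
        have "norm (sum ?t p1) \<le> (\<Sum>(x,K)\<in>p1. h K)"
        proof (rule sum_norm_le, safe)
          fix x K assume xK: "(x,K) \<in> p1"
          then have "x \<in> N" "K \<noteq> {}" using uv[of x K] by (auto simp: p1_def)
          then show "norm (measure lborel K *\<^sub>R g x - (f (Sup K) - f (Inf K))) \<le> h K"
            by (simp add: g_def h_def norm_minus_commute)
        qed
        also have "\<dots> = (\<Sum>K\<in>snd ` p1. h K)"
        proof (rule sum.over_tagged_division_lemma[OF tag1])
          fix u v :: real assume "box u v = {}"
          then show "h (cbox u v) = 0" by (cases "u = v") (auto simp: h_def)
        qed
        also have "\<dots> = (\<Sum>K\<in>snd ` p1. norm (f (Sup K) - f (Inf K)))"
          using mem1 by (intro sum.cong refl) (fastforce simp: h_def)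
        also have "\<dots> < e/2 * (b - a)" using F div sub len by blast
        finally show ?thesis by simp
      qed
      have "norm (sum ?t p1 + sum ?t p2) \<le> e/2 * (b - a) + e/2 * (b - a)"
        using B1 B2 norm_triangle_mono by blast
      also have "\<dots> = e * measure lborel {a..b}" using ab by simp
      finally show "norm ((\<Sum>(x, k)\<in>p. measure lborel k *\<^sub>R g x) - (f b - f a)) \<le> e * measure lborel {a..b}"
        unfolding eq .
    qed
  qed
  then show ?thesis
    by (rule has_integral_spike[OF N, rotated]) (auto simp: g_def)
qed

section \<open>Indefinite integrals: absolute continuity and differentiability almost
  everywhere\<close>

lemma integrable_on_division_member:
  fixes h :: "real \<Rightarrow> 'b::banach"
  assumes "h integrable_on {a..b}" "\<K> division_of S" "S \<subseteq> {a..b}" "K \<in> \<K>"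
  shows "h integrable_on K"
proof -
  obtain u v where "K = cbox u v" using assms division_ofD(4) by blast
  moreover have "K \<subseteq> {a..b}" using assms division_ofD(2) by blast
  ultimately show ?thesis
    using integrable_on_subcbox[OF assms(1)] by simp
qed

text \<open>Truncating \<open>g\<close> at a high level \<open>n\<close> leaves a remainder whose
  integral over all of [a,b] is below e/2, while the truncated function contributes at most
  \<open>n\<close> times the total length of the division.\<close>

lemma integral_division_small:
  fixes g :: "real \<Rightarrow> real"
  assumes g: "g integrable_on {a..b}" and g0: "\<And>x. g x \<ge> 0" and e: "e > 0"
  obtains \<delta> where "\<delta> > 0"
    "\<And>\<K> S. \<K> division_of S \<Longrightarrow> S \<subseteq> {a..b} \<Longrightarrow> (\<Sum>K\<in>\<K>. Sup K - Inf K) < \<delta> \<Longrightarrow> (\<Sum>K\<in>\<K>. integral K g) < e"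
proof -
  have gN: "(\<lambda>x. min (g x) (real n)) integrable_on {a..b}" for n
  proof -
    have "g absolutely_integrable_on {a..b}"
      using g g0 by (simp add: nonnegative_absolutely_integrable_1)
    moreover have "(\<lambda>x. real n) absolutely_integrable_on {a..b}" by simp
    ultimately have "(\<lambda>x. min (g x) (real n)) absolutely_integrable_on {a..b}"
      by (rule absolutely_integrable_min_1)
    then show ?thesis by (simp add: absolutely_integrable_on_def)
  qed
  have "(\<lambda>n. integral {a..b} (\<lambda>x. min (g x) (real n))) \<longlonglongrightarrow> integral {a..b} g"
  proof (rule dominated_convergence(2)[OF gN g])
    show "norm (min (g x) (real n)) \<le> g x" for x n using g0[of x] by auto
    show "(\<lambda>n. min (g x) (real n)) \<longlonglongrightarrow> g x" for x
    proof (rule tendsto_eventually)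
      show "\<forall>\<^sub>F n in sequentially. min (g x) (real n) = g x"
        using eventually_ge_at_top[of "nat \<lceil>g x\<rceil>"]
        by eventually_elim (meson min.absorb1 of_nat_mono order_trans real_nat_ceiling_ge of_nat_le_iff)
    qed
  qed
  then obtain n where n: "\<bar>integral {a..b} (\<lambda>x. min (g x) (real n)) - integral {a..b} g\<bar> < e / 2"
    unfolding lim_sequentially dist_real_def by (meson e half_gt_zero order_refl)
  define r where "r = (\<lambda>x. g x - min (g x) (real n))"
  have r: "r integrable_on {a..b}" "\<And>x. r x \<ge> 0" unfolding r_def using g gN integrable_diff by auto
  have ri: "integral {a..b} r < e / 2" 
    using n unfolding r_def integral_diff[OF g gN[of n]] by linarith
  have g_eq: "g = (\<lambda>x. r x + min (g x) (real n))" by (simp add: r_def)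
  show ?thesis
  \<comment> \<open>The denominator contains \<open>n + 1\<close> instead of \<open>n\<close> so
    that the level n = 0 is covered.\<close>
  proof (rule that[of "e / (2 * (real n + 1))"])
    show "e / (2 * (real n + 1)) > 0" using e by simp
    fix \<K> S assume K: "\<K> division_of S" "S \<subseteq> {a..b}" and sm: "(\<Sum>K\<in>\<K>. Sup K - Inf K) < e / (2 * (real n + 1))"
    note mem = division_member_Inf_Sup[OF K]
    have on_K: "h integrable_on K" if "h integrable_on {a..b}" "K \<in> \<K>" for K and h :: "real \<Rightarrow> real"
      using that integrable_on_division_member[OF _ K] by blast
    have "(\<Sum>K\<in>\<K>. integral K g) \<le> (\<Sum>K\<in>\<K>. integral K r + real n * (Sup K - Inf K))"
    proof (rule sum_mono)
      fix K assume KK: "K \<in> \<K>"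
      have "integral K g = integral K r + integral K (\<lambda>x. min (g x) (real n))"
        using integral_add[OF on_K[OF r(1) KK] on_K[OF gN[of n] KK]] unfolding g_eq[symmetric] .
      moreover have "integral K (\<lambda>x. min (g x) (real n)) \<le> integral K (\<lambda>x. real n)"
      proof (rule integral_le[OF on_K[OF gN[of n] KK]])
        show "(\<lambda>x. real n) integrable_on K" by (rule on_K[OF _ KK]) (simp add: integrable_const_ivl)
      qed simp
      moreover have "integral K (\<lambda>x. real n) = real n * (Sup K - Inf K)"
        by (subst mem(1)[OF KK], subst integral_const_real) (simp add: mem(2)[OF KK] mult.commute)
      ultimately show "integral K g \<le> integral K r + real n * (Sup K - Inf K)" by linarith
    qed
    also have "\<dots> = (\<Sum>K\<in>\<K>. integral K r) + real n * (\<Sum>K\<in>\<K>. Sup K - Inf K)"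
      by (simp add: sum.distrib sum_distrib_left)
    also have "(\<Sum>K\<in>\<K>. integral K r) = integral S r"
    proof (rule integral_combine_division_topdown[symmetric])
      show "r integrable_on S" using integrable_on_subdivision[OF K(1) r(1) K(2)] .
    qed (rule K)
    also have "integral S r \<le> integral {a..b} r"
      using integrable_on_subdivision[OF K(1) r(1) K(2)] r K by (intro integral_subset_le) auto
    also have "real n * (\<Sum>K\<in>\<K>. Sup K - Inf K) \<le> real n * (e / (2 * (real n + 1)))"
      using sm by (intro mult_left_mono) auto
    also have "\<dots> \<le> e / 2" using e by (simp add: field_simps)
    finally show "(\<Sum>K\<in>\<K>. integral K g) < e" using ri by linarith
  qed
qed

lemma abs_cont_on_of_integral:
  fixes F f :: "real \<Rightarrow> 'b::euclidean_space"
  assumes f: "f absolutely_integrable_on {a..b}"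
    and F: "\<And>x y. \<lbrakk>a \<le> x; x \<le> y; y \<le> b\<rbrakk> \<Longrightarrow> (f has_integral F y - F x) {x..y}"
  shows "abs_cont_on a b F"
  unfolding abs_cont_on_def
proof (intro allI impI)
  fix e :: real assume e: "e > 0"
  have nf: "(\<lambda>x. norm (f x)) integrable_on {a..b}" using f by (simp add: absolutely_integrable_on_def)
  obtain \<delta> where \<delta>: "\<delta> > 0"
    "\<And>\<K> S. \<K> division_of S \<Longrightarrow> S \<subseteq> {a..b} \<Longrightarrow> (\<Sum>K\<in>\<K>. Sup K - Inf K) < \<delta> \<Longrightarrow> (\<Sum>K\<in>\<K>. integral K (\<lambda>x. norm (f x))) < e"
    using integral_division_small[OF nf _ e] by auto
  show "\<exists>\<delta>>0. \<forall>\<K> S. \<K> division_of S \<and> S \<subseteq> {a..b} \<and> (\<Sum>K\<in>\<K>. Sup K - Inf K) < \<delta>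
        \<longrightarrow> (\<Sum>K\<in>\<K>. norm (F (Sup K) - F (Inf K))) < e"
  proof (intro exI[of _ \<delta>] conjI \<delta> allI impI)
    fix \<K> S assume A: "\<K> division_of S \<and> S \<subseteq> {a..b} \<and> (\<Sum>K\<in>\<K>. Sup K - Inf K) < \<delta>"
    have "(\<Sum>K\<in>\<K>. norm (F (Sup K) - F (Inf K))) \<le> (\<Sum>K\<in>\<K>. integral K (\<lambda>x. norm (f x)))"
    proof (rule sum_mono)
      fix K assume KK: "K \<in> \<K>"
      have A': "\<K> division_of S" "S \<subseteq> {a..b}" using A by auto
      note m = division_member_Inf_Sup[OF A' KK]
      have K: "K = {Inf K..Sup K}" by (rule m(1))
      have K': "a \<le> Inf K" "Inf K \<le> Sup K" "Sup K \<le> b" using m(2-4) by simp_all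
      have i: "(f has_integral F (Sup K) - F (Inf K)) K" using F[OF K'] K by metis
      then have "integral K f = F (Sup K) - F (Inf K)" by blast
      moreover have "norm (integral K f) \<le> integral K (\<lambda>x. norm (f x))"
      proof (rule integral_norm_bound_integral)
        show "f integrable_on K" using i by blast
        show "(\<lambda>x. norm (f x)) integrable_on K"
          using integrable_on_division_member[OF nf A' KK] .
      qed auto
      ultimately show "norm (F (Sup K) - F (Inf K)) \<le> integral K (\<lambda>x. norm (f x))" by metis
    qed
    then show "(\<Sum>K\<in>\<K>. norm (F (Sup K) - F (Inf K))) < e" using \<delta>(2) A by (meson le_less_trans)
  qed
qed

lemma AE_lebesgue_iff_negligible: "(AE x in lebesgue. P x) \<longleftrightarrow> negligible {x. \<not> P x}"
proof
  assume "AE x in lebesgue. P x"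
  then obtain N where "N \<in> null_sets lebesgue" "{x \<in> space lebesgue. \<not> P x} \<subseteq> N"
    unfolding eventually_ae_filter by blast
  then show "negligible {x. \<not> P x}" using negligible_iff_null_sets negligible_subset by auto
next
  assume "negligible {x. \<not> P x}"
  then show "AE x in lebesgue. P x"
    unfolding eventually_ae_filter by (auto simp: negligible_iff_null_sets)
qed

text \<open>The library only differentiates the indefinite integral from the right; the left
  derivative is the right derivative of the reflected function.\<close>

lemma AE_has_vector_derivative_of_integral:
  fixes F f :: "real \<Rightarrow> 'b::euclidean_space"
  assumes F: "\<And>x y. x \<le> y \<Longrightarrow> (f has_integral F y - F x) {x..y}"
  shows "AE x in lebesgue. (F has_vector_derivative f x) (at x)"
proof -
  have right: "\<exists>N. negligible N \<and> (\<forall>x e. x \<notin> N \<and> 0 < e \<longrightarrow> (\<exists>d>0. \<forall>h. 0 < h \<and> h < d \<longrightarrow>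
                  norm ((G (x + h) - G x) /\<^sub>R h - g x) < e))"
    if G: "\<And>x y. x \<le> y \<Longrightarrow> (g has_integral G y - G x) {x..y}" for G g :: "real \<Rightarrow> 'b"
  proof -
    have "g integrable_on cbox a b" for a b
      using G[of a b] by (cases "a \<le> b") (auto simp: integrable_on_def)
    then obtain N where N: "negligible N" "\<And>x e. \<lbrakk>x \<notin> N; 0 < e\<rbrakk> \<Longrightarrow>
               \<exists>d>0. \<forall>h. 0 < h \<and> h < d \<longrightarrow>
                         norm(integral (cbox x (x + h *\<^sub>R One)) g /\<^sub>R h ^ DIM(real) - g x) < e"
      using integrable_ccontinuous_explicit by blast
    have I: "integral (cbox x (x + h *\<^sub>R One)) g = G (x + h) - G x" if "0 < h" for x h
      using G[of x "x + h"] that by (auto intro: integral_unique)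
    have "\<exists>d>0. \<forall>h. 0 < h \<and> h < d \<longrightarrow> norm ((G (x + h) - G x) /\<^sub>R h - g x) < e" if "x \<notin> N" "0 < e" for x e
    proof -
      obtain d where "d > 0" "\<forall>h. 0 < h \<and> h < d \<longrightarrow>
                         norm(integral (cbox x (x + h *\<^sub>R One)) g /\<^sub>R h ^ DIM(real) - g x) < e"
        using N(2)[OF \<open>x \<notin> N\<close> \<open>0 < e\<close>] by blast
      then show ?thesis by (intro exI[of _ d]) (simp add: I[simplified])
    qed
    then show ?thesis using N(1) by blast
  qed
  obtain N1 where N1: "negligible N1" "\<And>x e. \<lbrakk>x \<notin> N1; 0 < e\<rbrakk> \<Longrightarrow> \<exists>d>0. \<forall>h. 0 < h \<and> h < d \<longrightarrow>
                  norm ((F (x + h) - F x) /\<^sub>R h - f x) < e"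
    using right[OF F] by blast
  have "((\<lambda>x. f (- x)) has_integral (- F (- y)) - (- F (- x))) {x..y}" if "x \<le> y" for x y
    using F[of "- y" "- x"] that has_integral_reflect_real[where f=f and a="- y" and b="- x"] by simp
  from right[OF this] obtain N2 where N2: "negligible N2" "\<And>x e. \<lbrakk>x \<notin> N2; 0 < e\<rbrakk> \<Longrightarrow> \<exists>d>0. \<forall>h. 0 < h \<and> h < d \<longrightarrow>
                  norm ((- F (- (x + h)) - - F (- x)) /\<^sub>R h - f (- x)) < e"
    by blast
  have "negligible (uminus ` N2)"
    
    using N2(1) by (intro negligible_differentiable_image_negligible) (auto intro!: derivative_intros)
  with N1 have N: "negligible (N1 \<union> uminus ` N2)" by simp
  show ?thesis
    unfolding AE_lebesgue_iff_negligible
  proof (rule negligible_subset[OF N], clarify)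
    fix x assume nd: "\<not> (F has_vector_derivative f x) (at x)" and x2: "x \<notin> uminus ` N2"
    show "x \<in> N1"
    proof (rule ccontr)
      assume x1: "x \<notin> N1"
      have x2': "- x \<notin> N2" using x2 by force
      have "(F has_vector_derivative f x) (at x)"
        unfolding has_vector_derivative_def has_derivative_at_alt
      proof (intro conjI allI impI bounded_linear_scaleR_left)
        fix e :: real assume e: "e > 0"
        obtain d1 where d1: "d1 > 0" "\<And>h. 0 < h \<Longrightarrow> h < d1 \<Longrightarrow> norm ((F (x + h) - F x) /\<^sub>R h - f x) < e"
          using N1(2)[OF x1 e] by blast
        obtain d2 where d2: "d2 > 0" "\<And>h. 0 < h \<Longrightarrow> h < d2 \<Longrightarrow> norm ((- F (- (- x + h)) - - F (- (- x))) /\<^sub>R h - f (- (- x))) < e"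
          using N2(2)[OF x2' e] by blast
        show "\<exists>d>0. \<forall>y. norm (y - x) < d \<longrightarrow> norm (F y - F x - (y - x) *\<^sub>R f x) \<le> e * norm (y - x)"
        proof (intro exI[of _ "min d1 d2"] conjI allI impI)
          show "min d1 d2 > 0" using d1 d2 by simp
          fix y assume y: "norm (y - x) < min d1 d2"
          have sc: "norm v \<le> e * h" if "h > 0" "norm (v /\<^sub>R h) < e" for v :: 'b and h
            using that by (simp add: divide_simps mult.commute)
          consider "y = x" | "y > x" | "y < x" by linarith
          then show "norm (F y - F x - (y - x) *\<^sub>R f x) \<le> e * norm (y - x)"
          proof cases
            case 2
            then have "norm ((F y - F x) /\<^sub>R (y - x) - f x) < e" using d1(2)[of "y - x"] y by simp
            moreover have "(F y - F x) /\<^sub>R (y - x) - f x = (F y - F x - (y - x) *\<^sub>R f x) /\<^sub>R (y - x)"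
              using 2 by (simp add: scaleR_diff_right)
            ultimately show ?thesis using 2 sc[of "y - x" "F y - F x - (y - x) *\<^sub>R f x"] by simp
          next
            case 3
            then have "norm ((- F y + F x) /\<^sub>R (x - y) - f x) < e" using d2(2)[of "x - y"] y by simp
            moreover have "(- F y + F x) /\<^sub>R (x - y) - f x = (- (F y - F x - (y - x) *\<^sub>R f x)) /\<^sub>R (x - y)"
            proof -
              have "- (F y - F x - (y - x) *\<^sub>R f x) = (- F y + F x) - (x - y) *\<^sub>R f x" by (simp add: algebra_simps)
              then show ?thesis using 3 by (simp only: scaleR_diff_right) simp
            qed
            ultimately have "norm ((- (F y - F x - (y - x) *\<^sub>R f x)) /\<^sub>R (x - y)) < e" by metis
            then have "norm (- (F y - F x - (y - x) *\<^sub>R f x)) \<le> e * (x - y)" using 3 by (intro sc) simp_all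
            then show ?thesis using 3 unfolding norm_minus_cancel by simp
          qed simp
        qed
      qed
      with nd show False by simp
    qed
  qed
qed

section \<open>Calculus of absolutely continuous functions with a named derivative\<close>

text \<open>Naming the derivative makes product rules and differential inequalities composable, and
  \<open>f'\<close> may be altered on null sets. Asking for the two-sided derivative is harmless at
  the end points, which form a null set.\<close>

definition ac_deriv :: "real \<Rightarrow> real \<Rightarrow> (real \<Rightarrow> 'b::real_normed_vector) \<Rightarrow> (real \<Rightarrow> 'b) \<Rightarrow> bool" where
  "ac_deriv a b f f' \<longleftrightarrow> abs_cont_on a b f \<and>
     (AE x in lebesgue. x \<in> {a..b} \<longrightarrow> (f has_vector_derivative f' x) (at x))"

lemma ac_deriv_has_integral:
  fixes f :: "real \<Rightarrow> 'b::banach"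
  assumes "ac_deriv a b f f'" "a \<le> c" "c \<le> d" "d \<le> b"
  shows "(f' has_integral (f d - f c)) {c..d}"
proof (rule abs_cont_on_has_integral[OF assms(3)])
  show "abs_cont_on c d f" using assms abs_cont_on_subset unfolding ac_deriv_def by force
  have "AE x in lebesgue. x \<in> {a..b} \<longrightarrow> (f has_vector_derivative f' x) (at x)"
    using assms unfolding ac_deriv_def by simp
  then show "AE x in lebesgue. x \<in> {c..d} \<longrightarrow> (f has_vector_derivative f' x) (at x)"
    using assms by (auto elim: eventually_mono)
qed

lemma ac_deriv_subinterval:
  assumes "ac_deriv a b f f'" "a \<le> c" "d \<le> b"
  shows "ac_deriv c d f f'"
  unfolding ac_deriv_def
proof
  show "abs_cont_on c d f" using assms abs_cont_on_subset unfolding ac_deriv_def by force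
  have "AE x in lebesgue. x \<in> {a..b} \<longrightarrow> (f has_vector_derivative f' x) (at x)"
    using assms unfolding ac_deriv_def by simp
  then show "AE x in lebesgue. x \<in> {c..d} \<longrightarrow> (f has_vector_derivative f' x) (at x)"
    using assms by (auto elim: eventually_mono)
qed

lemma ac_deriv_continuous: "ac_deriv a b f f' \<Longrightarrow> continuous_on {a..b} f"
  unfolding ac_deriv_def using abs_cont_on_continuous by blast

lemma ac_deriv_cong_AE:
  assumes "ac_deriv a b f f'" "AE x in lebesgue. x \<in> {a..b} \<longrightarrow> f' x = g' x"
  shows "ac_deriv a b f g'"
proof -
  have "AE x in lebesgue. x \<in> {a..b} \<longrightarrow> (f has_vector_derivative f' x) (at x)"
    using assms unfolding ac_deriv_def by simp
  then have "AE x in lebesgue. x \<in> {a..b} \<longrightarrow> (f has_vector_derivative g' x) (at x)"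
    using assms(2) by eventually_elim simp
  then show ?thesis using assms(1) unfolding ac_deriv_def by simp
qed

lemma ac_deriv_bounded_linear:
  assumes "bounded_linear h" "ac_deriv a b f f'"
  shows "ac_deriv a b (\<lambda>x. h (f x)) (\<lambda>x. h (f' x))"
  unfolding ac_deriv_def
proof
  obtain K where K: "\<And>x. norm (h x) \<le> norm x * K" using assms(1) bounded_linear.bounded by blast
  have f: "abs_cont_on a b f" using assms unfolding ac_deriv_def by simp
  show "abs_cont_on a b (\<lambda>x. h (f x))"
  proof (rule abs_cont_on_dominated[OF f f])
    fix x y
    have "norm (h (f x) - h (f y)) = norm (h (f x - f y))"
      using assms(1) by (simp add: bounded_linear.linear linear_diff)
    also have "\<dots> \<le> norm (f x - f y) * K" by (rule K)
    also have "\<dots> \<le> norm (f x - f y) * \<bar>K\<bar>" by (intro mult_left_mono) auto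
    also have "\<dots> \<le> (norm (f x - f y) + norm (f x - f y)) * \<bar>K\<bar>" by (intro mult_right_mono) auto
    also have "\<dots> = \<bar>K\<bar> * (norm (f x - f y) + norm (f x - f y))" by (rule mult.commute)
    finally show "norm (h (f x) - h (f y)) \<le> \<bar>K\<bar> * (norm (f x - f y) + norm (f x - f y))" .
  qed
  show "AE x in lebesgue. x \<in> {a..b} \<longrightarrow> ((\<lambda>x. h (f x)) has_vector_derivative h (f' x)) (at x)"
    using assms(2) unfolding ac_deriv_def
    by (auto elim!: eventually_mono intro: bounded_linear.has_vector_derivative[OF assms(1)])
qed

lemma ac_deriv_add:
  assumes "ac_deriv a b f f'" "ac_deriv a b g g'"
  shows "ac_deriv a b (\<lambda>x. f x + g x) (\<lambda>x. f' x + g' x)"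
  unfolding ac_deriv_def
proof
  have fg: "abs_cont_on a b f" "abs_cont_on a b g" using assms unfolding ac_deriv_def by simp_all
  show "abs_cont_on a b (\<lambda>x. f x + g x)"
  proof (rule abs_cont_on_dominated[OF fg])
    fix x y
    show "norm (f x + g x - (f y + g y)) \<le> 1 * (norm (f x - f y) + norm (g x - g y))"
      using norm_triangle_ineq[of "f x - f y" "g x - g y"] by (simp add: algebra_simps)
  qed
  have "AE x in lebesgue. x \<in> {a..b} \<longrightarrow> (f has_vector_derivative f' x) (at x)"
    "AE x in lebesgue. x \<in> {a..b} \<longrightarrow> (g has_vector_derivative g' x) (at x)"
    using assms unfolding ac_deriv_def by simp_all
  then show "AE x in lebesgue. x \<in> {a..b} \<longrightarrow> ((\<lambda>x. f x + g x) has_vector_derivative f' x + g' x) (at x)"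
    by eventually_elim (simp add: has_vector_derivative_add)
qed

lemma ac_deriv_minus: "ac_deriv a b f f' \<Longrightarrow> ac_deriv a b (\<lambda>x. - f x) (\<lambda>x. - f' x)"
  using ac_deriv_bounded_linear[OF bounded_linear_minus[OF bounded_linear_ident]] by blast

lemma ac_deriv_diff:
  assumes "ac_deriv a b f f'" "ac_deriv a b g g'"
  shows "ac_deriv a b (\<lambda>x. f x - g x) (\<lambda>x. f' x - g' x)"
  using ac_deriv_add[OF assms(1) ac_deriv_minus[OF assms(2)]] by simp

lemma ac_deriv_const: "ac_deriv a b (\<lambda>x. c) (\<lambda>x. 0)"
  by (simp add: ac_deriv_def abs_cont_on_const)

lemma ac_deriv_sum:
  assumes "\<And>i. i \<in> I \<Longrightarrow> ac_deriv a b (f i) (f' i)"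
  shows "ac_deriv a b (\<lambda>x. \<Sum>i\<in>I. f i x) (\<lambda>x. \<Sum>i\<in>I. f' i x)"
  using assms by (induction I rule: infinite_finite_induct) (auto intro: ac_deriv_const ac_deriv_add)

text \<open>On [a,b] both factors are bounded, being continuous, and then the increments of the
  product are controlled by those of the factors. This single rule serves real products, inner
  products, scalar multiples and matrix products.\<close>

lemma ac_deriv_bounded_bilinear:
  assumes h: "bounded_bilinear h" and f: "ac_deriv a b f f'" and g: "ac_deriv a b g g'"
  shows "ac_deriv a b (\<lambda>x. h (f x) (g x)) (\<lambda>x. h (f x) (g' x) + h (f' x) (g x))"
  unfolding ac_deriv_def
proof
  have fg: "abs_cont_on a b f" "abs_cont_on a b g" using assms unfolding ac_deriv_def by simp_all
  obtain K where K: "K > 0" "\<And>x y. norm (h x y) \<le> norm x * norm y * K"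
    using bounded_bilinear.pos_bounded[OF h] by blast
  have "compact (f ` {a..b})" "compact (g ` {a..b})"
    using f g by (auto intro: compact_continuous_image ac_deriv_continuous)
  then obtain A B where A: "A > 0" "\<And>x. x \<in> {a..b} \<Longrightarrow> norm (f x) \<le> A" and B: "\<And>x. x \<in> {a..b} \<Longrightarrow> norm (g x) \<le> B" "B > 0"
    using compact_imp_bounded bounded_pos by (metis image_eqI)
  show "abs_cont_on a b (\<lambda>x. h (f x) (g x))"
  proof (rule abs_cont_on_dominated[OF fg])
    fix x y assume xy: "x \<in> {a..b}" "y \<in> {a..b}"
    have "h (f x) (g x) - h (f y) (g y) = h (f x) (g x - g y) + h (f x - f y) (g y)"
      by (simp add: bounded_bilinear.diff_left[OF h] bounded_bilinear.diff_right[OF h])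
    then have "norm (h (f x) (g x) - h (f y) (g y)) \<le> norm (f x) * norm (g x - g y) * K + norm (f x - f y) * norm (g y) * K"
      using K(2)[of "f x" "g x - g y"] K(2)[of "f x - f y" "g y"] norm_triangle_ineq[of "h (f x) (g x - g y)" "h (f x - f y) (g y)"]
      by (simp only:)
    also have "\<dots> \<le> (A + B) * norm (g x - g y) * K + norm (f x - f y) * (A + B) * K"
      using A(2)[OF xy(1)] B(1)[OF xy(2)] K(1) A(1) B(2)
      by (intro add_mono mult_mono) (auto intro!: mult_nonneg_nonneg)
    also have "\<dots> = ((A + B) * K) * (norm (f x - f y) + norm (g x - g y))" by (simp add: algebra_simps)
    finally show "norm (h (f x) (g x) - h (f y) (g y)) \<le> ((A + B) * K) * (norm (f x - f y) + norm (g x - g y))" .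
  qed
  have "AE x in lebesgue. x \<in> {a..b} \<longrightarrow> (f has_vector_derivative f' x) (at x)"
    "AE x in lebesgue. x \<in> {a..b} \<longrightarrow> (g has_vector_derivative g' x) (at x)"
    using assms unfolding ac_deriv_def by simp_all
  then show "AE x in lebesgue. x \<in> {a..b} \<longrightarrow> ((\<lambda>x. h (f x) (g x)) has_vector_derivative (h (f x) (g' x) + h (f' x) (g x))) (at x)"
    by eventually_elim (simp add: bounded_bilinear.has_vector_derivative[OF h])
qed

lemmas ac_deriv_mult = ac_deriv_bounded_bilinear[OF bounded_bilinear_mult]
lemmas ac_deriv_inner = ac_deriv_bounded_bilinear[OF bounded_bilinear_inner]

lemma ac_deriv_of_integral:
  fixes F f :: "real \<Rightarrow> 'b::euclidean_space"
  assumes "\<And>a b. f absolutely_integrable_on {a..b}"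
    and "\<And>x y. x \<le> y \<Longrightarrow> (f has_integral F y - F x) {x..y}"
  shows "ac_deriv a b F f"
  unfolding ac_deriv_def
  using abs_cont_on_of_integral[where f = f and F = F, OF assms] AE_has_vector_derivative_of_integral[where f = f and F = F, OF assms(2)]
  by (auto elim: eventually_mono)

lemma ac_deriv_smooth:
  fixes f :: "real \<Rightarrow> 'b::euclidean_space"
  assumes "\<And>x. (f has_vector_derivative f' x) (at x)" "continuous_on UNIV f'"
  shows "ac_deriv a b f f'"
proof (rule ac_deriv_of_integral)
  show "f' absolutely_integrable_on {a..b}" for a b
    using assms(2) by (metis absolutely_integrable_continuous_real continuous_on_subset subset_UNIV)
  show "(f' has_integral f y - f x) {x..y}" if "x \<le> y" for x y
    using that assms(1) by (intro fundamental_theorem_of_calculus) (auto intro: has_vector_derivative_at_within)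
qed

text \<open>On the bounded range of \<open>g\<close> the exponential is Lipschitz, with constant exp
  B for a bound B of \<open>g\<close>.\<close>

lemma ac_deriv_exp:
  fixes g :: "real \<Rightarrow> real"
  assumes g: "ac_deriv a b g g'"
  shows "ac_deriv a b (\<lambda>x. exp (g x)) (\<lambda>x. exp (g x) * g' x)"
  unfolding ac_deriv_def
proof
  have ag: "abs_cont_on a b g" using g unfolding ac_deriv_def by simp
  have "compact (g ` {a..b})" using g by (auto intro: compact_continuous_image ac_deriv_continuous)
  then obtain B where B: "\<And>x. x \<in> {a..b} \<Longrightarrow> norm (g x) \<le> B"
    using compact_imp_bounded bounded_iff by (metis image_eqI)
  have lip: "exp v - exp u \<le> exp B * (v - u)" if "u \<le> v" "v \<le> B" for u v :: real
  proof -
    have "exp v - exp u = exp v * (1 - exp (u - v))" by (simp add: algebra_simps flip: exp_add)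
    also have "\<dots> \<le> exp v * (v - u)" 
    proof (rule mult_left_mono)
      show "1 - exp (u - v) \<le> v - u" using exp_ge_add_one_self[of "u - v"] by linarith
    qed simp
    also have "\<dots> \<le> exp B * (v - u)" using that by (intro mult_right_mono) auto
    finally show ?thesis .
  qed
  show "abs_cont_on a b (\<lambda>x. exp (g x))"
  proof (rule abs_cont_on_dominated[OF ag ag])
    fix x y assume xy: "x \<in> {a..b}" "y \<in> {a..b}"
    have "norm (exp (g x) - exp (g y)) \<le> exp B * norm (g x - g y)"
      using lip[of "g x" "g y"] lip[of "g y" "g x"] B[OF xy(1)] B[OF xy(2)]
      by (cases "g x \<le> g y") auto
    also have "\<dots> \<le> exp B * (norm (g x - g y) + norm (g x - g y))" by (intro mult_left_mono) auto
    finally show "norm (exp (g x) - exp (g y)) \<le> exp B * (norm (g x - g y) + norm (g x - g y))" .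
  qed
  show "AE x in lebesgue. x \<in> {a..b} \<longrightarrow> ((\<lambda>x. exp (g x)) has_vector_derivative exp (g x) * g' x) (at x)"
    using g unfolding ac_deriv_def
    by (auto elim!: eventually_mono intro!: derivative_eq_intros
        simp: has_real_derivative_iff_has_vector_derivative[symmetric])
qed

section \<open>Monotonicity and the Gronwall inequality\<close>

lemma ac_deriv_nonpos_decreasing:
  fixes f :: "real \<Rightarrow> real"
  assumes f: "ac_deriv a b f f'" and ab: "a \<le> b" and le: "AE x in lebesgue. x \<in> {a..b} \<longrightarrow> f' x \<le> 0"
  shows "f b \<le> f a"
proof -
  \<comment> \<open>Replacing f' by min(f', 0) changes it only on a null set and makes the sign hold
    at every point, as the comparison of integrals demands.\<close>
  have "ac_deriv a b f (\<lambda>x. min (f' x) 0)"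
    by (rule ac_deriv_cong_AE[OF f]) (use le in \<open>auto elim!: eventually_mono\<close>)
  from ac_deriv_has_integral[OF this _ ab] have "((\<lambda>x. min (f' x) 0) has_integral f b - f a) {a..b}" by simp
  moreover have "((\<lambda>x. 0) has_integral 0) {a..b}" by simp
  ultimately have "f b - f a \<le> 0" by (rule has_integral_le) simp
  then show ?thesis by simp
qed

text \<open>Integrating factor: f exp(-G) has nonpositive derivative. As \<open>f\<close> may take
  either sign, applying this to -f gives the lower bound with the same \<open>G\<close>.\<close>

lemma gronwall_upper:
  fixes f g :: "real \<Rightarrow> real"
  assumes f: "ac_deriv a b f f'" and G: "ac_deriv a b G g" and ab: "a \<le> b"
    and le: "AE x in lebesgue. x \<in> {a..b} \<longrightarrow> f' x \<le> g x * f x"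
  shows "f b \<le> f a * exp (G b - G a)"
proof -
  have "ac_deriv a b (\<lambda>x. f x * exp (- G x)) (\<lambda>x. f x * (exp (- G x) * (- g x)) + f' x * exp (- G x))"
    by (intro ac_deriv_mult ac_deriv_exp ac_deriv_minus f G)
  moreover have "AE x in lebesgue. x \<in> {a..b} \<longrightarrow> f x * (exp (- G x) * (- g x)) + f' x * exp (- G x) \<le> 0"
    using le
  proof eventually_elim
    case (elim x)
    have "f x * (exp (- G x) * (- g x)) + f' x * exp (- G x) = exp (- G x) * (f' x - g x * f x)"
      by (simp add: algebra_simps)
    then show ?case using elim by (simp add: mult_nonneg_nonpos)
  qed
  ultimately have "f b * exp (- G b) \<le> f a * exp (- G a)" using ab ac_deriv_nonpos_decreasing by blast
  then have "f b * exp (- G b) * exp (G b) \<le> f a * exp (- G a) * exp (G b)" by (rule mult_right_mono) simp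
  then show ?thesis by (simp add: mult.assoc flip: exp_add)
qed

lemma gronwall_lower:
  fixes f g :: "real \<Rightarrow> real"
  assumes f: "ac_deriv a b f f'" and G: "ac_deriv a b G g" and ab: "a \<le> b"
    and le: "AE x in lebesgue. x \<in> {a..b} \<longrightarrow> g x * f x \<le> f' x"
  shows "f a * exp (G b - G a) \<le> f b"
  using gronwall_upper[OF ac_deriv_minus[OF f] G ab] le by (auto elim: eventually_mono)

section \<open>Primitives of locally integrable functions\<close>

text \<open>The oriented integral from \<open>c\<close>, so that initial value problems can be
  solved to both sides of the base point at once.\<close>

definition primitive :: "real \<Rightarrow> (real \<Rightarrow> 'b::euclidean_space) \<Rightarrow> real \<Rightarrow> 'b" where
  "primitive c f x = (if c \<le> x then integral {c..x} f else - integral {x..c} f)"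

lemma primitive_base [simp]: "primitive c f c = 0"
  by (simp add: primitive_def)

lemma
  fixes f :: "real \<Rightarrow> 'b::euclidean_space"
  assumes f: "L1_loc f"
  shows has_integral_primitive: "x \<le> y \<Longrightarrow> (f has_integral primitive c f y - primitive c f x) {x..y}"
    and ac_deriv_primitive: "ac_deriv a b (primitive c f) f"
proof -
  have int: "f integrable_on {x..y}" for x y
    using f by (simp add: L1_loc_def absolutely_integrable_on_def)
  have comb: "integral {x..y} f + integral {y..z} f = integral {x..z} f" if "x \<le> y" "y \<le> z" for x y z
    using that int by (simp add: Henstock_Kurzweil_Integration.integral_combine)
  show F: "(f has_integral primitive c f y - primitive c f x) {x..y}" if "x \<le> y" for x y
  proof -
    have "integral {x..y} f = primitive c f y - primitive c f x"
    proof -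
      consider "c \<le> x" | "x < c" "c \<le> y" | "y < c" by linarith
      then show ?thesis
      proof cases
        case 1
        then show ?thesis using comb[of c x y] that by (simp add: primitive_def eq_diff_eq add.commute)
      next
        case 2
        then show ?thesis using comb[of x c y] by (simp add: primitive_def add.commute)
      next
        case 3
        then show ?thesis using comb[of x y c] that by (simp add: primitive_def eq_diff_eq)
      qed
    qed
    then show ?thesis using int by (metis integrable_integral)
  qed
  show "ac_deriv a b (primitive c f) f"
    using f F by (intro ac_deriv_of_integral) (auto simp: L1_loc_def)
qed

lemma continuous_on_UNIV_of_intervals:
  fixes f :: "real \<Rightarrow> 'b::topological_space"
  assumes "\<And>a b. continuous_on {a..b} f"
  shows "continuous_on UNIV f"
proof (rule continuous_at_imp_continuous_on, rule ballI)
  fix x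
  have "continuous_on {x - 1<..<x + 1} f" by (rule continuous_on_subset[OF assms[of "x - 1" "x + 1"]]) auto
  then show "isCont f x" by (simp add: continuous_on_eq_continuous_at)
qed

lemma continuous_on_primitive: "L1_loc f \<Longrightarrow> continuous_on UNIV (primitive c f)"
  by (rule continuous_on_UNIV_of_intervals, rule ac_deriv_continuous, rule ac_deriv_primitive)

lemma L1_loc_continuous: "continuous_on UNIV f \<Longrightarrow> L1_loc f"
  unfolding L1_loc_def by (metis absolutely_integrable_continuous_real continuous_on_subset subset_UNIV)

lemma L1_loc_norm: "L1_loc f \<Longrightarrow> L1_loc (\<lambda>x. norm (f x))"
  unfolding L1_loc_def using absolutely_integrable_norm[of _ f] by (auto simp: o_def)

lemma L1_loc_add: "L1_loc f \<Longrightarrow> L1_loc g \<Longrightarrow> L1_loc (\<lambda>x. f x + g x)"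
  unfolding L1_loc_def by (simp add: set_integral_add(1))

lemma L1_loc_bounded_linear: "bounded_linear h \<Longrightarrow> L1_loc f \<Longrightarrow> L1_loc (\<lambda>x. h (f x))"
  unfolding L1_loc_def using absolutely_integrable_linear[of _ f h]
  by (auto simp: o_def)

lemma L1_loc_bounded_bilinear:
  fixes h :: "'a::euclidean_space \<Rightarrow> 'b::euclidean_space \<Rightarrow> 'c::euclidean_space"
  assumes h: "bounded_bilinear h" and f: "L1_loc f" and g: "continuous_on UNIV g"
  shows "L1_loc (\<lambda>x. h (f x) (g x))"
  unfolding L1_loc_def
proof (intro allI)
  fix a b :: real
  have gc: "continuous_on {a..b} g" using g continuous_on_subset by blast
  have "bilinear (\<lambda>u v. h v u)"
    using bounded_bilinear.flip[OF h] by (simp add: bilinear_conv_bounded_bilinear)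
  moreover have "g \<in> borel_measurable (lebesgue_on {a..b})"
    using gc by (intro continuous_imp_measurable_on_sets_lebesgue) auto
  moreover have "bounded (g ` {a..b})" using gc by (intro compact_imp_bounded compact_continuous_image) auto
  moreover have "f absolutely_integrable_on {a..b}" using f unfolding L1_loc_def by blast
  ultimately show "(\<lambda>x. h (f x) (g x)) absolutely_integrable_on {a..b}"
    using absolutely_integrable_bounded_measurable_product[where h = "\<lambda>u v. h v u" and f = g and g = f and S = "{a..b}"]
    by simp
qed

section \<open>Linear differential equations with locally integrable coefficients\<close>

lemma norm_matrix_vector_mult:
  fixes A :: "complex^'n^'m" and x :: "complex^'n"
  shows "norm (A *v x) \<le> norm A * norm x"
proof -
  have "norm (A *v x) = L2_set (\<lambda>i. norm ((A *v x) $ i)) UNIV" by (simp add: norm_vec_def)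
  also have "\<dots> \<le> L2_set (\<lambda>i. norm (A $ i) * norm x) UNIV"
  proof (rule L2_set_mono)
    fix i
    have "norm ((A *v x) $ i) \<le> (\<Sum>j\<in>UNIV. norm (A $ i $ j) * norm (x $ j))"
      unfolding matrix_vector_mult_def by (simp, rule order_trans[OF norm_sum]) (simp add: norm_mult)
    also have "\<dots> \<le> L2_set (\<lambda>j. norm (A $ i $ j)) UNIV * L2_set (\<lambda>j. norm (x $ j)) UNIV"
      using L2_set_mult_ineq[of "\<lambda>j. norm (A $ i $ j)" "\<lambda>j. norm (x $ j)" UNIV] by simp
    also have "\<dots> = norm (A $ i) * norm x" by (simp add: norm_vec_def)
    finally show "norm ((A *v x) $ i) \<le> norm (A $ i) * norm x" .
  qed simp
  also have "\<dots> = norm A * norm x"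
    by (subst L2_set_left_distrib[symmetric]) (simp_all add: norm_vec_def)
  finally show ?thesis .
qed

lemma bounded_bilinear_matrix_vector_mult_complex:
  "bounded_bilinear ((*v) :: complex^'n^'m \<Rightarrow> complex^'n \<Rightarrow> complex^'m)"
proof
  fix r :: real and a a' :: "complex^'n^'m" and b b' :: "complex^'n"
  show "(a + a') *v b = a *v b + a' *v b" by (rule matrix_vector_mult_add_rdistrib)
  show "a *v (b + b') = a *v b + a *v b'" by (rule matrix_vector_right_distrib)
  show "r *\<^sub>R a *v b = r *\<^sub>R (a *v b)" by (simp add: vec_eq_iff matrix_vector_mult_def scaleR_right.sum)
  show "a *v r *\<^sub>R b = r *\<^sub>R (a *v b)" by (simp add: vec_eq_iff matrix_vector_mult_def scaleR_right.sum)
  show "\<exists>K. \<forall>(a :: complex^'n^'m) b. norm (a *v b) \<le> norm a * norm b * K"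
    using norm_matrix_vector_mult by (intro exI[of _ 1]) auto
qed

lemma smult_matrix_vector_mult: "smult_matrix z K *v w = z *s (K *v w)"
  by (simp add: smult_matrix_def map_matrix_def matrix_vector_mult_def vec_eq_iff sum_distrib_left mult.assoc)

lemma norm_scalar_mult_vec: "norm (z *s (w :: complex^'n)) = norm z * norm w"
  unfolding norm_vec_def by (simp add: norm_mult L2_set_right_distrib)

lemma norm_smult_matrix: "norm (smult_matrix z K) = norm z * norm K"
proof -
  have "smult_matrix z K $ i = z *s (K $ i)" for i
    by (simp add: smult_matrix_def map_matrix_def vec_eq_iff)
  then show ?thesis
    by (simp add: norm_vec_def[of "smult_matrix z K"] norm_vec_def[of K] norm_scalar_mult_vec L2_set_right_distrib)
qed

lemma bounded_linear_scalar_mult_vec: "bounded_linear (\<lambda>w :: complex^'n. z *s w)"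
proof
  show "z *s (b1 + b2) = z *s b1 + z *s b2" for b1 b2 :: "complex^'n" by (rule vector_add_ldistrib)
  show "z *s (r *\<^sub>R b) = r *\<^sub>R (z *s b)" for r and b :: "complex^'n" by (simp add: vec_eq_iff)
  show "\<exists>K. \<forall>x :: complex^'n. norm (z *s x) \<le> norm x * K"
    by (intro exI[of _ "norm z"]) (simp add: norm_scalar_mult_vec mult.commute)
qed

section \<open>Solutions of the linear system and their uniqueness\<close>

definition linear_ode_solution :: "(real \<Rightarrow> complex^'n^'n) \<Rightarrow> (real \<Rightarrow> complex^'n) \<Rightarrow> bool" where
  "linear_ode_solution B V \<longleftrightarrow> (\<forall>a b. ac_deriv a b V (\<lambda>x. B x *v V x))"

lemma linear_ode_solution_continuous: "linear_ode_solution B V \<Longrightarrow> continuous_on UNIV V"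
  unfolding linear_ode_solution_def using continuous_on_UNIV_of_intervals ac_deriv_continuous by blast

text \<open>The integrated equation is the form that survives limits and changes of variable; the
  Picard limit and the reflected solutions are recognised as solutions through it.\<close>

lemma linear_ode_solution_of_integral:
  assumes "L1_loc B" "continuous_on UNIV V"
    and "\<And>x y. x \<le> y \<Longrightarrow> ((\<lambda>t. B t *v V t) has_integral V y - V x) {x..y}"
  shows "linear_ode_solution B V"
  unfolding linear_ode_solution_def
  using L1_loc_bounded_bilinear[OF bounded_bilinear_matrix_vector_mult_complex assms(1,2)] assms(3)
  by (intro allI ac_deriv_of_integral) (auto simp: L1_loc_def)

lemma linear_ode_solution_add:
  assumes "linear_ode_solution B V" "linear_ode_solution B W"
  shows "linear_ode_solution B (\<lambda>x. V x + W x)"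
  using assms ac_deriv_add unfolding linear_ode_solution_def matrix_vector_right_distrib by blast

lemma linear_ode_solution_scalar:
  assumes "linear_ode_solution B V" shows "linear_ode_solution B (\<lambda>x. z *s V x)"
proof -
  have "B x *v (z *s v) = z *s (B x *v v)" for x v
    by (simp add: matrix_vector_mult_def vec_eq_iff sum_distrib_left mult_ac)
  then show ?thesis
    using ac_deriv_bounded_linear[OF bounded_linear_scalar_mult_vec[of z]] assms
    unfolding linear_ode_solution_def by (simp only:) blast
qed

lemma linear_ode_solution_diff:
  assumes "linear_ode_solution B V" "linear_ode_solution B W"
  shows "linear_ode_solution B (\<lambda>x. V x - W x)"
  using assms ac_deriv_diff unfolding linear_ode_solution_def matrix_vector_mult_diff_distrib by blast

text \<open>Since the derivative of |V|^2 is at most 2 |B| |V|^2 in absolute value, the Gronwall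
  inequality with weight 2 |B| carries the zero at \<open>c\<close> to both sides; to the left, the
  lower bound is used.\<close>

lemma linear_ode_zero:
  assumes B: "L1_loc B" and V: "linear_ode_solution B V" and c: "V c = 0"
  shows "V x = 0"
proof -
  let ?f = "\<lambda>x. V x \<bullet> V x" and ?f' = "\<lambda>x. V x \<bullet> (B x *v V x) + (B x *v V x) \<bullet> V x"
  let ?G = "primitive c (\<lambda>x. norm (B x))"
  have f: "ac_deriv a b ?f ?f'" for a b
    using V ac_deriv_inner unfolding linear_ode_solution_def by blast
  have G: "ac_deriv a b (\<lambda>x. 2 * ?G x) (\<lambda>x. 2 * norm (B x))" for a b
    using ac_deriv_bounded_linear[OF bounded_linear_mult_right[of 2] ac_deriv_primitive[OF L1_loc_norm[OF B]]] .
  have bd: "\<bar>?f' x\<bar> \<le> 2 * norm (B x) * ?f x" for x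
  proof -
    have "\<bar>V x \<bullet> (B x *v V x)\<bar> \<le> norm (V x) * (norm (B x) * norm (V x))"
      using Cauchy_Schwarz_ineq2[of "V x" "B x *v V x"] norm_matrix_vector_mult[of "B x" "V x"]
      by (meson mult_left_mono norm_ge_zero order_trans)
    then show ?thesis
      by (simp add: inner_commute[of "B x *v V x"] dot_square_norm power2_eq_square mult_ac)
  qed
  show ?thesis
  proof (cases "c \<le> x")
    case True
    have "?f x \<le> ?f c * exp (2 * ?G x - 2 * ?G c)"
    proof (rule gronwall_upper[OF f G True])
      show "AE t in lebesgue. t \<in> {c..x} \<longrightarrow> ?f' t \<le> 2 * norm (B t) * ?f t"
        using bd by (intro AE_I2) (meson abs_le_D1)
    qed
    then have "norm (V x) ^ 2 \<le> 0" using c by (simp add: dot_square_norm)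
    then show ?thesis by simp
  next
    case False
    have "?f x * exp (- (2 * ?G c) - - (2 * ?G x)) \<le> ?f c"
    proof (rule gronwall_lower[OF f ac_deriv_minus[OF G]])
      show "AE t in lebesgue. t \<in> {x..c} \<longrightarrow> - (2 * norm (B t)) * ?f t \<le> ?f' t"
      proof (rule AE_I2, rule impI)
        show "- (2 * norm (B t)) * ?f t \<le> ?f' t" for t using bd[of t] by linarith
      qed
      show "x \<le> c" using False by simp
    qed
    then have "norm (V x) ^ 2 \<le> 0" using c by (simp add: mult_le_0_iff dot_square_norm)
    then show ?thesis by simp
  qed
qed

lemma linear_ode_unique:
  assumes "L1_loc B" "linear_ode_solution B V" "linear_ode_solution B W" "V c = W c"
  shows "V = W"
  using linear_ode_zero[OF assms(1) linear_ode_solution_diff[OF assms(2,3)], of c] assms(4) by (auto simp: fun_eq_iff)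

section \<open>Existence by Picard iteration, with entire dependence on the parameter\<close>

text \<open>The Picard iterates for the coefficient \<open>A + \<zeta> K\<close> are polynomials in \<open>\<zeta>\<close>; \<open>picard_coeff A K c v n j\<close>
  is the coefficient of \<open>\<zeta>^j\<close> in the \<open>n\<close>-th increment.\<close>

fun picard_coeff :: "(real \<Rightarrow> complex^'n^'n) \<Rightarrow> complex^'n^'n \<Rightarrow> real \<Rightarrow> complex^'n \<Rightarrow> nat \<Rightarrow> nat \<Rightarrow> real \<Rightarrow> complex^'n" where
  "picard_coeff A K c v 0 j x = (if j = 0 then v else 0)"
| "picard_coeff A K c v (Suc n) j x = primitive c (\<lambda>t. A t *v picard_coeff A K c v n j t +
      (if j = 0 then 0 else K *v picard_coeff A K c v n (j - 1) t)) x"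

definition picard_term :: "(real \<Rightarrow> complex^'n^'n) \<Rightarrow> complex^'n^'n \<Rightarrow> real \<Rightarrow> complex^'n \<Rightarrow> nat \<Rightarrow> complex \<Rightarrow> real \<Rightarrow> complex^'n" where
  "picard_term A K c v n \<zeta> x = (\<Sum>j\<le>n. \<zeta> ^ j *s picard_coeff A K c v n j x)"

context
  fixes A :: "real \<Rightarrow> complex^'n^'n" and K :: "complex^'n^'n" and c :: real and v :: "complex^'n"
  assumes A: "L1_loc A"
begin

lemma continuous_picard_coeff: "continuous_on UNIV (picard_coeff A K c v n j)"
  and L1_picard_coeff: "L1_loc (\<lambda>t. A t *v picard_coeff A K c v n j t +
      (if j = 0 then 0 else K *v picard_coeff A K c v n (j - 1) t))"
proof -
  have L: "L1_loc (\<lambda>t. A t *v g t + (if j = 0 then 0 else K *v h t))"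
    if "continuous_on UNIV g" "continuous_on UNIV h" for j :: nat and g h :: "real \<Rightarrow> complex^'n"
  proof (rule L1_loc_add)
    show "L1_loc (\<lambda>t. A t *v g t)"
      by (rule L1_loc_bounded_bilinear[OF bounded_bilinear_matrix_vector_mult_complex A that(1)])
    show "L1_loc (\<lambda>t. if j = 0 then 0 else K *v h t)"
      using L1_loc_continuous[OF bounded_linear.continuous_on[OF
        bounded_bilinear.bounded_linear_right[OF bounded_bilinear_matrix_vector_mult_complex] that(2)]]
        L1_loc_continuous[OF continuous_on_const] by (cases j) simp_all
  qed
  have cont: "continuous_on UNIV (picard_coeff A K c v n j)" for n j
  proof (induction n arbitrary: j)
    case 0 then show ?case by simp
  next
    case (Suc n)
    have "picard_coeff A K c v (Suc n) j = primitive c (\<lambda>t. A t *v picard_coeff A K c v n j t +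
      (if j = 0 then 0 else K *v picard_coeff A K c v n (j - 1) t))" by (rule ext) simp
    then show ?case using continuous_on_primitive[OF L[OF Suc Suc]] by (simp only:)
  qed
  then show "continuous_on UNIV (picard_coeff A K c v n j)" by blast
  show "L1_loc (\<lambda>t. A t *v picard_coeff A K c v n j t +
      (if j = 0 then 0 else K *v picard_coeff A K c v n (j - 1) t))" by (rule L[OF cont cont])
qed

lemma picard_coeff_zero: "n < j \<Longrightarrow> picard_coeff A K c v n j x = 0"
proof (induction n arbitrary: j x)
  case (Suc n)
  then have "picard_coeff A K c v n j t = 0" "picard_coeff A K c v n (j - 1) t = 0" for t by auto
  with Suc.prems show ?case by (simp add: primitive_def)
qed simp

lemma continuous_picard_term: "continuous_on UNIV (picard_term A K c v n \<zeta>)"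
  unfolding picard_term_def
  by (intro continuous_on_sum bounded_linear.continuous_on[OF bounded_linear_scalar_mult_vec] continuous_picard_coeff)

lemma picard_term_0: "picard_term A K c v 0 \<zeta> x = v"
  by (simp add: picard_term_def)

lemma picard_term_base: "picard_term A K c v (Suc n) \<zeta> c = 0"
  by (simp add: picard_term_def)

text \<open>Collecting powers of \<zeta>: multiplication by \<zeta> K raises the degree by one,
  which is the \<open>j - 1\<close> in the recursion of the coefficients. What results is the Picard
  recursion for the coefficient A + \<zeta> K.\<close>

lemma picard_term_Suc:
  assumes "x \<le> y"
  shows "((\<lambda>t. (A t + smult_matrix \<zeta> K) *v picard_term A K c v n \<zeta> t) has_integral
    picard_term A K c v (Suc n) \<zeta> y - picard_term A K c v (Suc n) \<zeta> x) {x..y}"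
proof -
  let ?C = "picard_coeff A K c v n"
  let ?I = "\<lambda>j t. A t *v ?C j t + (if j = 0 then 0 else K *v ?C (j - 1) t)"
  have "((\<lambda>t. \<Sum>j\<le>Suc n. \<zeta> ^ j *s ?I j t) has_integral
     (\<Sum>j\<le>Suc n. \<zeta> ^ j *s (primitive c (?I j) y - primitive c (?I j) x))) {x..y}"
    using has_integral_primitive[OF L1_picard_coeff assms]
    by (intro has_integral_sum finite_atMost has_integral_linear[OF _ bounded_linear_scalar_mult_vec, unfolded o_def]) blast
  also have "(\<Sum>j\<le>Suc n. \<zeta> ^ j *s (primitive c (?I j) y - primitive c (?I j) x))
      = picard_term A K c v (Suc n) \<zeta> y - picard_term A K c v (Suc n) \<zeta> x"
    by (simp add: picard_term_def sum_subtractf vector_ssub_ldistrib)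
  also have "(\<lambda>t. \<Sum>j\<le>Suc n. \<zeta> ^ j *s ?I j t) = (\<lambda>t. (A t + smult_matrix \<zeta> K) *v picard_term A K c v n \<zeta> t)"
  proof
    fix t
    have mv: "M *v (z *s w) = z *s (M *v w)" for M :: "complex^'n^'n" and z w
      by (simp add: matrix_vector_mult_def vec_eq_iff sum_distrib_left mult_ac)
    have ms: "M *v (\<Sum>j\<in>S. f j) = (\<Sum>j\<in>S. M *v f j)" for M :: "complex^'n^'n" and f and S :: "nat set"
      by (rule bounded_linear.linear[OF bounded_bilinear.bounded_linear_right[OF bounded_bilinear_matrix_vector_mult_complex], THEN linear_sum])
    have "(\<Sum>j\<le>Suc n. \<zeta> ^ j *s ?I j t) = (\<Sum>j\<le>Suc n. \<zeta> ^ j *s (A t *v ?C j t))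
        + (\<Sum>j\<le>Suc n. \<zeta> ^ j *s (if j = 0 then 0 else K *v ?C (j - 1) t))"
      by (simp only: vector_add_ldistrib sum.distrib)
    also have "(\<Sum>j\<le>Suc n. \<zeta> ^ j *s (A t *v ?C j t)) = A t *v picard_term A K c v n \<zeta> t"
      by (simp add: picard_term_def ms mv picard_coeff_zero)
    also have "(\<Sum>j\<le>Suc n. \<zeta> ^ j *s (if j = 0 then 0 else K *v ?C (j - 1) t))
        = (\<Sum>j\<le>n. \<zeta> ^ Suc j *s (K *v ?C j t))"
      by (subst sum.atMost_Suc_shift) simp
    also have "\<dots> = smult_matrix \<zeta> K *v picard_term A K c v n \<zeta> t"
      by (simp add: picard_term_def ms mv smult_matrix_vector_mult vector_smult_assoc mult_ac)
    finally show "(\<Sum>j\<le>Suc n. \<zeta> ^ j *s ?I j t) = (A t + smult_matrix \<zeta> K) *v picard_term A K c v n \<zeta> t"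
      by (simp only: matrix_vector_mult_add_rdistrib)
  qed
  finally show ?thesis .
qed

text \<open>The usual factorial bound by induction on \<open>n\<close>, with the integral of |A| + R
  |K| as the growing quantity. Fixing \<open>R\<close> in place of |\<zeta>| makes it uniform on
  discs, as holomorphy requires. To the left of \<open>c\<close> this integral is negative, so its
  negative takes over.\<close>

lemma picard_term_bound:
  assumes R: "norm \<zeta> \<le> R"
  shows "norm (picard_term A K c v n \<zeta> x)
    \<le> norm v * \<bar>primitive c (\<lambda>t. norm (A t) + R * norm K) x\<bar> ^ n / fact n"
proof -
  define b where "b = (\<lambda>t. norm (A t) + R * norm K)"
  define \<beta> where "\<beta> = primitive c b"
  have R0: "R \<ge> 0" using R norm_ge_zero order_trans by blast
  have b0: "b t \<ge> 0" for t using R0 by (simp add: b_def)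
  have b: "L1_loc b" unfolding b_def
    by (intro L1_loc_add L1_loc_norm A L1_loc_continuous continuous_on_const)
  have bB: "norm ((A t + smult_matrix \<zeta> K) *v w) \<le> b t * norm w" for t w
  proof -
    have "norm (A t + smult_matrix \<zeta> K) \<le> norm (A t) + norm \<zeta> * norm K"
      by (metis norm_triangle_ineq norm_smult_matrix)
    also have "\<dots> \<le> b t" unfolding b_def using R by (simp add: mult_right_mono)
    finally show ?thesis by (meson norm_matrix_vector_mult mult_right_mono norm_ge_zero order_trans)
  qed
  \<comment> \<open>The induction step in differentiated form: f^(n+1)/(n+1)! is a primitive of f'
    f^n/n!.\<close>
  have pow: "ac_deriv p q (\<lambda>x. f x ^ Suc n / fact (Suc n)) (\<lambda>x. f' x * (f x ^ n / fact n))"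
    if f: "ac_deriv p q f f'" for p q n and f f' :: "real \<Rightarrow> real"
  proof -
    have "ac_deriv p q (\<lambda>x. f x ^ Suc n) (\<lambda>x. f' x * (real (Suc n) * f x ^ n))"
    proof (induction n)
      case 0 then show ?case using f by simp
    next
      case (Suc n)
      have "ac_deriv p q (\<lambda>x. f x * f x ^ Suc n) (\<lambda>x. f x * (f' x * (real (Suc n) * f x ^ n)) + f' x * f x ^ Suc n)"
        by (rule ac_deriv_mult[OF f Suc])
      then show ?case by (simp add: algebra_simps)
    qed
    from ac_deriv_bounded_linear[OF bounded_linear_divide[of "fact (Suc n)"] this] show ?thesis
      by (simp add: divide_simps del: of_nat_Suc)
  qed
  have \<beta>: "ac_deriv p q \<beta> b" for p q unfolding \<beta>_def by (rule ac_deriv_primitive[OF b])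
  have "(c \<le> x \<longrightarrow> norm (picard_term A K c v n \<zeta> x) \<le> norm v * (\<beta> x ^ n / fact n)) \<and>
        (x \<le> c \<longrightarrow> norm (picard_term A K c v n \<zeta> x) \<le> norm v * ((- \<beta> x) ^ n / fact n))" for x
  proof (induction n arbitrary: x)
    case 0 then show ?case by (simp add: picard_term_0)
  next
    case (Suc n)
    have "norm (picard_term A K c v (Suc n) \<zeta> x) \<le> norm v * (\<beta> x ^ Suc n / fact (Suc n))" if x: "c \<le> x"
    proof -
      have i: "((\<lambda>t. norm v * (b t * (\<beta> t ^ n / fact n))) has_integral norm v * (\<beta> x ^ Suc n / fact (Suc n))) {c..x}"
        using has_integral_mult_right[OF ac_deriv_has_integral[OF pow[OF \<beta>] order_refl x order_refl], of "norm v" n]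
        by (simp add: \<beta>_def)
      have j: "((\<lambda>t. (A t + smult_matrix \<zeta> K) *v picard_term A K c v n \<zeta> t) has_integral
          picard_term A K c v (Suc n) \<zeta> x) {c..x}"
        using picard_term_Suc[OF x] by (simp add: picard_term_base)
      have le: "norm ((A t + smult_matrix \<zeta> K) *v picard_term A K c v n \<zeta> t) \<le> norm v * (b t * (\<beta> t ^ n / fact n))"
        if "t \<in> {c..x}" for t
      proof -
        have "norm ((A t + smult_matrix \<zeta> K) *v picard_term A K c v n \<zeta> t) \<le> b t * (norm v * (\<beta> t ^ n / fact n))"
          using Suc[of t] that by (intro order_trans[OF bB] mult_left_mono b0) auto
        then show ?thesis by (simp only: mult.left_commute)
      qed
      show ?thesis using integral_norm_bound_integral[OF has_integral_integrable[OF j] has_integral_integrable[OF i] le]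
        by (simp only: integral_unique[OF i] integral_unique[OF j])
    qed
    moreover have "norm (picard_term A K c v (Suc n) \<zeta> x) \<le> norm v * ((- \<beta> x) ^ Suc n / fact (Suc n))" if x: "x \<le> c"
    proof -
      have "((\<lambda>t. norm v * (- b t * ((- \<beta> t) ^ n / fact n))) has_integral
          norm v * ((- \<beta> c) ^ Suc n / fact (Suc n) - (- \<beta> x) ^ Suc n / fact (Suc n))) {x..c}"
        using has_integral_mult_right[OF ac_deriv_has_integral[OF pow[OF ac_deriv_minus[OF \<beta>]] order_refl x order_refl], of "norm v" n]
        by blast
      from has_integral_neg[OF this]
      have i: "((\<lambda>t. norm v * (b t * ((- \<beta> t) ^ n / fact n))) has_integral norm v * ((- \<beta> x) ^ Suc n / fact (Suc n))) {x..c}"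
        by (simp add: \<beta>_def)
      have j: "((\<lambda>t. (A t + smult_matrix \<zeta> K) *v picard_term A K c v n \<zeta> t) has_integral
          - picard_term A K c v (Suc n) \<zeta> x) {x..c}"
        using picard_term_Suc[OF x] by (simp add: picard_term_base)
      have le: "norm ((A t + smult_matrix \<zeta> K) *v picard_term A K c v n \<zeta> t) \<le> norm v * (b t * ((- \<beta> t) ^ n / fact n))"
        if "t \<in> {x..c}" for t
      proof -
        have "norm ((A t + smult_matrix \<zeta> K) *v picard_term A K c v n \<zeta> t) \<le> b t * (norm v * ((- \<beta> t) ^ n / fact n))"
          using Suc[of t] that by (intro order_trans[OF bB] mult_left_mono b0) auto
        then show ?thesis by (simp only: mult.left_commute)
      qed
      show ?thesis using integral_norm_bound_integral[OF has_integral_integrable[OF j] has_integral_integrable[OF i] le]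
        by (simp only: integral_unique[OF i] integral_unique[OF j] norm_minus_cancel)
    qed
    ultimately show ?case by blast
  qed
  moreover have "c \<le> x \<Longrightarrow> \<beta> x \<ge> 0" "x \<le> c \<Longrightarrow> \<beta> x \<le> 0"
    using has_integral_nonneg[OF has_integral_primitive[OF b, of c x c]]
      has_integral_nonneg[OF has_integral_primitive[OF b, of x c c]] b0 by (auto simp: \<beta>_def)
  ultimately have "norm (picard_term A K c v n \<zeta> x) \<le> norm v * (\<bar>\<beta> x\<bar> ^ n / fact n)"
    by (cases "c \<le> x") simp_all
  then show ?thesis by (simp add: \<beta>_def b_def)
qed


text \<open>Uniformity in \<open>x\<close> makes the limit continuous, uniformity in \<zeta> makes
  it holomorphic. The bound on the partial sums supplies the dominating function when the limit is
  taken under the integral.\<close>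

lemma picard_uniform_limit:
  "uniform_limit (cball 0 R \<times> {p..q}) (\<lambda>N (\<zeta>, x). \<Sum>n<N. picard_term A K c v n \<zeta> x)
     (\<lambda>(\<zeta>, x). \<Sum>n. picard_term A K c v n \<zeta> x) sequentially" (is ?U)
  and picard_partial_sum_bounded:
  "\<exists>C. \<forall>\<zeta> x N. norm \<zeta> \<le> R \<longrightarrow> x \<in> {p..q} \<longrightarrow> norm (\<Sum>n<N. picard_term A K c v n \<zeta> x) \<le> C" (is ?B)
proof -
  define b where "b = (\<lambda>t. norm (A t) + R * norm K)"
  have "L1_loc b" unfolding b_def by (intro L1_loc_add L1_loc_norm A L1_loc_continuous continuous_on_const)
  then have "compact (primitive c b ` {p..q})"
    using continuous_on_primitive continuous_on_subset by (intro compact_continuous_image) blast+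
  then obtain M where M: "\<And>x. x \<in> {p..q} \<Longrightarrow> \<bar>primitive c b x\<bar> \<le> M"
    using compact_imp_bounded bounded_iff by (metis image_eqI real_norm_def)
  have bd: "norm (picard_term A K c v n \<zeta> x) \<le> norm v * M ^ n / fact n" if "norm \<zeta> \<le> R" "x \<in> {p..q}" for n \<zeta> x
  proof -
    have "norm (picard_term A K c v n \<zeta> x) \<le> norm v * \<bar>primitive c b x\<bar> ^ n / fact n"
      using picard_term_bound[OF that(1)] by (simp add: b_def)
    also have "\<dots> \<le> norm v * M ^ n / fact n"
      using M[OF that(2)] by (intro divide_right_mono mult_left_mono power_mono) auto
    finally show ?thesis .
  qed
  have sm: "summable (\<lambda>n. norm v * M ^ n / fact n)"
    using summable_mult[OF summable_exp[of M], of "norm v"] by (simp add: field_simps)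
  show ?U
    using Weierstrass_m_test[where A = "cball 0 R \<times> {p..q}" and f = "\<lambda>n (\<zeta>, x). picard_term A K c v n \<zeta> x", OF _ sm] bd
    by (simp add: case_prod_unfold mem_Times_iff)
  show ?B
  proof (intro exI[of _ "\<Sum>n. norm v * M ^ n / fact n"] allI impI)
    fix \<zeta> :: complex and x N assume a: "norm \<zeta> \<le> R" "x \<in> {p..q}"
    have M0: "M \<ge> 0" using M[OF a(2)] by linarith
    have "norm (\<Sum>n<N. picard_term A K c v n \<zeta> x) \<le> (\<Sum>n<N. norm v * M ^ n / fact n)"
      by (rule sum_norm_le) (rule bd[OF a])
    also have "\<dots> \<le> (\<Sum>n. norm v * M ^ n / fact n)"
      by (rule sum_le_suminf[OF sm]) (use M0 in auto)
    finally show "norm (\<Sum>n<N. picard_term A K c v n \<zeta> x) \<le> (\<Sum>n. norm v * M ^ n / fact n)" .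
  qed
qed

text \<open>The integral equation passes to the limit by dominated convergence, with C |A + \<zeta>
  K| as majorant. The components are locally uniform limits of polynomials in \<zeta>, hence
  entire.\<close>

lemma picard_solution:
  defines "U \<equiv> \<lambda>\<zeta> x. \<Sum>n. picard_term A K c v n \<zeta> x"
  shows "linear_ode_solution (\<lambda>x. A x + smult_matrix \<zeta> K) (U \<zeta>)" (is ?S)
    and "U \<zeta> c = v" (is ?C)
    and "(\<lambda>\<zeta>. U \<zeta> x $ i) holomorphic_on UNIV" (is ?H)
proof -
  let ?P = "\<lambda>N \<zeta> x. \<Sum>n<N. picard_term A K c v n \<zeta> x"
  have ulx: "uniform_limit {p..q} (\<lambda>N x. ?P N \<zeta> x) (U \<zeta>) sequentially" for p q \<zeta>
    using picard_uniform_limit[of "norm \<zeta>" p q] unfolding uniform_limit_iff U_def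
    by (fastforce elim!: eventually_mono)
  have lim: "(\<lambda>N. ?P N \<zeta> x) \<longlonglongrightarrow> U \<zeta> x" for \<zeta> x
    using tendsto_uniform_limitI[OF ulx[where p = x and q = x and \<zeta> = \<zeta>]] by simp
  have contP: "continuous_on UNIV (?P N \<zeta>)" for N \<zeta>
    by (intro continuous_on_sum continuous_picard_term)
  have contU: "continuous_on UNIV (U \<zeta>)" for \<zeta>
  proof (rule continuous_on_UNIV_of_intervals)
    show "continuous_on {p..q} (U \<zeta>)" for p q
    proof (rule uniform_limit_theorem[OF _ ulx])
      show "\<forall>\<^sub>F N in sequentially. continuous_on {p..q} (?P N \<zeta>)"
        by (rule always_eventually) (blast intro: continuous_on_subset[OF contP])
    qed simp
  qed
  let ?B = "\<lambda>x. A x + smult_matrix \<zeta> K"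
  have LB: "L1_loc ?B" by (intro L1_loc_add A L1_loc_continuous continuous_on_const)
  show ?C
  proof -
    have "picard_term A K c v n \<zeta> c = (if n = 0 then v else 0)" for n
      by (cases n) (simp_all add: picard_term_0 picard_term_base)
    then show ?thesis unfolding U_def using suminf_finite[of "{0}" "\<lambda>n. picard_term A K c v n \<zeta> c"] by simp
  qed
  show ?S
  proof (rule linear_ode_solution_of_integral[OF LB contU])
    fix x y :: real assume xy: "x \<le> y"
    obtain C where C: "\<And>t N. t \<in> {x..y} \<Longrightarrow> norm (?P N \<zeta> t) \<le> C"
      using picard_partial_sum_bounded[of "norm \<zeta>" x y] by blast
    \<comment> \<open>Summing the recursion shifts the index: the sum of the first \<open>N\<close>
      terms is integrated to the increment of the sum of the first \<open>N + 1\<close>, since the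
      zeroth term is the constant \<open>v\<close>.\<close>
    have step: "((\<lambda>t. ?B t *v ?P N \<zeta> t) has_integral ?P (Suc N) \<zeta> y - ?P (Suc N) \<zeta> x) {x..y}" for N
    proof -
      have "((\<lambda>t. \<Sum>n<N. ?B t *v picard_term A K c v n \<zeta> t) has_integral
          (\<Sum>n<N. picard_term A K c v (Suc n) \<zeta> y - picard_term A K c v (Suc n) \<zeta> x)) {x..y}"
        by (intro has_integral_sum picard_term_Suc xy) auto
      moreover have "(\<Sum>n<N. ?B t *v picard_term A K c v n \<zeta> t) = ?B t *v ?P N \<zeta> t" for t
        by (rule bounded_linear.linear[OF bounded_bilinear.bounded_linear_right[OF bounded_bilinear_matrix_vector_mult_complex], THEN linear_sum, symmetric])
      moreover have "(\<Sum>n<N. picard_term A K c v (Suc n) \<zeta> y - picard_term A K c v (Suc n) \<zeta> x)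
         = ?P (Suc N) \<zeta> y - ?P (Suc N) \<zeta> x"
        by (simp add: sum.lessThan_Suc_shift picard_term_0 sum_subtractf del: sum.lessThan_Suc)
      ultimately show ?thesis by simp
    qed
    have int: "(\<lambda>t. ?B t *v ?P N \<zeta> t) integrable_on {x..y}" for N using step by blast
    have h: "(\<lambda>t. norm (?B t) * C) integrable_on {x..y}"
      using L1_loc_norm[OF LB] by (simp add: L1_loc_def absolutely_integrable_on_def integrable_on_mult_left)
    have le: "norm (?B t *v ?P N \<zeta> t) \<le> norm (?B t) * C" if "t \<in> {x..y}" for t N
      using C[OF that] by (meson mult_left_mono norm_ge_zero norm_matrix_vector_mult order_trans)
    have ptw: "(\<lambda>N. ?B t *v ?P N \<zeta> t) \<longlonglongrightarrow> ?B t *v U \<zeta> t" for t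
      by (rule bounded_linear.tendsto[OF bounded_bilinear.bounded_linear_right[OF bounded_bilinear_matrix_vector_mult_complex] lim])
    note dc = dominated_convergence[OF int h le ptw]
    have "(\<lambda>N. integral {x..y} (\<lambda>t. ?B t *v ?P N \<zeta> t)) \<longlonglongrightarrow> U \<zeta> y - U \<zeta> x"
      unfolding integral_unique[OF step] by (intro tendsto_diff LIMSEQ_Suc lim)
    then have "integral {x..y} (\<lambda>t. ?B t *v U \<zeta> t) = U \<zeta> y - U \<zeta> x"
      using dc(2) LIMSEQ_unique by blast
    then show "((\<lambda>t. ?B t *v U \<zeta> t) has_integral U \<zeta> y - U \<zeta> x) {x..y}"
      using dc(1) by (metis integrable_integral)
  qed
  show ?H
  proof (rule holomorphic_uniform_sequence[where f = "\<lambda>N \<zeta>. ?P N \<zeta> x $ i"])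
    show "(\<lambda>\<zeta>. ?P N \<zeta> x $ i) holomorphic_on UNIV" for N
      unfolding picard_term_def by (simp add: sum_component) (intro holomorphic_intros)
    fix z :: complex assume "z \<in> UNIV"
    have "uniform_limit (cball z 1) (\<lambda>N \<zeta>. ?P N \<zeta> x $ i) (\<lambda>\<zeta>. U \<zeta> x $ i) sequentially"
      unfolding uniform_limit_iff
    proof (intro allI impI)
      fix e :: real assume e: "e > 0"
      show "\<forall>\<^sub>F N in sequentially. \<forall>\<zeta>\<in>cball z 1. dist (?P N \<zeta> x $ i) (U \<zeta> x $ i) < e"
        using picard_uniform_limit[of "norm z + 1" x x, unfolded uniform_limit_iff, rule_format, OF e]
      proof eventually_elim
        case (elim N)
        show ?case
        proof
          fix \<zeta> assume "\<zeta> \<in> cball z 1"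
          then have "norm \<zeta> \<le> norm z + 1" by (smt (verit) dist_norm mem_cball norm_minus_commute norm_triangle_sub)
          then have "dist (?P N \<zeta> x) (U \<zeta> x) < e" using elim by (auto simp: U_def)
          then show "dist (?P N \<zeta> x $ i) (U \<zeta> x $ i) < e" by (meson dist_vec_nth_le le_less_trans)
        qed
      qed
    qed
    then show "\<exists>d>0. cball z d \<subseteq> UNIV \<and> uniform_limit (cball z d) (\<lambda>N \<zeta>. ?P N \<zeta> x $ i) (\<lambda>\<zeta>. U \<zeta> x $ i) sequentially"
      by (intro exI[of _ 1]) simp
  qed simp
qed

end

text \<open>The solution of V' = (A + \<zeta> K) V with value \<open>v\<close> at
  \<open>c\<close>.\<close>

definition linear_ode_flow :: "(real \<Rightarrow> complex^'n^'n) \<Rightarrow> complex^'n^'n \<Rightarrow> real \<Rightarrow> complex^'n \<Rightarrow> complex \<Rightarrow> real \<Rightarrow> complex^'n" where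
  "linear_ode_flow A K c v \<zeta> x = (\<Sum>n. picard_term A K c v n \<zeta> x)"

lemmas linear_ode_flow_solution = picard_solution(1)[folded linear_ode_flow_def]
lemmas linear_ode_flow_base [simp] = picard_solution(2)[folded linear_ode_flow_def]
lemmas linear_ode_flow_holomorphic = picard_solution(3)[folded linear_ode_flow_def]

section \<open>The Dirac system in diagonal form\<close>

definition upper :: "'a^('m::finite + 'm) \<Rightarrow> 'a^'m" where "upper V = (\<chi> k. V $ Inl k)"
definition lower :: "'a^('m::finite + 'm) \<Rightarrow> 'a^'m" where "lower V = (\<chi> k. V $ Inr k)"
definition join :: "'a^'m \<Rightarrow> 'a^'m \<Rightarrow> 'a^('m::finite + 'm)" where
  "join u w = (\<chi> i. case i of Inl k \<Rightarrow> u $ k | Inr k \<Rightarrow> w $ k)"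

lemma upper_lower_simps [simp]:
  "upper (join u w) = u" "lower (join u w) = w" "join (upper V) (lower V) = V"
  "upper (V + W) = upper V + upper W" "lower (V + W) = lower V + lower W"
  "upper (X - Y) = upper X - upper Y" "lower (X - Y) = lower X - lower Y"
  "upper (c *s T) = c *s upper T" "lower (c *s T) = c *s lower T"
  "upper 0 = 0" "lower 0 = 0"
  for V W :: "'a::ab_semigroup_add^('m::finite + 'm)" and X Y :: "'b::ab_group_add^('m + 'm)"
    and T :: "'c::times^('m + 'm)"
  by (auto simp: upper_def lower_def join_def vec_eq_iff split: sum.split)

lemma vec_sum_eqI: "upper V = upper W \<Longrightarrow> lower V = lower W \<Longrightarrow> V = W"
  unfolding upper_def lower_def vec_eq_iff by (auto, metis sum.exhaust)

lemma vec_sum_eq_iff: "V = W \<longleftrightarrow> upper V = upper W \<and> lower V = lower W"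
  using vec_sum_eqI by blast

lemma upper_lower_block:
  fixes V :: "complex^('m::finite + 'm)"
  shows "upper (block P Q R S *v V) = P *v upper V + Q *v lower V"
    and "lower (block P Q R S *v V) = R *v upper V + S *v lower V"
  by (simp_all add: upper_def lower_def block_def matrix_vector_mult_def vec_eq_iff
      UNIV_Plus_UNIV[symmetric] sum.Plus del: UNIV_Plus_UNIV)

lemma bounded_linear_upper: "bounded_linear (upper :: complex^('m::finite + 'm) \<Rightarrow> complex^'m)"
  and bounded_linear_lower: "bounded_linear (lower :: complex^('m::finite + 'm) \<Rightarrow> complex^'m)"
  unfolding upper_def lower_def
  by (auto intro!: linear_conv_bounded_linear[THEN iffD1] linearI simp: vec_eq_iff)

lemma norm_upper_lower: "(norm V)\<^sup>2 = (norm (upper V))\<^sup>2 + (norm (lower V))\<^sup>2"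
  for V :: "complex^('m::finite + 'm)"
  by (simp add: norm_vec_def L2_set_def upper_def lower_def sum_nonneg
      UNIV_Plus_UNIV[symmetric] sum.Plus del: UNIV_Plus_UNIV)

lemma bounded_bilinear_scalar_mult_vec: "bounded_bilinear ((*s) :: complex \<Rightarrow> complex^'n \<Rightarrow> complex^'n)"
proof
  fix r :: real and a a' :: complex and b b' :: "complex^'n"
  show "(a + a') *s b = a *s b + a' *s b" by (rule vector_sadd_rdistrib)
  show "a *s (b + b') = a *s b + a *s b'" by (rule vector_add_ldistrib)
  show "r *\<^sub>R a *s b = r *\<^sub>R (a *s b)" by (simp add: vec_eq_iff)
  show "a *s r *\<^sub>R b = r *\<^sub>R (a *s b)" by (simp add: vec_eq_iff)
  show "\<exists>K. \<forall>a (b :: complex^'n). norm (a *s b) \<le> norm a * norm b * K"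
    by (intro exI[of _ 1]) (simp add: norm_scalar_mult_vec)
qed

text \<open>Solving the Dirac equation for the derivative gives V' = (diag(-\<phi>, \<phi>) +
  \<zeta> J) V; \<open>dirac_coeff\<close> is the first matrix and \<open>dirac_twist\<close> is
  J.\<close>

abbreviation dirac_coeff :: "(real \<Rightarrow> complex^'m^'m) \<Rightarrow> real \<Rightarrow> complex^('m::finite + 'm)^('m + 'm)" where
  "dirac_coeff \<phi> \<equiv> \<lambda>x. block (- \<phi> x) 0 0 (\<phi> x)"

abbreviation dirac_twist :: "complex^('m::finite + 'm)^('m + 'm)" where
  "dirac_twist \<equiv> block 0 (mat 1) (- mat 1) 0"

lemma AE_all_intervals:
  assumes "\<And>a b. AE x in lebesgue. x \<in> {a..b :: real} \<longrightarrow> P x"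
  shows "AE x in lebesgue. P x"
proof -
  have "AE x in lebesgue. \<forall>n::nat. x \<in> {- real n..real n} \<longrightarrow> P x"
    using assms unfolding AE_all_countable by blast
  then show ?thesis
  proof eventually_elim
    case (elim x)
    have "x \<in> {- real (nat \<lceil>\<bar>x\<bar>\<rceil>)..real (nat \<lceil>\<bar>x\<bar>\<rceil>)}"
      using le_of_int_ceiling[of "\<bar>x\<bar>"] by simp linarith
    with elim show ?case by blast
  qed
qed

lemma matrix_minus_vector_mult: "(- M) *v w = - (M *v w)" for M :: "complex^'n^'k"
  by (simp add: matrix_vector_mult_def vec_eq_iff sum_negf)

lemma upper_minus [simp]: "upper (- V) = - upper V" and lower_minus [simp]: "lower (- V) = - lower V"
  for V :: "'b::group_add^('m::finite + 'm)"
  by (simp_all add: upper_def lower_def vec_eq_iff)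

text \<open>The matrix in front of V' in the Dirac operator is invertible, so the implicit equation
  can be solved for V'. Differentiability is demanded alongside the equation, which makes the
  pointwise conditions equivalent.\<close>

lemma dirac_solution_iff:
  "dirac_solution \<phi> \<zeta> V \<longleftrightarrow> linear_ode_solution (\<lambda>x. dirac_coeff \<phi> x + smult_matrix \<zeta> dirac_twist) V"
proof -
  let ?B = "\<lambda>x. dirac_coeff \<phi> x + smult_matrix \<zeta> dirac_twist"
  have B: "?B x *v w = join (- (\<phi> x *v upper w) + \<zeta> *s lower w) (\<phi> x *v lower w - \<zeta> *s upper w)" for x w
    by (rule vec_sum_eqI) (simp_all add: matrix_vector_mult_add_rdistrib smult_matrix_vector_mult
      upper_lower_block matrix_minus_vector_mult vec_eq_iff)
  have eq: "block 0 (- mat 1) (mat 1) 0 *v d + block 0 (\<phi> x) (\<phi> x) 0 *v V x = \<zeta> *s V x \<longleftrightarrow> d = ?B x *v V x" for d x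
  proof -
    have "block 0 (- mat 1) (mat 1) 0 *v d + block 0 (\<phi> x) (\<phi> x) 0 *v V x = \<zeta> *s V x
      \<longleftrightarrow> - lower d + \<phi> x *v lower (V x) = \<zeta> *s upper (V x) \<and> upper d + \<phi> x *v upper (V x) = \<zeta> *s lower (V x)"
      unfolding vec_sum_eq_iff[of "_ + _"] by (simp add: upper_lower_block matrix_minus_vector_mult)
    also have "\<dots> \<longleftrightarrow> upper d = - (\<phi> x *v upper (V x)) + \<zeta> *s lower (V x) \<and> lower d = \<phi> x *v lower (V x) - \<zeta> *s upper (V x)"
      by (auto simp: algebra_simps eq_diff_eq diff_eq_eq)
    also have "\<dots> \<longleftrightarrow> d = ?B x *v V x"
      unfolding B vec_sum_eq_iff[of d] by simp
    finally show ?thesis .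
  qed
  have iff: "V differentiable (at x) \<and> dirac \<phi> V x = \<zeta> *s V x \<longleftrightarrow> (V has_vector_derivative ?B x *v V x) (at x)" for x
    unfolding dirac_def eq
    by (metis (no_types) differentiableI_vector vector_derivative_at vector_derivative_works)
  show ?thesis
  proof
    assume "dirac_solution \<phi> \<zeta> V"
    then show "linear_ode_solution ?B V"
      unfolding dirac_solution_def loc_abs_cont_def iff linear_ode_solution_def ac_deriv_def
      by (auto elim: eventually_mono)
  next
    assume "linear_ode_solution ?B V"
    then show "dirac_solution \<phi> \<zeta> V"
      unfolding dirac_solution_def loc_abs_cont_def iff linear_ode_solution_def ac_deriv_def
      by (auto intro: AE_all_intervals)
  qed
qed

text \<open>In the coordinates \<open>p = V\<^sub>1 + \<i> V\<^sub>2\<close>, \<open>q = V\<^sub>1 - \<i> V\<^sub>2\<close> the \<open>\<zeta>\<close>-term of the system is diagonal.\<close>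

definition pos_part :: "complex^('m::finite + 'm) \<Rightarrow> complex^'m" where
  "pos_part V = upper V + \<i> *s lower V"
definition neg_part :: "complex^('m::finite + 'm) \<Rightarrow> complex^'m" where
  "neg_part V = upper V - \<i> *s lower V"

lemma bounded_linear_pos_part: "bounded_linear pos_part"
  and bounded_linear_neg_part: "bounded_linear neg_part"
  unfolding pos_part_def neg_part_def
  by (intro bounded_linear_add bounded_linear_sub bounded_linear_upper
      bounded_linear_compose[OF bounded_linear_scalar_mult_vec bounded_linear_lower])+

lemma norm_pos_neg_part:
  fixes V :: "complex^('m::finite + 'm)"
  shows "(norm (pos_part V))\<^sup>2 + (norm (neg_part V))\<^sup>2 = 2 * (norm V)\<^sup>2"
proof -
  have "(norm (a + b))\<^sup>2 + (norm (a - b))\<^sup>2 = 2 * (norm a)\<^sup>2 + 2 * (norm b)\<^sup>2" for a b :: "complex^'m"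
    by (simp add: power2_norm_eq_inner inner_add_left inner_add_right inner_diff_left inner_diff_right)
  then show ?thesis
    unfolding pos_part_def neg_part_def norm_upper_lower[of V] by (simp add: norm_scalar_mult_vec)
qed

lemma pos_neg_part_eqI:
  assumes "pos_part V = pos_part W" "neg_part V = neg_part W" shows "V = W"
proof -
  interpret p: bounded_linear pos_part by (rule bounded_linear_pos_part)
  interpret q: bounded_linear neg_part by (rule bounded_linear_neg_part)
  have "pos_part (V - W) = 0" "neg_part (V - W) = 0" using assms by (simp_all add: p.diff q.diff)
  then have "norm (V - W) = 0" using norm_pos_neg_part[of "V - W"] by simp
  then show ?thesis by simp
qed

text \<open>Confined to an interval, unlike \<open>dirac_solution\<close>: coefficients that agree
  a.e. on [a,b] have the same solutions there, and this is what allows Weyl solutions of two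
  different systems to be subtracted.\<close>

definition diag_solution :: "(real \<Rightarrow> complex^'m^'m) \<Rightarrow> complex \<Rightarrow> real \<Rightarrow> real \<Rightarrow>
    (real \<Rightarrow> complex^'m) \<Rightarrow> (real \<Rightarrow> complex^'m) \<Rightarrow> bool" where
  "diag_solution \<phi> \<zeta> a b p q \<longleftrightarrow>
     ac_deriv a b p (\<lambda>x. - (\<i> * \<zeta>) *s p x - \<phi> x *v q x) \<and>
     ac_deriv a b q (\<lambda>x. (\<i> * \<zeta>) *s q x - \<phi> x *v p x)"

lemma diag_solution_of_dirac:
  assumes "dirac_solution \<phi> \<zeta> V"
  shows "diag_solution \<phi> \<zeta> a b (\<lambda>x. pos_part (V x)) (\<lambda>x. neg_part (V x))"
proof -
  let ?B = "\<lambda>x. dirac_coeff \<phi> x + smult_matrix \<zeta> dirac_twist"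
  have V: "ac_deriv a b V (\<lambda>x. ?B x *v V x)"
    using assms unfolding dirac_solution_iff linear_ode_solution_def by blast
  have mv: "M *v (z *s w) = z *s (M *v w)" for M :: "complex^'a^'a" and z w
    by (simp add: matrix_vector_mult_def vec_eq_iff sum_distrib_left mult_ac)
  have "pos_part (?B x *v w) = - (\<i> * \<zeta>) *s pos_part w - \<phi> x *v neg_part w"
    "neg_part (?B x *v w) = (\<i> * \<zeta>) *s neg_part w - \<phi> x *v pos_part w" for x w
    by (simp_all add: pos_part_def neg_part_def matrix_vector_mult_add_rdistrib smult_matrix_vector_mult
      upper_lower_block matrix_minus_vector_mult matrix_vector_right_distrib matrix_vector_mult_diff_distrib mv)
      (simp_all add: vec_eq_iff algebra_simps)
  then show ?thesis
    using ac_deriv_bounded_linear[OF bounded_linear_pos_part V] ac_deriv_bounded_linear[OF bounded_linear_neg_part V]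
    unfolding diag_solution_def by simp
qed

lemma diag_solution_subinterval:
  "diag_solution \<phi> \<zeta> a b p q \<Longrightarrow> a \<le> c \<Longrightarrow> d \<le> b \<Longrightarrow> diag_solution \<phi> \<zeta> c d p q"
  unfolding diag_solution_def using ac_deriv_subinterval by blast

lemma inner_vec_complex: "x \<bullet> y = Re (\<Sum>i\<in>UNIV. cnj (x $ i) * y $ i)" for x y :: "complex^'n"
  by (simp add: inner_vec_def inner_complex_def)

lemma inner_scalar_mult_self: "x \<bullet> (c *s x) = Re c * (x \<bullet> x)" for x :: "complex^'n"
proof -
  have "cnj a * (c * a) = c * complex_of_real (cmod a ^ 2)" for a
    by (metis (no_types, lifting) complex_norm_square mult.assoc mult.commute)
  moreover have "cnj a * a = complex_of_real (cmod a ^ 2)" for a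
    by (metis complex_norm_square mult.commute)
  ultimately have "(\<Sum>i\<in>UNIV. cnj (x $ i) * (c *s x) $ i) = c * (\<Sum>i\<in>UNIV. complex_of_real (cmod (x $ i) ^ 2))"
    "(\<Sum>i\<in>UNIV. cnj (x $ i) * x $ i) = (\<Sum>i\<in>UNIV. complex_of_real (cmod (x $ i) ^ 2))"
    by (simp_all only: vector_smult_component sum_distrib_left)
  then show ?thesis unfolding inner_vec_complex by (simp flip: of_real_sum of_real_power)
qed

lemma inner_hermitian:
  assumes "M = adjoint_matrix M" shows "x \<bullet> (M *v y) = (M *v x) \<bullet> y"
proof -
  have M: "M $ i $ j = cnj (M $ j $ i)" for i j
    by (subst assms) (simp add: adjoint_matrix_def transpose_def map_matrix_def)
  have "(\<Sum>i\<in>UNIV. cnj (x $ i) * (M *v y) $ i) = (\<Sum>i\<in>UNIV. \<Sum>j\<in>UNIV. cnj (x $ i) * M $ i $ j * y $ j)"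
    by (simp add: matrix_vector_mult_def sum_distrib_left mult.assoc)
  also have "\<dots> = (\<Sum>j\<in>UNIV. \<Sum>i\<in>UNIV. cnj (x $ i) * M $ i $ j * y $ j)" by (rule sum.swap)
  also have "\<dots> = (\<Sum>j\<in>UNIV. cnj ((M *v x) $ j) * y $ j)"
    by (subst M) (simp add: matrix_vector_mult_def sum_distrib_right sum_distrib_left mult_ac)
  finally show ?thesis unfolding inner_vec_complex by simp
qed

lemma abs_inner_matrix_vector_le: "\<bar>x \<bullet> (M *v y)\<bar> \<le> norm M * norm x * norm y" for M :: "complex^'n^'n"
proof -
  have "\<bar>x \<bullet> (M *v y)\<bar> \<le> norm x * norm (M *v y)" by (rule Cauchy_Schwarz_ineq2)
  also have "\<dots> \<le> norm x * (norm M * norm y)" by (intro mult_left_mono norm_matrix_vector_mult) simp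
  finally show ?thesis by (simp add: mult_ac)
qed

lemma ac_deriv_norm_sq:
  fixes f :: "real \<Rightarrow> 'b::real_inner"
  assumes "ac_deriv a b f f'"
  shows "ac_deriv a b (\<lambda>x. (norm (f x))\<^sup>2) (\<lambda>x. 2 * (f x \<bullet> f' x))"
proof -
  have "f x \<bullet> f' x + f' x \<bullet> f x = 2 * (f x \<bullet> f' x)" for x
    by (subst inner_commute[of "f' x"]) simp
  then show ?thesis using ac_deriv_inner[OF assms assms] by (simp add: power2_norm_eq_inner)
qed

text \<open>The real part of -i \<zeta> is Im \<zeta>. For Im \<zeta> > 0 the free equation
  therefore makes \<open>p\<close> grow and \<open>q\<close> decay, and \<phi> enters only through
  the coupling of the two.\<close>

lemma diag_solution_norm_deriv:
  assumes "diag_solution \<phi> \<zeta> a b p q"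
  shows "ac_deriv a b (\<lambda>x. (norm (p x))\<^sup>2) (\<lambda>x. 2 * (Im \<zeta> * (norm (p x))\<^sup>2 - p x \<bullet> (\<phi> x *v q x)))"
    and "ac_deriv a b (\<lambda>x. (norm (q x))\<^sup>2) (\<lambda>x. 2 * (- Im \<zeta> * (norm (q x))\<^sup>2 - q x \<bullet> (\<phi> x *v p x)))"
proof -
  have p: "ac_deriv a b p (\<lambda>x. - (\<i> * \<zeta>) *s p x - \<phi> x *v q x)"
    and q: "ac_deriv a b q (\<lambda>x. (\<i> * \<zeta>) *s q x - \<phi> x *v p x)"
    using assms unfolding diag_solution_def by auto
  show "ac_deriv a b (\<lambda>x. (norm (p x))\<^sup>2) (\<lambda>x. 2 * (Im \<zeta> * (norm (p x))\<^sup>2 - p x \<bullet> (\<phi> x *v q x)))"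
    using ac_deriv_norm_sq[OF p] by (simp add: inner_diff_right inner_scalar_mult_self power2_norm_eq_inner)
  show "ac_deriv a b (\<lambda>x. (norm (q x))\<^sup>2) (\<lambda>x. 2 * (- Im \<zeta> * (norm (q x))\<^sup>2 - q x \<bullet> (\<phi> x *v p x)))"
    using ac_deriv_norm_sq[OF q] by (simp add: inner_diff_right inner_scalar_mult_self power2_norm_eq_inner)
qed

section \<open>Growth estimates\<close>

definition mass :: "(real \<Rightarrow> 'b::euclidean_space) \<Rightarrow> real \<Rightarrow> real \<Rightarrow> real" where
  "mass \<phi> a b = integral {a..b} (\<lambda>x. norm (\<phi> x))"

lemma mass_nonneg: "L1_loc \<phi> \<Longrightarrow> 0 \<le> mass \<phi> a b"
  unfolding mass_def using L1_loc_norm[of \<phi>]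
  by (intro integral_nonneg) (auto simp: L1_loc_def absolutely_integrable_on_def)

lemma mass_mono: "L1_loc \<phi> \<Longrightarrow> {a..b} \<subseteq> {c..d} \<Longrightarrow> mass \<phi> a b \<le> mass \<phi> c d"
  unfolding mass_def using L1_loc_norm[of \<phi>]
  by (intro integral_subset_le) (auto simp: L1_loc_def absolutely_integrable_on_def)

lemma primitive_eq_mass: "a \<le> b \<Longrightarrow> primitive a (\<lambda>x. norm (\<phi> x)) b = mass \<phi> a b"
  by (simp add: primitive_def mass_def)

lemma ac_deriv_linear: "ac_deriv a b (\<lambda>x. r * x) (\<lambda>x. r)" for r :: real
  by (rule ac_deriv_smooth) (auto intro!: derivative_eq_intros
      simp: has_real_derivative_iff_has_vector_derivative[symmetric])

text \<open>The exponents of the Gronwall estimates below have this shape: \<open>r\<close> is Im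
  \<zeta>, -Im \<zeta> or |Im \<zeta>|, and \<open>s\<close> = 1 or -1 weighs the coupling.\<close>

lemma ac_deriv_weight:
  assumes "L1_loc \<phi>"
  shows "ac_deriv a b (\<lambda>x. 2 * (r * x + s * primitive c (\<lambda>x. norm (\<phi> x)) x)) (\<lambda>x. 2 * (r + s * norm (\<phi> x)))"
  by (intro ac_deriv_bounded_linear[OF bounded_linear_mult_right] ac_deriv_add ac_deriv_linear
      ac_deriv_primitive L1_loc_norm assms)

context
  fixes \<phi> :: "real \<Rightarrow> complex^'m^'m::finite" and \<zeta> :: complex and a b :: real and p q :: "real \<Rightarrow> complex^'m"
  assumes L1: "L1_loc \<phi>" and ab: "a \<le> b" and sol: "diag_solution \<phi> \<zeta> a b p q"
begin

text \<open>Each of the two coupling terms is at most 2 |\<phi>| |p| |q|, so together they are at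
  most 2 |\<phi>| (|p|^2 + |q|^2). The two bounds propagate solutions forwards and
  backwards.\<close>

lemma diag_solution_growth:
  shows "(norm (p b))\<^sup>2 + (norm (q b))\<^sup>2 \<le> ((norm (p a))\<^sup>2 + (norm (q a))\<^sup>2) * exp (2 * (\<bar>Im \<zeta>\<bar> * (b - a) + mass \<phi> a b))"
    and "(norm (p a))\<^sup>2 + (norm (q a))\<^sup>2 \<le> ((norm (p b))\<^sup>2 + (norm (q b))\<^sup>2) * exp (2 * (\<bar>Im \<zeta>\<bar> * (b - a) + mass \<phi> a b))"
proof -
  let ?f = "\<lambda>x. (norm (p x))\<^sup>2 + (norm (q x))\<^sup>2"
  let ?f' = "\<lambda>x. 2 * (Im \<zeta> * (norm (p x))\<^sup>2 - p x \<bullet> (\<phi> x *v q x)) + 2 * (- Im \<zeta> * (norm (q x))\<^sup>2 - q x \<bullet> (\<phi> x *v p x))"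
  have f: "ac_deriv a b ?f ?f'"
    by (intro ac_deriv_add diag_solution_norm_deriv[OF sol])
  have bd: "\<bar>?f' x\<bar> \<le> 2 * (\<bar>Im \<zeta>\<bar> + norm (\<phi> x)) * ?f x" for x
  proof -
    have "\<bar>p x \<bullet> (\<phi> x *v q x)\<bar> \<le> norm (\<phi> x) * (norm (p x) * norm (q x))"
      "\<bar>q x \<bullet> (\<phi> x *v p x)\<bar> \<le> norm (\<phi> x) * (norm (p x) * norm (q x))"
      using abs_inner_matrix_vector_le[of "p x" "\<phi> x" "q x"] abs_inner_matrix_vector_le[of "q x" "\<phi> x" "p x"]
      by (simp_all add: mult_ac)
    moreover have "norm (\<phi> x) * (2 * (norm (p x) * norm (q x))) \<le> norm (\<phi> x) * ?f x"
      using sum_squares_bound[of "norm (p x)" "norm (q x)"] by (intro mult_left_mono) simp_all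
    moreover have "\<bar>Im \<zeta> * (norm (p x))\<^sup>2\<bar> = \<bar>Im \<zeta>\<bar> * (norm (p x))\<^sup>2"
      "\<bar>Im \<zeta> * (norm (q x))\<^sup>2\<bar> = \<bar>Im \<zeta>\<bar> * (norm (q x))\<^sup>2" by (simp_all add: abs_mult)
    ultimately show ?thesis by (simp add: algebra_simps)
  qed
  have G: "ac_deriv a b (\<lambda>x. 2 * (\<bar>Im \<zeta>\<bar> * x + 1 * primitive a (\<lambda>x. norm (\<phi> x)) x)) (\<lambda>x. 2 * (\<bar>Im \<zeta>\<bar> + 1 * norm (\<phi> x)))"
    by (rule ac_deriv_weight[OF L1])
  have "?f b \<le> ?f a * exp (2 * (\<bar>Im \<zeta>\<bar> * b + 1 * primitive a (\<lambda>x. norm (\<phi> x)) b) - 2 * (\<bar>Im \<zeta>\<bar> * a + 1 * primitive a (\<lambda>x. norm (\<phi> x)) a))"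
  proof (rule gronwall_upper[OF f G ab], rule AE_I2, rule impI)
    show "?f' x \<le> 2 * (\<bar>Im \<zeta>\<bar> + 1 * norm (\<phi> x)) * ?f x" for x using bd[of x] by simp
  qed
  then show "?f b \<le> ?f a * exp (2 * (\<bar>Im \<zeta>\<bar> * (b - a) + mass \<phi> a b))"
    by (simp add: primitive_eq_mass[OF ab] algebra_simps)
  have "?f a * exp (- (2 * (\<bar>Im \<zeta>\<bar> * b + 1 * primitive a (\<lambda>x. norm (\<phi> x)) b)) - - (2 * (\<bar>Im \<zeta>\<bar> * a + 1 * primitive a (\<lambda>x. norm (\<phi> x)) a))) \<le> ?f b"
  proof (rule gronwall_lower[OF f ac_deriv_minus[OF G] ab], rule AE_I2, rule impI)
    show "- (2 * (\<bar>Im \<zeta>\<bar> + 1 * norm (\<phi> x))) * ?f x \<le> ?f' x" for x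
      using bd[of x] by (simp only: mult_1 mult_minus_left)
  qed
  then have "?f a * exp (- (2 * (\<bar>Im \<zeta>\<bar> * (b - a) + mass \<phi> a b))) \<le> ?f b"
    by (simp add: primitive_eq_mass[OF ab] algebra_simps)
  then have "?f a * exp (- (2 * (\<bar>Im \<zeta>\<bar> * (b - a) + mass \<phi> a b))) * exp (2 * (\<bar>Im \<zeta>\<bar> * (b - a) + mass \<phi> a b))
      \<le> ?f b * exp (2 * (\<bar>Im \<zeta>\<bar> * (b - a) + mass \<phi> a b))" by (intro mult_right_mono) simp_all
  then show "?f a \<le> ?f b * exp (2 * (\<bar>Im \<zeta>\<bar> * (b - a) + mass \<phi> a b))"
    by (simp only: mult.assoc exp_add[symmetric]) simp
qed

text \<open>In the cone |p| \<le> |q| the coupling is at most |\<phi>| |q|^2, so the inequality for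
  |q|^2 closes and \<open>q\<close> decays at the free rate up to a factor exp(mass).\<close>

lemma diag_solution_decay:
  assumes le: "\<And>x. x \<in> {a..b} \<Longrightarrow> norm (p x) \<le> norm (q x)"
  shows "norm (q b) \<le> norm (q a) * exp (mass \<phi> a b - Im \<zeta> * (b - a))"
proof -
  have "(norm (q b))\<^sup>2 \<le> (norm (q a))\<^sup>2 * exp (2 * ((- Im \<zeta>) * b + 1 * primitive a (\<lambda>x. norm (\<phi> x)) b) - 2 * ((- Im \<zeta>) * a + 1 * primitive a (\<lambda>x. norm (\<phi> x)) a))"
  proof (rule gronwall_upper[OF diag_solution_norm_deriv(2)[OF sol] ac_deriv_weight[OF L1] ab], rule AE_I2, rule impI)
    fix x assume x: "x \<in> {a..b}"
    have "\<bar>q x \<bullet> (\<phi> x *v p x)\<bar> \<le> norm (\<phi> x) * norm (q x) * norm (p x)" by (rule abs_inner_matrix_vector_le)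
    also have "\<dots> \<le> norm (\<phi> x) * norm (q x) * norm (q x)" by (intro mult_left_mono le x) simp
    finally show "2 * (- Im \<zeta> * (norm (q x))\<^sup>2 - q x \<bullet> (\<phi> x *v p x)) \<le> 2 * (- Im \<zeta> + 1 * norm (\<phi> x)) * (norm (q x))\<^sup>2"
      by (simp add: power2_eq_square algebra_simps)
  qed
  also have "\<dots> = (norm (q a) * exp (mass \<phi> a b - Im \<zeta> * (b - a)))\<^sup>2"
    by (simp add: primitive_eq_mass[OF ab] algebra_simps power_mult_distrib flip: exp_double)
  finally show ?thesis by (rule power2_le_imp_le) simp
qed

text \<open>The mirror image: in the cone |q| \<le> |p| the inequality for |p|^2 closes, and
  \<open>p\<close> grows at the free rate up to a factor exp(-mass).\<close>

lemma diag_solution_increase: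
  assumes le: "\<And>x. x \<in> {a..b} \<Longrightarrow> norm (q x) \<le> norm (p x)"
  shows "norm (p a) * exp (Im \<zeta> * (b - a) - mass \<phi> a b) \<le> norm (p b)"
proof -
  have "(norm (p a) * exp (Im \<zeta> * (b - a) - mass \<phi> a b))\<^sup>2
     = (norm (p a))\<^sup>2 * exp (2 * (Im \<zeta> * b + (- 1) * primitive a (\<lambda>x. norm (\<phi> x)) b) - 2 * (Im \<zeta> * a + (- 1) * primitive a (\<lambda>x. norm (\<phi> x)) a))"
    by (simp add: primitive_eq_mass[OF ab] algebra_simps power_mult_distrib flip: exp_double)
  also have "\<dots> \<le> (norm (p b))\<^sup>2"
  proof (rule gronwall_lower[OF diag_solution_norm_deriv(1)[OF sol] ac_deriv_weight[OF L1] ab], rule AE_I2, rule impI)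
    fix x assume x: "x \<in> {a..b}"
    have "\<bar>p x \<bullet> (\<phi> x *v q x)\<bar> \<le> norm (\<phi> x) * norm (p x) * norm (q x)" by (rule abs_inner_matrix_vector_le)
    also have "\<dots> \<le> norm (\<phi> x) * norm (p x) * norm (p x)" by (intro mult_left_mono le x) simp
    finally show "2 * (Im \<zeta> + (- 1) * norm (\<phi> x)) * (norm (p x))\<^sup>2 \<le> 2 * (Im \<zeta> * (norm (p x))\<^sup>2 - p x \<bullet> (\<phi> x *v q x))"
      by (simp add: power2_eq_square algebra_simps)
  qed
  finally show ?thesis by (rule power2_le_imp_le) simp
qed

text \<open>For Hermitian \<phi> the two coupling terms are equal and cancel in the derivative of
  |p|^2 - |q|^2, which leaves a multiple of |p|^2 + |q|^2.\<close>

lemma diag_solution_energy: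
  assumes herm: "AE x in lebesgue. x \<in> {a..b} \<longrightarrow> \<phi> x = adjoint_matrix (\<phi> x)"
  shows "((\<lambda>x. 2 * Im \<zeta> * ((norm (p x))\<^sup>2 + (norm (q x))\<^sup>2)) has_integral
    ((norm (p b))\<^sup>2 - (norm (q b))\<^sup>2) - ((norm (p a))\<^sup>2 - (norm (q a))\<^sup>2)) {a..b}"
proof -
  have "ac_deriv a b (\<lambda>x. (norm (p x))\<^sup>2 - (norm (q x))\<^sup>2) (\<lambda>x. 2 * Im \<zeta> * ((norm (p x))\<^sup>2 + (norm (q x))\<^sup>2))"
  proof (rule ac_deriv_cong_AE[OF ac_deriv_diff[OF diag_solution_norm_deriv[OF sol]]])
    show "AE x in lebesgue. x \<in> {a..b} \<longrightarrow> 2 * (Im \<zeta> * (norm (p x))\<^sup>2 - p x \<bullet> (\<phi> x *v q x)) -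
        2 * (- Im \<zeta> * (norm (q x))\<^sup>2 - q x \<bullet> (\<phi> x *v p x)) = 2 * Im \<zeta> * ((norm (p x))\<^sup>2 + (norm (q x))\<^sup>2)"
      using herm
    proof eventually_elim
      case (elim x)
      have "p x \<bullet> (\<phi> x *v q x) = q x \<bullet> (\<phi> x *v p x)" if "x \<in> {a..b}"
        using inner_hermitian[of "\<phi> x" "p x" "q x"] elim that by (simp add: inner_commute)
      then show ?case by (simp add: algebra_simps)
    qed
  qed
  then show ?thesis by (rule ac_deriv_has_integral[OF _ order_refl ab order_refl])
qed

text \<open>Integrating \<open>(e\<^bsup>i\<zeta>(x-a)\<^esup> p)' = - e\<^bsup>i\<zeta>(x-a)\<^esup> \<phi> q\<close> shows that \<open>p\<close> is small against \<open>q\<close>.\<close>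

lemma diag_solution_pos_small:
  assumes le: "\<And>x. x \<in> {a..b} \<Longrightarrow> norm (p x) \<le> norm (q x)" and Im: "0 \<le> Im \<zeta>"
  shows "norm (p a) \<le> norm (q a) * exp (mass \<phi> a b) * (exp (- Im \<zeta> * (b - a)) + mass \<phi> a b)"
proof -
  let ?e = "\<lambda>x. exp (\<i> * \<zeta> * of_real (x - a))"
  have p: "ac_deriv a b p (\<lambda>x. - (\<i> * \<zeta>) *s p x - \<phi> x *v q x)" using sol unfolding diag_solution_def by blast
  have e: "ac_deriv a b ?e (\<lambda>x. (\<i> * \<zeta>) * ?e x)"
  proof (rule ac_deriv_smooth)
    have "((\<lambda>z. exp (\<i> * \<zeta> * (z - of_real a))) has_field_derivative (\<i> * \<zeta>) * exp (\<i> * \<zeta> * (of_real x - of_real a))) (at (of_real x))" for x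
      by (auto intro!: derivative_eq_intros)
    from has_vector_derivative_real_field[OF this]
    show "(?e has_vector_derivative (\<i> * \<zeta>) * ?e x) (at x)" for x by simp
  qed (intro continuous_intros)
  have "ac_deriv a b (\<lambda>x. ?e x *s p x) (\<lambda>x. - (?e x *s (\<phi> x *v q x)))"
    using ac_deriv_bounded_bilinear[OF bounded_bilinear_scalar_mult_vec e p]
    by (simp add: vec_eq_iff algebra_simps)
  from ac_deriv_has_integral[OF this order_refl ab order_refl]
  have i: "((\<lambda>x. - (?e x *s (\<phi> x *v q x))) has_integral ?e b *s p b - p a) {a..b}" by simp
  have dq: "norm (q x) \<le> norm (q a) * exp (mass \<phi> a b)" and ne: "norm (?e x) \<le> 1" if x: "x \<in> {a..b}" for x
  proof -
    show ne: "norm (?e x) \<le> 1" using x Im by simp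
    have "x \<le> b" "a \<le> x" using x by auto
    \<comment> \<open>The exported form of the decay estimate is used, because it is applied on
      [a,x] instead of the interval fixed by the context.\<close>
    have "norm (q x) \<le> norm (q a) * exp (mass \<phi> a x - Im \<zeta> * (x - a))"
      by (rule Submission.diag_solution_decay[OF L1 \<open>a \<le> x\<close> diag_solution_subinterval[OF sol order_refl \<open>x \<le> b\<close>]])
        (use le x in auto)
    also have "\<dots> \<le> norm (q a) * exp (mass \<phi> a b)"
      using mass_mono[OF L1, of a x a b] x Im
      by (intro mult_left_mono) (auto intro: order_trans[of _ "mass \<phi> a x"])
    finally show "norm (q x) \<le> norm (q a) * exp (mass \<phi> a b)" .
  qed
  have j: "(\<lambda>x. norm (\<phi> x) * (norm (q a) * exp (mass \<phi> a b))) integrable_on {a..b}"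
    using L1_loc_norm[OF L1] by (simp add: L1_loc_def absolutely_integrable_on_def integrable_on_mult_left)
  have "norm (integral {a..b} (\<lambda>x. - (?e x *s (\<phi> x *v q x)))) \<le> integral {a..b} (\<lambda>x. norm (\<phi> x) * (norm (q a) * exp (mass \<phi> a b)))"
  proof (rule integral_norm_bound_integral[OF has_integral_integrable[OF i] j])
    fix x assume x: "x \<in> {a..b}"
    have "norm (?e x *s (\<phi> x *v q x)) \<le> 1 * (norm (\<phi> x) * norm (q x))"
      unfolding norm_scalar_mult_vec by (intro mult_mono ne x norm_matrix_vector_mult) simp_all
    also have "\<dots> \<le> norm (\<phi> x) * (norm (q a) * exp (mass \<phi> a b))" using mult_left_mono[OF dq[OF x] norm_ge_zero[of "\<phi> x"]] by simp
    finally show "norm (- (?e x *s (\<phi> x *v q x))) \<le> norm (\<phi> x) * (norm (q a) * exp (mass \<phi> a b))" by simp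
  qed
  also have "\<dots> = mass \<phi> a b * (norm (q a) * exp (mass \<phi> a b))" by (simp add: mass_def)
  finally have 1: "norm (?e b *s p b - p a) \<le> mass \<phi> a b * (norm (q a) * exp (mass \<phi> a b))"
    unfolding integral_unique[OF i] .
  have "norm (?e b *s p b) \<le> exp (- Im \<zeta> * (b - a)) * (norm (q a) * exp (mass \<phi> a b))"
  proof -
    have "norm (?e b) = exp (- Im \<zeta> * (b - a))" by simp
    then show ?thesis using le[of b] dq[of b] ab unfolding norm_scalar_mult_vec by (simp add: mult_left_mono)
  qed
  with 1 have "norm (p a) \<le> mass \<phi> a b * (norm (q a) * exp (mass \<phi> a b)) + exp (- Im \<zeta> * (b - a)) * (norm (q a) * exp (mass \<phi> a b))"
    by (smt (verit) norm_triangle_ineq4 norm_minus_commute norm_triangle_sub)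
  then show ?thesis by (simp add: algebra_simps)
qed

end

section \<open>Weyl theory\<close>

abbreviation dirac_flow :: "(real \<Rightarrow> complex^'m^'m) \<Rightarrow> complex \<Rightarrow> real \<Rightarrow> complex^('m::finite + 'm) \<Rightarrow> real \<Rightarrow> complex^('m + 'm)" where
  "dirac_flow \<phi> \<zeta> c v \<equiv> linear_ode_flow (dirac_coeff \<phi>) dirac_twist c v \<zeta>"

lemma L1_loc_dirac_coeff:
  fixes \<phi> :: "real \<Rightarrow> complex^'m^'m::finite"
  assumes "L1_loc \<phi>" shows "L1_loc (dirac_coeff \<phi>)"
proof -
  have "bounded_linear (\<lambda>M :: complex^'m^'m. block (- M) 0 0 M)"
    by (intro linear_conv_bounded_linear[THEN iffD1] linearI)
      (auto simp: block_def vec_eq_iff split: sum.split)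
  from L1_loc_bounded_linear[OF this assms] show ?thesis .
qed

lemma L1_loc_dirac_matrix: "L1_loc \<phi> \<Longrightarrow> L1_loc (\<lambda>x. dirac_coeff \<phi> x + smult_matrix \<zeta> dirac_twist)"
  by (rule L1_loc_add[OF L1_loc_dirac_coeff L1_loc_continuous[OF continuous_on_const]])

lemma dirac_flow_solution: "L1_loc \<phi> \<Longrightarrow> dirac_solution \<phi> \<zeta> (dirac_flow \<phi> \<zeta> c v)"
  unfolding dirac_solution_iff by (intro linear_ode_flow_solution L1_loc_dirac_coeff)

lemma dirac_flow_base [simp]: "L1_loc \<phi> \<Longrightarrow> dirac_flow \<phi> \<zeta> c v c = v"
  by (intro linear_ode_flow_base L1_loc_dirac_coeff)

lemma dirac_solution_unique:
  assumes "L1_loc \<phi>" "dirac_solution \<phi> \<zeta> V" "dirac_solution \<phi> \<zeta> W" "V c = W c"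
  shows "V = W"
  using linear_ode_unique[OF L1_loc_dirac_matrix[OF assms(1)]] assms unfolding dirac_solution_iff by blast

lemma dirac_solution_eq_flow: "L1_loc \<phi> \<Longrightarrow> dirac_solution \<phi> \<zeta> V \<Longrightarrow> V = dirac_flow \<phi> \<zeta> c (V c)"
  by (rule dirac_solution_unique[of \<phi> \<zeta> _ _ c]) (auto intro: dirac_flow_solution)

lemma dirac_solution_add: "dirac_solution \<phi> \<zeta> V \<Longrightarrow> dirac_solution \<phi> \<zeta> W \<Longrightarrow> dirac_solution \<phi> \<zeta> (\<lambda>x. V x + W x)"
  and dirac_solution_scalar: "dirac_solution \<phi> \<zeta> V \<Longrightarrow> dirac_solution \<phi> \<zeta> (\<lambda>x. z *s V x)"
  unfolding dirac_solution_iff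
  by (blast intro: linear_ode_solution_add linear_ode_solution_scalar)+

lemma dirac_solution_zero: "dirac_solution \<phi> \<zeta> (\<lambda>x. 0)"
  unfolding dirac_solution_iff linear_ode_solution_def by (simp add: ac_deriv_const)

lemma dirac_solution_sum:
  "(\<And>i. i \<in> I \<Longrightarrow> dirac_solution \<phi> \<zeta> (V i)) \<Longrightarrow> dirac_solution \<phi> \<zeta> (\<lambda>x. \<Sum>i\<in>I. V i x)"
  by (induction I rule: infinite_finite_induct) (simp_all add: dirac_solution_zero dirac_solution_add)

lemma dirac_flow_add:
  assumes "L1_loc \<phi>"
  shows "dirac_flow \<phi> \<zeta> c (v + w) x = dirac_flow \<phi> \<zeta> c v x + dirac_flow \<phi> \<zeta> c w x"
  using fun_cong[OF dirac_solution_unique[OF assms dirac_flow_solution[OF assms, of \<zeta> c "v + w"]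
    dirac_solution_add[OF dirac_flow_solution[OF assms, of \<zeta> c v] dirac_flow_solution[OF assms, of \<zeta> c w]], of c]] assms
  by simp

lemma dirac_flow_scalar:
  assumes "L1_loc \<phi>"
  shows "dirac_flow \<phi> \<zeta> c (z *s v) x = z *s dirac_flow \<phi> \<zeta> c v x"
  using fun_cong[OF dirac_solution_unique[OF assms dirac_flow_solution[OF assms, of \<zeta> c "z *s v"]
    dirac_solution_scalar[OF dirac_flow_solution[OF assms, of \<zeta> c v]], of c]] assms
  by simp

lemma vec_scaleR_eq_scalar_mult: "r *\<^sub>R v = complex_of_real r *s v" for v :: "complex^'n"
  unfolding vec_eq_iff vector_scaleR_component vector_smult_component by (simp add: scaleR_conv_of_real)

lemma bounded_linear_dirac_flow:
  assumes "L1_loc \<phi>" shows "bounded_linear (\<lambda>v. dirac_flow \<phi> \<zeta> c v x)"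
  by (intro linear_conv_bounded_linear[THEN iffD1] linearI)
    (simp_all add: dirac_flow_add[OF assms] dirac_flow_scalar[OF assms] vec_scaleR_eq_scalar_mult)

lemma matrix_vector_mult_eq_sum_columns: "M *v w = (\<Sum>j\<in>UNIV. (w $ j) *s column j M)" for M :: "complex^'n^'k"
  by (simp add: matrix_vector_mult_def column_def vec_eq_iff mult.commute sum_component)

text \<open>Uniqueness of each column gives the definite description its meaning. From here on the
  fundamental matrix is handled only through the flow, which is linear in the initial value and
  entire in \<zeta>.\<close>

lemma dirac_fundamental_flow:
  fixes \<phi> :: "real \<Rightarrow> complex^'m^'m::finite"
  assumes L: "L1_loc \<phi>"
  shows "dirac_fundamental \<phi> \<zeta> c x *v w = dirac_flow \<phi> \<zeta> c w x"
proof -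
  define \<Psi> :: "real \<Rightarrow> complex^('m + 'm)^('m + 'm)" where
    "\<Psi> = (\<lambda>x. \<chi> i j. dirac_flow \<phi> \<zeta> c (axis j 1) x $ i)"
  have col: "column j (\<Psi> x) = dirac_flow \<phi> \<zeta> c (axis j 1) x" for j x
    by (simp add: \<Psi>_def column_def vec_eq_iff)
  have colI: "column j (mat 1) = (axis j 1 :: complex^('m + 'm))" for j
    by (auto simp: column_def mat_def axis_def vec_eq_iff)
  have eqI: "M = N" if "\<And>j. column j M = column j N" for M N :: "complex^('m + 'm)^('m + 'm)"
    using that by (simp add: column_def vec_eq_iff)
  have "dirac_fundamental \<phi> \<zeta> c = \<Psi>"
    unfolding dirac_fundamental_def
  proof (rule the_equality)
    show "(\<forall>j. dirac_solution \<phi> \<zeta> (\<lambda>x. column j (\<Psi> x))) \<and> \<Psi> c = mat 1"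
      unfolding col using L by (auto intro!: dirac_flow_solution eqI simp: col colI)
    fix \<Psi>' assume *: "(\<forall>j. dirac_solution \<phi> \<zeta> (\<lambda>x. column j (\<Psi>' x))) \<and> \<Psi>' c = mat 1"
    have "(\<lambda>x. column j (\<Psi>' x)) = (\<lambda>x. column j (\<Psi> x))" for j
      unfolding col using * L by (intro dirac_solution_unique[OF L, where c = c]) (auto intro: dirac_flow_solution simp: colI)
    then show "\<Psi>' = \<Psi>" by (intro ext eqI) meson
  qed
  moreover have "\<Psi> x *v w = dirac_flow \<phi> \<zeta> c w x"
  proof -
    have "(\<lambda>x. \<Psi> x *v w) = dirac_flow \<phi> \<zeta> c w"
    proof (rule dirac_solution_unique[OF L _ dirac_flow_solution[OF L], where c = c])
      show "dirac_solution \<phi> \<zeta> (\<lambda>x. \<Psi> x *v w)"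
        unfolding matrix_vector_mult_eq_sum_columns col
        by (intro dirac_solution_sum dirac_solution_scalar dirac_flow_solution L)
      have "\<Psi> c = mat 1" by (rule eqI) (simp add: col colI L)
      then show "\<Psi> c *v w = dirac_flow \<phi> \<zeta> c w c" using L by simp
    qed
    then show ?thesis by (rule fun_cong)
  qed
  ultimately show ?thesis by simp
qed

section \<open>Square integrability at infinity in terms of the energy\<close>

text \<open>Solutions whose energy |p|^2 - |q|^2 is nowhere positive. For Im \<zeta> > 0 these are
  the solutions square integrable at +infinity, described without an integral and without a base
  point.\<close>

definition weyl_space :: "(real \<Rightarrow> complex^'m^'m) \<Rightarrow> complex \<Rightarrow> (real \<Rightarrow> complex^('m::finite + 'm)) set" where
  "weyl_space \<phi> \<zeta> = {V. dirac_solution \<phi> \<zeta> V \<and> (\<forall>x. norm (pos_part (V x)) \<le> norm (neg_part (V x)))}"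

definition of_parts :: "complex^'m \<Rightarrow> complex^'m \<Rightarrow> complex^('m::finite + 'm)" where
  "of_parts p q = join ((1/2) *s (p + q)) ((- \<i>/2) *s (p - q))"

lemma pos_neg_of_parts [simp]: "pos_part (of_parts p q) = p" "neg_part (of_parts p q) = q"
  by (simp_all add: pos_part_def neg_part_def of_parts_def vec_eq_iff field_simps)

lemma nonneg_integrable_halfline:
  fixes f :: "real \<Rightarrow> real"
  assumes f0: "\<And>x. f x \<ge> 0" and i: "\<And>y. f integrable_on {c..y}" and b: "\<And>y. c \<le> y \<Longrightarrow> integral {c..y} f \<le> B"
  shows "f absolutely_integrable_on {c..}"
proof -
  let ?f = "\<lambda>n x. if x \<in> {c..c + real n} then f x else 0"
  have iff: "(?f n has_integral integral {c..c + real n} f) {c..}" for n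
    using has_integral_restrict[of "{c..c + real n}" "{c..}" f] integrable_integral[OF i[of "c + real n"]] by auto
  have "f integrable_on {c..} \<and> (\<lambda>n. integral {c..} (?f n)) \<longlonglongrightarrow> integral {c..} f"
  proof (rule monotone_convergence_increasing)
    show "?f n integrable_on {c..}" for n using iff by blast
    show "?f n x \<le> ?f (Suc n) x" for n x using f0 by auto
    show "(\<lambda>n. ?f n x) \<longlonglongrightarrow> f x" if "x \<in> {c..}" for x
    proof (rule tendsto_eventually)
      show "\<forall>\<^sub>F n in sequentially. ?f n x = f x"
        using eventually_ge_at_top[of "nat \<lceil>x - c\<rceil>"]
      proof eventually_elim
        case (elim n)
        then have "x - c \<le> real n" by (meson of_nat_mono order_trans real_nat_ceiling_ge of_nat_le_iff)
        then show ?case using that by auto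
      qed
    qed
    have "integral {c..} (?f n) \<in> {0..B}" for n
      using b[of "c + real n"] integral_nonneg[OF i[of "c + real n"]] f0 integral_unique[OF iff, of n] by auto
    then show "bounded (range (\<lambda>n. integral {c..} (?f n)))"
      by (intro bounded_subset[OF bounded_closed_interval[of 0 B]]) auto
  qed
  then show ?thesis using f0 by (simp add: nonnegative_absolutely_integrable_1)
qed

lemma halfline_not_integrable:
  fixes f :: "real \<Rightarrow> real"
  assumes f: "f absolutely_integrable_on {c..}" and f0: "\<And>x. f x \<ge> 0" and e: "e > 0" and ge: "\<And>x. d \<le> x \<Longrightarrow> e \<le> f x"
  shows False
proof -
  define m where "m = max c d"
  \<comment> \<open>With this length, e n exceeds the integral over the half-line by at least
    1.\<close>
  define n where "n = (\<bar>integral {c..} f\<bar> + 1) / e"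
  have n0: "n > 0" using e by (simp add: n_def)
  have fi: "f integrable_on {c..}" using f absolutely_integrable_on_def by blast
  have fi2: "f integrable_on {m..m + n}"
    using integrable_on_subcbox[OF fi, of m "m + n"] by (auto simp: m_def)
  have "e * n \<le> integral {m..m + n} f"
  proof -
    have "integral {m..m + n} (\<lambda>x. e) \<le> integral {m..m + n} f"
      by (rule integral_le[OF _ fi2]) (use ge in \<open>auto simp: m_def\<close>)
    then show ?thesis using n0 by (simp add: mult.commute)
  qed
  also have "\<dots> \<le> integral {c..} f"
    by (rule integral_subset_le[OF _ fi2 fi]) (use f0 in \<open>auto simp: m_def\<close>)
  finally show False using e by (simp add: n_def)
qed

context
  fixes \<phi> :: "real \<Rightarrow> complex^'m^'m::finite" and \<zeta> :: complex
  assumes L1: "L1_loc \<phi>" and herm: "AE x in lebesgue. \<phi> x = adjoint_matrix (\<phi> x)" and Im: "Im \<zeta> > 0"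
begin

lemma dirac_solution_energy:
  assumes V: "dirac_solution \<phi> \<zeta> V" and ab: "a \<le> b"
  shows "((\<lambda>x. 4 * Im \<zeta> * (norm (V x))\<^sup>2) has_integral
    ((norm (pos_part (V b)))\<^sup>2 - (norm (neg_part (V b)))\<^sup>2) - ((norm (pos_part (V a)))\<^sup>2 - (norm (neg_part (V a)))\<^sup>2)) {a..b}"
proof -
  have "AE x in lebesgue. x \<in> {a..b} \<longrightarrow> \<phi> x = adjoint_matrix (\<phi> x)" using herm by (auto elim: eventually_mono)
  from diag_solution_energy[OF L1 ab diag_solution_of_dirac[OF V, of a b] this] show ?thesis
    by (simp only: norm_pos_neg_part) (simp add: mult.assoc mult.left_commute)
qed

lemma dirac_energy_mono:
  assumes V: "dirac_solution \<phi> \<zeta> V" and ab: "a \<le> b"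
  shows "(norm (pos_part (V a)))\<^sup>2 - (norm (neg_part (V a)))\<^sup>2 \<le> (norm (pos_part (V b)))\<^sup>2 - (norm (neg_part (V b)))\<^sup>2"
  using has_integral_nonneg[OF dirac_solution_energy[OF assms]] Im by simp

lemma dirac_pos_le_neg_mono:
  assumes V: "dirac_solution \<phi> \<zeta> V" and ab: "a \<le> b" and "norm (pos_part (V b)) \<le> norm (neg_part (V b))"
  shows "norm (pos_part (V a)) \<le> norm (neg_part (V a))"
proof -
  have "(norm (pos_part (V b)))\<^sup>2 \<le> (norm (neg_part (V b)))\<^sup>2" using assms(3) by (intro power_mono) auto
  then have "(norm (pos_part (V a)))\<^sup>2 \<le> (norm (neg_part (V a)))\<^sup>2" using dirac_energy_mono[OF V ab] by linarith
  then show ?thesis by (rule power2_le_imp_le) simp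
qed

text \<open>The energy is nondecreasing. If it is nonnegative at \<open>a\<close> and nonpositive at
  the later point \<open>b\<close>, then its increase, the integral of 4 Im \<zeta> |V|^2, vanishes.
  The injectivity arguments that produce Weyl solutions rest on this.\<close>

lemma dirac_energy_sandwich_zero:
  assumes V: "dirac_solution \<phi> \<zeta> V" and ab: "a < b"
    and "norm (neg_part (V a)) \<le> norm (pos_part (V a))" "norm (pos_part (V b)) \<le> norm (neg_part (V b))"
  shows "V = (\<lambda>x. 0)"
proof -
  let ?I = "((norm (pos_part (V b)))\<^sup>2 - (norm (neg_part (V b)))\<^sup>2) - ((norm (pos_part (V a)))\<^sup>2 - (norm (neg_part (V a)))\<^sup>2)"
  have "(norm (neg_part (V a)))\<^sup>2 \<le> (norm (pos_part (V a)))\<^sup>2" "(norm (pos_part (V b)))\<^sup>2 \<le> (norm (neg_part (V b)))\<^sup>2"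
    using assms by (auto intro: power_mono)
  then have I0: "?I = 0" using dirac_energy_mono[OF V less_imp_le[OF ab]] by linarith
  have i: "((\<lambda>x. 4 * Im \<zeta> * (norm (V x))\<^sup>2) has_integral 0) (cbox a b)"
    using dirac_solution_energy[OF V less_imp_le[OF ab]] unfolding I0 by simp
  have "continuous_on UNIV V" using V linear_ode_solution_continuous unfolding dirac_solution_iff by blast
  then have "continuous_on (cbox a b) (\<lambda>x. 4 * Im \<zeta> * (norm (V x))\<^sup>2)"
    by (intro continuous_intros) (rule continuous_on_subset, auto)
  then have "4 * Im \<zeta> * (norm (V a))\<^sup>2 = 0"
    by (rule has_integral_0_cbox_imp_0[OF _ _ i]) (use Im ab in auto)
  then have "V a = 0" using Im by simp
  then show ?thesis using dirac_solution_unique[OF L1 V dirac_solution_zero, of a] by simp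
qed

text \<open>A solution that has positive energy somewhere keeps at least that energy to the right,
  so |V|^2 stays above a positive constant and is not integrable. Conversely, nonpositive energy at
  every y bounds the integral of 4 Im \<zeta> |V|^2 over [c,y] by |q(c)|^2.\<close>

lemma L2_solutions_eq_weyl_space: "L2_solutions \<phi> \<zeta> {c..} = weyl_space \<phi> \<zeta>"
proof (intro set_eqI iffI)
  fix V assume "V \<in> L2_solutions \<phi> \<zeta> {c..}"
  then have V: "dirac_solution \<phi> \<zeta> V" and i: "(\<lambda>x. (norm (V x))\<^sup>2) absolutely_integrable_on {c..}"
    by (auto simp: L2_solutions_def)
  have "norm (pos_part (V x)) \<le> norm (neg_part (V x))" for x
  proof (rule ccontr)
    let ?E = "\<lambda>x. (norm (pos_part (V x)))\<^sup>2 - (norm (neg_part (V x)))\<^sup>2"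
    assume "\<not> norm (pos_part (V x)) \<le> norm (neg_part (V x))"
    then have E: "?E x > 0" by (simp add: power_strict_mono)
    have "?E x / 2 \<le> (norm (V y))\<^sup>2" if "x \<le> y" for y
    proof -
      have "?E x \<le> ?E y" by (rule dirac_energy_mono[OF V that])
      also have "\<dots> \<le> (norm (pos_part (V y)))\<^sup>2 + (norm (neg_part (V y)))\<^sup>2" by simp
      finally show ?thesis unfolding norm_pos_neg_part by simp
    qed
    then show False using halfline_not_integrable[OF i _ half_gt_zero[OF E], of x] by simp
  qed
  with V show "V \<in> weyl_space \<phi> \<zeta>" by (simp add: weyl_space_def)
next
  fix V assume "V \<in> weyl_space \<phi> \<zeta>"
  then have V: "dirac_solution \<phi> \<zeta> V" and le: "\<And>x. norm (pos_part (V x)) \<le> norm (neg_part (V x))"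
    by (auto simp: weyl_space_def)
  have cV: "continuous_on UNIV V" using V linear_ode_solution_continuous unfolding dirac_solution_iff by blast
  let ?B = "(norm (neg_part (V c)))\<^sup>2 / (4 * Im \<zeta>)"
  have "(\<lambda>x. (norm (V x))\<^sup>2) absolutely_integrable_on {c..}"
  proof (rule nonneg_integrable_halfline)
    show "(\<lambda>x. (norm (V x))\<^sup>2) integrable_on {c..y}" for y
      by (intro integrable_continuous_real continuous_intros continuous_on_subset[OF cV]) simp
    show "integral {c..y} (\<lambda>x. (norm (V x))\<^sup>2) \<le> ?B" if "c \<le> y" for y
    proof -
      have "(norm (pos_part (V y)))\<^sup>2 \<le> (norm (neg_part (V y)))\<^sup>2" using le by (intro power_mono) auto
      moreover have "(norm (pos_part (V c)))\<^sup>2 \<ge> 0" by simp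
      moreover have "4 * Im \<zeta> * integral {c..y} (\<lambda>x. (norm (V x))\<^sup>2) =
        ((norm (pos_part (V y)))\<^sup>2 - (norm (neg_part (V y)))\<^sup>2) - ((norm (pos_part (V c)))\<^sup>2 - (norm (neg_part (V c)))\<^sup>2)"
        using integral_unique[OF dirac_solution_energy[OF V that]] by simp
      ultimately have "4 * Im \<zeta> * integral {c..y} (\<lambda>x. (norm (V x))\<^sup>2) \<le> (norm (neg_part (V c)))\<^sup>2" by linarith
      then show ?thesis using Im by (simp add: pos_le_divide_eq mult_ac)
    qed
  qed simp
  with V show "V \<in> L2_solutions \<phi> \<zeta> {c..}" by (simp add: L2_solutions_def)
qed

text \<open>The condition |p| \<le> |q| is not linear. Closure under sums is borrowed from the
  square integrable functions, with which the space has just been identified.\<close>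

lemma weyl_space_diff: "V \<in> weyl_space \<phi> \<zeta> \<Longrightarrow> W \<in> weyl_space \<phi> \<zeta> \<Longrightarrow> (\<lambda>x. V x - W x) \<in> weyl_space \<phi> \<zeta>"
  and weyl_space_add: "V \<in> weyl_space \<phi> \<zeta> \<Longrightarrow> W \<in> weyl_space \<phi> \<zeta> \<Longrightarrow> (\<lambda>x. V x + W x) \<in> weyl_space \<phi> \<zeta>"
  and weyl_space_scalar: "V \<in> weyl_space \<phi> \<zeta> \<Longrightarrow> (\<lambda>x. z *s V x) \<in> weyl_space \<phi> \<zeta>"
proof -
  have sq: "(norm (a + b))\<^sup>2 \<le> 2 * (norm a)\<^sup>2 + 2 * (norm b)\<^sup>2" for a b :: "complex^('m + 'm)"
  proof -
    have "0 \<le> (norm (a - b))\<^sup>2" by simp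
    then show ?thesis by (simp add: power2_norm_eq_inner inner_add_left inner_add_right inner_diff_left inner_diff_right)
  qed
  have meas: "(\<lambda>x. (norm (W x))\<^sup>2) absolutely_integrable_on {0..}"
    if W: "dirac_solution \<phi> \<zeta> W" and U: "\<And>x. (norm (W x))\<^sup>2 \<le> 2 * f x" "f absolutely_integrable_on {0..}" for W f
  proof -
    have cW: "continuous_on UNIV W" using W linear_ode_solution_continuous unfolding dirac_solution_iff by blast
    have fi: "f integrable_on {0..}" using U(2) absolutely_integrable_on_def by blast
    have f0: "f x \<ge> 0" for x using U(1)[of x] by (smt (verit) zero_le_power2)
    show ?thesis
    proof (rule nonneg_integrable_halfline)
      show i: "(\<lambda>x. (norm (W x))\<^sup>2) integrable_on {0..y}" for y
        by (intro integrable_continuous_real continuous_intros continuous_on_subset[OF cW]) simp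
      show "integral {0..y} (\<lambda>x. (norm (W x))\<^sup>2) \<le> 2 * integral {0..} f" if "0 \<le> y" for y
      proof -
        have fi2: "f integrable_on {0..y}" using integrable_on_subcbox[OF fi, of 0 y] by auto
        have "integral {0..y} (\<lambda>x. (norm (W x))\<^sup>2) \<le> integral {0..y} (\<lambda>x. 2 * f x)"
          by (rule integral_le[OF i]) (use fi2 U(1) in \<open>auto intro: integrable_on_mult_right\<close>)
        also have "\<dots> = 2 * integral {0..y} f" by simp
        also have "integral {0..y} f \<le> integral {0..} f"
          by (rule integral_subset_le[OF _ fi2 fi]) (use f0 in auto)
        finally show ?thesis by simp
      qed
    qed simp
  qed
  have add: "(\<lambda>x. V x + W x) \<in> weyl_space \<phi> \<zeta>" if "V \<in> weyl_space \<phi> \<zeta>" "W \<in> weyl_space \<phi> \<zeta>" for V W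
  proof -
    have VW: "dirac_solution \<phi> \<zeta> V" "dirac_solution \<phi> \<zeta> W"
      "(\<lambda>x. (norm (V x))\<^sup>2) absolutely_integrable_on {0..}" "(\<lambda>x. (norm (W x))\<^sup>2) absolutely_integrable_on {0..}"
      using that unfolding L2_solutions_eq_weyl_space[of 0, symmetric] L2_solutions_def by auto
    have "(\<lambda>x. (norm (V x + W x))\<^sup>2) absolutely_integrable_on {0..}"
      by (rule meas[OF dirac_solution_add[OF VW(1,2)] _ set_integral_add(1)[OF VW(3,4)]]) (simp add: sq)
    then show ?thesis
      unfolding L2_solutions_eq_weyl_space[of 0, symmetric] L2_solutions_def
      using dirac_solution_add[OF VW(1,2)] by simp
  qed
  have scal: "(\<lambda>x. z *s V x) \<in> weyl_space \<phi> \<zeta>" if "V \<in> weyl_space \<phi> \<zeta>" for V z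
  proof -
    have "pos_part (z *s v) = z *s pos_part v" "neg_part (z *s v) = z *s neg_part v" for v :: "complex^('m + 'm)"
      by (simp_all add: pos_part_def neg_part_def vec_eq_iff algebra_simps)
    then show ?thesis using that by (auto simp: weyl_space_def dirac_solution_scalar norm_scalar_mult_vec intro: mult_left_mono)
  qed
  show "V \<in> weyl_space \<phi> \<zeta> \<Longrightarrow> W \<in> weyl_space \<phi> \<zeta> \<Longrightarrow> (\<lambda>x. V x + W x) \<in> weyl_space \<phi> \<zeta>" by (rule add)
  show "V \<in> weyl_space \<phi> \<zeta> \<Longrightarrow> (\<lambda>x. z *s V x) \<in> weyl_space \<phi> \<zeta>" by (rule scal)
  show "V \<in> weyl_space \<phi> \<zeta> \<Longrightarrow> W \<in> weyl_space \<phi> \<zeta> \<Longrightarrow> (\<lambda>x. V x - W x) \<in> weyl_space \<phi> \<zeta>"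
    using add[of V "\<lambda>x. (- 1) *s W x"] scal[of W "- 1"] by (simp add: vec_eq_iff fun_eq_iff)
qed

end

section \<open>Existence and uniqueness of the Weyl matrix on the right half-line\<close>

lemma pos_neg_part_linear:
  "pos_part (V + W) = pos_part V + pos_part W" "neg_part (V + W) = neg_part V + neg_part W"
  "pos_part (V - W) = pos_part V - pos_part W" "neg_part (V - W) = neg_part V - neg_part W"
  "pos_part (z *s V) = z *s pos_part V" "neg_part (z *s V) = z *s neg_part V"
  "pos_part 0 = 0" "neg_part 0 = 0"
  by (simp_all add: pos_part_def neg_part_def vec_eq_iff algebra_simps)

lemma of_parts_linear:
  "of_parts (p + p') (q + q') = of_parts p q + of_parts p' q'"
  "of_parts (z *s p) (z *s q) = z *s of_parts p q"
  by (rule pos_neg_part_eqI; simp add: pos_neg_part_linear)+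

lemma weyl_spaceD:
  fixes \<phi> :: "real \<Rightarrow> complex^'m^'m::finite"
  assumes "V \<in> weyl_space \<phi> \<zeta>"
  shows "dirac_solution \<phi> \<zeta> V" "norm (pos_part (V x)) \<le> norm (neg_part (V x))"
  using assms by (auto simp: weyl_space_def)

lemma stack_vector_mult: "stack (mat 1) M *v u = join u (M *v u)" for M :: "complex^'m^'m::finite"
  by (rule vec_sum_eqI)
    (simp_all add: upper_def lower_def stack_def join_def matrix_vector_mult_def mat_def vec_eq_iff if_distrib
      if_distribR sum.delta cong: if_cong)

lemma weyl_columns:
  fixes \<phi> :: "real \<Rightarrow> complex^'m^'m::finite"
  assumes L1: "L1_loc \<phi>"
  shows "(\<lambda>u x. (dirac_fundamental \<phi> \<zeta> c x ** stack (mat 1) M) *v u) = (\<lambda>u. dirac_flow \<phi> \<zeta> c (join u (M *v u)))"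
  by (intro ext) (simp add: matrix_vector_mul_assoc[symmetric] dirac_fundamental_flow[OF L1] stack_vector_mult)

lemma matrix_eqI_vector: "(\<And>u. M *v u = N *v u) \<Longrightarrow> M = N" for M N :: "complex^'k^'l"
  by (simp add: matrix_eq)

context
  fixes \<phi> :: "real \<Rightarrow> complex^'m^'m::finite" and \<zeta> :: complex
  assumes L1: "L1_loc \<phi>" and herm: "AE x in lebesgue. \<phi> x = adjoint_matrix (\<phi> x)" and Im: "Im \<zeta> > 0"
begin

lemma weyl_space_neg_zero:
  assumes "V \<in> weyl_space \<phi> \<zeta>" "neg_part (V c) = 0" shows "V = (\<lambda>x. 0)"
proof -
  have "pos_part (V c) = 0" using weyl_spaceD(2)[OF assms(1), of c] assms(2) by simp
  then have "V c = 0" using assms(2) by (intro pos_neg_part_eqI) (simp_all add: pos_neg_part_linear)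
  then show ?thesis using dirac_solution_unique[OF L1 weyl_spaceD(1)[OF assms(1)] dirac_solution_zero, of c] by simp
qed

text \<open>If V1 vanishes at \<open>c\<close>, then |p| = |q| there, so the energy is zero at
  \<open>c\<close> and nonpositive at c + 1. Together with linearity, a Weyl solution is thus
  determined by its first component at any one point.\<close>

lemma weyl_space_upper_zero:
  assumes V: "V \<in> weyl_space \<phi> \<zeta>" and "upper (V c) = 0" shows "V = (\<lambda>x. 0)"
proof -
  have "norm (neg_part (V c)) \<le> norm (pos_part (V c))"
    using assms(2) by (simp add: pos_part_def neg_part_def norm_scalar_mult_vec)
  then show ?thesis
    using dirac_energy_sandwich_zero[OF L1 herm Im weyl_spaceD(1)[OF V], of c "c + 1"] weyl_spaceD(2)[OF V, of "c + 1"]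
    by simp
qed

text \<open>Solving backwards from p(d) = 0 gives a linear map from q(d) to q(c). Where q(c) = 0,
  the energy is nonnegative at \<open>c\<close> and nonpositive at \<open>d\<close>, so the solution
  vanishes; an injective linear map of a finite-dimensional space to itself is onto.\<close>

lemma dirac_boundary_value:
  assumes cd: "c < d"
  obtains V where "dirac_solution \<phi> \<zeta> V" "neg_part (V c) = q" "pos_part (V d) = 0"
proof -
  let ?F = "\<lambda>r. dirac_flow \<phi> \<zeta> d (of_parts 0 r)"
  let ?S = "\<lambda>r. neg_part (?F r c)"
  have lin: "linear ?S"
  proof (rule linearI)
    show "?S (r + s) = ?S r + ?S s" for r s
      using of_parts_linear(1)[of 0 0 r s] by (simp add: dirac_flow_add[OF L1] pos_neg_part_linear)
    show "?S (a *\<^sub>R r) = a *\<^sub>R ?S r" for a r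
      using of_parts_linear(2)[of "complex_of_real a" 0 r]
      by (simp add: vec_scaleR_eq_scalar_mult dirac_flow_scalar[OF L1] pos_neg_part_linear)
  qed
  have "inj ?S"
    unfolding linear_injective_0[OF lin]
  proof (intro allI impI)
    fix r assume r: "?S r = 0"
    have "?F r = (\<lambda>x. 0)"
      by (rule dirac_energy_sandwich_zero[OF L1 herm Im dirac_flow_solution[OF L1] cd]) (simp_all add: r L1)
    then have "neg_part (?F r d) = 0" by (simp add: pos_neg_part_linear)
    then show "r = 0" using L1 by simp
  qed
  from surjD[OF linear_injective_imp_surjective[OF lin this], of q] obtain r where "?S r = q" by blast
  then show ?thesis by (intro that[of "?F r"] dirac_flow_solution[OF L1]) (simp_all add: L1)
qed

text \<open>The approximants satisfy p = 0 at the far points c + n + 1 and share the prescribed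
  q(c). Monotonicity of the energy gives |p| \<le> |q| to the left of the far point, so the values
  at \<open>c\<close> are bounded and a subsequence converges; continuity of the flow in the data
  extends the convergence to every point.\<close>

lemma weyl_space_exists_neg: "\<exists>V \<in> weyl_space \<phi> \<zeta>. neg_part (V c) = q"
proof -
  have "\<forall>n. \<exists>V. dirac_solution \<phi> \<zeta> V \<and> neg_part (V c) = q \<and> pos_part (V (c + real (Suc n))) = 0"
    using dirac_boundary_value[of c] by (metis less_add_same_cancel1 of_nat_0_less_iff zero_less_Suc)
  then obtain V where V: "\<And>n. dirac_solution \<phi> \<zeta> (V n)" "\<And>n. neg_part (V n c) = q" "\<And>n. pos_part (V n (c + real (Suc n))) = 0"
    by metis
  have le: "norm (pos_part (V n x)) \<le> norm (neg_part (V n x))" if "x \<le> c + real (Suc n)" for n x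
    by (rule dirac_pos_le_neg_mono[OF L1 herm Im V(1) that]) (simp only: V(3), simp)
  have bd: "norm (V n c) \<le> norm q" for n
  proof (rule power2_le_imp_le)
    have "(norm (pos_part (V n c)))\<^sup>2 \<le> (norm q)\<^sup>2" using le[of c n] V(2)[of n] by (intro power_mono) auto
    then show "(norm (V n c))\<^sup>2 \<le> (norm q)\<^sup>2" using norm_pos_neg_part[of "V n c"] unfolding V(2) by linarith
  qed simp
  then have "bounded (range (\<lambda>n. V n c))" by (auto simp: bounded_iff)
  then obtain v r where r: "strict_mono r" and v: "((\<lambda>n. V n c) \<circ> r) \<longlonglongrightarrow> v"
    using bounded_imp_convergent_subsequence by blast
  let ?W = "dirac_flow \<phi> \<zeta> c v"
  have lim: "(\<lambda>n. V (r n) x) \<longlonglongrightarrow> ?W x" for x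
  proof -
    have "(\<lambda>n. dirac_flow \<phi> \<zeta> c (V (r n) c) x) \<longlonglongrightarrow> ?W x"
      using bounded_linear.tendsto[OF bounded_linear_dirac_flow[OF L1, where \<zeta> = \<zeta> and c = c and x = x] v] by (simp add: o_def)
    moreover have "dirac_flow \<phi> \<zeta> c (V (r n) c) x = V (r n) x" for n
      by (rule fun_cong[OF dirac_solution_eq_flow[OF L1 V(1), symmetric]])
    ultimately show ?thesis by simp
  qed
  have "neg_part (?W c) = q"
    using bounded_linear.tendsto[OF bounded_linear_neg_part lim[of c]] unfolding V(2) LIMSEQ_const_iff by simp
  moreover have "norm (pos_part (?W x)) \<le> norm (neg_part (?W x))" for x
  proof (rule LIMSEQ_le)
    show "(\<lambda>n. norm (pos_part (V (r n) x))) \<longlonglongrightarrow> norm (pos_part (?W x))"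
      by (intro tendsto_norm bounded_linear.tendsto[OF bounded_linear_pos_part] lim)
    show "(\<lambda>n. norm (neg_part (V (r n) x))) \<longlonglongrightarrow> norm (neg_part (?W x))"
      by (intro tendsto_norm bounded_linear.tendsto[OF bounded_linear_neg_part] lim)
    show "\<exists>N. \<forall>n\<ge>N. norm (pos_part (V (r n) x)) \<le> norm (neg_part (V (r n) x))"
    proof (intro exI allI impI)
      fix n assume n: "nat \<lceil>x - c\<rceil> \<le> n"
      have "x - c \<le> real n" using n by (meson of_nat_mono order_trans real_nat_ceiling_ge of_nat_le_iff)
      \<comment> \<open>A strictly increasing selection satisfies r n \<ge> n, so the far point of
        the \<open>n\<close>-th selected approximant lies beyond \<open>x\<close>.\<close>
      also have "real n \<le> real (r n)" using seq_suble[OF r] by simp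
      finally show "norm (pos_part (V (r n) x)) \<le> norm (neg_part (V (r n) x))" by (intro le) simp
    qed
  qed
  ultimately show ?thesis using dirac_flow_solution[OF L1] unfolding weyl_space_def by blast
qed

text \<open>So far the Weyl space is parametrised by q(c). Passing from q(c) to V1(c) is an
  injective linear map, hence onto, and this turns the space into a graph over the first
  component.\<close>

lemma weyl_space_exists: "\<exists>V \<in> weyl_space \<phi> \<zeta>. upper (V c) = u"
proof -
  obtain F where F: "\<And>q. F q \<in> weyl_space \<phi> \<zeta>" "\<And>q. neg_part (F q c) = q"
    using weyl_space_exists_neg[of c] by metis
  note closed = weyl_space_add[OF L1 herm Im] weyl_space_diff[OF L1 herm Im] weyl_space_scalar[OF L1 herm Im]
  \<comment> \<open>The solutions \<open>F q\<close> are chosen separately for each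
    \<open>q\<close>; uniqueness is what makes the choice linear.\<close>
  have uniq: "F (neg_part (V c)) = V" if V: "V \<in> weyl_space \<phi> \<zeta>" for V
    using weyl_space_neg_zero[OF closed(2)[OF F(1)[of "neg_part (V c)"] V], of c] F(2)
    by (simp add: pos_neg_part_linear fun_eq_iff)
  let ?T = "\<lambda>q. upper (F q c)"
  have lin: "linear ?T"
  proof (rule linearI)
    show "?T (r + s) = ?T r + ?T s" for r s
      using uniq[OF closed(1)[OF F(1)[of r] F(1)[of s]]] F(2) by (simp add: pos_neg_part_linear fun_eq_iff)
    show "?T (a *\<^sub>R r) = a *\<^sub>R ?T r" for a r
      using uniq[OF closed(3)[OF F(1)[of r], of "complex_of_real a"]] F(2)
      by (simp add: pos_neg_part_linear fun_eq_iff vec_scaleR_eq_scalar_mult)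
  qed
  have "inj ?T"
    unfolding linear_injective_0[OF lin]
  proof (intro allI impI)
    fix r assume "?T r = 0"
    then have "F r = (\<lambda>x. 0)" using weyl_space_upper_zero F(1) by blast
    then show "r = 0" using F(2)[of r] by (simp add: pos_neg_part_linear)
  qed
  from surjD[OF linear_injective_imp_surjective[OF lin this], of u] obtain r where "?T r = u" by blast
  then show ?thesis using F(1) by blast
qed

lemma weyl_matrix_exists:
  obtains M where "weyl_space \<phi> \<zeta> = range (\<lambda>u. dirac_flow \<phi> \<zeta> c (join u (M *v u)))"
proof -
  obtain F where F: "\<And>u. F u \<in> weyl_space \<phi> \<zeta>" "\<And>u. upper (F u c) = u"
    using weyl_space_exists[of c] by metis
  \<comment> \<open>The columns are the second components of the Weyl solutions whose first
    components at \<open>c\<close> are the unit vectors.\<close>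
  define M where "M = (\<chi> i j. lower (F (axis j 1) c) $ i)"
  have col: "column j M = lower (F (axis j 1) c)" for j by (simp add: M_def column_def vec_eq_iff)
  have sum: "(\<lambda>x. \<Sum>j\<in>I. (u $ j) *s F (axis j 1) x) \<in> weyl_space \<phi> \<zeta>" if "finite I" for I u
    using that
  proof (induction I)
    case empty then show ?case by (simp add: weyl_space_def dirac_solution_zero pos_neg_part_linear)
  next
    case (insert i I)
    then show ?case using weyl_space_add[OF L1 herm Im weyl_space_scalar[OF L1 herm Im F(1)]] by simp
  qed
  have up: "upper (\<Sum>j\<in>I. f j) = (\<Sum>j\<in>I. upper (f j))" "lower (\<Sum>j\<in>I. f j) = (\<Sum>j\<in>I. lower (f j))"
    for I and f :: "'m \<Rightarrow> complex^('m + 'm)"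
    using bounded_linear.linear[OF bounded_linear_upper] bounded_linear.linear[OF bounded_linear_lower] linear_sum by blast+
  have flow: "(\<lambda>x. \<Sum>j\<in>UNIV. (u $ j) *s F (axis j 1) x) = dirac_flow \<phi> \<zeta> c (join u (M *v u))" (is "?L u = _") for u
  proof -
    have "?L u c = join u (M *v u)"
    proof (rule vec_sum_eqI)
      have "(\<Sum>j\<in>UNIV. u $ j *s axis j 1) = (u :: complex^'m)"
        using basis_expansion[of u] .
      then show "upper (?L u c) = upper (join u (M *v u))" by (simp add: up F(2))
      show "lower (?L u c) = lower (join u (M *v u))"
        by (simp add: up matrix_vector_mult_eq_sum_columns col)
    qed
    then show ?thesis using dirac_solution_eq_flow[OF L1 weyl_spaceD(1)[OF sum[OF finite, of u UNIV]], where c = c] by simp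
  qed
  have "weyl_space \<phi> \<zeta> = range (\<lambda>u. dirac_flow \<phi> \<zeta> c (join u (M *v u)))"
  proof (intro equalityI subsetI)
    fix V assume V: "V \<in> weyl_space \<phi> \<zeta>"
    let ?u = "upper (V c)"
    have "(\<lambda>x. V x - ?L ?u x) = (\<lambda>x. 0)"
      by (rule weyl_space_upper_zero[OF weyl_space_diff[OF L1 herm Im V sum[OF finite]], of c]) (simp add: fun_cong[OF flow] L1)
    from fun_cong[OF this] have "V x = ?L ?u x" for x by (simp only: eq_iff_diff_eq_0[of "V x"])
    then have "V = dirac_flow \<phi> \<zeta> c (join ?u (M *v ?u))" unfolding flow[symmetric] by (rule ext)
    then show "V \<in> range (\<lambda>u. dirac_flow \<phi> \<zeta> c (join u (M *v u)))" by blast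
  next
    fix V assume "V \<in> range (\<lambda>u. dirac_flow \<phi> \<zeta> c (join u (M *v u)))"
    then obtain u where "V = dirac_flow \<phi> \<zeta> c (join u (M *v u))" by blast
    then show "V \<in> weyl_space \<phi> \<zeta>" using sum[OF finite, of u UNIV] unfolding flow by (simp only:)
  qed
  then show ?thesis by (rule that)
qed

text \<open>Any matrix that parametrises the space can be read off at \<open>c\<close>, where the
  flow is the identity. The definite description therefore denotes the matrix constructed
  above.\<close>

lemma weyl_dirac_range: "weyl_space \<phi> \<zeta> = range (\<lambda>u. dirac_flow \<phi> \<zeta> c (join u (weyl_dirac \<phi> \<zeta> c {c..} *v u)))"
proof -
  obtain M where M: "weyl_space \<phi> \<zeta> = range (\<lambda>u. dirac_flow \<phi> \<zeta> c (join u (M *v u)))"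
    using weyl_matrix_exists by blast
  have "weyl_dirac \<phi> \<zeta> c {c..} = M"
    unfolding weyl_dirac_def weyl_columns[OF L1] L2_solutions_eq_weyl_space[OF L1 herm Im]
  proof (rule the_equality)
    show "range (\<lambda>u. dirac_flow \<phi> \<zeta> c (join u (M *v u))) = weyl_space \<phi> \<zeta>" by (simp add: M)
    fix N assume N: "range (\<lambda>u. dirac_flow \<phi> \<zeta> c (join u (N *v u))) = weyl_space \<phi> \<zeta>"
    show "N = M"
    proof (rule matrix_eqI_vector)
      fix u
      have "dirac_flow \<phi> \<zeta> c (join u (N *v u)) \<in> range (\<lambda>u. dirac_flow \<phi> \<zeta> c (join u (M *v u)))"
        using N M by blast
      then obtain w where "dirac_flow \<phi> \<zeta> c (join u (N *v u)) = dirac_flow \<phi> \<zeta> c (join w (M *v w))" by blast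
      from fun_cong[OF this, of c] have eq: "join u (N *v u) = join w (M *v w)" using L1 by simp
      have "u = w" "N *v u = M *v w" using arg_cong[OF eq, of upper] arg_cong[OF eq, of lower] by simp_all
      then show "N *v u = M *v u" by simp
    qed
  qed
  then show ?thesis using M by simp
qed

lemma weyl_space_graph:
  assumes "V \<in> weyl_space \<phi> \<zeta>" shows "lower (V c) = weyl_dirac \<phi> \<zeta> c {c..} *v upper (V c)"
proof -
  obtain u where "V = dirac_flow \<phi> \<zeta> c (join u (weyl_dirac \<phi> \<zeta> c {c..} *v u))"
    using assms weyl_dirac_range by blast
  then show ?thesis using L1 by simp
qed

lemma weyl_flow_in_space: "dirac_flow \<phi> \<zeta> c (join u (weyl_dirac \<phi> \<zeta> c {c..} *v u)) \<in> weyl_space \<phi> \<zeta>"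
  using weyl_dirac_range by blast

end

section \<open>Reflection to the left half-line\<close>

text \<open>Reflecting x reverses the sign of the derivative. Changing the sign of V2 as well
  restores the Dirac form with the same \<zeta>, and the coefficient becomes -\<phi>(-x).\<close>

definition reflect_pot :: "(real \<Rightarrow> complex^'m^'m) \<Rightarrow> real \<Rightarrow> complex^'m^'m" where
  "reflect_pot \<phi> = (\<lambda>x. - \<phi> (- x))"

definition flip_lower :: "complex^('m::finite + 'm) \<Rightarrow> complex^('m + 'm)" where
  "flip_lower v = join (upper v) (- lower v)"

lemma flip_lower_simps [simp]:
  "upper (flip_lower v) = upper v" "lower (flip_lower v) = - lower v" "flip_lower (flip_lower v) = v"
  "pos_part (flip_lower v) = neg_part v" "neg_part (flip_lower v) = pos_part v" "norm (flip_lower v) = norm v"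
proof -
  show 1: "upper (flip_lower v) = upper v" "lower (flip_lower v) = - lower v" by (simp_all add: flip_lower_def)
  then show "flip_lower (flip_lower v) = v" by (intro vec_sum_eqI) (simp_all add: flip_lower_def)
  show "pos_part (flip_lower v) = neg_part v" "neg_part (flip_lower v) = pos_part v"
    by (simp_all add: pos_part_def neg_part_def 1 vec_eq_iff)
  have "(norm (flip_lower v))\<^sup>2 = (norm v)\<^sup>2" using norm_upper_lower[of v] norm_upper_lower[of "flip_lower v"] 1 by simp
  then show "norm (flip_lower v) = norm v" by simp
qed

lemma bounded_linear_flip_lower: "bounded_linear flip_lower"
  by (intro linear_conv_bounded_linear[THEN iffD1] linearI)
    (auto simp: flip_lower_def join_def upper_def lower_def vec_eq_iff split: sum.split)

lemma reflect_pot_reflect [simp]: "reflect_pot (reflect_pot \<phi>) = \<phi>"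
  by (simp add: reflect_pot_def)

lemma AE_reflect:
  assumes "AE x in lebesgue. P (x::real)" shows "AE x in lebesgue. P (- x)"
proof -
  have "negligible (uminus ` {x. \<not> P x})"
    using assms unfolding AE_lebesgue_iff_negligible
    by (intro negligible_differentiable_image_negligible) (auto intro!: derivative_intros)
  moreover have "{x. \<not> P (- x)} \<subseteq> uminus ` {x. \<not> P x}" by force
  ultimately show ?thesis unfolding AE_lebesgue_iff_negligible using negligible_subset by blast
qed

lemma L1_loc_reflect: "L1_loc f \<Longrightarrow> L1_loc (\<lambda>x. f (- x))"
  unfolding L1_loc_def
proof (intro allI)
  fix a b :: real assume "\<forall>a b. f absolutely_integrable_on {a..b}"
  then have "f absolutely_integrable_on {- b..- a}" by blast
  then show "(\<lambda>x. f (- x)) absolutely_integrable_on {a..b}"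
    using absolutely_integrable_reflect_real[where f = f and a = "- b" and b = "- a"] by simp
qed

lemma L1_loc_reflect_pot: "L1_loc \<phi> \<Longrightarrow> L1_loc (reflect_pot \<phi>)"
  unfolding reflect_pot_def
  by (rule L1_loc_bounded_linear[OF bounded_linear_minus[OF bounded_linear_ident] L1_loc_reflect])

lemma hermitian_reflect_pot:
  fixes \<phi> :: "real \<Rightarrow> complex^'m^'m"
  assumes "AE x in lebesgue. \<phi> x = adjoint_matrix (\<phi> x)"
  shows "AE x in lebesgue. reflect_pot \<phi> x = adjoint_matrix (reflect_pot \<phi> x)"
proof -
  have "adjoint_matrix (- M) = - adjoint_matrix M" for M :: "complex^'m^'m"
    by (simp add: adjoint_matrix_def transpose_def map_matrix_def vec_eq_iff)
  then show ?thesis using AE_reflect[OF assms] unfolding reflect_pot_def by (auto elim: eventually_mono)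
qed

text \<open>Checked in integrated form, where the reflection is a change of variable in the
  integral.\<close>

lemma dirac_solution_reflect:
  assumes L1: "L1_loc \<phi>" and V: "dirac_solution \<phi> \<zeta> V"
  shows "dirac_solution (reflect_pot \<phi>) \<zeta> (\<lambda>x. flip_lower (V (- x)))"
  unfolding dirac_solution_iff
proof (rule linear_ode_solution_of_integral[OF L1_loc_dirac_matrix[OF L1_loc_reflect_pot[OF L1]]])
  let ?B = "\<lambda>\<phi> x. dirac_coeff \<phi> x + smult_matrix \<zeta> dirac_twist"
  have sol: "linear_ode_solution (?B \<phi>) V" using V unfolding dirac_solution_iff .
  have cV: "continuous_on UNIV V" by (rule linear_ode_solution_continuous[OF sol])
  show "continuous_on UNIV (\<lambda>x. flip_lower (V (- x)))"
    by (intro bounded_linear.continuous_on[OF bounded_linear_flip_lower] continuous_on_compose2[OF cV] continuous_intros) simp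
  have eq: "?B (reflect_pot \<phi>) x *v flip_lower w = - flip_lower (?B \<phi> (- x) *v w)" for x w
  proof -
    have neg: "M *v (- u) = - (M *v u)" for M :: "complex^'a^'a" and u
      by (simp add: matrix_vector_mult_def vec_eq_iff sum_negf)
    show ?thesis
      by (rule vec_sum_eqI) (simp_all add: matrix_vector_mult_add_rdistrib smult_matrix_vector_mult
        upper_lower_block matrix_minus_vector_mult reflect_pot_def neg vec_eq_iff)
  qed
  fix x y :: real assume xy: "x \<le> y"
  have "((\<lambda>t. ?B \<phi> t *v V t) has_integral V (- x) - V (- y)) {- y..- x}"
    using sol unfolding linear_ode_solution_def
    by (intro ac_deriv_has_integral[of "- y" "- x"]) (use xy in auto)
  then have "((\<lambda>t. ?B \<phi> (- t) *v V (- t)) has_integral V (- x) - V (- y)) {x..y}"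
    using has_integral_reflect_real[where f = "\<lambda>t. ?B \<phi> t *v V t" and a = "- y" and b = "- x"] by simp
  from has_integral_neg[OF has_integral_linear[OF this bounded_linear_flip_lower]]
  show "((\<lambda>t. ?B (reflect_pot \<phi>) t *v flip_lower (V (- t))) has_integral flip_lower (V (- y)) - flip_lower (V (- x))) {x..y}"
    unfolding eq by (simp add: o_def linear_diff[OF bounded_linear.linear[OF bounded_linear_flip_lower]])
qed

lemma L2_solutions_reflect:
  assumes L1: "L1_loc \<phi>"
  shows "V \<in> L2_solutions \<phi> \<zeta> {..c} \<longleftrightarrow> (\<lambda>x. flip_lower (V (- x))) \<in> L2_solutions (reflect_pot \<phi>) \<zeta> {- c..}"
proof -
  have "dirac_solution \<phi> \<zeta> V \<longleftrightarrow> dirac_solution (reflect_pot \<phi>) \<zeta> (\<lambda>x. flip_lower (V (- x)))"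
    using dirac_solution_reflect[OF L1, of \<zeta> V]
      dirac_solution_reflect[OF L1_loc_reflect_pot[OF L1], of \<zeta> "\<lambda>x. flip_lower (V (- x))"] by auto
  moreover have "(\<lambda>x. (norm (V x))\<^sup>2) absolutely_integrable_on {..c} \<longleftrightarrow>
      (\<lambda>x. (norm (flip_lower (V (- x))))\<^sup>2) absolutely_integrable_on {- c..}"
  proof -
    have "uminus ` {- c..} \<subseteq> {..c}" "uminus ` {..c} \<subseteq> {- c..}" "{- c..} \<in> sets lebesgue" by auto
    from has_absolute_integral_reflect_real[OF this, where f = "\<lambda>x. (norm (V x))\<^sup>2"] show ?thesis by auto
  qed
  ultimately show ?thesis by (simp add: L2_solutions_def)
qed

lemma dirac_flow_reflect:
  assumes "L1_loc \<phi>"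
  shows "flip_lower (dirac_flow \<phi> \<zeta> c v (- x)) = dirac_flow (reflect_pot \<phi>) \<zeta> (- c) (flip_lower v) x"
  using fun_cong[OF dirac_solution_eq_flow[OF L1_loc_reflect_pot[OF assms]
    dirac_solution_reflect[OF assms dirac_flow_solution[OF assms]], where c = "- c"]] assms by simp

text \<open>Reflection maps the solutions square integrable to the left of \<open>c\<close> onto
  those square integrable to the right of -c, and the sign change of V2 turns the graph of a matrix
  into the graph of its negative. Existence and uniqueness on the left follow from those on the
  right.\<close>

lemma weyl_dirac_left:
  fixes \<phi> :: "real \<Rightarrow> complex^'m^'m::finite"
  assumes L1: "L1_loc \<phi>" and herm: "AE x in lebesgue. \<phi> x = adjoint_matrix (\<phi> x)" and Im: "Im \<zeta> > 0"
  shows "weyl_dirac \<phi> \<zeta> c {..c} = - weyl_dirac (reflect_pot \<phi>) \<zeta> (- c) {- c..}"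
proof -
  let ?\<psi> = "reflect_pot \<phi>"
  let ?R = "\<lambda>V x. flip_lower (V (- x))"
  have RR: "?R (?R V) = V" for V :: "real \<Rightarrow> complex^('m + 'm)" by simp
  have L2: "L2_solutions \<phi> \<zeta> {..c} = ?R ` L2_solutions ?\<psi> \<zeta> {- c..}"
  proof (intro set_eqI iffI)
    fix V assume "V \<in> L2_solutions \<phi> \<zeta> {..c}"
    then show "V \<in> ?R ` L2_solutions ?\<psi> \<zeta> {- c..}"
      using L2_solutions_reflect[OF L1, of V \<zeta> c] by (intro image_eqI[of _ _ "?R V"]) auto
  next
    fix V assume "V \<in> ?R ` L2_solutions ?\<psi> \<zeta> {- c..}"
    then show "V \<in> L2_solutions \<phi> \<zeta> {..c}" using L2_solutions_reflect[OF L1, of V \<zeta> c] by auto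
  qed
  have rng: "range (\<lambda>u. dirac_flow \<phi> \<zeta> c (join u (N *v u))) = ?R ` range (\<lambda>u. dirac_flow ?\<psi> \<zeta> (- c) (join u ((- N) *v u)))" for N
  proof -
    have fl: "flip_lower (join u w) = join u (- w)" for u w :: "complex^'m" by (simp add: flip_lower_def)
    have "dirac_flow \<phi> \<zeta> c (join u (N *v u)) = ?R (dirac_flow ?\<psi> \<zeta> (- c) (join u ((- N) *v u)))" for u
      by (rule ext) (simp add: dirac_flow_reflect[OF L1_loc_reflect_pot[OF L1]] fl matrix_minus_vector_mult)
    then show ?thesis by (auto simp: image_image)
  qed
  have inj: "?R ` A = ?R ` B \<longleftrightarrow> A = B" for A B :: "(real \<Rightarrow> complex^('m + 'm)) set"
    by (rule inj_image_eq_iff, rule inj_on_inverseI[where g = ?R]) (rule RR)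
  have iff: "range (\<lambda>u. dirac_flow \<phi> \<zeta> c (join u (N *v u))) = L2_solutions \<phi> \<zeta> {..c}
     \<longleftrightarrow> range (\<lambda>u. dirac_flow ?\<psi> \<zeta> (- c) (join u ((- N) *v u))) = L2_solutions ?\<psi> \<zeta> {- c..}" for N
    unfolding L2 rng inj ..
  let ?M = "weyl_dirac ?\<psi> \<zeta> (- c) {- c..}"
  note hyps = L1_loc_reflect_pot[OF L1] hermitian_reflect_pot[OF herm] Im
  have M: "range (\<lambda>u. dirac_flow ?\<psi> \<zeta> (- c) (join u (?M *v u))) = L2_solutions ?\<psi> \<zeta> {- c..}"
    using weyl_dirac_range[OF hyps, of "- c"] L2_solutions_eq_weyl_space[OF hyps, of "- c"] by simp
  show ?thesis
    unfolding weyl_dirac_def[of \<phi>] weyl_columns[OF L1]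
  proof (rule the_equality)
    show "range (\<lambda>u. dirac_flow \<phi> \<zeta> c (join u ((- ?M) *v u))) = L2_solutions \<phi> \<zeta> {..c}"
      unfolding iff using M by simp
    fix N assume "range (\<lambda>u. dirac_flow \<phi> \<zeta> c (join u (N *v u))) = L2_solutions \<phi> \<zeta> {..c}"
    then have N: "range (\<lambda>u. dirac_flow ?\<psi> \<zeta> (- c) (join u ((- N) *v u))) = L2_solutions ?\<psi> \<zeta> {- c..}" unfolding iff .
    have "- N = ?M"
    proof (rule matrix_eqI_vector)
      fix u
      have "dirac_flow ?\<psi> \<zeta> (- c) (join u ((- N) *v u)) \<in> weyl_space ?\<psi> \<zeta>"
        using N L2_solutions_eq_weyl_space[OF hyps] by blast
      from weyl_space_graph[OF hyps this, of "- c"] show "(- N) *v u = ?M *v u" by (simp add: hyps(1))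
    qed
    then show "N = - ?M" by (metis minus_minus)
  qed
qed

text \<open>Reflection exchanges \<open>p\<close> and \<open>q\<close>, so left Weyl solutions have
  nonnegative energy everywhere.\<close>

lemma weyl_left_flow:
  assumes L1: "L1_loc \<phi>" and herm: "AE x in lebesgue. \<phi> x = adjoint_matrix (\<phi> x)" and Im: "Im \<zeta> > 0"
  shows "norm (neg_part (dirac_flow \<phi> \<zeta> c (join u (weyl_dirac \<phi> \<zeta> c {..c} *v u)) x))
    \<le> norm (pos_part (dirac_flow \<phi> \<zeta> c (join u (weyl_dirac \<phi> \<zeta> c {..c} *v u)) x))"
proof -
  let ?M = "weyl_dirac \<phi> \<zeta> c {..c}"
  note hyps = L1_loc_reflect_pot[OF L1] hermitian_reflect_pot[OF herm] Im
  have fl: "flip_lower (join u w) = join u (- w)" for u w :: "complex^'a" by (simp add: flip_lower_def)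
  have eq: "flip_lower (dirac_flow \<phi> \<zeta> c (join u (?M *v u)) x)
    = dirac_flow (reflect_pot \<phi>) \<zeta> (- c) (join u (weyl_dirac (reflect_pot \<phi>) \<zeta> (- c) {- c..} *v u)) (- x)"
    using dirac_flow_reflect[OF L1, of c "join u (?M *v u)" \<zeta> "- x"]
    by (simp add: fl weyl_dirac_left[OF assms] matrix_minus_vector_mult)
  show ?thesis
    using weyl_spaceD(2)[OF weyl_flow_in_space[OF hyps, of "- c" u], of "- x", folded eq]
    by (simp only: flip_lower_simps)
qed

section \<open>High-energy asymptotics\<close>

lemma dirac_solution_growth:
  assumes L1: "L1_loc \<phi>" and V: "dirac_solution \<phi> \<zeta> V" and xy: "x \<le> y"
  shows "norm (V y) \<le> norm (V x) * exp (\<bar>Im \<zeta>\<bar> * (y - x) + mass \<phi> x y)"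
    and "norm (V x) \<le> norm (V y) * exp (\<bar>Im \<zeta>\<bar> * (y - x) + mass \<phi> x y)"
proof -
  have sq: "u \<le> v * exp t" if "2 * u\<^sup>2 \<le> 2 * v\<^sup>2 * exp (2 * t)" "0 \<le> v" for u v t :: real
    using that by (intro power2_le_imp_le[of u "v * exp t"]) (simp_all add: power_mult_distrib flip: exp_double)
  note g = diag_solution_growth[OF L1 xy diag_solution_of_dirac[OF V]]
  show "norm (V y) \<le> norm (V x) * exp (\<bar>Im \<zeta>\<bar> * (y - x) + mass \<phi> x y)"
    by (rule sq[OF g(1)[unfolded norm_pos_neg_part] norm_ge_zero])
  show "norm (V x) \<le> norm (V y) * exp (\<bar>Im \<zeta>\<bar> * (y - x) + mass \<phi> x y)"
    by (rule sq[OF g(2)[unfolded norm_pos_neg_part] norm_ge_zero])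
qed

lemma norm_le_neg_part: "norm (pos_part v) \<le> norm (neg_part v) \<Longrightarrow> norm v \<le> norm (neg_part v)"
  and norm_le_pos_part: "norm (neg_part v) \<le> norm (pos_part v) \<Longrightarrow> norm v \<le> norm (pos_part v)"
  and norm_pos_part_le: "norm (pos_part v) \<le> 2 * norm v"
  and norm_neg_part_le: "norm (neg_part v) \<le> 2 * norm v"
proof -
  note e = norm_pos_neg_part[of v]
  show "norm v \<le> norm (neg_part v)" if "norm (pos_part v) \<le> norm (neg_part v)"
  proof (rule power2_le_imp_le)
    show "(norm v)\<^sup>2 \<le> (norm (neg_part v))\<^sup>2" using power_mono[OF that norm_ge_zero, of 2] e by linarith
  qed simp
  show "norm v \<le> norm (pos_part v)" if "norm (neg_part v) \<le> norm (pos_part v)"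
  proof (rule power2_le_imp_le)
    show "(norm v)\<^sup>2 \<le> (norm (pos_part v))\<^sup>2" using power_mono[OF that norm_ge_zero, of 2] e by linarith
  qed simp
  have *: "(norm (pos_part v))\<^sup>2 \<le> (2 * norm v)\<^sup>2" "(norm (neg_part v))\<^sup>2 \<le> (2 * norm v)\<^sup>2"
  proof -
    have "(2 * norm v)\<^sup>2 = 4 * (norm v)\<^sup>2" by (simp add: power_mult_distrib)
    then show "(norm (pos_part v))\<^sup>2 \<le> (2 * norm v)\<^sup>2" "(norm (neg_part v))\<^sup>2 \<le> (2 * norm v)\<^sup>2"
      using e zero_le_power2[of "norm (pos_part v)"] zero_le_power2[of "norm (neg_part v)"] zero_le_power2[of "norm v"]
      by linarith+
  qed
  show "norm (pos_part v) \<le> 2 * norm v" "norm (neg_part v) \<le> 2 * norm v"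
    using power2_le_imp_le[OF *(1)] power2_le_imp_le[OF *(2)] by simp_all
qed

lemma weyl_space_decay:
  assumes L1: "L1_loc \<phi>" and V: "V \<in> weyl_space \<phi> \<zeta>" and xy: "x \<le> y"
  shows "norm (V y) \<le> 2 * norm (V x) * exp (mass \<phi> x y - Im \<zeta> * (y - x))"
proof -
  have "norm (V y) \<le> norm (neg_part (V y))" by (rule norm_le_neg_part[OF weyl_spaceD(2)[OF V]])
  also have "\<dots> \<le> norm (neg_part (V x)) * exp (mass \<phi> x y - Im \<zeta> * (y - x))"
    by (rule diag_solution_decay[OF L1 xy diag_solution_of_dirac[OF weyl_spaceD(1)[OF V]] weyl_spaceD(2)[OF V]])
  also have "\<dots> \<le> 2 * norm (V x) * exp (mass \<phi> x y - Im \<zeta> * (y - x))"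
    by (intro mult_right_mono norm_neg_part_le) simp
  finally show ?thesis .
qed

lemma left_weyl_decay:
  assumes L1: "L1_loc \<phi>" and V: "dirac_solution \<phi> \<zeta> V" "\<And>x. norm (neg_part (V x)) \<le> norm (pos_part (V x))" and xy: "x \<le> y"
  shows "norm (V x) \<le> 2 * norm (V y) * exp (mass \<phi> x y - Im \<zeta> * (y - x))"
proof -
  have "norm (V x) \<le> norm (pos_part (V x))" by (rule norm_le_pos_part[OF V(2)])
  also have "\<dots> = norm (pos_part (V x)) * exp (Im \<zeta> * (y - x) - mass \<phi> x y) * exp (mass \<phi> x y - Im \<zeta> * (y - x))"
    by (simp add: mult.assoc flip: exp_add)
  also have "\<dots> \<le> norm (pos_part (V y)) * exp (mass \<phi> x y - Im \<zeta> * (y - x))"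
    by (intro mult_right_mono diag_solution_increase[OF L1 xy diag_solution_of_dirac[OF V(1)] V(2)]) simp
  also have "\<dots> \<le> 2 * norm (V y) * exp (mass \<phi> x y - Im \<zeta> * (y - x))"
    by (intro mult_right_mono norm_pos_part_le) simp
  finally show ?thesis .
qed

section \<open>Limits of the Weyl matrices for large imaginary part\<close>

lemma mass_small:
  fixes \<phi> :: "real \<Rightarrow> 'b::euclidean_space"
  assumes L1: "L1_loc \<phi>" and e: "e > 0"
  obtains d where "c < d" "mass \<phi> c d < e"
proof -
  have "isCont (primitive c (\<lambda>x. norm (\<phi> x))) c"
    using continuous_on_primitive[OF L1_loc_norm[OF L1]] by (simp add: continuous_on_eq_continuous_at)
  then obtain s where s: "s > 0" "\<forall>x. \<bar>x - c\<bar> < s \<longrightarrow> \<bar>primitive c (\<lambda>x. norm (\<phi> x)) x - primitive c (\<lambda>x. norm (\<phi> x)) c\<bar> < e"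
    using e unfolding continuous_at_eps_delta dist_real_def by blast
  have "mass \<phi> c (c + s / 2) < e"
    using s(2)[rule_format, of "c + s/2"] s(1) primitive_eq_mass[of c "c + s/2" \<phi>] by (simp add: abs_less_iff)
  then show ?thesis using s(1) that[of "c + s/2"] by simp
qed

text \<open>The order of choices matters: \<open>d\<close> is taken so close to \<open>c\<close>
  that the mass of \<phi> on [c,d] is small, and only then is Im \<zeta> made large enough for
  exp(-Im \<zeta> (d - c)) to be small.\<close>

lemma weyl_space_pos_part_small:
  fixes \<phi> :: "real \<Rightarrow> complex^'m^'m::finite"
  assumes L1: "L1_loc \<phi>" and e: "e > 0"
  obtains R where "R > 0" "\<And>\<zeta> V. R \<le> Im \<zeta> \<Longrightarrow> V \<in> weyl_space \<phi> \<zeta> \<Longrightarrow> norm (pos_part (V c)) \<le> e * norm (neg_part (V c))"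
proof -
  obtain d where d: "c < d" "mass \<phi> c d < min 1 (e / 6)" using mass_small[OF L1, of "min 1 (e / 6)"] e by auto
  \<comment> \<open>Beyond this value exp(-Im \<zeta> (d - c)) \<le> e/6. With the mass also below
    e/6 and exp(mass) \<le> 3, the factor in front of |q(c)| is at most e.\<close>
  define R where "R = max 1 (ln (6 / e) / (d - c))"
  show ?thesis
  proof (rule that[of R])
    show "R > 0" by (simp add: R_def)
    fix \<zeta> V assume R: "R \<le> Im \<zeta>" and V: "V \<in> weyl_space \<phi> \<zeta>"
    let ?m = "mass \<phi> c d"
    have "ln (6 / e) / (d - c) \<le> Im \<zeta>" "0 \<le> Im \<zeta>" using R unfolding R_def by auto
    then have "ln (6 / e) \<le> Im \<zeta> * (d - c)" using d(1) by (simp add: pos_divide_le_eq)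
    then have "exp (- Im \<zeta> * (d - c)) \<le> exp (- ln (6 / e))" by simp
    also have "\<dots> = e / 6" using e by (simp add: exp_minus)
    finally have E: "exp (- Im \<zeta> * (d - c)) + ?m \<le> e / 3" using d(2) by simp
    have m: "exp ?m \<le> 3"
      using d(2) exp_le by (smt (verit) exp_le_cancel_iff min_less_iff_conj)
    have "norm (pos_part (V c)) \<le> norm (neg_part (V c)) * exp ?m * (exp (- Im \<zeta> * (d - c)) + ?m)"
      by (rule diag_solution_pos_small[OF L1 less_imp_le[OF d(1)] diag_solution_of_dirac[OF weyl_spaceD(1)[OF V]]
            weyl_spaceD(2)[OF V] \<open>0 \<le> Im \<zeta>\<close>])
    also have "\<dots> \<le> norm (neg_part (V c)) * 3 * (e / 3)"
      using m E mass_nonneg[OF L1, of c d] by (intro mult_mono mult_left_mono) (auto intro!: add_nonneg_nonneg mult_nonneg_nonneg)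
    finally show "norm (pos_part (V c)) \<le> e * norm (neg_part (V c))" by (simp add: mult.commute)
  qed
qed

text \<open>For Weyl data (u, w) one has w - iu = -ip and q = 2u - p, so smallness of
  \<open>p\<close> against \<open>q\<close> is closeness of the Weyl matrix to i.\<close>

lemma weyl_dirac_near_i:
  fixes \<phi> :: "real \<Rightarrow> complex^'m^'m::finite"
  assumes L1: "L1_loc \<phi>" and herm: "AE x in lebesgue. \<phi> x = adjoint_matrix (\<phi> x)" and e: "e > 0"
  obtains R where "R > 0" "\<And>\<zeta> u. R \<le> Im \<zeta> \<Longrightarrow> norm (weyl_dirac \<phi> \<zeta> c {c..} *v u - \<i> *s u) \<le> e * norm u"
proof -
  \<comment> \<open>With \<delta> \<le> 1/2 the term \<delta> |p| is absorbed on the left, which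
    doubles the constant 2 \<delta>; hence the requirement 4 \<delta> \<le> e.\<close>
  define \<delta> where "\<delta> = min (1/2) (e / 4)"
  have \<delta>: "\<delta> > 0" "\<delta> \<le> 1/2" "4 * \<delta> \<le> e" using e by (auto simp: \<delta>_def)
  obtain R where R: "R > 0" "\<And>\<zeta> V. R \<le> Im \<zeta> \<Longrightarrow> V \<in> weyl_space \<phi> \<zeta> \<Longrightarrow> norm (pos_part (V c)) \<le> \<delta> * norm (neg_part (V c))"
    using weyl_space_pos_part_small[OF L1 \<delta>(1)] by metis
  show ?thesis
  proof (rule that[OF R(1)])
    fix \<zeta> u assume z: "R \<le> Im \<zeta>"
    let ?w = "weyl_dirac \<phi> \<zeta> c {c..} *v u"
    define v where "v = join u ?w"
    have "Im \<zeta> > 0" using z R(1) by linarith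
    from R(2)[OF z weyl_flow_in_space[OF L1 herm this, of c u]] have le: "norm (pos_part v) \<le> \<delta> * norm (neg_part v)"
      using L1 by (simp add: v_def)
    have p: "?w - \<i> *s u = (- \<i>) *s pos_part v"
      unfolding pos_part_def v_def by (simp add: vec_eq_iff algebra_simps)
    have "neg_part v = 2 *s u - pos_part v"
      unfolding neg_part_def pos_part_def v_def by (simp add: vec_eq_iff algebra_simps)
    then have "norm (neg_part v) \<le> 2 * norm u + norm (pos_part v)"
      using norm_triangle_ineq4[of "2 *s u" "pos_part v"] by (simp add: norm_scalar_mult_vec)
    then have "norm (pos_part v) \<le> \<delta> * (2 * norm u + norm (pos_part v))"
      using le \<delta>(1) by (meson less_imp_le mult_left_mono order_trans)
    also have "\<dots> \<le> 2 * \<delta> * norm u + 1/2 * norm (pos_part v)"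
      using mult_right_mono[OF \<delta>(2) norm_ge_zero[of "pos_part v"]] by (simp add: algebra_simps)
    finally have "norm (pos_part v) \<le> 4 * \<delta> * norm u" by simp
    also have "\<dots> \<le> e * norm u" using \<delta>(3) by (intro mult_right_mono) auto
    finally show "norm (?w - \<i> *s u) \<le> e * norm u" unfolding p by (simp add: norm_scalar_mult_vec)
  qed
qed

lemma left_weyl_dirac_near_i:
  fixes \<phi> :: "real \<Rightarrow> complex^'m^'m::finite"
  assumes L1: "L1_loc \<phi>" and herm: "AE x in lebesgue. \<phi> x = adjoint_matrix (\<phi> x)" and e: "e > 0"
  obtains R where "R > 0" "\<And>\<zeta> u. R \<le> Im \<zeta> \<Longrightarrow> norm (weyl_dirac \<phi> \<zeta> c {..c} *v u + \<i> *s u) \<le> e * norm u"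
proof -
  obtain R where R: "R > 0" "\<And>\<zeta> u. R \<le> Im \<zeta> \<Longrightarrow> norm (weyl_dirac (reflect_pot \<phi>) \<zeta> (- c) {- c..} *v u - \<i> *s u) \<le> e * norm u"
    using weyl_dirac_near_i[OF L1_loc_reflect_pot[OF L1] hermitian_reflect_pot[OF herm] e] by metis
  show ?thesis
  proof (rule that[OF R(1)])
    fix \<zeta> u assume z: "R \<le> Im \<zeta>"
    then have "Im \<zeta> > 0" using R(1) by linarith
    then show "norm (weyl_dirac \<phi> \<zeta> c {..c} *v u + \<i> *s u) \<le> e * norm u"
      using R(2)[OF z, of u] by (simp add: weyl_dirac_left[OF L1 herm] matrix_minus_vector_mult norm_minus_commute)
  qed
qed

section \<open>Locality of the Weyl matrices\<close>

lemma diag_solution_cong_AE: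
  assumes "diag_solution \<phi> \<zeta> a b p q" "AE x in lebesgue. x \<in> {a..b} \<longrightarrow> \<phi> x = \<psi> x"
  shows "diag_solution \<psi> \<zeta> a b p q"
proof -
  have p: "ac_deriv a b p (\<lambda>x. - (\<i> * \<zeta>) *s p x - \<phi> x *v q x)" and q: "ac_deriv a b q (\<lambda>x. (\<i> * \<zeta>) *s q x - \<phi> x *v p x)"
    using assms(1) unfolding diag_solution_def by auto
  show ?thesis unfolding diag_solution_def
    using assms(2) by (auto intro!: ac_deriv_cong_AE[OF p] ac_deriv_cong_AE[OF q] elim!: eventually_mono)
qed

lemma diag_solution_diff:
  assumes "diag_solution \<phi> \<zeta> a b p q" "diag_solution \<phi> \<zeta> a b p' q'"
  shows "diag_solution \<phi> \<zeta> a b (\<lambda>x. p x - p' x) (\<lambda>x. q x - q' x)"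
proof -
  note d = assms[unfolded diag_solution_def]
  show ?thesis
    using ac_deriv_diff[OF conjunct1[OF d(1)] conjunct1[OF d(2)]] ac_deriv_diff[OF conjunct2[OF d(1)] conjunct2[OF d(2)]]
    unfolding diag_solution_def by (simp add: matrix_vector_mult_diff_distrib vector_ssub_ldistrib algebra_simps)
qed

text \<open>Both Weyl solutions with the same first component are exponentially small at \<open>c + a\<close>, whereas their
  difference solves the common system on \<open>[c, c + a]\<close> and starts in the cone of growing solutions.\<close>

lemma weyl_dirac_local:
  fixes \<phi>\<^sub>1 \<phi>\<^sub>2 :: "real \<Rightarrow> complex^'m^'m::finite"
  assumes L: "L1_loc \<phi>\<^sub>1" "L1_loc \<phi>\<^sub>2"
    and herm: "AE x in lebesgue. \<phi>\<^sub>1 x = adjoint_matrix (\<phi>\<^sub>1 x)" "AE x in lebesgue. \<phi>\<^sub>2 x = adjoint_matrix (\<phi>\<^sub>2 x)"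
    and a: "a > 0" and eq: "AE x in lebesgue. x \<in> {c<..<c + a} \<longrightarrow> \<phi>\<^sub>1 x = \<phi>\<^sub>2 x"
  obtains K R where "R > 0" "\<And>\<zeta> u. R \<le> Im \<zeta> \<Longrightarrow>
    norm (weyl_dirac \<phi>\<^sub>1 \<zeta> c {c..} *v u - weyl_dirac \<phi>\<^sub>2 \<zeta> c {c..} *v u) \<le> K * exp (- 2 * Im \<zeta> * a) * norm u"
proof -
  obtain R1 where R1: "R1 > 0" "\<And>\<zeta> u. R1 \<le> Im \<zeta> \<Longrightarrow> norm (weyl_dirac \<phi>\<^sub>1 \<zeta> c {c..} *v u - \<i> *s u) \<le> 1 * norm u"
    using weyl_dirac_near_i[OF L(1) herm(1) zero_less_one] by metis
  obtain R2 where R2: "R2 > 0" "\<And>\<zeta> u. R2 \<le> Im \<zeta> \<Longrightarrow> norm (weyl_dirac \<phi>\<^sub>2 \<zeta> c {c..} *v u - \<i> *s u) \<le> 1 * norm u"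
    using weyl_dirac_near_i[OF L(2) herm(2) zero_less_one] by metis
  let ?m1 = "mass \<phi>\<^sub>1 c (c + a)" and ?m2 = "mass \<phi>\<^sub>2 c (c + a)"
  have m0: "?m1 \<ge> 0" "?m2 \<ge> 0" using mass_nonneg L by auto
  have eq': "AE x in lebesgue. x \<in> {c..c + a} \<longrightarrow> \<phi>\<^sub>2 x = \<phi>\<^sub>1 x"
  proof -
    have "{x. \<not> x \<notin> {c, c + a}} = {c, c + a}" by blast
    then have "AE x in lebesgue. x \<notin> {c, c + a}" unfolding AE_lebesgue_iff_negligible by simp
    then show ?thesis using eq by eventually_elim auto
  qed
  have herm1: "AE x in lebesgue. x \<in> S \<longrightarrow> \<phi>\<^sub>1 x = adjoint_matrix (\<phi>\<^sub>1 x)" for S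
    using herm(1) by (auto elim: eventually_mono)
  show ?thesis
  proof (rule that[of "max R1 R2" "6 * exp (2 * ?m1 + ?m2)"])
    show "max R1 R2 > 0" using R1 by simp
    fix \<zeta> u assume z: "max R1 R2 \<le> Im \<zeta>"
    then have z1: "R1 \<le> Im \<zeta>" and z2: "R2 \<le> Im \<zeta>" and Im: "Im \<zeta> > 0" using R1(1) by auto
    let ?w1 = "weyl_dirac \<phi>\<^sub>1 \<zeta> c {c..} *v u" and ?w2 = "weyl_dirac \<phi>\<^sub>2 \<zeta> c {c..} *v u"
    let ?V1 = "dirac_flow \<phi>\<^sub>1 \<zeta> c (join u ?w1)" and ?V2 = "dirac_flow \<phi>\<^sub>2 \<zeta> c (join u ?w2)"
    have V1: "?V1 \<in> weyl_space \<phi>\<^sub>1 \<zeta>" and V2: "?V2 \<in> weyl_space \<phi>\<^sub>2 \<zeta>"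
      using weyl_flow_in_space[OF L(1) herm(1) Im] weyl_flow_in_space[OF L(2) herm(2) Im] by blast+
    let ?p = "\<lambda>x. pos_part (?V1 x) - pos_part (?V2 x)" and ?q = "\<lambda>x. neg_part (?V1 x) - neg_part (?V2 x)"
    have sol: "diag_solution \<phi>\<^sub>1 \<zeta> c (c + a) ?p ?q"
      by (rule diag_solution_diff[OF diag_solution_of_dirac[OF weyl_spaceD(1)[OF V1]]
            diag_solution_cong_AE[OF diag_solution_of_dirac[OF weyl_spaceD(1)[OF V2]] eq']])
    \<comment> \<open>The first components agree at \<open>c\<close>, so the difference starts from
      (0, w1 - w2), where |p| = |q| and the energy is zero.\<close>
    have base: "?p c = \<i> *s (?w1 - ?w2)" "?q c = (- \<i>) *s (?w1 - ?w2)"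
      using L by (simp_all add: pos_part_def neg_part_def vec_eq_iff algebra_simps)
    have nbase: "norm (?p c) = norm (?w1 - ?w2)" "norm (?q c) = norm (?w1 - ?w2)"
      unfolding base norm_scalar_mult_vec by simp_all
    have cone: "norm (?q x) \<le> norm (?p x)" if x: "x \<in> {c..c + a}" for x
    proof -
      have cx: "c \<le> x" and xa: "x \<le> c + a" using x by auto
      have sx: "diag_solution \<phi>\<^sub>1 \<zeta> c x ?p ?q" by (rule diag_solution_subinterval[OF sol order_refl xa])
      have "0 \<le> ((norm (?p x))\<^sup>2 - (norm (?q x))\<^sup>2) - ((norm (?p c))\<^sup>2 - (norm (?q c))\<^sup>2)"
        by (rule has_integral_nonneg[OF diag_solution_energy[OF L(1) cx sx herm1]]) (use Im in simp)
      then have "(norm (?q x))\<^sup>2 \<le> (norm (?p x))\<^sup>2" unfolding nbase by simp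
      then show ?thesis by (rule power2_le_imp_le) simp
    qed
    have "norm (?w1 - ?w2) * exp (Im \<zeta> * (c + a - c) - ?m1) \<le> norm (?p (c + a))"
      using diag_solution_increase[OF L(1) _ sol cone] a unfolding nbase by simp
    also have "\<dots> \<le> norm (neg_part (?V1 (c + a))) + norm (neg_part (?V2 (c + a)))"
      using norm_triangle_ineq4[of "pos_part (?V1 (c + a))" "pos_part (?V2 (c + a))"]
        weyl_spaceD(2)[OF V1, of "c + a"] weyl_spaceD(2)[OF V2, of "c + a"] by linarith
    also have "\<dots> \<le> 3 * norm u * exp (?m1 + ?m2 - Im \<zeta> * a) + 3 * norm u * exp (?m1 + ?m2 - Im \<zeta> * a)"
    proof (rule add_mono)
      have ca: "c \<le> c + a" using a by simp
      have nq: "norm (neg_part (join u w)) \<le> 3 * norm u" if "norm (w - \<i> *s u) \<le> 1 * norm u" for w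
      proof -
        have "neg_part (join u w) = 2 *s u - \<i> *s (w - \<i> *s u)" by (simp add: neg_part_def vec_eq_iff algebra_simps)
        then have "norm (neg_part (join u w)) \<le> norm (2 *s u) + norm (\<i> *s (w - \<i> *s u))"
          by (metis norm_triangle_ineq4)
        then show ?thesis using that unfolding norm_scalar_mult_vec by simp
      qed
      have "norm (neg_part (?V1 (c + a))) \<le> norm (neg_part (?V1 c)) * exp (?m1 - Im \<zeta> * (c + a - c))"
        by (rule diag_solution_decay[OF L(1) ca diag_solution_of_dirac[OF weyl_spaceD(1)[OF V1]] weyl_spaceD(2)[OF V1]])
      also have "\<dots> \<le> 3 * norm u * exp (?m1 + ?m2 - Im \<zeta> * a)"
      proof (rule mult_mono)
        show "norm (neg_part (?V1 c)) \<le> 3 * norm u" using nq[OF R1(2)[OF z1]] unfolding dirac_flow_base[OF L(1)] .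
        show "exp (?m1 - Im \<zeta> * (c + a - c)) \<le> exp (?m1 + ?m2 - Im \<zeta> * a)" using m0 by simp
      qed simp_all
      finally show "norm (neg_part (?V1 (c + a))) \<le> 3 * norm u * exp (?m1 + ?m2 - Im \<zeta> * a)" .
      have "norm (neg_part (?V2 (c + a))) \<le> norm (neg_part (?V2 c)) * exp (?m2 - Im \<zeta> * (c + a - c))"
        by (rule diag_solution_decay[OF L(2) ca diag_solution_of_dirac[OF weyl_spaceD(1)[OF V2]] weyl_spaceD(2)[OF V2]])
      also have "\<dots> \<le> 3 * norm u * exp (?m1 + ?m2 - Im \<zeta> * a)"
      proof (rule mult_mono)
        show "norm (neg_part (?V2 c)) \<le> 3 * norm u" using nq[OF R2(2)[OF z2]] unfolding dirac_flow_base[OF L(2)] .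
        show "exp (?m2 - Im \<zeta> * (c + a - c)) \<le> exp (?m1 + ?m2 - Im \<zeta> * a)" using m0 by simp
      qed simp_all
      finally show "norm (neg_part (?V2 (c + a))) \<le> 3 * norm u * exp (?m1 + ?m2 - Im \<zeta> * a)" .
    qed
    finally have "norm (?w1 - ?w2) * exp (Im \<zeta> * a - ?m1) \<le> 6 * norm u * exp (?m1 + ?m2 - Im \<zeta> * a)" by simp
    \<comment> \<open>Decay of the two Weyl solutions and growth of their difference each contribute
      one factor exp(-Im \<zeta> a).\<close>
    then have "norm (?w1 - ?w2) * exp (Im \<zeta> * a - ?m1) * exp (?m1 - Im \<zeta> * a) \<le> 6 * norm u * exp (?m1 + ?m2 - Im \<zeta> * a) * exp (?m1 - Im \<zeta> * a)"
      by (rule mult_right_mono) simp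
    moreover have "exp (Im \<zeta> * a - ?m1) * exp (?m1 - Im \<zeta> * a) = 1" by (simp flip: exp_add)
    moreover have "exp (?m1 + ?m2 - Im \<zeta> * a) * exp (?m1 - Im \<zeta> * a) = exp (2 * ?m1 + ?m2) * exp (- 2 * Im \<zeta> * a)"
      by (simp add: algebra_simps flip: exp_add)
    ultimately show "norm (?w1 - ?w2) \<le> 6 * exp (2 * ?m1 + ?m2) * exp (- 2 * Im \<zeta> * a) * norm u"
      by (simp only: mult.assoc) (simp only: mult_1_right mult.commute mult.left_commute)
  qed
qed

lemma left_weyl_dirac_local:
  fixes \<phi>\<^sub>1 \<phi>\<^sub>2 :: "real \<Rightarrow> complex^'m^'m::finite"
  assumes L: "L1_loc \<phi>\<^sub>1" "L1_loc \<phi>\<^sub>2"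
    and herm: "AE x in lebesgue. \<phi>\<^sub>1 x = adjoint_matrix (\<phi>\<^sub>1 x)" "AE x in lebesgue. \<phi>\<^sub>2 x = adjoint_matrix (\<phi>\<^sub>2 x)"
    and a: "a > 0" and eq: "AE x in lebesgue. x \<in> {c - a<..<c} \<longrightarrow> \<phi>\<^sub>1 x = \<phi>\<^sub>2 x"
  obtains K R where "R > 0" "\<And>\<zeta> u. R \<le> Im \<zeta> \<Longrightarrow>
    norm (weyl_dirac \<phi>\<^sub>1 \<zeta> c {..c} *v u - weyl_dirac \<phi>\<^sub>2 \<zeta> c {..c} *v u) \<le> K * exp (- 2 * Im \<zeta> * a) * norm u"
proof -
  have "AE x in lebesgue. x \<in> {- c<..<- c + a} \<longrightarrow> reflect_pot \<phi>\<^sub>1 x = reflect_pot \<phi>\<^sub>2 x"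
    using AE_reflect[OF eq] by (auto elim!: eventually_mono simp: reflect_pot_def)
  note local = weyl_dirac_local[OF L[THEN L1_loc_reflect_pot] herm[THEN hermitian_reflect_pot] a this]
  show ?thesis
  proof (rule local)
    fix K R assume R0: "R > (0::real)"
      and R: "\<And>\<zeta> u. R \<le> Im \<zeta> \<Longrightarrow>
        norm (weyl_dirac (reflect_pot \<phi>\<^sub>1) \<zeta> (- c) {- c..} *v u - weyl_dirac (reflect_pot \<phi>\<^sub>2) \<zeta> (- c) {- c..} *v u)
          \<le> K * exp (- 2 * Im \<zeta> * a) * norm u"
    show ?thesis
    proof (rule that[OF R0])
      fix \<zeta> u assume z: "R \<le> Im \<zeta>"
      then have Im: "Im \<zeta> > 0" using R0 by linarith
      have neg: "norm (- v - - w) = norm (v - w)" for v w :: "complex^'m"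
        by (metis minus_diff_minus norm_minus_cancel)
      show "norm (weyl_dirac \<phi>\<^sub>1 \<zeta> c {..c} *v u - weyl_dirac \<phi>\<^sub>2 \<zeta> c {..c} *v u) \<le> K * exp (- 2 * Im \<zeta> * a) * norm u"
        using R[OF z, of u]
        unfolding weyl_dirac_left[OF L(1) herm(1) Im] weyl_dirac_left[OF L(2) herm(2) Im] matrix_minus_vector_mult neg .
    qed
  qed
qed

section \<open>A Phragmen-Lindelof principle\<close>

text \<open>In the coordinate \<open>w = log z\<close> the sector is a strip and the maximum principle is applied on rectangles to
  \<open>f(e\<^bsup>w\<^esup>) exp(-\<epsilon> e\<^bsup>\<rho>w\<^esup>)\<close> with \<open>1 < \<rho> < \<pi>/(2\<alpha>)\<close>.\<close>

lemma phragmen_lindelof_symmetric_sector: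
  fixes f :: "complex \<Rightarrow> complex"
  assumes hol: "f holomorphic_on UNIV" and type: "\<And>z. norm (f z) \<le> B * exp (K * norm z)"
    and \<alpha>: "0 < \<alpha>" "\<alpha> < pi / 2"
    and ray: "\<And>r. 0 \<le> r \<Longrightarrow> norm (f (of_real r * cis \<alpha>)) \<le> M" "\<And>r. 0 \<le> r \<Longrightarrow> norm (f (of_real r * cis (- \<alpha>))) \<le> M"
    and r: "0 \<le> r" and t: "\<bar>t\<bar> \<le> \<alpha>"
  shows "norm (f (of_real r * cis t)) \<le> M"
proof (cases "r = 0")
  case True then show ?thesis using ray(1)[of 0] by simp
next
  case False
  with r have r0: "r > 0" by simp
  have K0: "B * exp (K * norm z) \<ge> 0" for z :: complex using type[of z] norm_ge_zero order_trans by blast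
  have B0: "B \<ge> 0" using K0[of 0] by simp
  \<comment> \<open>The midpoint of the admissible range: \<rho> > 1 beats the exponential type, and
    \<rho> \<alpha> < pi/2 keeps cos(\<rho> s) positive on the closed sector.\<close>
  define \<rho> where "\<rho> = (1 + pi / (2 * \<alpha>)) / 2"
  have q: "1 < pi / (2 * \<alpha>)" using \<alpha> by (simp add: field_simps)
  have \<rho>: "1 < \<rho>" "\<rho> * \<alpha> < pi / 2"
  proof -
    show "1 < \<rho>" using q by (simp add: \<rho>_def)
    have "\<rho> < pi / (2 * \<alpha>)" using q by (simp add: \<rho>_def)
    then show "\<rho> * \<alpha> < pi / 2" using \<alpha> by (simp add: pos_less_divide_eq mult_ac)
  qed
  define \<kappa> where "\<kappa> = cos (\<rho> * \<alpha>)"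
  have "0 \<le> \<rho> * \<alpha>" using \<rho> \<alpha> by simp
  then have \<kappa>: "\<kappa> > 0" unfolding \<kappa>_def using \<rho>(2) by (intro cos_gt_zero_pi) auto
  have cosge: "\<kappa> \<le> cos (\<rho> * s)" if "\<bar>s\<bar> \<le> \<alpha>" for s
  proof -
    have "cos (\<rho> * s) = cos (\<rho> * \<bar>s\<bar>)" by (cases "s \<ge> 0") auto
    moreover have "\<rho> * \<bar>s\<bar> \<le> \<rho> * \<alpha>" using that \<rho>(1) by (intro mult_left_mono) auto
    moreover have "0 \<le> \<rho> * \<bar>s\<bar>" using \<rho>(1) by simp
    ultimately show ?thesis unfolding \<kappa>_def using \<rho>(2) by (simp add: cos_monotone_0_pi_le)
  qed
  have main: "norm (f (of_real r * cis t)) \<le> (M + \<epsilon>) * exp (\<epsilon> * exp (\<rho> * ln r))" if \<epsilon>: "\<epsilon> > 0" for \<epsilon> :: real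
  proof -
    define g where "g = (\<lambda>w. f (exp w) * exp (- of_real \<epsilon> * exp (of_real \<rho> * w)))"
    have M0: "M \<ge> 0" using ray(1)[of 0] norm_ge_zero order_trans by blast
    have ng: "norm (g w) = norm (f (exp w)) * exp (- \<epsilon> * (exp (\<rho> * Re w) * cos (\<rho> * Im w)))" for w
      by (simp add: g_def norm_mult Re_exp)
    have ngle: "norm (g w) \<le> norm (f (exp w)) * exp (- \<epsilon> * (exp (\<rho> * Re w) * \<kappa>))" if "\<bar>Im w\<bar> \<le> \<alpha>" for w
      unfolding ng using cosge[OF that] \<epsilon> by (intro mult_left_mono) auto
    have ngle1: "norm (g w) \<le> norm (f (exp w))" if "\<bar>Im w\<bar> \<le> \<alpha>" for w
    proof -
      have "exp (- \<epsilon> * (exp (\<rho> * Re w) * \<kappa>)) \<le> 1" using \<epsilon> \<kappa> by simp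
      then have "norm (f (exp w)) * exp (- \<epsilon> * (exp (\<rho> * Re w) * \<kappa>)) \<le> norm (f (exp w)) * 1"
        by (intro mult_left_mono) auto
      then show ?thesis using ngle[OF that] by simp
    qed
    have expw: "exp w = of_real (exp (Re w)) * cis (Im w)" for w :: complex
      by (simp add: exp_eq_polar)
    have "continuous_on UNIV f" using hol holomorphic_on_imp_continuous_on by blast
    then have "isCont f 0" by (simp add: continuous_on_eq_continuous_at)
    then obtain d where d: "d > 0" "\<And>z. norm z < d \<Longrightarrow> norm (f z - f 0) < \<epsilon>"
      unfolding continuous_at_eps_delta dist_norm using \<epsilon> by (metis diff_zero)
    \<comment> \<open>The left edge lies so far out that exp w is close to the vertex, where
      \<open>f\<close> differs from f(0) by less than \<epsilon>; the vertex itself belongs to the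
      rays.\<close>
    define L where "L = min (ln r) (ln (d / 2)) - 1"
    have L: "exp L < d" "L < ln r"
    proof -
      have "L < ln (d / 2)" "L < ln r" unfolding L_def by auto
      then show "L < ln r" by simp
      have "exp L < exp (ln (d/2))" using \<open>L < ln (d/2)\<close> by simp
      then show "exp L < d" using d(1) by simp
    qed
    \<comment> \<open>Three demands on the right edge: it lies beyond ln r, the damping \<epsilon>
      \<kappa> exp(\<rho> U) is at least (|K| + 1) exp U, and B exp(-exp U) \<le>
      \<epsilon>.\<close>
    define U where "U = Max {ln r + 1, ln ((\<bar>K\<bar> + 1) / (\<epsilon> * \<kappa>)) / (\<rho> - 1), ln (\<bar>B\<bar> / \<epsilon> + 1)}"
    have U: "ln r < U" "ln ((\<bar>K\<bar> + 1) / (\<epsilon> * \<kappa>)) / (\<rho> - 1) \<le> U" "ln (\<bar>B\<bar> / \<epsilon> + 1) \<le> U"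
      unfolding U_def by (auto simp: less_max_iff_disj le_max_iff_disj)
    have top: "norm (g w) \<le> M + \<epsilon>" if w: "Re w = U" "\<bar>Im w\<bar> \<le> \<alpha>" for w
    proof -
      have "ln ((\<bar>K\<bar> + 1) / (\<epsilon> * \<kappa>)) \<le> (\<rho> - 1) * U" using U(2) \<rho>(1) by (simp add: pos_divide_le_eq mult.commute)
      then have "exp (ln ((\<bar>K\<bar> + 1) / (\<epsilon> * \<kappa>))) \<le> exp ((\<rho> - 1) * U)" by (simp only: exp_le_cancel_iff)
      then have "(\<bar>K\<bar> + 1) / (\<epsilon> * \<kappa>) \<le> exp ((\<rho> - 1) * U)" using \<epsilon> \<kappa> by simp
      then have "\<bar>K\<bar> + 1 \<le> exp ((\<rho> - 1) * U) * (\<epsilon> * \<kappa>)" using \<epsilon> \<kappa> by (simp add: pos_divide_le_eq)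
      then have "exp U * (\<bar>K\<bar> + 1) \<le> exp U * (exp ((\<rho> - 1) * U) * (\<epsilon> * \<kappa>))" by (intro mult_left_mono) auto
      also have "\<dots> = \<epsilon> * (exp (\<rho> * U) * \<kappa>)" by (simp add: algebra_simps flip: exp_add)
      finally have 1: "exp U * \<bar>K\<bar> + exp U \<le> \<epsilon> * (exp (\<rho> * U) * \<kappa>)" by (simp add: algebra_simps)
      have "norm (g w) \<le> norm (f (exp w)) * exp (- \<epsilon> * (exp (\<rho> * U) * \<kappa>))" using ngle[OF w(2)] w(1) by simp
      also have "\<dots> \<le> (B * exp (K * exp U)) * exp (- \<epsilon> * (exp (\<rho> * U) * \<kappa>))"
        using type[of "exp w"] w(1) by (intro mult_right_mono) auto
      also have "\<dots> = B * exp (K * exp U - \<epsilon> * (exp (\<rho> * U) * \<kappa>))" by (simp add: mult.assoc flip: exp_add)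
      also have "\<dots> \<le> B * exp (- exp U)"
      proof -
        have "K * exp U \<le> \<bar>K\<bar> * exp U" by (intro mult_right_mono) auto
        then have "K * exp U - \<epsilon> * (exp (\<rho> * U) * \<kappa>) \<le> - exp U" using 1 unfolding mult.commute[of "exp U" "\<bar>K\<bar>"] by linarith
        then show ?thesis using B0 by (intro mult_left_mono) auto
      qed
      also have "\<dots> \<le> \<epsilon>"
      proof -
        have "\<bar>B\<bar> / \<epsilon> + 1 > 0" using \<epsilon> by (simp add: add_nonneg_pos)
        moreover have "exp (ln (\<bar>B\<bar> / \<epsilon> + 1)) \<le> exp U" using U(3) by (simp only: exp_le_cancel_iff)
        ultimately have "\<bar>B\<bar> / \<epsilon> + 1 \<le> exp U" by (simp only: exp_ln)
        also have "\<dots> \<le> exp (exp U)" using exp_ge_add_one_self[of "exp U"] by linarith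
        finally have "B / \<epsilon> \<le> exp (exp U)" using B0 by simp
        then have "B * exp (- exp U) \<le> exp (exp U) * \<epsilon> * exp (- exp U)"
          using \<epsilon> by (intro mult_right_mono) (simp_all add: pos_divide_le_eq)
        also have "\<dots> = \<epsilon>" by (simp add: exp_minus)
        finally show ?thesis .
      qed
      finally show ?thesis using M0 by simp
    qed
    have bot: "norm (g w) \<le> M + \<epsilon>" if w: "Re w = L" "\<bar>Im w\<bar> \<le> \<alpha>" for w
    proof -
      have "norm (f (exp w) - f 0) < \<epsilon>" using d(2)[of "exp w"] L w(1) by simp
      then have "norm (f (exp w)) \<le> norm (f 0) + \<epsilon>" using norm_triangle_ineq2[of "f (exp w)" "f 0"] by linarith
      then show ?thesis using ngle1[OF w(2)] ray(1)[of 0] by simp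
    qed
    have sides: "norm (g w) \<le> M + \<epsilon>" if w: "\<bar>Im w\<bar> = \<alpha>" for w
    proof -
      have "Im w = \<alpha> \<or> Im w = - \<alpha>" using w by linarith
      then have "norm (f (exp w)) \<le> M" unfolding expw using ray[of "exp (Re w)"] by (elim disjE) simp_all
      then show ?thesis using ngle1[of w] w \<epsilon> by simp
    qed
    define w0 where "w0 = Complex (ln r) t"
    let ?S = "cbox (Complex L (- \<alpha>)) (Complex U \<alpha>)"
    have S: "w \<in> ?S \<longleftrightarrow> L \<le> Re w \<and> Re w \<le> U \<and> \<bar>Im w\<bar> \<le> \<alpha>" for w by (auto simp: in_cbox_complex_iff abs_le_iff)
    have gh: "g holomorphic_on UNIV"
    proof -
      have "(\<lambda>w. f (exp w)) holomorphic_on UNIV"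
        using holomorphic_on_compose[OF holomorphic_on_exp holomorphic_on_subset[OF hol subset_UNIV]] by (simp add: o_def)
      then show ?thesis unfolding g_def by (intro holomorphic_intros)
    qed
    have "norm (g w0) \<le> M + \<epsilon>"
    proof (rule maximum_modulus_frontier[where S = ?S and f = g and \<xi> = w0])
      show "g holomorphic_on interior ?S" by (rule holomorphic_on_subset[OF gh subset_UNIV])
      show "continuous_on (closure ?S) g" by (rule continuous_on_subset[OF holomorphic_on_imp_continuous_on[OF gh] subset_UNIV])
      show "bounded ?S" by simp
      show "w0 \<in> ?S" unfolding S w0_def using t U(1) L(2) by simp
      fix w assume "w \<in> frontier ?S"
      then have "w \<in> ?S" "w \<notin> box (Complex L (- \<alpha>)) (Complex U \<alpha>)" by (auto simp: frontier_cbox)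
      then have "Re w = L \<or> Re w = U \<or> \<bar>Im w\<bar> = \<alpha>" "\<bar>Im w\<bar> \<le> \<alpha>"
        unfolding S by (auto simp: in_box_complex_iff)
      then show "norm (g w) \<le> M + \<epsilon>" using top bot sides by blast
    qed
    have ew: "exp w0 = of_real r * cis t" using r0 by (simp add: expw w0_def)
    have "norm (g w0) = norm (f (of_real r * cis t)) * exp (- \<epsilon> * (exp (\<rho> * ln r) * cos (\<rho> * t)))"
      unfolding ng ew by (simp add: w0_def)
    then have "norm (f (of_real r * cis t)) = norm (g w0) * exp (\<epsilon> * (exp (\<rho> * ln r) * cos (\<rho> * t)))"
      by (simp add: mult.assoc flip: exp_add)
    also have "\<dots> \<le> (M + \<epsilon>) * exp (\<epsilon> * exp (\<rho> * ln r))"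
      using \<open>norm (g w0) \<le> M + \<epsilon>\<close> \<epsilon> M0 by (intro mult_mono) (auto simp: mult_left_le)
    finally show ?thesis .
  qed
  \<comment> \<open>For fixed \<open>r\<close>, letting \<epsilon> tend to 0 removes the auxiliary
    factor.\<close>
  show ?thesis
  proof (rule tendsto_lowerbound)
    have "((\<lambda>\<epsilon>. (M + \<epsilon>) * exp (\<epsilon> * exp (\<rho> * ln r))) \<longlongrightarrow> (M + 0) * exp (0 * exp (\<rho> * ln r))) (at_right 0)"
      by (intro tendsto_intros)
    then show "((\<lambda>\<epsilon>. (M + \<epsilon>) * exp (\<epsilon> * exp (\<rho> * ln r))) \<longlongrightarrow> M) (at_right 0)" by simp
    show "\<forall>\<^sub>F \<epsilon> in at_right 0. norm (f (of_real r * cis t)) \<le> (M + \<epsilon>) * exp (\<epsilon> * exp (\<rho> * ln r))"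
      using eventually_at_right_less[of "0 :: real"] by eventually_elim (rule main)
  qed simp
qed

text \<open>Rotation by the bisecting angle reduces a general sector to the symmetric one.\<close>

lemma phragmen_lindelof_sector:
  fixes f :: "complex \<Rightarrow> complex"
  assumes hol: "f holomorphic_on UNIV" and type: "\<And>z. norm (f z) \<le> B * exp (K * norm z)"
    and s: "s1 < s2" "s2 - s1 < pi"
    and ray: "\<And>r. 0 \<le> r \<Longrightarrow> norm (f (of_real r * cis s1)) \<le> M" "\<And>r. 0 \<le> r \<Longrightarrow> norm (f (of_real r * cis s2)) \<le> M"
    and r: "0 \<le> r" and t: "s1 \<le> t" "t \<le> s2"
  shows "norm (f (of_real r * cis t)) \<le> M"
proof -
  let ?\<gamma> = "(s1 + s2) / 2" and ?\<alpha> = "(s2 - s1) / 2"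
  let ?g = "\<lambda>z. f (z * cis ?\<gamma>)"
  have rot: "of_real x * cis y * cis ?\<gamma> = of_real x * cis (y + ?\<gamma>)" for x y by (simp add: mult.assoc cis_mult)
  have "norm (?g (of_real r * cis (t - ?\<gamma>))) \<le> M"
  proof (rule phragmen_lindelof_symmetric_sector[where \<alpha> = ?\<alpha> and B = B and K = K])
    show "?g holomorphic_on UNIV"
      using holomorphic_on_compose[of "\<lambda>z. z * cis ?\<gamma>" UNIV, OF _ holomorphic_on_subset[OF hol subset_UNIV]]
      by (simp add: o_def holomorphic_intros)
    show "norm (?g z) \<le> B * exp (K * norm z)" for z using type[of "z * cis ?\<gamma>"] by (simp add: norm_mult)
    show "0 < ?\<alpha>" "?\<alpha> < pi / 2" using s by auto
    have e: "?\<alpha> + ?\<gamma> = s2" "- ?\<alpha> + ?\<gamma> = s1" by (simp_all add: field_simps)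
    show "norm (?g (of_real r * cis ?\<alpha>)) \<le> M" "norm (?g (of_real r * cis (- ?\<alpha>))) \<le> M" if "0 \<le> r" for r
      unfolding rot e using ray that by blast+
    show "\<bar>t - ?\<gamma>\<bar> \<le> ?\<alpha>" using t by (auto simp: abs_le_iff field_simps)
  qed (rule r)
  then show ?thesis unfolding rot by simp
qed

text \<open>The ray cuts the half-plane into two sectors of opening less than pi, each with bounded
  values on both sides. Control on an inner ray is essential: exp(-iz) is of exponential type and
  bounded on the real axis but unbounded in the upper half-plane.\<close>

lemma bounded_upper_half_plane:
  fixes f :: "complex \<Rightarrow> complex"
  assumes hol: "f holomorphic_on UNIV" and type: "\<And>z. norm (f z) \<le> B * exp (K * norm z)"
    and real: "\<And>x. norm (f (of_real x)) \<le> M1" and s: "0 < s" "s < pi"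
    and ray: "\<And>r. R0 \<le> r \<Longrightarrow> norm (f (of_real r * cis s)) \<le> M2"
  obtains C where "\<And>z. 0 \<le> Im z \<Longrightarrow> norm (f z) \<le> C"
proof -
  have "continuous_on {0..R0} (\<lambda>r. of_real r * cis s)" by (intro continuous_intros)
  then have "continuous_on {0..R0} (\<lambda>r. f (of_real r * cis s))"
    by (rule continuous_on_compose2[OF holomorphic_on_imp_continuous_on[OF hol]]) simp
  then have "bounded ((\<lambda>r. f (of_real r * cis s)) ` {0..R0})"
    by (intro compact_imp_bounded compact_continuous_image) simp_all
  then obtain M3 where "\<forall>w \<in> (\<lambda>r. f (of_real r * cis s)) ` {0..R0}. norm w \<le> M3"
    unfolding bounded_iff by (elim exE)
  then have M3: "norm (f (of_real r * cis s)) \<le> M3" if "r \<in> {0..R0}" for r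
    using that by (rule bspec[OF _ imageI])
  define M where "M = Max {M1, M2, M3}"
  have M: "M1 \<le> M" "M2 \<le> M" "M3 \<le> M" by (auto simp: M_def le_max_iff_disj)
  have r0: "norm (f (of_real r * cis 0)) \<le> M" for r using real[of r] M by simp
  have rpi: "norm (f (of_real r * cis pi)) \<le> M" for r using real[of "- r"] M by simp
  have rs: "norm (f (of_real r * cis s)) \<le> M" if "0 \<le> r" for r
    using ray[of r] M3[of r] M that by (cases "R0 \<le> r") auto
  show ?thesis
  proof (rule that[of M])
    fix z :: complex assume z: "0 \<le> Im z"
    have "f z = f (of_real (norm z) * cis (Arg z))" using rcis_cmod_Arg[of z] by (simp only: rcis_def)
    moreover have "0 \<le> Arg z" "Arg z \<le> pi" using z Arg_le_pi[of z] by (simp_all add: Arg_less_0)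
    moreover have "norm (f (of_real (norm z) * cis t)) \<le> M" if "0 \<le> t" "t \<le> pi" for t
    proof (cases "t \<le> s")
      case True
      show ?thesis
        by (rule phragmen_lindelof_sector[OF hol type _ _ r0 rs _ that(1) True]) (use s in auto)
    next
      case False
      show ?thesis
        by (rule phragmen_lindelof_sector[OF hol type _ _ rs rpi _ _ that(2)]) (use s False in auto)
    qed
    ultimately show "norm (f z) \<le> M" by (simp only:)
  qed
qed

section \<open>Local uniqueness\<close>

text \<open>The sign change of V2 commutes with diag(-\<phi>, \<phi>) and anticommutes with the
  matrix multiplying \<zeta>, so it trades \<zeta> for -\<zeta>.\<close>

lemma dirac_solution_flip:
  assumes L1: "L1_loc \<phi>" and V: "dirac_solution \<phi> \<zeta> V"
  shows "dirac_solution \<phi> (- \<zeta>) (\<lambda>x. flip_lower (V x))"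
  unfolding dirac_solution_iff linear_ode_solution_def
proof (intro allI)
  fix a b
  have "ac_deriv a b V (\<lambda>x. (dirac_coeff \<phi> x + smult_matrix \<zeta> dirac_twist) *v V x)"
    using V unfolding dirac_solution_iff linear_ode_solution_def by blast
  from ac_deriv_bounded_linear[OF bounded_linear_flip_lower this]
  have "ac_deriv a b (\<lambda>x. flip_lower (V x)) (\<lambda>x. flip_lower ((dirac_coeff \<phi> x + smult_matrix \<zeta> dirac_twist) *v V x))" .
  moreover have "flip_lower ((dirac_coeff \<phi> x + smult_matrix \<zeta> dirac_twist) *v w)
     = (dirac_coeff \<phi> x + smult_matrix (- \<zeta>) dirac_twist) *v flip_lower w" for x w
  proof -
    have neg: "M *v (- u) = - (M *v u)" for M :: "complex^'a^'a" and u
      by (simp add: matrix_vector_mult_def vec_eq_iff sum_negf)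
    show ?thesis
      by (rule vec_sum_eqI) (simp_all add: matrix_vector_mult_add_rdistrib smult_matrix_vector_mult
        upper_lower_block matrix_minus_vector_mult neg vec_eq_iff)
  qed
  ultimately show "ac_deriv a b (\<lambda>x. flip_lower (V x)) (\<lambda>x. (dirac_coeff \<phi> x + smult_matrix (- \<zeta>) dirac_twist) *v flip_lower (V x))"
    by simp
qed

lemma dirac_flow_flip:
  assumes "L1_loc \<phi>"
  shows "flip_lower (dirac_flow \<phi> \<zeta> c v x) = dirac_flow \<phi> (- \<zeta>) c (flip_lower v) x"
  using fun_cong[OF dirac_solution_eq_flow[OF assms dirac_solution_flip[OF assms dirac_flow_solution[OF assms]], where c = c]] assms
  by simp

lemma dirac_flow_expand:
  assumes "L1_loc \<phi>"
  shows "dirac_flow \<phi> \<zeta> c w x = (\<Sum>j\<in>UNIV. (w $ j) *s dirac_flow \<phi> \<zeta> c (axis j 1) x)"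
proof -
  have "w = (\<Sum>j\<in>UNIV. (w $ j) *s axis j 1)" by (rule basis_expansion[symmetric])
  then have "dirac_flow \<phi> \<zeta> c w x = dirac_flow \<phi> \<zeta> c (\<Sum>j\<in>UNIV. (w $ j) *s axis j 1) x" by (rule arg_cong)
  also have "\<dots> = (\<Sum>j\<in>UNIV. dirac_flow \<phi> \<zeta> c ((w $ j) *s axis j 1) x)"
    by (rule linear_sum[OF bounded_linear.linear[OF bounded_linear_dirac_flow[OF assms]]])
  finally show ?thesis by (simp add: dirac_flow_scalar[OF assms])
qed

lemma norm_join_le: "norm (join u w) \<le> norm u + norm w" for u w :: "complex^'m::finite"
proof (rule power2_le_imp_le)
  show "(norm (join u w))\<^sup>2 \<le> (norm u + norm w)\<^sup>2"
    unfolding norm_upper_lower[of "join u w"] upper_lower_simps by (simp add: power2_sum)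
qed simp

lemma norm_upper_le: "norm (upper v) \<le> norm v" and norm_lower_le: "norm (lower v) \<le> norm v"
  for v :: "complex^('m::finite + 'm)"
proof -
  have "(norm (upper v))\<^sup>2 \<le> (norm v)\<^sup>2" "(norm (lower v))\<^sup>2 \<le> (norm v)\<^sup>2" using norm_upper_lower[of v] by simp_all
  then show "norm (upper v) \<le> norm v" "norm (lower v) \<le> norm v" using power2_le_imp_le norm_ge_zero by blast+
qed

lemma join_add: "join (u + u') (w + w') = join u w + join u' w'" for u u' w w' :: "complex^'m::finite"
  by (rule vec_sum_eqI) simp_all

section \<open>The transition matrix between the two systems\<close>

text \<open>\<open>transition \<phi>\<^sub>1 \<phi>\<^sub>2 c d \<zeta>\<close> is \<open>\<Psi>\<^sub>1(\<zeta>,d,c) \<Psi>\<^sub>2(\<zeta>,d,c)\<^sup>-\<^sup>1\<close>.\<close>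

definition transition :: "(real \<Rightarrow> complex^'m^'m) \<Rightarrow> (real \<Rightarrow> complex^'m^'m) \<Rightarrow> real \<Rightarrow> real \<Rightarrow> complex \<Rightarrow>
    complex^('m::finite + 'm) \<Rightarrow> complex^('m + 'm)" where
  "transition \<phi>\<^sub>1 \<phi>\<^sub>2 c d \<zeta> v = dirac_flow \<phi>\<^sub>1 \<zeta> c (dirac_flow \<phi>\<^sub>2 \<zeta> d v c) d"

context
  fixes \<phi>\<^sub>1 \<phi>\<^sub>2 :: "real \<Rightarrow> complex^'m^'m::finite" and c d :: real
  assumes L1: "L1_loc \<phi>\<^sub>1" and L2: "L1_loc \<phi>\<^sub>2" and cd: "c < d"
begin

lemma transition_add: "transition \<phi>\<^sub>1 \<phi>\<^sub>2 c d \<zeta> (v + w) = transition \<phi>\<^sub>1 \<phi>\<^sub>2 c d \<zeta> v + transition \<phi>\<^sub>1 \<phi>\<^sub>2 c d \<zeta> w"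
  and transition_scalar: "transition \<phi>\<^sub>1 \<phi>\<^sub>2 c d \<zeta> (z *s v) = z *s transition \<phi>\<^sub>1 \<phi>\<^sub>2 c d \<zeta> v"
  by (simp_all add: transition_def dirac_flow_add[OF L1] dirac_flow_add[OF L2] dirac_flow_scalar[OF L1] dirac_flow_scalar[OF L2])

lemma transition_flip: "flip_lower (transition \<phi>\<^sub>1 \<phi>\<^sub>2 c d \<zeta> v) = transition \<phi>\<^sub>1 \<phi>\<^sub>2 c d (- \<zeta>) (flip_lower v)"
  by (simp add: transition_def dirac_flow_flip[OF L1] dirac_flow_flip[OF L2])

text \<open>The value at \<open>d\<close> of a solution for \<open>\<phi>\<^sub>2\<close> goes to
  the value at \<open>d\<close> of the solution for \<open>\<phi>\<^sub>1\<close> with the same data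
  at \<open>c\<close>. In this form the bounds for Weyl solutions of either system can be
  applied.\<close>

lemma transition_solution:
  assumes "dirac_solution \<phi>\<^sub>2 \<zeta> V"
  shows "transition \<phi>\<^sub>1 \<phi>\<^sub>2 c d \<zeta> (V d) = dirac_flow \<phi>\<^sub>1 \<zeta> c (V c) d"
proof -
  have "dirac_flow \<phi>\<^sub>2 \<zeta> d (V d) c = V c" by (rule fun_cong[OF dirac_solution_eq_flow[OF L2 assms, symmetric]])
  then show ?thesis by (simp only: transition_def)
qed

lemma transition_holomorphic: "(\<lambda>\<zeta>. transition \<phi>\<^sub>1 \<phi>\<^sub>2 c d \<zeta> v $ i) holomorphic_on UNIV"
proof -
  have "transition \<phi>\<^sub>1 \<phi>\<^sub>2 c d \<zeta> v $ i = (\<Sum>j\<in>UNIV. dirac_flow \<phi>\<^sub>2 \<zeta> d v c $ j * dirac_flow \<phi>\<^sub>1 \<zeta> c (axis j 1) d $ i)" for \<zeta>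
    unfolding transition_def by (subst dirac_flow_expand[OF L1]) (simp add: sum_component)
  then show ?thesis
    by (simp only:) (intro holomorphic_on_sum holomorphic_on_mult linear_ode_flow_holomorphic L1_loc_dirac_coeff L1 L2)
qed

abbreviation (input) "total_mass \<equiv> mass \<phi>\<^sub>1 c d + mass \<phi>\<^sub>2 c d"

text \<open>One backward and one forward propagation over [c,d]. On the real axis the bound does not
  involve \<zeta>; elsewhere it gives exponential type 2 (d - c).\<close>

lemma transition_bound: "norm (transition \<phi>\<^sub>1 \<phi>\<^sub>2 c d \<zeta> v) \<le> norm v * exp (2 * \<bar>Im \<zeta>\<bar> * (d - c) + total_mass)"
proof -
  let ?w = "dirac_flow \<phi>\<^sub>2 \<zeta> d v c"
  have 1: "norm ?w \<le> norm v * exp (\<bar>Im \<zeta>\<bar> * (d - c) + mass \<phi>\<^sub>2 c d)"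
    using dirac_solution_growth(2)[OF L2 dirac_flow_solution[OF L2, of \<zeta> d v] less_imp_le[OF cd]] L2 by simp
  have "norm (transition \<phi>\<^sub>1 \<phi>\<^sub>2 c d \<zeta> v) \<le> norm ?w * exp (\<bar>Im \<zeta>\<bar> * (d - c) + mass \<phi>\<^sub>1 c d)"
    using dirac_solution_growth(1)[OF L1 dirac_flow_solution[OF L1, of \<zeta> c ?w] less_imp_le[OF cd]] L1 by (simp add: transition_def)
  also have "\<dots> \<le> norm v * exp (\<bar>Im \<zeta>\<bar> * (d - c) + mass \<phi>\<^sub>2 c d) * exp (\<bar>Im \<zeta>\<bar> * (d - c) + mass \<phi>\<^sub>1 c d)"
    using 1 by (rule mult_right_mono) simp
  also have "\<dots> = norm v * exp (2 * \<bar>Im \<zeta>\<bar> * (d - c) + total_mass)"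
    by (simp add: mult.assoc algebra_simps flip: exp_add)
  finally show ?thesis .
qed

context
  assumes herm1: "AE x in lebesgue. \<phi>\<^sub>1 x = adjoint_matrix (\<phi>\<^sub>1 x)" and herm2: "AE x in lebesgue. \<phi>\<^sub>2 x = adjoint_matrix (\<phi>\<^sub>2 x)"
begin

text \<open>At \<open>c\<close> the solution V has data (x, M2 x). Replacing M2 by M1 yields data of
  a Weyl solution W of the first system; the possible growth of V from \<open>d\<close> back to
  \<open>c\<close> is undone by the decay of W from \<open>c\<close> to \<open>d\<close>. The defect
  (0, (M2 - M1) x) may grow in both propagations, which costs the factor exp(2 Im \<zeta> (d - c))
  against \<eta>.\<close>

lemma transition_weyl_split:
  assumes Im: "Im \<zeta> > 0" and V: "V \<in> weyl_space \<phi>\<^sub>2 \<zeta>"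
    and near: "\<And>u. norm (weyl_dirac \<phi>\<^sub>1 \<zeta> c {c..} *v u - \<i> *s u) \<le> norm u"
    and diff: "\<And>u. norm (weyl_dirac \<phi>\<^sub>1 \<zeta> c {c..} *v u - weyl_dirac \<phi>\<^sub>2 \<zeta> c {c..} *v u) \<le> \<eta> * norm u"
  obtains W r where "W \<in> weyl_space \<phi>\<^sub>1 \<zeta>" "transition \<phi>\<^sub>1 \<phi>\<^sub>2 c d \<zeta> (V d) = W d + r"
    "norm (W d) \<le> 6 * exp total_mass * norm (V d)"
    "norm r \<le> \<eta> * exp (2 * Im \<zeta> * (d - c) + total_mass) * norm (V d)"
proof -
  let ?M1 = "weyl_dirac \<phi>\<^sub>1 \<zeta> c {c..}" and ?M2 = "weyl_dirac \<phi>\<^sub>2 \<zeta> c {c..}"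
  define x where "x = upper (V c)"
  have V': "dirac_solution \<phi>\<^sub>2 \<zeta> V" by (rule weyl_spaceD(1)[OF V])
  have Vc: "V c = join x (?M2 *v x)"
    using weyl_space_graph[OF L2 herm2 Im V, of c] by (intro vec_sum_eqI) (simp_all add: x_def)
  define W where "W = dirac_flow \<phi>\<^sub>1 \<zeta> c (join x (?M1 *v x))"
  define e where "e = join 0 (?M2 *v x - ?M1 *v x)"
  define r where "r = dirac_flow \<phi>\<^sub>1 \<zeta> c e d"
  have W: "W \<in> weyl_space \<phi>\<^sub>1 \<zeta>" unfolding W_def by (rule weyl_flow_in_space[OF L1 herm1 Im])
  have "V c = join x (?M1 *v x) + e" unfolding Vc e_def by (simp flip: join_add)
  then have split: "transition \<phi>\<^sub>1 \<phi>\<^sub>2 c d \<zeta> (V d) = W d + r"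
    unfolding transition_solution[OF V'] W_def r_def by (simp add: dirac_flow_add[OF L1])
  have nVc: "norm (V c) \<le> norm (V d) * exp (Im \<zeta> * (d - c) + mass \<phi>\<^sub>2 c d)"
    using dirac_solution_growth(2)[OF L2 V' less_imp_le[OF cd]] Im by simp
  have nx: "norm x \<le> norm (V c)" unfolding x_def by (rule norm_upper_le)
  have nWc: "norm (W c) \<le> 3 * norm (V c)"
  proof -
    have "norm (?M1 *v x) \<le> norm (?M1 *v x - \<i> *s x) + norm (\<i> *s x)" using norm_triangle_ineq[of "?M1 *v x - \<i> *s x" "\<i> *s x"] by simp
    also have "\<dots> \<le> 2 * norm x" using near[of x] by (simp add: norm_scalar_mult_vec)
    finally have "norm (join x (?M1 *v x)) \<le> 3 * norm x" using norm_join_le[of x "?M1 *v x"] by simp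
    then show ?thesis using nx L1 by (simp add: W_def)
  qed
  have nW: "norm (W d) \<le> 6 * exp total_mass * norm (V d)"
  proof -
    have "norm (W d) \<le> 2 * norm (W c) * exp (mass \<phi>\<^sub>1 c d - Im \<zeta> * (d - c))"
      by (rule weyl_space_decay[OF L1 W less_imp_le[OF cd]])
    also have "\<dots> \<le> 2 * (3 * (norm (V d) * exp (Im \<zeta> * (d - c) + mass \<phi>\<^sub>2 c d))) * exp (mass \<phi>\<^sub>1 c d - Im \<zeta> * (d - c))"
      using nWc nVc by (intro mult_right_mono mult_left_mono) auto
    also have "\<dots> = 6 * norm (V d) * (exp (Im \<zeta> * (d - c) + mass \<phi>\<^sub>2 c d) * exp (mass \<phi>\<^sub>1 c d - Im \<zeta> * (d - c)))" by simp
    also have "exp (Im \<zeta> * (d - c) + mass \<phi>\<^sub>2 c d) * exp (mass \<phi>\<^sub>1 c d - Im \<zeta> * (d - c)) = exp total_mass"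
      unfolding exp_add[symmetric] by (simp add: algebra_simps)
    finally show ?thesis by (simp add: mult_ac)
  qed
  \<comment> \<open>A nonzero \<open>x\<close> forces \<eta> \<ge> 0 through the assumed bound on
    the difference of the Weyl matrices; for x = 0 both sides vanish.\<close>
  have nr: "norm r \<le> \<eta> * exp (2 * Im \<zeta> * (d - c) + total_mass) * norm (V d)"
  proof (cases "x = 0")
    case True
    then have "V c = 0" unfolding Vc by (intro vec_sum_eqI) simp_all
    then have "V = (\<lambda>x. 0)" using dirac_solution_unique[OF L2 V' dirac_solution_zero, of c] by simp
    moreover have "e = 0" using True unfolding e_def by (intro vec_sum_eqI) simp_all
    then have "r = 0" using dirac_flow_scalar[OF L1, of c 0 0 \<zeta> d] unfolding r_def by simp
    ultimately show ?thesis by simp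
  next
    case False
    have \<eta>0: "\<eta> \<ge> 0" using diff[of x] False norm_ge_zero[of "?M1 *v x - ?M2 *v x"]
      by (smt (verit) mult_neg_pos zero_less_norm_iff)
    have "norm e \<le> \<eta> * norm x" unfolding e_def using norm_join_le[of 0 "?M2 *v x - ?M1 *v x"] diff[of x] by (simp add: norm_minus_commute)
    also have "\<dots> \<le> \<eta> * (norm (V d) * exp (Im \<zeta> * (d - c) + mass \<phi>\<^sub>2 c d))"
      using nx nVc \<eta>0 by (intro mult_left_mono) auto
    finally have ne: "norm e \<le> \<eta> * (norm (V d) * exp (Im \<zeta> * (d - c) + mass \<phi>\<^sub>2 c d))" .
    have "norm r \<le> norm e * exp (Im \<zeta> * (d - c) + mass \<phi>\<^sub>1 c d)"
      using dirac_solution_growth(1)[OF L1 dirac_flow_solution[OF L1, of \<zeta> c e] less_imp_le[OF cd]] Im L1 by (simp add: r_def)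
    also have "\<dots> \<le> \<eta> * (norm (V d) * exp (Im \<zeta> * (d - c) + mass \<phi>\<^sub>2 c d)) * exp (Im \<zeta> * (d - c) + mass \<phi>\<^sub>1 c d)"
      using ne by (rule mult_right_mono) simp
    also have "\<dots> = \<eta> * norm (V d) * (exp (Im \<zeta> * (d - c) + mass \<phi>\<^sub>2 c d) * exp (Im \<zeta> * (d - c) + mass \<phi>\<^sub>1 c d))" by simp
    also have "exp (Im \<zeta> * (d - c) + mass \<phi>\<^sub>2 c d) * exp (Im \<zeta> * (d - c) + mass \<phi>\<^sub>1 c d) = exp (2 * Im \<zeta> * (d - c) + total_mass)"
      unfolding exp_add[symmetric] by (simp add: algebra_simps)
    finally show ?thesis by (simp add: mult_ac)
  qed
  show ?thesis by (rule that[OF W split nW nr])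
qed

text \<open>A left Weyl solution shrinks by exp(-Im \<zeta> (d - c)) from \<open>d\<close> back to
  \<open>c\<close>, and on the way forward the first system can grow by at most the inverse factor;
  only the masses remain.\<close>

lemma transition_left_weyl:
  assumes V: "dirac_solution \<phi>\<^sub>2 \<zeta> V" "\<And>x. norm (neg_part (V x)) \<le> norm (pos_part (V x))" and Im: "Im \<zeta> > 0"
  shows "norm (transition \<phi>\<^sub>1 \<phi>\<^sub>2 c d \<zeta> (V d)) \<le> 2 * exp total_mass * norm (V d)"
proof -
  have "norm (transition \<phi>\<^sub>1 \<phi>\<^sub>2 c d \<zeta> (V d)) \<le> norm (V c) * exp (Im \<zeta> * (d - c) + mass \<phi>\<^sub>1 c d)"
    unfolding transition_solution[OF V(1)]
    using dirac_solution_growth(1)[OF L1 dirac_flow_solution[OF L1, of \<zeta> c "V c"] less_imp_le[OF cd]] Im L1 by simp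
  also have "\<dots> \<le> 2 * norm (V d) * exp (mass \<phi>\<^sub>2 c d - Im \<zeta> * (d - c)) * exp (Im \<zeta> * (d - c) + mass \<phi>\<^sub>1 c d)"
    by (rule mult_right_mono[OF left_weyl_decay[OF L2 V less_imp_le[OF cd]]]) simp
  also have "\<dots> = 2 * norm (V d) * (exp (mass \<phi>\<^sub>2 c d - Im \<zeta> * (d - c)) * exp (Im \<zeta> * (d - c) + mass \<phi>\<^sub>1 c d))" by simp
  also have "exp (mass \<phi>\<^sub>2 c d - Im \<zeta> * (d - c)) * exp (Im \<zeta> * (d - c) + mass \<phi>\<^sub>1 c d) = exp total_mass"
    unfolding exp_add[symmetric] by (simp add: algebra_simps)
  finally show ?thesis by (simp add: mult_ac)
qed

text \<open>Since \<open>M\<^sub>+ \<approx> \<i>\<close> and \<open>M\<^sub>- \<approx> -\<i>\<close>, initial data at \<open>d\<close> split boundedly into left and right Weyl data.\<close>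

lemma weyl_decomposition:
  assumes Im: "Im \<zeta> > 0"
    and right: "\<And>u. norm (weyl_dirac \<phi>\<^sub>2 \<zeta> d {d..} *v u - \<i> *s u) \<le> 1/2 * norm u"
    and left: "\<And>u. norm (weyl_dirac \<phi>\<^sub>2 \<zeta> d {..d} *v u + \<i> *s u) \<le> 1/2 * norm u"
  obtains V W where "V \<in> weyl_space \<phi>\<^sub>2 \<zeta>" "dirac_solution \<phi>\<^sub>2 \<zeta> W" "\<And>x. norm (neg_part (W x)) \<le> norm (pos_part (W x))"
    "v = V d + W d" "norm (V d) \<le> 12 * norm v" "norm (W d) \<le> 12 * norm v"
proof -
  let ?P = "weyl_dirac \<phi>\<^sub>2 \<zeta> d {d..}" and ?N = "weyl_dirac \<phi>\<^sub>2 \<zeta> d {..d}"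
  have iu: "norm (\<i> *s u) = norm u" "norm (2 *s (\<i> *s u)) = 2 * norm u" for u :: "complex^'m"
    by (simp_all add: norm_scalar_mult_vec)
  have nP: "norm (?P *v u) \<le> 2 * norm u" for u
  proof -
    have "norm (?P *v u) \<le> norm (?P *v u - \<i> *s u) + norm (\<i> *s u)"
      using norm_triangle_ineq[of "?P *v u - \<i> *s u" "\<i> *s u"] by simp
    then show ?thesis using right[of u] norm_ge_zero[of u] unfolding iu by linarith
  qed
  have nN: "norm (?N *v u) \<le> 2 * norm u" for u
  proof -
    have "norm (?N *v u) \<le> norm (?N *v u + \<i> *s u) + norm (\<i> *s u)"
      using norm_triangle_ineq4[of "?N *v u + \<i> *s u" "\<i> *s u"] by simp
    then show ?thesis using left[of u] norm_ge_zero[of u] unfolding iu by linarith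
  qed
  \<comment> \<open>The two Weyl matrices differ by approximately 2i, so this map is bounded
    below.\<close>
  define T where "T = (\<lambda>u. ?P *v u - ?N *v u)"
  have Tge: "norm u \<le> norm (T u)" for u
  proof -
    have "2 *s (\<i> *s u) = T u - (?P *v u - \<i> *s u) + (?N *v u + \<i> *s u)" unfolding T_def by (simp add: vec_eq_iff)
    from arg_cong[OF this, of norm] have "norm (2 *s (\<i> *s u)) \<le> norm (T u) + norm (?P *v u - \<i> *s u) + norm (?N *v u + \<i> *s u)"
      using norm_triangle_ineq[of "T u - (?P *v u - \<i> *s u)" "?N *v u + \<i> *s u"]
        norm_triangle_ineq4[of "T u" "?P *v u - \<i> *s u"] by linarith
    then show ?thesis using right[of u] left[of u] unfolding iu by linarith
  qed
  have lin: "linear T"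
    unfolding T_def
    by (rule bounded_linear.linear[OF bounded_linear_sub[OF bounded_bilinear.bounded_linear_right[OF bounded_bilinear_matrix_vector_mult_complex]
          bounded_bilinear.bounded_linear_right[OF bounded_bilinear_matrix_vector_mult_complex]]])
  have "inj T" unfolding linear_injective_0[OF lin] 
  proof (intro allI impI)
    fix u assume "T u = 0"
    then show "u = 0" using Tge[of u] by simp
  qed
  \<comment> \<open>Splitting v = (v1, v2) into (u, P u) + (w, N w) requires w = v1 - u and (P - N)
    u = v2 - N v1.\<close>
  from surjD[OF linear_injective_imp_surjective[OF lin this], of "lower v - ?N *v upper v"]
  obtain u where u: "lower v - ?N *v upper v = T u" by blast
  define w where "w = upper v - u"
  have nu: "norm u \<le> 3 * norm v"
  proof -
    have "norm u \<le> norm (lower v - ?N *v upper v)" unfolding u by (rule Tge)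
    also have "\<dots> \<le> norm (lower v) + norm (?N *v upper v)" by (rule norm_triangle_ineq4)
    finally show ?thesis using nN[of "upper v"] norm_upper_le[of v] norm_lower_le[of v] by linarith
  qed
  have nw: "norm w \<le> 4 * norm v"
    unfolding w_def using norm_triangle_ineq4[of "upper v" u] nu norm_upper_le[of v] by linarith
  define V where "V = dirac_flow \<phi>\<^sub>2 \<zeta> d (join u (?P *v u))"
  define W where "W = dirac_flow \<phi>\<^sub>2 \<zeta> d (join w (?N *v w))"
  have Vd: "V d = join u (?P *v u)" and Wd: "W d = join w (?N *v w)" using L2 by (simp_all add: V_def W_def)
  show ?thesis
  proof (rule that[of V W])
    show "V \<in> weyl_space \<phi>\<^sub>2 \<zeta>" unfolding V_def by (rule weyl_flow_in_space[OF L2 herm2 Im])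
    show "dirac_solution \<phi>\<^sub>2 \<zeta> W" unfolding W_def by (rule dirac_flow_solution[OF L2])
    show "norm (neg_part (W x)) \<le> norm (pos_part (W x))" for x unfolding W_def by (rule weyl_left_flow[OF L2 herm2 Im])
    show "v = V d + W d"
    proof (rule vec_sum_eqI)
      show "upper v = upper (V d + W d)" by (simp add: Vd Wd w_def)
      have "lower v = T u + ?N *v upper v" using u by (simp add: diff_eq_eq)
      then show "lower v = lower (V d + W d)" by (simp add: Vd Wd w_def T_def matrix_vector_mult_diff_distrib)
    qed
    show "norm (V d) \<le> 12 * norm v" unfolding Vd using norm_join_le[of u "?P *v u"] nP[of u] nu norm_ge_zero[of v] by linarith
    show "norm (W d) \<le> 12 * norm v" unfolding Wd using norm_join_le[of w "?N *v w"] nN[of w] nw by linarith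
  qed
qed

end

end

lemma norm_vec_le_sum: "norm x \<le> (\<Sum>i\<in>UNIV. norm (x $ i))" for x :: "complex^'n"
  unfolding norm_vec_def by (rule L2_set_le_sum) simp

lemma eventually_Im_ge:
  assumes s: "0 < s" "s < pi" and R: "R > 0"
  shows "\<forall>\<^sub>F r in at_top. R \<le> Im (of_real r * cis s) \<and> 0 < Im (of_real r * cis s)"
  using eventually_ge_at_top[of "R / sin s"]
proof eventually_elim
  case (elim r)
  then have "R \<le> r * sin s" using sin_gt_zero[OF s] by (simp add: pos_divide_le_eq)
  then show ?case using R by simp
qed

section \<open>Constancy and block form of the transition matrix\<close>

context
  fixes \<phi>\<^sub>1 \<phi>\<^sub>2 :: "real \<Rightarrow> complex^'m^'m::finite" and c d s K R0 b :: real
  assumes L1: "L1_loc \<phi>\<^sub>1" and L2: "L1_loc \<phi>\<^sub>2" and cd: "c < d"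
    and herm1: "AE x in lebesgue. \<phi>\<^sub>1 x = adjoint_matrix (\<phi>\<^sub>1 x)"
    and herm2: "AE x in lebesgue. \<phi>\<^sub>2 x = adjoint_matrix (\<phi>\<^sub>2 x)"
    and s: "0 < s" "s < pi" and b: "d - c < b"
    and diff: "\<And>r u. R0 \<le> r \<Longrightarrow> norm (weyl_dirac \<phi>\<^sub>1 (of_real r * cis s) c {c..} *v u - weyl_dirac \<phi>\<^sub>2 (of_real r * cis s) c {c..} *v u)
        \<le> K * exp (- 2 * (r * sin s) * b) * norm u"
begin

abbreviation (input) "T\<^sub>1\<^sub>2 \<equiv> transition \<phi>\<^sub>1 \<phi>\<^sub>2 c d"
abbreviation (input) "\<mu>\<^sub>1\<^sub>2 \<equiv> mass \<phi>\<^sub>1 c d + mass \<phi>\<^sub>2 c d"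

lemma sin_pos: "sin s > 0" using s by (rule sin_gt_zero)

lemma eventually_near:
  assumes e: "e > 0"
  shows "\<forall>\<^sub>F r in at_top. \<forall>u. norm (weyl_dirac \<phi>\<^sub>1 (of_real r * cis s) c {c..} *v u - \<i> *s u) \<le> e * norm u"
    and "\<forall>\<^sub>F r in at_top. \<forall>u. norm (weyl_dirac \<phi>\<^sub>2 (of_real r * cis s) d {d..} *v u - \<i> *s u) \<le> e * norm u"
    and "\<forall>\<^sub>F r in at_top. \<forall>u. norm (weyl_dirac \<phi>\<^sub>2 (of_real r * cis s) d {..d} *v u + \<i> *s u) \<le> e * norm u"
proof -
  show "\<forall>\<^sub>F r in at_top. \<forall>u. norm (weyl_dirac \<phi>\<^sub>1 (of_real r * cis s) c {c..} *v u - \<i> *s u) \<le> e * norm u"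
  proof (rule weyl_dirac_near_i[OF L1 herm1 e, of c])
    fix R :: real assume R: "R > 0" "\<And>\<zeta> u. R \<le> Im \<zeta> \<Longrightarrow> norm (weyl_dirac \<phi>\<^sub>1 \<zeta> c {c..} *v u - \<i> *s u) \<le> e * norm u"
    show ?thesis using eventually_Im_ge[OF s R(1)] by eventually_elim (use R(2) in blast)
  qed
  show "\<forall>\<^sub>F r in at_top. \<forall>u. norm (weyl_dirac \<phi>\<^sub>2 (of_real r * cis s) d {d..} *v u - \<i> *s u) \<le> e * norm u"
  proof (rule weyl_dirac_near_i[OF L2 herm2 e, of d])
    fix R :: real assume R: "R > 0" "\<And>\<zeta> u. R \<le> Im \<zeta> \<Longrightarrow> norm (weyl_dirac \<phi>\<^sub>2 \<zeta> d {d..} *v u - \<i> *s u) \<le> e * norm u"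
    show ?thesis using eventually_Im_ge[OF s R(1)] by eventually_elim (use R(2) in blast)
  qed
  show "\<forall>\<^sub>F r in at_top. \<forall>u. norm (weyl_dirac \<phi>\<^sub>2 (of_real r * cis s) d {..d} *v u + \<i> *s u) \<le> e * norm u"
  proof (rule left_weyl_dirac_near_i[OF L2 herm2 e, of d])
    fix R :: real assume R: "R > 0" "\<And>\<zeta> u. R \<le> Im \<zeta> \<Longrightarrow> norm (weyl_dirac \<phi>\<^sub>2 \<zeta> d {..d} *v u + \<i> *s u) \<le> e * norm u"
    show ?thesis using eventually_Im_ge[OF s R(1)] by eventually_elim (use R(2) in blast)
  qed
qed

text \<open>Since b > d - c, the assumed closeness of the Weyl matrices makes the defect of the
  splitting tend to zero along the ray. What remains is a Weyl solution of the first system, whose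
  growing amplitude at \<open>d\<close> is small.\<close>

lemma eventually_transition_weyl:
  assumes e: "e > 0"
  shows "\<forall>\<^sub>F r in at_top. \<forall>V \<in> weyl_space \<phi>\<^sub>2 (of_real r * cis s).
    norm (T\<^sub>1\<^sub>2 (of_real r * cis s) (V d)) \<le> (6 + \<bar>K\<bar>) * exp \<mu>\<^sub>1\<^sub>2 * norm (V d) \<and>
    norm (pos_part (T\<^sub>1\<^sub>2 (of_real r * cis s) (V d))) \<le> e * norm (V d)"
proof -
  \<comment> \<open>As |q(W d)| \<le> 2 |W d| \<le> 12 exp(\<open>\<mu>\<^sub>1\<^sub>2\<close>) |V
    d|, this value leaves e/2 |V d| for the Weyl part. The defect, whose \<open>p\<close> is at most
    twice its norm, gets the other half from the threshold e / (4
    exp(\<open>\<mu>\<^sub>1\<^sub>2\<close>)).\<close>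
  define \<epsilon> where "\<epsilon> = e / (24 * exp \<mu>\<^sub>1\<^sub>2)"
  have \<epsilon>: "\<epsilon> > 0" using e by (simp add: \<epsilon>_def)
  have pos: "\<forall>\<^sub>F r in at_top. \<forall>W \<in> weyl_space \<phi>\<^sub>1 (of_real r * cis s). norm (pos_part (W d)) \<le> \<epsilon> * norm (neg_part (W d))"
  proof (rule weyl_space_pos_part_small[OF L1 \<epsilon>, of d])
    fix R :: real assume R: "R > 0" "\<And>\<zeta> V. R \<le> Im \<zeta> \<Longrightarrow> V \<in> weyl_space \<phi>\<^sub>1 \<zeta> \<Longrightarrow> norm (pos_part (V d)) \<le> \<epsilon> * norm (neg_part (V d))"
    show ?thesis using eventually_Im_ge[OF s R(1)] by eventually_elim (use R(2) in blast)
  qed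
  let ?q = "\<lambda>r. \<bar>K\<bar> * exp (- 2 * (r * sin s) * (b - (d - c)))"
  have "((\<lambda>r. exp (- (2 * sin s * (b - (d - c))) * r)) \<longlongrightarrow> 0) at_top"
  proof -
    have "2 * sin s * (b - (d - c)) > 0" using sin_pos b by simp
    then have "filterlim (\<lambda>r. (2 * sin s * (b - (d - c))) * r) at_top at_top"
      by (intro filterlim_tendsto_pos_mult_at_top[OF tendsto_const _ filterlim_ident])
    from filterlim_compose[OF exp_at_bot filterlim_compose[OF filterlim_uminus_at_bot_at_top this]] show ?thesis by simp
  qed
  from tendsto_mult_right_zero[OF this, of "\<bar>K\<bar>"]
  have q0: "(?q \<longlongrightarrow> 0) at_top" by (simp add: mult_ac)
  have q: "\<forall>\<^sub>F r in at_top. ?q r < e / (4 * exp \<mu>\<^sub>1\<^sub>2)" using order_tendstoD(2)[OF q0] e by simp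
  show ?thesis
    using eventually_near(1)[OF zero_less_one] pos q eventually_Im_ge[OF s zero_less_one] eventually_ge_at_top[of R0] eventually_ge_at_top[of 0]
  proof eventually_elim
    case (elim r)
    let ?z = "of_real r * cis s"
    have Imz: "Im ?z = r * sin s" by simp
    have Im: "Im ?z > 0" using elim(4) by blast
    show ?case
    proof
      fix V assume V: "V \<in> weyl_space \<phi>\<^sub>2 ?z"
      have near: "norm (weyl_dirac \<phi>\<^sub>1 ?z c {c..} *v u - \<i> *s u) \<le> norm u" for u using elim(1) by simp
      have dif: "norm (weyl_dirac \<phi>\<^sub>1 ?z c {c..} *v u - weyl_dirac \<phi>\<^sub>2 ?z c {c..} *v u) \<le> (\<bar>K\<bar> * exp (- 2 * (r * sin s) * b)) * norm u" for u
        by (rule order_trans[OF diff[OF elim(5)]]) (intro mult_right_mono, auto)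
      show "norm (T\<^sub>1\<^sub>2 ?z (V d)) \<le> (6 + \<bar>K\<bar>) * exp \<mu>\<^sub>1\<^sub>2 * norm (V d) \<and> norm (pos_part (T\<^sub>1\<^sub>2 ?z (V d))) \<le> e * norm (V d)"
      proof (rule transition_weyl_split[OF L1 L2 cd herm1 herm2 Im V near dif])
        fix W \<rho>
        assume W: "W \<in> weyl_space \<phi>\<^sub>1 ?z" and eq: "T\<^sub>1\<^sub>2 ?z (V d) = W d + \<rho>"
          and nW: "norm (W d) \<le> 6 * exp \<mu>\<^sub>1\<^sub>2 * norm (V d)"
          and n\<rho>: "norm \<rho> \<le> (\<bar>K\<bar> * exp (- 2 * (r * sin s) * b)) * exp (2 * Im ?z * (d - c) + \<mu>\<^sub>1\<^sub>2) * norm (V d)"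
        have eqn: "(\<bar>K\<bar> * exp (- 2 * (r * sin s) * b)) * exp (2 * Im ?z * (d - c) + \<mu>\<^sub>1\<^sub>2) = ?q r * exp \<mu>\<^sub>1\<^sub>2"
          unfolding Imz by (simp add: mult.assoc algebra_simps flip: exp_add)
        note n\<rho> = n\<rho>[unfolded eqn]
        have "0 \<le> (r * sin s) * (b - (d - c))" using elim(4) b unfolding Imz by simp
        then have "exp (- 2 * (r * sin s) * (b - (d - c))) \<le> 1" by simp
        then have "?q r \<le> \<bar>K\<bar> * 1" by (intro mult_left_mono) auto
        then have "?q r * exp \<mu>\<^sub>1\<^sub>2 * norm (V d) \<le> \<bar>K\<bar> * exp \<mu>\<^sub>1\<^sub>2 * norm (V d)" by (intro mult_right_mono) auto
        with n\<rho> have A: "norm \<rho> \<le> \<bar>K\<bar> * exp \<mu>\<^sub>1\<^sub>2 * norm (V d)" by (rule order_trans)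
        have "?q r * exp \<mu>\<^sub>1\<^sub>2 * norm (V d) \<le> e / (4 * exp \<mu>\<^sub>1\<^sub>2) * exp \<mu>\<^sub>1\<^sub>2 * norm (V d)"
          using elim(3) by (intro mult_right_mono) auto
        with n\<rho> have B: "norm \<rho> \<le> e / 4 * norm (V d)" by simp
        have "norm (pos_part (W d)) \<le> \<epsilon> * norm (neg_part (W d))" using elim(2) W by blast
        also have "\<dots> \<le> \<epsilon> * (2 * (6 * exp \<mu>\<^sub>1\<^sub>2 * norm (V d)))"
          using norm_neg_part_le[of "W d"] nW \<epsilon> by (intro mult_left_mono) auto
        also have "\<dots> = e / 2 * norm (V d)" by (simp add: \<epsilon>_def)
        finally have C: "norm (pos_part (W d)) \<le> e / 2 * norm (V d)" .
        have 1: "norm (T\<^sub>1\<^sub>2 ?z (V d)) \<le> (6 + \<bar>K\<bar>) * exp \<mu>\<^sub>1\<^sub>2 * norm (V d)"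
          unfolding eq using norm_triangle_ineq[of "W d" \<rho>] nW A by (simp add: algebra_simps)
        have "norm (pos_part (W d + \<rho>)) \<le> norm (pos_part (W d)) + 2 * norm \<rho>"
          unfolding pos_neg_part_linear using norm_triangle_ineq[of "pos_part (W d)" "pos_part \<rho>"] norm_pos_part_le[of \<rho>] by linarith
        then have 2: "norm (pos_part (T\<^sub>1\<^sub>2 ?z (V d))) \<le> e * norm (V d)" unfolding eq using B C by linarith
        from 1 2 show ?thesis ..
      qed
    qed
  qed
qed

text \<open>Both pieces of the decomposition have norm at most 12 |v|; the right one contributes the
  factor 6 + |K|, the left one the factor 2.\<close>

lemma eventually_transition_bounded:
  "\<forall>\<^sub>F r in at_top. \<forall>v. norm (T\<^sub>1\<^sub>2 (of_real r * cis s) v) \<le> 12 * (8 + \<bar>K\<bar>) * exp \<mu>\<^sub>1\<^sub>2 * norm v"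
  using eventually_transition_weyl[OF zero_less_one] eventually_near(2,3)[OF half_gt_zero[OF zero_less_one]] eventually_Im_ge[OF s zero_less_one]
proof eventually_elim
  case (elim r)
  let ?z = "of_real r * cis s"
  have Im: "Im ?z > 0" using elim(4) by blast
  show ?case
  proof
    fix v
    have near: "norm (weyl_dirac \<phi>\<^sub>2 ?z d {d..} *v u - \<i> *s u) \<le> 1/2 * norm u"
      "norm (weyl_dirac \<phi>\<^sub>2 ?z d {..d} *v u + \<i> *s u) \<le> 1/2 * norm u" for u
      using elim(2,3) by blast+
    show "norm (T\<^sub>1\<^sub>2 ?z v) \<le> 12 * (8 + \<bar>K\<bar>) * exp \<mu>\<^sub>1\<^sub>2 * norm v"
    proof (rule weyl_decomposition[OF L1 L2 cd herm1 herm2 Im near, of v])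
      fix V W assume V: "V \<in> weyl_space \<phi>\<^sub>2 ?z" and W: "dirac_solution \<phi>\<^sub>2 ?z W" "\<And>x. norm (neg_part (W x)) \<le> norm (pos_part (W x))"
        and v: "v = V d + W d" and nV: "norm (V d) \<le> 12 * norm v" and nW: "norm (W d) \<le> 12 * norm v"
      have "norm (T\<^sub>1\<^sub>2 ?z (V d)) \<le> (6 + \<bar>K\<bar>) * exp \<mu>\<^sub>1\<^sub>2 * norm (V d)" using elim(1) V by blast
      also have "\<dots> \<le> (6 + \<bar>K\<bar>) * exp \<mu>\<^sub>1\<^sub>2 * (12 * norm v)" using nV by (intro mult_left_mono) auto
      finally have 1: "norm (T\<^sub>1\<^sub>2 ?z (V d)) \<le> (6 + \<bar>K\<bar>) * exp \<mu>\<^sub>1\<^sub>2 * (12 * norm v)" .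
      have "norm (T\<^sub>1\<^sub>2 ?z (W d)) \<le> 2 * exp \<mu>\<^sub>1\<^sub>2 * norm (W d)" by (rule transition_left_weyl[OF L1 L2 cd herm1 herm2 W Im])
      also have "\<dots> \<le> 2 * exp \<mu>\<^sub>1\<^sub>2 * (12 * norm v)" using nW by (intro mult_left_mono) auto
      finally have 2: "norm (T\<^sub>1\<^sub>2 ?z (W d)) \<le> 2 * exp \<mu>\<^sub>1\<^sub>2 * (12 * norm v)" .
      have "T\<^sub>1\<^sub>2 ?z v = T\<^sub>1\<^sub>2 ?z (V d) + T\<^sub>1\<^sub>2 ?z (W d)" unfolding v by (rule transition_add[OF L1 L2 cd])
      then have "norm (T\<^sub>1\<^sub>2 ?z v) \<le> norm (T\<^sub>1\<^sub>2 ?z (V d)) + norm (T\<^sub>1\<^sub>2 ?z (W d))" by (simp only: norm_triangle_ineq)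
      then show ?thesis using 1 2 by (simp add: algebra_simps)
    qed
  qed
qed

lemma transition_bounded_upper: "\<exists>C. \<forall>z. 0 \<le> Im z \<longrightarrow> norm (T\<^sub>1\<^sub>2 z v) \<le> C"
proof -
  obtain R where R: "\<And>r. R \<le> r \<Longrightarrow> norm (T\<^sub>1\<^sub>2 (of_real r * cis s) v) \<le> 12 * (8 + \<bar>K\<bar>) * exp \<mu>\<^sub>1\<^sub>2 * norm v"
    using eventually_transition_bounded unfolding eventually_at_top_linorder by blast
  have "\<exists>C. \<forall>z. 0 \<le> Im z \<longrightarrow> norm (T\<^sub>1\<^sub>2 z v $ i) \<le> C" for i
  proof (rule bounded_upper_half_plane[where f = "\<lambda>z. T\<^sub>1\<^sub>2 z v $ i" and s = s and ?R0.0 = R])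
    show "(\<lambda>z. T\<^sub>1\<^sub>2 z v $ i) holomorphic_on UNIV" by (rule transition_holomorphic[OF L1 L2 cd])
    show "norm (T\<^sub>1\<^sub>2 z v $ i) \<le> (norm v * exp \<mu>\<^sub>1\<^sub>2) * exp (2 * (d - c) * norm z)" for z
    proof -
      have "norm (T\<^sub>1\<^sub>2 z v $ i) \<le> norm v * exp (2 * \<bar>Im z\<bar> * (d - c) + \<mu>\<^sub>1\<^sub>2)"
        using Finite_Cartesian_Product.norm_nth_le[of "T\<^sub>1\<^sub>2 z v" i] transition_bound[OF L1 L2 cd, of z v] by linarith
      also have "\<dots> \<le> norm v * exp (\<mu>\<^sub>1\<^sub>2 + 2 * (d - c) * norm z)"
        using mult_left_mono[OF abs_Im_le_cmod[of z], of "2 * (d - c)"] cd by (intro mult_left_mono) (simp_all add: mult_ac)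
      finally show ?thesis by (simp add: exp_add mult.assoc)
    qed
    show "norm (T\<^sub>1\<^sub>2 (of_real x) v $ i) \<le> norm v * exp \<mu>\<^sub>1\<^sub>2" for x
      using Finite_Cartesian_Product.norm_nth_le[of "T\<^sub>1\<^sub>2 (of_real x) v" i] transition_bound[OF L1 L2 cd, of "of_real x" v] by simp
    show "norm (T\<^sub>1\<^sub>2 (of_real r * cis s) v $ i) \<le> 12 * (8 + \<bar>K\<bar>) * exp \<mu>\<^sub>1\<^sub>2 * norm v" if "R \<le> r" for r
      using Finite_Cartesian_Product.norm_nth_le[of "T\<^sub>1\<^sub>2 (of_real r * cis s) v" i] R[OF that] by linarith
    fix C assume "\<And>z. 0 \<le> Im z \<Longrightarrow> norm (T\<^sub>1\<^sub>2 z v $ i) \<le> C"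
    then show ?thesis by blast
  qed (rule s)+
  then obtain C where C: "\<And>i z. 0 \<le> Im z \<Longrightarrow> norm (T\<^sub>1\<^sub>2 z v $ i) \<le> C i" by metis
  show ?thesis
  proof (intro exI allI impI)
    fix z :: complex assume "0 \<le> Im z"
    then show "norm (T\<^sub>1\<^sub>2 z v) \<le> (\<Sum>i\<in>UNIV. C i)"
      by (intro order_trans[OF norm_vec_le_sum] sum_mono C)
  qed
qed

text \<open>The flip symmetry carries the bound from the upper to the lower half-plane, and a
  bounded entire function is constant.\<close>

lemma transition_constant: "T\<^sub>1\<^sub>2 z v = T\<^sub>1\<^sub>2 0 v"
proof -
  obtain C1 where C1: "\<And>z. 0 \<le> Im z \<Longrightarrow> norm (T\<^sub>1\<^sub>2 z v) \<le> C1" using transition_bounded_upper by blast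
  obtain C2 where C2: "\<And>z. 0 \<le> Im z \<Longrightarrow> norm (T\<^sub>1\<^sub>2 z (flip_lower v)) \<le> C2" using transition_bounded_upper by blast
  have all: "norm (T\<^sub>1\<^sub>2 z v) \<le> max C1 C2" for z
  proof (cases "0 \<le> Im z")
    case True then show ?thesis using C1[of z] by simp
  next
    case False
    have "T\<^sub>1\<^sub>2 z v = flip_lower (T\<^sub>1\<^sub>2 (- z) (flip_lower v))" using transition_flip[OF L1 L2 cd, of "- z" "flip_lower v"] by simp
    then have "norm (T\<^sub>1\<^sub>2 z v) = norm (T\<^sub>1\<^sub>2 (- z) (flip_lower v))" by simp
    then show ?thesis using C2[of "- z"] False by simp
  qed
  have "T\<^sub>1\<^sub>2 z v $ i = T\<^sub>1\<^sub>2 0 v $ i" for i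
  proof -
    have bdd: "bounded (range (\<lambda>z. T\<^sub>1\<^sub>2 z v $ i))"
      unfolding bounded_iff using all Finite_Cartesian_Product.norm_nth_le order_trans by blast
    show ?thesis
      using Liouville_theorem[OF transition_holomorphic[OF L1 L2 cd] bdd] unfolding constant_on_def by auto
  qed
  then show ?thesis by (simp add: vec_eq_iff)
qed

text \<open>Along the ray, right Weyl data at \<open>d\<close> approach (u, iu), the vectors with p
  = 0, and their images have small \<open>p\<close>. Since the transition matrix is constant, the
  limit becomes an exact statement about its value at 0: it preserves the subspace p = 0.\<close>

lemma transition_pos_part_zero: "pos_part (T\<^sub>1\<^sub>2 0 (join u (\<i> *s u))) = 0"
proof -
  have small: "norm (pos_part (T\<^sub>1\<^sub>2 0 (join u (\<i> *s u)))) \<le> e * (3 * norm u + 2 * exp \<mu>\<^sub>1\<^sub>2 * norm u)" if e: "e > 0" "e \<le> 1" for e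
  proof -
    have "\<forall>\<^sub>F r::real in at_top. norm (pos_part (T\<^sub>1\<^sub>2 0 (join u (\<i> *s u)))) \<le> e * (3 * norm u + 2 * exp \<mu>\<^sub>1\<^sub>2 * norm u)"
      using eventually_transition_weyl[OF e(1)] eventually_near(2)[OF e(1)] eventually_Im_ge[OF s zero_less_one]
    proof eventually_elim
      case (elim r)
      let ?z = "of_real r * cis s"
      have Im: "Im ?z > 0" using elim(3) by blast
      let ?w = "weyl_dirac \<phi>\<^sub>2 ?z d {d..} *v u"
      have near: "norm (?w - \<i> *s u) \<le> e * norm u" using elim(2) by blast
      also have "\<dots> \<le> 1 * norm u" using e by (intro mult_right_mono) auto
      finally have "norm ?w \<le> 2 * norm u"
        using norm_triangle_ineq[of "?w - \<i> *s u" "\<i> *s u"] by (simp add: norm_scalar_mult_vec)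
      then have nj: "norm (join u ?w) \<le> 3 * norm u" using norm_join_le[of u ?w] by simp
      have "norm (pos_part (T\<^sub>1\<^sub>2 ?z (join u ?w))) \<le> e * norm (join u ?w)"
        using elim(1)[rule_format, OF weyl_flow_in_space[OF L2 herm2 Im, of d u]] L2 by simp
      then have 1: "norm (pos_part (T\<^sub>1\<^sub>2 0 (join u ?w))) \<le> e * (3 * norm u)"
        unfolding transition_constant[of ?z] using nj e by (meson less_imp_le mult_left_mono order_trans)
      have "join u (\<i> *s u) + join 0 (?w - \<i> *s u) = join u ?w" by (simp flip: join_add)
      then have "T\<^sub>1\<^sub>2 0 (join u ?w) = T\<^sub>1\<^sub>2 0 (join u (\<i> *s u)) + T\<^sub>1\<^sub>2 0 (join 0 (?w - \<i> *s u))"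
        using transition_add[OF L1 L2 cd, of 0 "join u (\<i> *s u)" "join 0 (?w - \<i> *s u)"] by simp
      then have "pos_part (T\<^sub>1\<^sub>2 0 (join u (\<i> *s u))) = pos_part (T\<^sub>1\<^sub>2 0 (join u ?w)) - pos_part (T\<^sub>1\<^sub>2 0 (join 0 (?w - \<i> *s u)))"
        by (simp add: pos_neg_part_linear)
      then have 2: "norm (pos_part (T\<^sub>1\<^sub>2 0 (join u (\<i> *s u)))) \<le> norm (pos_part (T\<^sub>1\<^sub>2 0 (join u ?w))) + norm (pos_part (T\<^sub>1\<^sub>2 0 (join 0 (?w - \<i> *s u))))"
        by (simp only: norm_triangle_ineq4)
      have "norm (pos_part (T\<^sub>1\<^sub>2 0 (join 0 (?w - \<i> *s u)))) \<le> 2 * norm (T\<^sub>1\<^sub>2 0 (join 0 (?w - \<i> *s u)))" by (rule norm_pos_part_le)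
      also have "\<dots> \<le> 2 * (norm (join 0 (?w - \<i> *s u)) * exp \<mu>\<^sub>1\<^sub>2)"
        using transition_bound[OF L1 L2 cd, of 0 "join 0 (?w - \<i> *s u)"] by simp
      also have "\<dots> \<le> 2 * ((e * norm u) * exp \<mu>\<^sub>1\<^sub>2)"
        using norm_join_le[of 0 "?w - \<i> *s u"] near by (intro mult_left_mono mult_right_mono) auto
      finally show ?case using 1 2 by (simp add: algebra_simps)
    qed
    \<comment> \<open>The inequality no longer contains \<open>r\<close>, so holding eventually
      means holding.\<close>
    then show ?thesis by (simp add: eventually_const)
  qed
  have "norm (pos_part (T\<^sub>1\<^sub>2 0 (join u (\<i> *s u)))) \<le> 0"
  proof (rule tendsto_lowerbound)
    have "((\<lambda>e. e * (3 * norm u + 2 * exp \<mu>\<^sub>1\<^sub>2 * norm u)) \<longlongrightarrow> 0 * (3 * norm u + 2 * exp \<mu>\<^sub>1\<^sub>2 * norm u)) (at_right 0)"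
      by (intro tendsto_intros)
    then show "((\<lambda>e. e * (3 * norm u + 2 * exp \<mu>\<^sub>1\<^sub>2 * norm u)) \<longlongrightarrow> 0) (at_right 0)" by simp
    show "\<forall>\<^sub>F e in at_right 0. norm (pos_part (T\<^sub>1\<^sub>2 0 (join u (\<i> *s u)))) \<le> e * (3 * norm u + 2 * exp \<mu>\<^sub>1\<^sub>2 * norm u)"
      using eventually_at_right_real[OF zero_less_one] by eventually_elim (use small in auto)
  qed simp
  then show ?thesis by simp
qed

text \<open>The flip fixes \<zeta> = 0, so the constant acts on q = 0 as it does on p = 0: (u, iu)
  goes to (y, iy) and (u, -iu) to (y, -iy) with the same y. Half sums and half differences give the
  same block on both components.\<close>

lemma transition_diagonal: "\<exists>y. T\<^sub>1\<^sub>2 0 (join u 0) = join y 0 \<and> T\<^sub>1\<^sub>2 0 (join 0 u) = join 0 y"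
proof -
  define w where "w = T\<^sub>1\<^sub>2 0 (join u (\<i> *s u))"
  define y where "y = upper w"
  have "upper w + \<i> *s lower w = 0" using transition_pos_part_zero[of u] by (simp add: w_def pos_part_def)
  then have h: "upper w = - (\<i> *s lower w)" by (rule eq_neg_iff_add_eq_0[THEN iffD2])
  have "lower w = \<i> *s y" unfolding y_def h by (simp add: vec_eq_iff)
  then have w: "T\<^sub>1\<^sub>2 0 (join u (\<i> *s u)) = join y (\<i> *s y)" unfolding w_def[symmetric] by (intro vec_sum_eqI) (simp_all add: y_def)
  have fj: "flip_lower (join a a') = join a (- a')" for a a' :: "complex^'m" by (simp add: flip_lower_def)
  have w': "T\<^sub>1\<^sub>2 0 (join u (- (\<i> *s u))) = join y (- (\<i> *s y))"
    using transition_flip[OF L1 L2 cd, of 0 "join u (\<i> *s u)"] unfolding w fj by simp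
  have 1: "join u 0 = (1/2) *s (join u (\<i> *s u) + join u (- (\<i> *s u)))" for u :: "complex^'m"
    by (rule vec_sum_eqI) (simp_all add: vec_eq_iff)
  have 2: "join 0 u = (- \<i>/2) *s (join u (\<i> *s u) + (- 1) *s join u (- (\<i> *s u)))" for u :: "complex^'m"
    by (rule vec_sum_eqI) (simp_all add: vec_eq_iff algebra_simps)
  note lin = transition_add[OF L1 L2 cd] transition_scalar[OF L1 L2 cd]
  have "T\<^sub>1\<^sub>2 0 (join u 0) = join y 0" unfolding 1[of u] 1[of y] lin w w' ..
  moreover have "T\<^sub>1\<^sub>2 0 (join 0 u) = join 0 y" unfolding 2[of u] 2[of y] lin w w' ..
  ultimately show ?thesis by blast
qed

end

section \<open>Matrix solutions at spectral parameter zero\<close>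

lemma bounded_bilinear_matrix_matrix_mult_complex:
  "bounded_bilinear ((**) :: complex^'n^'n \<Rightarrow> complex^'n^'n \<Rightarrow> complex^'n^'n)"
proof -
  have "bilinear ((**) :: complex^'n^'n \<Rightarrow> complex^'n^'n \<Rightarrow> complex^'n^'n)"
    unfolding bilinear_def
    by (intro conjI allI linearI)
      (simp_all add: vec_eq_iff matrix_matrix_mult_def sum.distrib algebra_simps scaleR_right.sum)
  then show ?thesis by (simp add: bilinear_conv_bounded_bilinear)
qed

lemma bounded_linear_adjoint_matrix: "bounded_linear (adjoint_matrix :: complex^'n^'n \<Rightarrow> complex^'n^'n)"
  by (intro linear_conv_bounded_linear[THEN iffD1] linearI)
    (simp_all add: adjoint_matrix_def transpose_def map_matrix_def vec_eq_iff)

lemma adjoint_matrix_simps: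
  "adjoint_matrix (A ** B) = adjoint_matrix B ** adjoint_matrix A" "adjoint_matrix (adjoint_matrix A) = A"
  "adjoint_matrix (mat 1) = mat 1" "adjoint_matrix (- A) = - adjoint_matrix A"
  for A B :: "complex^'n^'n"
  by (simp_all add: adjoint_matrix_def transpose_def map_matrix_def vec_eq_iff matrix_matrix_mult_def mat_def mult.commute)

lemma matrix_minus_mult: "(- A) ** B = - (A ** B)" "A ** (- B) = - (A ** B)" for A B :: "complex^'n^'n"
  by (simp_all add: vec_eq_iff matrix_matrix_mult_def sum_negf)

text \<open>The fundamental matrix of Y' = B Y, assembled from the flow with the parameter term
  switched off.\<close>

definition matrix_flow :: "(real \<Rightarrow> complex^'n^'n) \<Rightarrow> real \<Rightarrow> real \<Rightarrow> complex^'n^'n" where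
  "matrix_flow B c x = (\<chi> i j. linear_ode_flow B 0 c (axis j 1) 0 x $ i)"

lemma matrix_flow_base: "L1_loc B \<Longrightarrow> matrix_flow B c c = mat 1"
  by (auto simp: matrix_flow_def vec_eq_iff mat_def axis_def)

lemma ac_deriv_matrix_flow:
  assumes B: "L1_loc B"
  shows "ac_deriv a b (matrix_flow B c) (\<lambda>x. B x ** matrix_flow B c x)"
proof -
  let ?v = "\<lambda>j. linear_ode_flow B 0 c (axis j 1) 0"
  \<comment> \<open>\<open>?E j\<close> places a vector into column \<open>j\<close>, so that the
    matrix becomes a sum of linear images of its columns and inherits their derivatives.\<close>
  let ?E = "\<lambda>j (v :: complex^'a). (\<chi> i k. if k = j then v $ i else 0) :: complex^'a^'a"
  have "smult_matrix 0 (0 :: complex^'a^'a) = 0" by (simp add: smult_matrix_def map_matrix_def vec_eq_iff)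
  then have "ac_deriv a b (?v j) (\<lambda>x. B x *v ?v j x)" for j
    using linear_ode_flow_solution[OF B, of 0 0 c "axis j 1"] unfolding linear_ode_solution_def by simp
  moreover have "bounded_linear (?E j)" for j
    by (intro linear_conv_bounded_linear[THEN iffD1] linearI) (auto simp: vec_eq_iff)
  ultimately have "ac_deriv a b (\<lambda>x. ?E j (?v j x)) (\<lambda>x. ?E j (B x *v ?v j x))" for j
    by (rule ac_deriv_bounded_linear[rotated])
  then have "ac_deriv a b (\<lambda>x. \<Sum>j\<in>UNIV. ?E j (?v j x)) (\<lambda>x. \<Sum>j\<in>UNIV. ?E j (B x *v ?v j x))"
    by (rule ac_deriv_sum)
  moreover have "(\<Sum>j\<in>UNIV. ?E j (?v j x)) = matrix_flow B c x" for x
    by (simp add: vec_eq_iff matrix_flow_def sum_component)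
  moreover have "(\<Sum>j\<in>UNIV. ?E j (B x *v ?v j x)) = B x ** matrix_flow B c x" for x
    by (simp add: vec_eq_iff matrix_flow_def sum_component matrix_matrix_mult_def matrix_vector_mult_def)
  ultimately show ?thesis by simp
qed

lemma ac_deriv_matrix_vector:
  fixes M :: "real \<Rightarrow> complex^'n^'k"
  assumes "ac_deriv a b M M'" shows "ac_deriv a b (\<lambda>x. M x *v u) (\<lambda>x. M' x *v u)"
  by (rule ac_deriv_bounded_linear[OF bounded_bilinear.bounded_linear_left[OF bounded_bilinear_matrix_vector_mult_complex] assms])

lemma ac_deriv_zero_constant:
  fixes f :: "real \<Rightarrow> 'b::banach"
  assumes "ac_deriv a b f f'" "AE x in lebesgue. x \<in> {a..b} \<longrightarrow> f' x = 0" "x \<in> {a..b}"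
  shows "f x = f a"
proof -
  have "ac_deriv a b f (\<lambda>x. 0)" by (rule ac_deriv_cong_AE[OF assms(1,2)])
  from ac_deriv_has_integral[OF this, of a x] have "((\<lambda>x. 0) has_integral f x - f a) {a..x}" using assms(3) by simp
  then have "f x - f a = 0" using has_integral_0 has_integral_unique by blast
  then show ?thesis by simp
qed

text \<open>With Y' = -\<phi> Y and W' = \<phi> W the product W^* Y has derivative W^* \<phi> Y -
  W^* \<phi> Y = 0 a.e., so it stays the identity. For square matrices a left inverse is a right
  inverse, and taking adjoints gives the second identity.\<close>

lemma matrix_flow_wronskian:
  fixes \<phi> :: "real \<Rightarrow> complex^'m^'m::finite"
  assumes L: "L1_loc \<phi>" and herm: "AE x in lebesgue. \<phi> x = adjoint_matrix (\<phi> x)" and cx: "c \<le> x"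
  shows "matrix_flow (\<lambda>x. - \<phi> x) c x ** adjoint_matrix (matrix_flow \<phi> c x) = mat 1"
    and "matrix_flow \<phi> c x ** adjoint_matrix (matrix_flow (\<lambda>x. - \<phi> x) c x) = mat 1"
proof -
  let ?Y = "matrix_flow (\<lambda>x. - \<phi> x) c" and ?W = "matrix_flow \<phi> c"
  have Lm: "L1_loc (\<lambda>x. - \<phi> x)" by (rule L1_loc_bounded_linear[OF bounded_linear_minus[OF bounded_linear_ident] L])
  have ac: "ac_deriv c x (\<lambda>x. adjoint_matrix (?W x) ** ?Y x)
     (\<lambda>x. adjoint_matrix (?W x) ** (- \<phi> x ** ?Y x) + adjoint_matrix (\<phi> x ** ?W x) ** ?Y x)"
    by (rule ac_deriv_bounded_bilinear[OF bounded_bilinear_matrix_matrix_mult_complex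
          ac_deriv_bounded_linear[OF bounded_linear_adjoint_matrix ac_deriv_matrix_flow[OF L]] ac_deriv_matrix_flow[OF Lm]])
  have ae: "AE t in lebesgue. t \<in> {c..x} \<longrightarrow> adjoint_matrix (?W t) ** (- \<phi> t ** ?Y t) + adjoint_matrix (\<phi> t ** ?W t) ** ?Y t = 0"
    using herm
  proof eventually_elim
    case (elim t)
    have "adjoint_matrix (\<phi> t ** ?W t) ** ?Y t = adjoint_matrix (?W t) ** (\<phi> t ** ?Y t)"
      unfolding adjoint_matrix_simps elim[symmetric] by (rule matrix_mul_assoc[symmetric])
    then show ?case by (simp add: matrix_minus_mult)
  qed
  have "adjoint_matrix (?W x) ** ?Y x = adjoint_matrix (?W c) ** ?Y c"
    using ac_deriv_zero_constant[OF ac ae, of x] cx by simp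
  then have "adjoint_matrix (?W x) ** ?Y x = mat 1" by (simp add: matrix_flow_base[OF L] matrix_flow_base[OF Lm] adjoint_matrix_simps)
  then show 1: "?Y x ** adjoint_matrix (?W x) = mat 1" by (simp add: matrix_left_right_inverse)
  from arg_cong[OF 1, of adjoint_matrix] show "?W x ** adjoint_matrix (?Y x) = mat 1" by (simp add: adjoint_matrix_simps)
qed

lemma dirac_solution_zero_energy:
  fixes \<phi> :: "real \<Rightarrow> complex^'m^'m::finite"
  assumes L: "L1_loc \<phi>"
  shows "dirac_solution \<phi> 0 (\<lambda>x. join (matrix_flow (\<lambda>x. - \<phi> x) c x *v u) 0)"
    and "dirac_solution \<phi> 0 (\<lambda>x. join 0 (matrix_flow \<phi> c x *v u))"
proof -
  have Lm: "L1_loc (\<lambda>x. - \<phi> x)" by (rule L1_loc_bounded_linear[OF bounded_linear_minus[OF bounded_linear_ident] L])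
  have bl: "bounded_linear (\<lambda>y :: complex^'m. join y 0)" "bounded_linear (\<lambda>y :: complex^'m. join 0 y)"
    by (intro linear_conv_bounded_linear[THEN iffD1] linearI; auto simp: join_def vec_eq_iff split: sum.split)+
  have j: "join (- w) 0 = (dirac_coeff \<phi> x + smult_matrix 0 dirac_twist) *v join v 0"
    "join 0 w = (dirac_coeff \<phi> x + smult_matrix 0 dirac_twist) *v join 0 v" if "w = \<phi> x *v v" for x v w
    by (rule vec_sum_eqI; simp add: that matrix_vector_mult_add_rdistrib smult_matrix_vector_mult
        upper_lower_block matrix_minus_vector_mult)+
  show "dirac_solution \<phi> 0 (\<lambda>x. join (matrix_flow (\<lambda>x. - \<phi> x) c x *v u) 0)"
    unfolding dirac_solution_iff linear_ode_solution_def
    using ac_deriv_bounded_linear[OF bl(1) ac_deriv_matrix_vector[OF ac_deriv_matrix_flow[OF Lm]]]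
    by (simp add: j(1)[symmetric] matrix_minus_mult matrix_minus_vector_mult matrix_vector_mul_assoc[symmetric])
  show "dirac_solution \<phi> 0 (\<lambda>x. join 0 (matrix_flow \<phi> c x *v u))"
    unfolding dirac_solution_iff linear_ode_solution_def
    using ac_deriv_bounded_linear[OF bl(2) ac_deriv_matrix_vector[OF ac_deriv_matrix_flow[OF L]]]
    by (simp add: j(2)[symmetric] matrix_vector_mul_assoc[symmetric])
qed

section \<open>Recovery of the coefficient from the Weyl matrix\<close>

lemma weyl_dirac_uniqueness:
  fixes \<phi>\<^sub>1 \<phi>\<^sub>2 :: "real \<Rightarrow> complex^'m^'m::finite"
  assumes L1: "L1_loc \<phi>\<^sub>1" and L2: "L1_loc \<phi>\<^sub>2"
    and herm1: "AE x in lebesgue. \<phi>\<^sub>1 x = adjoint_matrix (\<phi>\<^sub>1 x)"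
    and herm2: "AE x in lebesgue. \<phi>\<^sub>2 x = adjoint_matrix (\<phi>\<^sub>2 x)"
    and s: "0 < s" "s < pi"
    and diff: "\<And>b. 0 < b \<Longrightarrow> b < a \<Longrightarrow> \<exists>K R0. \<forall>r u. R0 \<le> r \<longrightarrow>
        norm (weyl_dirac \<phi>\<^sub>1 (of_real r * cis s) c {c..} *v u - weyl_dirac \<phi>\<^sub>2 (of_real r * cis s) c {c..} *v u)
        \<le> K * exp (- 2 * (r * sin s) * b) * norm u"
  shows "AE x in lebesgue. x \<in> {c<..<c + a} \<longrightarrow> \<phi>\<^sub>1 x = \<phi>\<^sub>2 x"
proof -
  have Lm: "L1_loc (\<lambda>x. - \<phi> x)" if "L1_loc \<phi>" for \<phi> :: "real \<Rightarrow> complex^'m^'m"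
    by (rule L1_loc_bounded_linear[OF bounded_linear_minus[OF bounded_linear_ident] that])
  let ?Y1 = "matrix_flow (\<lambda>x. - \<phi>\<^sub>1 x) c" and ?Y2 = "matrix_flow (\<lambda>x. - \<phi>\<^sub>2 x) c"
  let ?W1 = "matrix_flow \<phi>\<^sub>1 c" and ?W2 = "matrix_flow \<phi>\<^sub>2 c"
  define G where "G = (\<lambda>x. ?Y1 x ** adjoint_matrix (?W2 x))"
  define H where "H = (\<lambda>x. ?W1 x ** adjoint_matrix (?Y2 x))"
  have base: "G c = mat 1" "H c = mat 1"
    by (simp_all add: G_def H_def matrix_flow_base L1 L2 Lm adjoint_matrix_simps)
  have GH: "G d = H d" if d: "c < d" "d < c + a" for d
  proof -
    \<comment> \<open>Halfway between d - c and \<open>a\<close>: large enough to beat the growth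
      over [c,d], small enough for the hypothesis.\<close>
    let ?b = "(d - c + a) / 2"
    have b: "0 < ?b" "?b < a" "d - c < ?b" using d by auto
    obtain K R0 where KR: "\<And>r u. R0 \<le> r \<Longrightarrow>
        norm (weyl_dirac \<phi>\<^sub>1 (of_real r * cis s) c {c..} *v u - weyl_dirac \<phi>\<^sub>2 (of_real r * cis s) c {c..} *v u)
        \<le> K * exp (- 2 * (r * sin s) * ?b) * norm u"
      using diff[OF b(1,2)] by blast
    let ?F = "transition \<phi>\<^sub>1 \<phi>\<^sub>2 c d 0"
    have diag: "\<exists>y. ?F (join u 0) = join y 0 \<and> ?F (join 0 u) = join 0 y" for u
      by (rule transition_diagonal[OF L1 L2 d(1) herm1 herm2 s b(3)]) (rule KR)
    have flow: "dirac_flow \<phi>\<^sub>1 0 c (join u 0) d = join (?Y1 d *v u) 0" "dirac_flow \<phi>\<^sub>1 0 c (join 0 u) d = join 0 (?W1 d *v u)" for u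
      using fun_cong[OF dirac_solution_eq_flow[OF L1 dirac_solution_zero_energy(1)[OF L1, of c u], of c], of d]
        fun_cong[OF dirac_solution_eq_flow[OF L1 dirac_solution_zero_energy(2)[OF L1, of c u], of c], of d]
      by (simp_all add: matrix_flow_base L1 Lm)
    have F: "?F (join (?Y2 d *v u) 0) = join (?Y1 d *v u) 0" "?F (join 0 (?W2 d *v u)) = join 0 (?W1 d *v u)" for u
      using transition_solution[OF L1 L2 d(1) dirac_solution_zero_energy(1)[OF L2, of c u]]
        transition_solution[OF L1 L2 d(1) dirac_solution_zero_energy(2)[OF L2, of c u]]
      by (simp_all add: matrix_flow_base L2 Lm flow)
    \<comment> \<open>Equality of the two diagonal blocks transfers the action on upper components,
      known from \<open>?Y1\<close> and \<open>?Y2\<close>, to lower components.\<close>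
    have low: "?F (join 0 (?Y2 d *v u)) = join 0 (?Y1 d *v u)" for u
    proof -
      obtain y where y: "?F (join (?Y2 d *v u) 0) = join y 0" "?F (join 0 (?Y2 d *v u)) = join 0 y"
        using diag[of "?Y2 d *v u"] by blast
      have "join y 0 = join (?Y1 d *v u) 0" using y(1) F(1)[of u] by simp
      from arg_cong[OF this, of upper] have "y = ?Y1 d *v u" by simp
      then show ?thesis using y(2) by simp
    qed
    have FG: "?F (join 0 w) = join 0 (G d *v w)" for w
    proof -
      have "?Y2 d *v (adjoint_matrix (?W2 d) *v w) = w"
        unfolding matrix_vector_mul_assoc[of "?Y2 d"] using matrix_flow_wronskian(1)[OF L2 herm2 less_imp_le[OF d(1)]] by simp
      then show ?thesis
        using low[of "adjoint_matrix (?W2 d) *v w"] by (simp add: G_def matrix_vector_mul_assoc)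
    qed
    \<comment> \<open>The lower block is computed twice, as \<open>G\<close> through the equality of
      the blocks and directly from the solutions \<open>?W1\<close> and \<open>?W2\<close>.\<close>
    have "G d *v (?W2 d *v u) = ?W1 d *v u" for u
      using arg_cong[OF trans[OF FG[symmetric] F(2)], of lower] by simp
    then have "G d ** ?W2 d = ?W1 d" by (intro matrix_eqI_vector) (simp add: matrix_vector_mul_assoc[symmetric])
    then have "G d ** (?W2 d ** adjoint_matrix (?Y2 d)) = H d" by (simp add: H_def matrix_mul_assoc)
    then show ?thesis using matrix_flow_wronskian(2)[OF L2 herm2 less_imp_le[OF d(1)]] by simp
  qed
  have G': "ac_deriv x y G (\<lambda>x. ?Y1 x ** adjoint_matrix (\<phi>\<^sub>2 x ** ?W2 x) + (- \<phi>\<^sub>1 x ** ?Y1 x) ** adjoint_matrix (?W2 x))" for x y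
    unfolding G_def
    by (rule ac_deriv_bounded_bilinear[OF bounded_bilinear_matrix_matrix_mult_complex ac_deriv_matrix_flow[OF Lm[OF L1]]
          ac_deriv_bounded_linear[OF bounded_linear_adjoint_matrix ac_deriv_matrix_flow[OF L2]]])
  have H': "ac_deriv x y H (\<lambda>x. ?W1 x ** adjoint_matrix (- \<phi>\<^sub>2 x ** ?Y2 x) + (\<phi>\<^sub>1 x ** ?W1 x) ** adjoint_matrix (?Y2 x))" for x y
    unfolding H_def
    by (rule ac_deriv_bounded_bilinear[OF bounded_bilinear_matrix_matrix_mult_complex ac_deriv_matrix_flow[OF L1]
          ac_deriv_bounded_linear[OF bounded_linear_adjoint_matrix ac_deriv_matrix_flow[OF Lm[OF L2]]]])
  have dG: "?Y1 x ** adjoint_matrix (\<phi>\<^sub>2 x ** ?W2 x) + (- \<phi>\<^sub>1 x ** ?Y1 x) ** adjoint_matrix (?W2 x) = G x ** \<phi>\<^sub>2 x - \<phi>\<^sub>1 x ** G x"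
    and dH: "?W1 x ** adjoint_matrix (- \<phi>\<^sub>2 x ** ?Y2 x) + (\<phi>\<^sub>1 x ** ?W1 x) ** adjoint_matrix (?Y2 x) = \<phi>\<^sub>1 x ** H x - H x ** \<phi>\<^sub>2 x"
    if "\<phi>\<^sub>2 x = adjoint_matrix (\<phi>\<^sub>2 x)" for x
    by (simp_all add: G_def H_def adjoint_matrix_simps that[symmetric] matrix_minus_mult matrix_mul_assoc)
  have G1: "G x = mat 1" if x: "x \<in> {c..<c + a}" for x
  proof -
    have GHx: "G t = H t" if "t \<in> {c..x}" for t
      using GH[of t] that x base by (cases "t = c") auto
    \<comment> \<open>The derivatives \<open>G ** \<phi>\<^sub>2 - \<phi>\<^sub>1 ** G\<close> and
      \<open>\<phi>\<^sub>1 ** H - H ** \<phi>\<^sub>2\<close> cancel where G = H. Working with the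
      sum avoids comparing the derivatives of two equal functions almost everywhere.\<close>
    have "(\<lambda>x. G x + H x) x = (\<lambda>x. G x + H x) c"
    proof (rule ac_deriv_zero_constant[OF ac_deriv_add[OF G' H']])
      show "AE t in lebesgue. t \<in> {c..x} \<longrightarrow>
        ?Y1 t ** adjoint_matrix (\<phi>\<^sub>2 t ** ?W2 t) + (- \<phi>\<^sub>1 t ** ?Y1 t) ** adjoint_matrix (?W2 t) +
        (?W1 t ** adjoint_matrix (- \<phi>\<^sub>2 t ** ?Y2 t) + (\<phi>\<^sub>1 t ** ?W1 t) ** adjoint_matrix (?Y2 t)) = 0"
        using herm2
      proof eventually_elim
        case (elim t)
        show ?case unfolding dG[OF elim] dH[OF elim] using GHx[of t] by simp
      qed
      show "x \<in> {c..x}" using x by simp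
    qed
    then have "G x + G x = mat 1 + mat 1" using GHx[of x] x base by simp
    then have "2 *\<^sub>R G x = 2 *\<^sub>R mat 1" by (simp only: scaleR_2)
    then show ?thesis by simp
  qed
  have "AE x in lebesgue. (G has_vector_derivative
      ?Y1 x ** adjoint_matrix (\<phi>\<^sub>2 x ** ?W2 x) + (- \<phi>\<^sub>1 x ** ?Y1 x) ** adjoint_matrix (?W2 x)) (at x)"
    using conjunct2[OF G'[unfolded ac_deriv_def]] by (rule AE_all_intervals)
  then show ?thesis
    using herm2
  proof eventually_elim
    case (elim x)
    show ?case
    proof
      assume x: "x \<in> {c<..<c + a}"
      \<comment> \<open>\<open>G\<close> is constant on the open interval, so its derivative at
        \<open>x\<close> is 0, while the equation with G = 1 makes it
        \<open>\<phi>\<^sub>2 x - \<phi>\<^sub>1 x\<close>.\<close>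
      have "((\<lambda>x. mat 1) has_vector_derivative 0) (at x)" by simp
      then have "(G has_vector_derivative 0) (at x)"
        by (rule has_vector_derivative_transform_within_open[where S = "{c<..<c + a}"]) (use x G1 in auto)
      from vector_derivative_unique_at[OF this elim(1)] have "G x ** \<phi>\<^sub>2 x - \<phi>\<^sub>1 x ** G x = 0"
        unfolding dG[OF elim(2)] ..
      then show "\<phi>\<^sub>1 x = \<phi>\<^sub>2 x" using G1[of x] x by simp
    qed
  qed
qed

lemma left_weyl_dirac_uniqueness:
  fixes \<phi>\<^sub>1 \<phi>\<^sub>2 :: "real \<Rightarrow> complex^'m^'m::finite"
  assumes L1: "L1_loc \<phi>\<^sub>1" and L2: "L1_loc \<phi>\<^sub>2"
    and herm1: "AE x in lebesgue. \<phi>\<^sub>1 x = adjoint_matrix (\<phi>\<^sub>1 x)"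
    and herm2: "AE x in lebesgue. \<phi>\<^sub>2 x = adjoint_matrix (\<phi>\<^sub>2 x)"
    and s: "0 < s" "s < pi"
    and diff: "\<And>b. 0 < b \<Longrightarrow> b < a \<Longrightarrow> \<exists>K R0. \<forall>r u. R0 \<le> r \<longrightarrow>
        norm (weyl_dirac \<phi>\<^sub>1 (of_real r * cis s) c {..c} *v u - weyl_dirac \<phi>\<^sub>2 (of_real r * cis s) c {..c} *v u)
        \<le> K * exp (- 2 * (r * sin s) * b) * norm u"
  shows "AE x in lebesgue. x \<in> {c - a<..<c} \<longrightarrow> \<phi>\<^sub>1 x = \<phi>\<^sub>2 x"
proof -
  let ?\<psi>1 = "reflect_pot \<phi>\<^sub>1" and ?\<psi>2 = "reflect_pot \<phi>\<^sub>2"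
  have "AE x in lebesgue. x \<in> {- c<..<- c + a} \<longrightarrow> ?\<psi>1 x = ?\<psi>2 x"
  proof (rule weyl_dirac_uniqueness[OF L1_loc_reflect_pot[OF L1] L1_loc_reflect_pot[OF L2]
        hermitian_reflect_pot[OF herm1] hermitian_reflect_pot[OF herm2] s])
    fix b assume b: "0 < b" "b < a"
    obtain K R0 where KR: "\<And>r u. R0 \<le> r \<Longrightarrow>
        norm (weyl_dirac \<phi>\<^sub>1 (of_real r * cis s) c {..c} *v u - weyl_dirac \<phi>\<^sub>2 (of_real r * cis s) c {..c} *v u)
        \<le> K * exp (- 2 * (r * sin s) * b) * norm u"
      using diff[OF b] by blast
    show "\<exists>K R0. \<forall>r u. R0 \<le> r \<longrightarrow>
        norm (weyl_dirac ?\<psi>1 (of_real r * cis s) (- c) {- c..} *v u - weyl_dirac ?\<psi>2 (of_real r * cis s) (- c) {- c..} *v u)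
        \<le> K * exp (- 2 * (r * sin s) * b) * norm u"
    proof (intro exI allI impI)
      \<comment> \<open>The bound r \<ge> 1 secures Im \<zeta> > 0, under which left and reflected
        right Weyl matrices are related.\<close>
      fix r u assume r: "max R0 1 \<le> r"
      have Im: "Im (of_real r * cis s) > 0" using r sin_gt_zero[OF s] by simp
      have neg: "norm (- v - - w) = norm (v - w)" for v w :: "complex^'m"
        by (metis minus_diff_minus norm_minus_cancel)
      show "norm (weyl_dirac ?\<psi>1 (of_real r * cis s) (- c) {- c..} *v u - weyl_dirac ?\<psi>2 (of_real r * cis s) (- c) {- c..} *v u)
        \<le> K * exp (- 2 * (r * sin s) * b) * norm u"
        using KR[of r u] r unfolding weyl_dirac_left[OF L1 herm1 Im] weyl_dirac_left[OF L2 herm2 Im] matrix_minus_vector_mult neg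
        by simp
    qed
  qed
  from AE_reflect[OF this] show ?thesis by (auto elim!: eventually_mono simp: reflect_pot_def)
qed

section \<open>The Weyl--Titchmarsh matrix along rays\<close>

lemma norm_matrix_sq: "(norm M)\<^sup>2 = (\<Sum>i\<in>UNIV. \<Sum>j\<in>UNIV. (norm (M $ i $ j))\<^sup>2)" for M :: "complex^'n^'k"
  by (simp add: norm_vec_def L2_set_def sum_nonneg)

lemma norm_transpose: "norm (transpose M) = norm M" for M :: "complex^'n^'k"
proof -
  have "(norm (transpose M))\<^sup>2 = (norm M)\<^sup>2"
    unfolding norm_matrix_sq transpose_def by (simp, rule sum.swap)
  then show ?thesis by simp
qed

lemma norm_matrix_matrix_mult: "norm (A ** B) \<le> norm A * norm B" for A :: "complex^'n^'k" and B :: "complex^'l^'n"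
proof -
  have row: "(A ** B) $ i = transpose B *v (A $ i)" for i
    by (simp add: vec_eq_iff matrix_matrix_mult_def matrix_vector_mult_def transpose_def mult.commute)
  have "norm (A ** B) = L2_set (\<lambda>i. norm ((A ** B) $ i)) UNIV" by (simp add: norm_vec_def)
  also have "\<dots> \<le> L2_set (\<lambda>i. norm (A $ i) * norm B) UNIV"
  proof (rule L2_set_mono)
    show "norm ((A ** B) $ i) \<le> norm (A $ i) * norm B" for i
      unfolding row using norm_matrix_vector_mult[of "transpose B" "A $ i"] by (simp add: norm_transpose mult.commute)
  qed simp
  also have "\<dots> = norm A * norm B"
    by (subst L2_set_left_distrib[symmetric]) (simp_all add: norm_vec_def)
  finally show ?thesis .
qed

text \<open>The norm of a matrix is the Frobenius norm, whereas the Weyl estimates are obtained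
  vector by vector. Testing on unit vectors bounds each entry, and the number of entries is the
  price.\<close>

lemma norm_matrix_le:
  fixes A :: "complex^'n^'k"
  assumes "\<And>u. norm (A *v u) \<le> C * norm u"
  shows "norm A \<le> real CARD('k) * real CARD('n) * C"
proof -
  have ij: "norm (A $ i $ j) \<le> C" for i j
  proof -
    have "A *v axis j 1 = column j A" by (simp add: vec_eq_iff matrix_vector_mult_def column_def axis_def if_distrib sum.delta cong: if_cong)
    then have "norm (column j A) \<le> C" using assms[of "axis j 1"] by (simp add: norm_axis_1)
    then show ?thesis using Finite_Cartesian_Product.norm_nth_le[of "column j A" i] by (simp add: column_def)
  qed
  have "norm A \<le> (\<Sum>i\<in>UNIV. norm (A $ i))" unfolding norm_vec_def by (rule L2_set_le_sum) simp
  also have "\<dots> \<le> (\<Sum>i\<in>(UNIV::'k set). \<Sum>j\<in>(UNIV::'n set). C)"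
    by (intro sum_mono order_trans[OF norm_vec_le_sum] ij)
  finally show ?thesis by (simp add: mult_ac)
qed

lemma norm_block_sq:
  fixes P :: "complex^'m^'m::finite"
  shows "(norm (block P Q R S))\<^sup>2 = (norm P)\<^sup>2 + (norm Q)\<^sup>2 + (norm R)\<^sup>2 + (norm S)\<^sup>2"
  unfolding norm_matrix_sq
  by (simp add: block_def UNIV_Plus_UNIV[symmetric] sum.Plus sum.distrib del: UNIV_Plus_UNIV)

lemma norm_block_le: "norm (block P Q R S) \<le> norm P + norm Q + norm R + norm S" for P :: "complex^'m^'m::finite"
proof (rule power2_le_imp_le)
  have "a\<^sup>2 + b\<^sup>2 + c\<^sup>2 + d\<^sup>2 \<le> (a + b + c + d)\<^sup>2" if "a \<ge> 0" "b \<ge> 0" "c \<ge> 0" "d \<ge> 0" for a b c d :: real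
    using that by (simp add: power2_eq_square algebra_simps)
  then show "(norm (block P Q R S))\<^sup>2 \<le> (norm P + norm Q + norm R + norm S)\<^sup>2" unfolding norm_block_sq by simp
qed simp

lemma norm_le_block: "norm P \<le> norm (block P Q R S)" "norm Q \<le> norm (block P Q R S)" for P :: "complex^'m^'m::finite"
proof -
  have "(norm P)\<^sup>2 \<le> (norm (block P Q R S))\<^sup>2" "(norm Q)\<^sup>2 \<le> (norm (block P Q R S))\<^sup>2" unfolding norm_block_sq by simp_all
  then show "norm P \<le> norm (block P Q R S)" "norm Q \<le> norm (block P Q R S)" using power2_le_imp_le norm_ge_zero by blast+
qed

lemma block_diff: "block P Q R S - block P' Q' R' S' = block (P - P') (Q - Q') (R - R') (S - S')"
  for P :: "complex^'m^'m::finite"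
  by (simp add: block_def vec_eq_iff split: sum.split)

lemma smult_matrix_simps:
  "smult_matrix z A ** B = smult_matrix z (A ** B)" "A ** smult_matrix z B = smult_matrix z (A ** B)"
  "smult_matrix z (smult_matrix w A) = smult_matrix (z * w) A" "smult_matrix 1 A = A"
  "smult_matrix z A - smult_matrix z A' = smult_matrix z (A - A')" "smult_matrix z A + smult_matrix z A' = smult_matrix z (A + A')"
  for A A' B :: "complex^'n^'n"
  by (simp_all add: smult_matrix_def map_matrix_def vec_eq_iff matrix_matrix_mult_def sum_distrib_left algebra_simps)

lemma matrix_sub_distrib:
  "A ** (B - C) = A ** B - A ** C" "(A - B) ** C = A ** C - B ** C" for A B C :: "complex^'n^'n"
  by (simp_all add: vec_eq_iff matrix_matrix_mult_def sum_subtractf algebra_simps)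

text \<open>\<open>matrix_inv\<close> is a choice among two-sided inverses; exhibiting one
  determines it, because inverses are unique.\<close>

lemma matrix_inv_smult:
  fixes A :: "complex^'n^'n"
  assumes "z \<noteq> 0" "A ** X = mat 1" shows "matrix_inv (smult_matrix z A) = smult_matrix (1 / z) X"
proof -
  have XA: "X ** A = mat 1" using assms(2) by (simp add: matrix_left_right_inverse)
  have 1: "smult_matrix z A ** smult_matrix (1 / z) X = mat 1" "smult_matrix (1 / z) X ** smult_matrix z A = mat 1"
    using assms XA by (simp_all add: smult_matrix_simps)
  then have "\<exists>Y. smult_matrix z A ** Y = mat 1 \<and> Y ** smult_matrix z A = mat 1" by blast
  from someI_ex[OF this] have inv: "matrix_inv (smult_matrix z A) ** smult_matrix z A = mat 1"
    unfolding matrix_inv_def by blast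
  have "matrix_inv (smult_matrix z A) = matrix_inv (smult_matrix z A) ** (smult_matrix z A ** smult_matrix (1 / z) X)"
    by (simp add: 1)
  also have "\<dots> = smult_matrix (1 / z) X" by (simp add: matrix_mul_assoc inv)
  finally show ?thesis .
qed

lemma sqrt_up_square_eq:
  assumes "Im \<zeta> > 0" shows "sqrt_up (\<zeta>\<^sup>2) = \<zeta>"
proof -
  have "csqrt ((- \<i> * \<zeta>)\<^sup>2) = - \<i> * \<zeta>" using assms by (intro csqrt_square) simp
  moreover have "(- \<i> * \<zeta>)\<^sup>2 = - (\<zeta>\<^sup>2)" by (simp add: power_mult_distrib)
  ultimately have "csqrt (- (\<zeta>\<^sup>2)) = - \<i> * \<zeta>" by metis
  then show ?thesis unfolding sqrt_up_def by simp
qed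

text \<open>Here z = \<zeta>^2 with \<zeta> = r cis(\<theta>/2). Half the angle lies in (0, pi), so
  the Dirac parameter runs along a ray in the upper half-plane and is the chosen root of z.\<close>

lemma eventually_ray_at_infinity:
  assumes \<theta>: "0 < \<theta>" "\<theta> < 2 * pi"
  shows "eventually P (ray_at_infinity \<theta>) \<longleftrightarrow> (\<forall>\<^sub>F r in at_top. P ((of_real r * cis (\<theta> / 2))\<^sup>2))"
proof -
  have sq: "(of_real r * cis (\<theta> / 2))\<^sup>2 = of_real (r\<^sup>2) * cis \<theta>" for r
    by (simp add: power_mult_distrib power2_eq_square cis_mult)
  have iff: "eventually P (ray_at_infinity \<theta>) \<longleftrightarrow> (\<exists>b. \<forall>z. b \<le> norm z \<longrightarrow> z \<noteq> 0 \<longrightarrow> Arg2pi z = \<theta> \<longrightarrow> P z)"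
    unfolding ray_at_infinity_def eventually_inf_principal eventually_at_infinity by auto
  show ?thesis
    unfolding iff eventually_at_top_linorder sq
  proof (intro iffI; elim exE)
    fix b assume b: "\<forall>z. b \<le> norm z \<longrightarrow> z \<noteq> 0 \<longrightarrow> Arg2pi z = \<theta> \<longrightarrow> P z"
    have "P (of_real (r\<^sup>2) * cis \<theta>)" if r: "max 1 b \<le> r" for r
    proof -
      let ?z = "of_real (r\<^sup>2) * cis \<theta>"
      have "r \<le> r\<^sup>2" using r by (simp add: power2_eq_square)
      then have n: "b \<le> norm ?z" using r by (simp add: norm_mult norm_power)
      have "r\<^sup>2 > 0" using r by simp
      then have "Arg2pi ?z = \<theta>" using \<theta> by (intro Arg2pi_unique[of "r\<^sup>2"]) (simp_all add: cis_conv_exp)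
      moreover have "?z \<noteq> 0" using r by simp
      ultimately show ?thesis using b n by blast
    qed
    then show "\<exists>N. \<forall>r\<ge>N. P (of_real (r\<^sup>2) * cis \<theta>)" by blast
  next
    fix N assume N: "\<forall>r\<ge>N. P (of_real (r\<^sup>2) * cis \<theta>)"
    have "P z" if z: "N\<^sup>2 \<le> norm z" "Arg2pi z = \<theta>" for z
    proof -
      have "N \<le> sqrt (norm z)" using real_le_rsqrt[OF z(1)] .
      then have "P (of_real ((sqrt (norm z))\<^sup>2) * cis \<theta>)" using N by blast
      moreover have "z = of_real ((sqrt (norm z))\<^sup>2) * cis \<theta>"
        using Arg2pi_eq[of z] z(2) by (simp add: cis_conv_exp)
      ultimately show ?thesis by simp
    qed
    then show "\<exists>b. \<forall>z. b \<le> norm z \<longrightarrow> z \<noteq> 0 \<longrightarrow> Arg2pi z = \<theta> \<longrightarrow> P z" by blast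
  qed
qed

section \<open>Between the Dirac Weyl matrices and the full Weyl-Titchmarsh matrix\<close>

text \<open>The Dirac Weyl matrices \<open>P = M\<^sub>+\<^sup>D\<close>, \<open>N = M\<^sub>-\<^sup>D\<close> at large \<open>\<zeta>\<close>, together with \<open>X = (N - P)\<^sup>-\<^sup>1\<close>.\<close>

definition weyl_bounds :: "real \<Rightarrow> complex^'m^'m \<Rightarrow> complex^'m^'m \<Rightarrow> complex^'m^'m \<Rightarrow> bool" where
  "weyl_bounds B P N X \<longleftrightarrow> (N - P) ** X = mat 1 \<and> X ** (N - P) = mat 1 \<and>
     norm P \<le> B \<and> norm N \<le> B \<and> norm X \<le> B \<and> norm (N - P) \<le> B \<and> norm (N + P) \<le> B"

text \<open>N - P is close to -2i, hence bounded below by 1 and invertible with |X u| \<le> |u|. The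
  constant is the operator bound 4 multiplied by the number of entries.\<close>

lemma weyl_bounds_near_i:
  fixes P N :: "complex^'m^'m::finite"
  assumes P: "\<And>u. norm (P *v u - \<i> *s u) \<le> 1/2 * norm u" and N: "\<And>u. norm (N *v u + \<i> *s u) \<le> 1/2 * norm u"
  obtains X where "weyl_bounds (4 * (real CARD('m))\<^sup>2) P N X"
proof -
  have iu: "norm (\<i> *s u) = norm u" "norm (2 *s (\<i> *s u)) = 2 * norm u" for u :: "complex^'m"
    by (simp_all add: norm_scalar_mult_vec)
  have nP: "norm (P *v u) \<le> 2 * norm u" for u
  proof -
    have "norm (P *v u) \<le> norm (P *v u - \<i> *s u) + norm (\<i> *s u)"
      using norm_triangle_ineq[of "P *v u - \<i> *s u" "\<i> *s u"] by simp
    then show ?thesis using P[of u] norm_ge_zero[of u] unfolding iu by linarith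
  qed
  have nN: "norm (N *v u) \<le> 2 * norm u" for u
  proof -
    have "norm (N *v u) \<le> norm (N *v u + \<i> *s u) + norm (\<i> *s u)"
      using norm_triangle_ineq4[of "N *v u + \<i> *s u" "\<i> *s u"] by simp
    then show ?thesis using N[of u] norm_ge_zero[of u] unfolding iu by linarith
  qed
  have Tge: "norm u \<le> norm ((N - P) *v u)" for u
  proof -
    have "2 *s (\<i> *s u) = - ((N - P) *v u) - (P *v u - \<i> *s u) + (N *v u + \<i> *s u)"
      by (simp add: vec_eq_iff matrix_vector_mult_diff_rdistrib)
    from arg_cong[OF this, of norm]
    have "norm (2 *s (\<i> *s u)) \<le> norm (- ((N - P) *v u)) + norm (P *v u - \<i> *s u) + norm (N *v u + \<i> *s u)"
      using norm_triangle_ineq[of "- ((N - P) *v u) - (P *v u - \<i> *s u)" "N *v u + \<i> *s u"]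
        norm_triangle_ineq4[of "- ((N - P) *v u)" "P *v u - \<i> *s u"] by linarith
    then show ?thesis using P[of u] N[of u] unfolding iu norm_minus_cancel by linarith
  qed
  have "\<forall>u. (N - P) *v u = 0 \<longrightarrow> u = 0" using Tge by (metis norm_le_zero_iff norm_zero)
  then obtain X where X: "X ** (N - P) = mat 1" using matrix_left_invertible_ker by metis
  then have X': "(N - P) ** X = mat 1" by (simp add: matrix_left_right_inverse)
  have nX: "norm (X *v u) \<le> 1 * norm u" for u
    using Tge[of "X *v u"] by (simp add: matrix_vector_mul_assoc X')
  have sum: "norm ((N - P) *v u) \<le> 4 * norm u" "norm ((N + P) *v u) \<le> 4 * norm u" for u
    using nP[of u] nN[of u] norm_triangle_ineq4[of "N *v u" "P *v u"] norm_triangle_ineq[of "N *v u" "P *v u"]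
    by (simp_all add: matrix_vector_mult_diff_rdistrib matrix_vector_mult_add_rdistrib)
  have sq: "real CARD('m) * real CARD('m) * C \<le> 4 * (real CARD('m))\<^sup>2" if "C \<le> 4" for C
    using mult_left_mono[OF that, of "real CARD('m) * real CARD('m)"] by (simp add: power2_eq_square)
  have "weyl_bounds (4 * (real CARD('m))\<^sup>2) P N X"
    unfolding weyl_bounds_def
    using X X' order_trans[OF norm_matrix_le[OF nP] sq] order_trans[OF norm_matrix_le[OF nN] sq] order_trans[OF norm_matrix_le[OF nX] sq]
      order_trans[OF norm_matrix_le[OF sum(1)] sq] order_trans[OF norm_matrix_le[OF sum(2)] sq] by simp
  then show ?thesis by (rule that)
qed

text \<open>With both half-line matrices scaled by \<zeta>, the inverse of their difference is X /
  \<zeta>. The powers of \<zeta> cancel in the off-diagonal blocks, and one factor \<zeta> survives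
  in the lower right corner.\<close>

lemma weyl_matrix_eq:
  fixes \<phi> :: "real \<Rightarrow> complex^'m^'m::finite"
  assumes Im: "Im \<zeta> > 0" and inv: "(weyl_dirac \<phi> \<zeta> c {..c} - weyl_dirac \<phi> \<zeta> c {c..}) ** X = mat 1"
  shows "weyl_matrix \<phi> (\<zeta>\<^sup>2) c =
    (let P = weyl_dirac \<phi> \<zeta> c {c..}; N = weyl_dirac \<phi> \<zeta> c {..c} in
     block (smult_matrix (1 / \<zeta>) X) (smult_matrix (1/2) (X ** (N + P))) (smult_matrix (1/2) ((N + P) ** X)) (smult_matrix \<zeta> (P ** X ** N)))"
proof -
  have "\<zeta> \<noteq> 0" using Im by auto
  then show ?thesis
    unfolding weyl_matrix_def weyl_half_def sqrt_up_square_eq[OF Im] Let_def smult_matrix_simps matrix_inv_smult[OF \<open>\<zeta> \<noteq> 0\<close> inv]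
    by simp
qed

text \<open>Differences of products are telescoped, and X1 - X2 = X1 ((N2 - P2) - (N1 - P1)) X2
  handles the inverses. The blocks contribute 2 + 2 + 2 + 4 = 10 times B^4 |\<zeta>| \<delta>, lower
  powers of B and of |\<zeta>| being enlarged by B \<ge> 1 and |\<zeta>| \<ge> 1.\<close>

lemma weyl_matrix_diff_le:
  fixes P1 P2 N1 N2 :: "complex^'m^'m::finite"
  assumes w1: "weyl_bounds B P1 N1 X1" and w2: "weyl_bounds B P2 N2 X2" and B: "B \<ge> 1" and z: "norm \<zeta> \<ge> 1"
    and P: "norm (P1 - P2) \<le> \<delta>" and N: "norm (N1 - N2) \<le> \<delta>"
  shows "norm (block (smult_matrix (1 / \<zeta>) X1) (smult_matrix (1/2) (X1 ** (N1 + P1))) (smult_matrix (1/2) ((N1 + P1) ** X1)) (smult_matrix \<zeta> (P1 ** X1 ** N1))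
     - block (smult_matrix (1 / \<zeta>) X2) (smult_matrix (1/2) (X2 ** (N2 + P2))) (smult_matrix (1/2) ((N2 + P2) ** X2)) (smult_matrix \<zeta> (P2 ** X2 ** N2)))
     \<le> 10 * B ^ 4 * norm \<zeta> * \<delta>"
proof -
  note b1 = w1[unfolded weyl_bounds_def] and b2 = w2[unfolded weyl_bounds_def]
  have \<delta>0: "\<delta> \<ge> 0" using P norm_ge_zero order_trans by blast
  have B0: "B \<ge> 0" using B by simp
  have mm: "norm (S ** T) \<le> s * t" if "norm S \<le> s" "norm T \<le> t" for S T :: "complex^'m^'m" and s t
    using norm_matrix_matrix_mult[of S T] mult_mono'[OF that] norm_ge_zero order_trans by blast
  have dS: "norm ((N1 + P1) - (N2 + P2)) \<le> 2 * \<delta>" "norm ((N2 - P2) - (N1 - P1)) \<le> 2 * \<delta>"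
    using norm_triangle_ineq[of "N1 - N2" "P1 - P2"] norm_triangle_ineq[of "N2 - N1" "P1 - P2"] P N
    by (simp_all add: algebra_simps norm_minus_commute)
  have "X1 - X2 = X1 ** ((N2 - P2) - (N1 - P1)) ** X2"
  proof -
    have "X1 ** ((N2 - P2) - (N1 - P1)) ** X2 = X1 ** ((N2 - P2) ** X2) - (X1 ** (N1 - P1)) ** X2"
      by (simp add: matrix_mul_assoc matrix_sub_distrib)
    then show ?thesis using b1 b2 by simp
  qed
  then have dX: "norm (X1 - X2) \<le> B * (2 * \<delta>) * B"
    using b1 b2 dS(2) mm by metis
  have 2: "norm (X1 ** (N1 + P1) - X2 ** (N2 + P2)) \<le> (B * (2 * \<delta>) * B) * B + B * (2 * \<delta>)"
  proof -
    have "X1 ** (N1 + P1) - X2 ** (N2 + P2) = (X1 - X2) ** (N1 + P1) + X2 ** ((N1 + P1) - (N2 + P2))"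
      by (simp only: matrix_sub_distrib) simp
    then show ?thesis using mm[OF dX, of "N1 + P1" B] mm[of X2 B, OF _ dS(1)] b1 b2 norm_triangle_mono by metis
  qed
  have 3: "norm ((N1 + P1) ** X1 - (N2 + P2) ** X2) \<le> B * (B * (2 * \<delta>) * B) + (2 * \<delta>) * B"
  proof -
    have "(N1 + P1) ** X1 - (N2 + P2) ** X2 = (N1 + P1) ** (X1 - X2) + ((N1 + P1) - (N2 + P2)) ** X2"
      by (simp only: matrix_sub_distrib) simp
    then show ?thesis using mm[OF _ dX, of "N1 + P1" B] mm[OF dS(1), of X2 B] b1 b2 norm_triangle_mono by metis
  qed
  have 4: "norm (P1 ** X1 ** N1 - P2 ** X2 ** N2) \<le> (\<delta> * B * B + B * (B * (2 * \<delta>) * B) * B) + B * B * \<delta>"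
  proof -
    have "P1 ** X1 ** N1 - P2 ** X2 ** N2 = ((P1 - P2) ** X1 ** N1 + P2 ** (X1 - X2) ** N1) + P2 ** X2 ** (N1 - N2)"
      by (simp only: matrix_sub_distrib) simp
    moreover have "norm ((P1 - P2) ** X1 ** N1) \<le> \<delta> * B * B" using mm[OF mm[OF P]] b1 by blast
    moreover have "norm (P2 ** (X1 - X2) ** N1) \<le> B * (B * (2 * \<delta>) * B) * B" using mm[OF mm[OF _ dX]] b1 b2 by blast
    moreover have "norm (P2 ** X2 ** (N1 - N2)) \<le> B * B * \<delta>" using mm[OF mm N] b2 by blast
    ultimately show ?thesis by (metis norm_triangle_mono)
  qed
  have pw: "B\<^sup>2 * \<delta> \<le> B ^ 4 * \<delta>" "B ^ 3 * \<delta> \<le> B ^ 4 * \<delta>" "B * \<delta> \<le> B ^ 4 * \<delta>"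
    using power_increasing[of 2 4 B] power_increasing[of 3 4 B] power_increasing[of 1 4 B] B \<delta>0 by (auto intro: mult_right_mono)
  have X: "norm (X1 - X2) \<le> 2 * (B ^ 4 * \<delta>)" using dX pw by (simp add: power2_eq_square mult_ac)
  have XS: "norm (X1 ** (N1 + P1) - X2 ** (N2 + P2)) \<le> 4 * (B ^ 4 * \<delta>)"
    using 2 pw by (simp add: power3_eq_cube algebra_simps)
  have SX: "norm ((N1 + P1) ** X1 - (N2 + P2) ** X2) \<le> 4 * (B ^ 4 * \<delta>)"
    using 3 pw by (simp add: power3_eq_cube algebra_simps)
  have PXN: "norm (P1 ** X1 ** N1 - P2 ** X2 ** N2) \<le> 4 * (B ^ 4 * \<delta>)"
    using 4 pw by (simp add: power2_eq_square power4_eq_xxxx algebra_simps)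
  have t0: "B ^ 4 * \<delta> \<ge> 0" using B0 \<delta>0 by simp
  have "norm (1 / \<zeta>) \<le> 1" using z by (simp add: norm_divide divide_le_eq)
  then have iz: "norm (1 / \<zeta>) \<le> norm \<zeta>" using z by (rule order_trans)
  have s1: "norm (smult_matrix (1 / \<zeta>) (X1 - X2)) \<le> norm \<zeta> * (2 * (B ^ 4 * \<delta>))"
    unfolding norm_smult_matrix by (rule mult_mono[OF iz X]) (auto intro: order_trans[OF _ z])
  have s2: "norm (smult_matrix (1/2) (X1 ** (N1 + P1) - X2 ** (N2 + P2))) \<le> norm \<zeta> * (2 * (B ^ 4 * \<delta>))"
    "norm (smult_matrix (1/2) ((N1 + P1) ** X1 - (N2 + P2) ** X2)) \<le> norm \<zeta> * (2 * (B ^ 4 * \<delta>))"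
    using XS SX mult_right_mono[OF z, of "2 * (B ^ 4 * \<delta>)"] t0 unfolding norm_smult_matrix by simp_all
  have s4: "norm (smult_matrix \<zeta> (P1 ** X1 ** N1 - P2 ** X2 ** N2)) \<le> norm \<zeta> * (4 * (B ^ 4 * \<delta>))"
    unfolding norm_smult_matrix by (rule mult_left_mono[OF PXN]) simp
  show ?thesis
    unfolding block_diff smult_matrix_simps using order_trans[OF norm_block_le add_mono[OF add_mono[OF add_mono[OF s1 s2(1)] s2(2)] s4]]
    by (simp add: algebra_simps)
qed

text \<open>The upper row contains all the information: X is the inverse of N - P, and N + P = (N -
  P) (X (N + P)). Recovering X from X / \<zeta> costs the factor |\<zeta>|; half sum and half
  difference of N + P and N - P then give N and P.\<close>

lemma weyl_dirac_diff_le: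
  fixes P1 P2 N1 N2 :: "complex^'m^'m::finite"
  assumes w1: "weyl_bounds B P1 N1 X1" and w2: "weyl_bounds B P2 N2 X2" and B: "B \<ge> 1" and z: "norm \<zeta> \<ge> 1"
    and le: "norm (block (smult_matrix (1 / \<zeta>) X1) (smult_matrix (1/2) (X1 ** (N1 + P1))) (smult_matrix (1/2) ((N1 + P1) ** X1)) (smult_matrix \<zeta> (P1 ** X1 ** N1))
     - block (smult_matrix (1 / \<zeta>) X2) (smult_matrix (1/2) (X2 ** (N2 + P2))) (smult_matrix (1/2) ((N2 + P2) ** X2)) (smult_matrix \<zeta> (P2 ** X2 ** N2))) \<le> \<eta>"
  shows "norm (P1 - P2) \<le> 4 * B ^ 4 * norm \<zeta> * \<eta>" and "norm (N1 - N2) \<le> 4 * B ^ 4 * norm \<zeta> * \<eta>"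
proof -
  note b1 = w1[unfolded weyl_bounds_def] and b2 = w2[unfolded weyl_bounds_def]
  have \<eta>0: "\<eta> \<ge> 0" using le norm_ge_zero order_trans by blast
  have B0: "B \<ge> 0" using B by simp
  have mm: "norm (S ** T) \<le> s * t" if "norm S \<le> s" "norm T \<le> t" for S T :: "complex^'m^'m" and s t
    using norm_matrix_matrix_mult[of S T] mult_mono'[OF that] norm_ge_zero order_trans by blast
  note le' = le[unfolded block_diff smult_matrix_simps]
  have "norm (smult_matrix (1 / \<zeta>) (X1 - X2)) \<le> \<eta>" using order_trans[OF norm_le_block(1) le'] .
  then have dX: "norm (X1 - X2) \<le> norm \<zeta> * \<eta>" using z unfolding norm_smult_matrix
    by (simp add: norm_divide pos_divide_le_eq[OF less_le_trans[OF zero_less_one z]] mult.commute)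
  have "norm (smult_matrix (1/2) (X1 ** (N1 + P1) - X2 ** (N2 + P2))) \<le> \<eta>" using order_trans[OF norm_le_block(2) le'] .
  then have dXS: "norm (X1 ** (N1 + P1) - X2 ** (N2 + P2)) \<le> 2 * \<eta>" unfolding norm_smult_matrix by simp
  let ?w1 = "N1 - P1" and ?w2 = "N2 - P2"
  have "?w1 - ?w2 = ?w1 ** (X2 - X1) ** ?w2"
  proof -
    have "S ** (X2 - X1) ** T = S ** (X2 ** T) - (S ** X1) ** T" for S T :: "complex^'m^'m"
      by (simp only: matrix_mul_assoc matrix_sub_distrib)
    from this[of ?w1 ?w2] show ?thesis using b1 b2 by simp
  qed
  moreover have "norm (X2 - X1) \<le> norm \<zeta> * \<eta>" using dX by (simp add: norm_minus_commute)
  ultimately have dw: "norm (?w1 - ?w2) \<le> B * (norm \<zeta> * \<eta>) * B" using b1 b2 mm by metis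
  have S: "N1 + P1 = ?w1 ** (X1 ** (N1 + P1))" "N2 + P2 = ?w2 ** (X2 ** (N2 + P2))"
    using b1 b2 by (simp_all add: matrix_mul_assoc)
  have "(N1 + P1) - (N2 + P2) = (?w1 - ?w2) ** (X1 ** (N1 + P1)) + ?w2 ** (X1 ** (N1 + P1) - X2 ** (N2 + P2))"
  proof -
    have "(?w1 - ?w2) ** (X1 ** (N1 + P1)) + ?w2 ** (X1 ** (N1 + P1) - X2 ** (N2 + P2))
       = ?w1 ** (X1 ** (N1 + P1)) - ?w2 ** (X2 ** (N2 + P2))"
      by (simp only: matrix_sub_distrib) simp
    then show ?thesis using S by simp
  qed
  moreover have "norm ((?w1 - ?w2) ** (X1 ** (N1 + P1))) \<le> B * (norm \<zeta> * \<eta>) * B * (B * B)" using mm[OF dw mm] b1 by blast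
  moreover have "norm (?w2 ** (X1 ** (N1 + P1) - X2 ** (N2 + P2))) \<le> B * (2 * \<eta>)" using mm[OF _ dXS] b2 by blast
  ultimately have dS: "norm ((N1 + P1) - (N2 + P2)) \<le> B * (norm \<zeta> * \<eta>) * B * (B * B) + B * (2 * \<eta>)" by (metis norm_triangle_mono)
  define t where "t = B ^ 4 * norm \<zeta> * \<eta>"
  have p: "B\<^sup>2 * (norm \<zeta> * \<eta>) \<le> t" "B * \<eta> \<le> t"
  proof -
    have "B\<^sup>2 \<le> B ^ 4" "B ^ 1 \<le> B ^ 4" using B by (intro power_increasing; simp)+
    then show "B\<^sup>2 * (norm \<zeta> * \<eta>) \<le> t" unfolding t_def mult.assoc using \<eta>0 by (intro mult_right_mono) simp_all
    have "B * 1 \<le> B ^ 4 * norm \<zeta>" using \<open>B ^ 1 \<le> B ^ 4\<close> z B0 by (intro mult_mono) simp_all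
    then show "B * \<eta> \<le> t" unfolding t_def using \<eta>0 by (intro mult_right_mono) simp_all
  qed
  have dw': "norm (?w1 - ?w2) \<le> t" using dw p(1) by (simp add: power2_eq_square mult_ac)
  have dS': "norm ((N1 + P1) - (N2 + P2)) \<le> 3 * t" using dS p(2) by (simp add: t_def power4_eq_xxxx mult_ac)
  have t0: "t \<ge> 0" using dw' norm_ge_zero order_trans by blast
  have "2 *\<^sub>R (P1 - P2) = ((N1 + P1) - (N2 + P2)) - (?w1 - ?w2)" "2 *\<^sub>R (N1 - N2) = ((N1 + P1) - (N2 + P2)) + (?w1 - ?w2)"
    by (simp_all add: scaleR_2)
  from this[THEN arg_cong[of _ _ norm]] have "norm (2 *\<^sub>R (P1 - P2)) \<le> 4 * t" "norm (2 *\<^sub>R (N1 - N2)) \<le> 4 * t"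
    using dw' dS' norm_triangle_ineq4[of "(N1 + P1) - (N2 + P2)" "?w1 - ?w2"] norm_triangle_ineq[of "(N1 + P1) - (N2 + P2)" "?w1 - ?w2"]
    by linarith+
  then have "norm (P1 - P2) \<le> 4 * t" "norm (N1 - N2) \<le> 4 * t" using t0 by simp_all
  moreover have "4 * B ^ 4 * norm \<zeta> * \<eta> = 4 * t" by (simp only: t_def mult.assoc)
  ultimately show "norm (P1 - P2) \<le> 4 * B ^ 4 * norm \<zeta> * \<eta>" "norm (N1 - N2) \<le> 4 * B ^ 4 * norm \<zeta> * \<eta>"
    by (simp_all only:)
qed

lemma eventually_weyl_bounds:
  fixes \<phi> :: "real \<Rightarrow> complex^'m^'m::finite"
  assumes L: "L1_loc \<phi>" and herm: "AE x in lebesgue. \<phi> x = adjoint_matrix (\<phi> x)" and s: "0 < s" "s < pi"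
  shows "\<forall>\<^sub>F r in at_top. \<exists>X. weyl_bounds (4 * (real CARD('m))\<^sup>2)
    (weyl_dirac \<phi> (of_real r * cis s) c {c..}) (weyl_dirac \<phi> (of_real r * cis s) c {..c}) X"
proof -
  have half: "(0::real) < 1/2" by simp
  show ?thesis
  proof (rule weyl_dirac_near_i[OF L herm half, of c], rule left_weyl_dirac_near_i[OF L herm half, of c])
    fix R R' :: real
    assume R: "R > 0" "\<And>\<zeta> u. R \<le> Im \<zeta> \<Longrightarrow> norm (weyl_dirac \<phi> \<zeta> c {c..} *v u - \<i> *s u) \<le> 1/2 * norm u"
      and R': "R' > 0" "\<And>\<zeta> u. R' \<le> Im \<zeta> \<Longrightarrow> norm (weyl_dirac \<phi> \<zeta> c {..c} *v u + \<i> *s u) \<le> 1/2 * norm u"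
    show ?thesis
      using eventually_Im_ge[OF s R(1)] eventually_Im_ge[OF s R'(1)]
    proof eventually_elim
      case (elim r)
      show ?case
        by (rule weyl_bounds_near_i[OF R(2) R'(2)]) (use elim in auto)
    qed
  qed
qed

section \<open>The two directions along a ray\<close>

context
  fixes \<phi>\<^sub>1 \<phi>\<^sub>2 :: "real \<Rightarrow> complex^'m^'m::finite" and c a :: real
  assumes a: "a > 0" and L: "L1_loc \<phi>\<^sub>1" "L1_loc \<phi>\<^sub>2"
    and herm: "AE x in lebesgue. \<phi>\<^sub>1 x = adjoint_matrix (\<phi>\<^sub>1 x)" "AE x in lebesgue. \<phi>\<^sub>2 x = adjoint_matrix (\<phi>\<^sub>2 x)"
begin

lemma weyl_matrix_local:
  assumes eq: "AE x in lebesgue. x \<in> {c - a<..<c + a} \<longrightarrow> \<phi>\<^sub>1 x = \<phi>\<^sub>2 x" and \<theta>: "0 < \<theta>" "\<theta> < 2 * pi"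
  shows "(\<lambda>z. norm (weyl_matrix \<phi>\<^sub>1 z c - weyl_matrix \<phi>\<^sub>2 z c))
    \<in> O[ray_at_infinity \<theta>](\<lambda>z. norm (sqrt_up z) * exp (- 2 * Im (sqrt_up z) * a))"
proof -
  let ?n = "real CARD('m)"
  define B where "B = 4 * ?n\<^sup>2"
  have n1: "?n \<ge> 1" by simp
  then have B: "B \<ge> 1" unfolding B_def using one_le_power[OF n1, of 2] by linarith
  have s: "0 < \<theta> / 2" "\<theta> / 2 < pi" using \<theta> by auto
  have eqr: "AE x in lebesgue. x \<in> {c<..<c + a} \<longrightarrow> \<phi>\<^sub>1 x = \<phi>\<^sub>2 x"
    and eql: "AE x in lebesgue. x \<in> {c - a<..<c} \<longrightarrow> \<phi>\<^sub>1 x = \<phi>\<^sub>2 x"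
    using eq a by (auto elim!: eventually_mono)
  show ?thesis
  proof (rule weyl_dirac_local[OF L herm a eqr], rule left_weyl_dirac_local[OF L herm a eql])
    fix K R K' R'
    assume R: "R > 0" "\<And>\<zeta> u. R \<le> Im \<zeta> \<Longrightarrow>
        norm (weyl_dirac \<phi>\<^sub>1 \<zeta> c {c..} *v u - weyl_dirac \<phi>\<^sub>2 \<zeta> c {c..} *v u) \<le> K * exp (- 2 * Im \<zeta> * a) * norm u"
      and R': "R' > 0" "\<And>\<zeta> u. R' \<le> Im \<zeta> \<Longrightarrow>
        norm (weyl_dirac \<phi>\<^sub>1 \<zeta> c {..c} *v u - weyl_dirac \<phi>\<^sub>2 \<zeta> c {..c} *v u) \<le> K' * exp (- 2 * Im \<zeta> * a) * norm u"
    \<comment> \<open>The square of the dimension turns vectorwise estimates into Frobenius norms,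
      and the sum of the two constants serves both half-lines at once.\<close>
    define k where "k = ?n * ?n * (\<bar>K\<bar> + \<bar>K'\<bar>)"
    show ?thesis
    proof (rule bigoI[where c = "10 * B ^ 4 * k"], unfold eventually_ray_at_infinity[OF \<theta>])
      show "\<forall>\<^sub>F r in at_top. norm (norm (weyl_matrix \<phi>\<^sub>1 ((of_real r * cis (\<theta> / 2))\<^sup>2) c - weyl_matrix \<phi>\<^sub>2 ((of_real r * cis (\<theta> / 2))\<^sup>2) c))
         \<le> 10 * B ^ 4 * k * norm (norm (sqrt_up ((of_real r * cis (\<theta> / 2))\<^sup>2)) * exp (- 2 * Im (sqrt_up ((of_real r * cis (\<theta> / 2))\<^sup>2)) * a))"
        using eventually_weyl_bounds[OF L(1) herm(1) s, of c] eventually_weyl_bounds[OF L(2) herm(2) s, of c]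
          eventually_Im_ge[OF s R(1)] eventually_Im_ge[OF s R'(1)] eventually_ge_at_top[of 1]
      proof eventually_elim
        case (elim r)
        define \<zeta> where "\<zeta> = of_real r * cis (\<theta> / 2)"
        have Im: "Im \<zeta> > 0" and ge: "R \<le> Im \<zeta>" "R' \<le> Im \<zeta>" using elim(3,4) by (auto simp: \<zeta>_def)
        have n\<zeta>: "norm \<zeta> \<ge> 1" using elim(5) by (simp add: \<zeta>_def norm_mult)
        let ?P1 = "weyl_dirac \<phi>\<^sub>1 \<zeta> c {c..}" and ?N1 = "weyl_dirac \<phi>\<^sub>1 \<zeta> c {..c}"
        let ?P2 = "weyl_dirac \<phi>\<^sub>2 \<zeta> c {c..}" and ?N2 = "weyl_dirac \<phi>\<^sub>2 \<zeta> c {..c}"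
        obtain X1 X2 where X: "weyl_bounds B ?P1 ?N1 X1" "weyl_bounds B ?P2 ?N2 X2"
          using elim(1,2) unfolding B_def \<zeta>_def by blast
        have ex: "exp (- 2 * Im \<zeta> * a) \<ge> 0" by simp
        have dP: "norm (?P1 - ?P2) \<le> k * exp (- 2 * Im \<zeta> * a)"
        proof -
          have "norm ((?P1 - ?P2) *v u) \<le> ((\<bar>K\<bar> + \<bar>K'\<bar>) * exp (- 2 * Im \<zeta> * a)) * norm u" for u
            unfolding matrix_vector_mult_diff_rdistrib
            by (rule order_trans[OF R(2)[OF ge(1)]]) (intro mult_right_mono, auto)
          from norm_matrix_le[OF this] show ?thesis by (simp add: k_def mult.assoc)
        qed
        have dN: "norm (?N1 - ?N2) \<le> k * exp (- 2 * Im \<zeta> * a)"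
        proof -
          have "norm ((?N1 - ?N2) *v u) \<le> ((\<bar>K\<bar> + \<bar>K'\<bar>) * exp (- 2 * Im \<zeta> * a)) * norm u" for u
            unfolding matrix_vector_mult_diff_rdistrib
            by (rule order_trans[OF R'(2)[OF ge(2)]]) (intro mult_right_mono, auto)
          from norm_matrix_le[OF this] show ?thesis by (simp add: k_def mult.assoc)
        qed
        have "norm (weyl_matrix \<phi>\<^sub>1 (\<zeta>\<^sup>2) c - weyl_matrix \<phi>\<^sub>2 (\<zeta>\<^sup>2) c) \<le> 10 * B ^ 4 * norm \<zeta> * (k * exp (- 2 * Im \<zeta> * a))"
          using weyl_matrix_diff_le[OF X B n\<zeta> dP dN] X
          unfolding weyl_matrix_eq[OF Im conjunct1[OF X(1)[unfolded weyl_bounds_def]]]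
            weyl_matrix_eq[OF Im conjunct1[OF X(2)[unfolded weyl_bounds_def]]] Let_def by simp
        then show ?case unfolding \<zeta>_def[symmetric] sqrt_up_square_eq[OF Im] by (simp add: mult_ac)
      qed
    qed
  qed
qed

text \<open>From exp t \<ge> t^2/2: a polynomial factor can be paid for with an arbitrarily small
  part of the exponential rate.\<close>

lemma power2_exp_le:
  fixes r k :: real
  assumes "k > 0" "r \<ge> 0" shows "r\<^sup>2 * exp (- k * r) \<le> 2 / k\<^sup>2"
proof -
  have "(k * r)\<^sup>2 / 2 \<le> exp (k * r)"
    using exp_lower_Taylor_quadratic[of "k * r"] assms mult_nonneg_nonneg[of k r] by linarith
  then have "(k * r)\<^sup>2 / 2 * exp (- k * r) \<le> exp (k * r) * exp (- k * r)" by (rule mult_right_mono) simp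
  also have "\<dots> = 1" by (simp flip: exp_add)
  finally show ?thesis using assms by (simp add: field_simps power_mult_distrib)
qed

text \<open>Two factors |\<zeta>| stand in the way, one from the hypothesis and one from recovering
  the Dirac Weyl matrices. Any b < a leaves room in the exponent to absorb their product
  r^2.\<close>

lemma weyl_dirac_diff_of_weyl_matrix:
  assumes \<theta>: "0 < \<theta>" "\<theta> < 2 * pi" and b: "0 < b" "b < a"
    and O: "\<And>\<epsilon>. \<epsilon> > 0 \<Longrightarrow> (\<lambda>z. norm (weyl_matrix \<phi>\<^sub>1 z c - weyl_matrix \<phi>\<^sub>2 z c))
      \<in> O[ray_at_infinity \<theta>](\<lambda>z. norm (sqrt_up z) * exp (- 2 * Im (sqrt_up z) * (a - \<epsilon>)))"
  obtains K where "\<forall>\<^sub>F r in at_top.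
      norm (weyl_dirac \<phi>\<^sub>1 (of_real r * cis (\<theta> / 2)) c {c..} - weyl_dirac \<phi>\<^sub>2 (of_real r * cis (\<theta> / 2)) c {c..})
        \<le> K * exp (- 2 * (r * sin (\<theta> / 2)) * b) \<and>
      norm (weyl_dirac \<phi>\<^sub>1 (of_real r * cis (\<theta> / 2)) c {..c} - weyl_dirac \<phi>\<^sub>2 (of_real r * cis (\<theta> / 2)) c {..c})
        \<le> K * exp (- 2 * (r * sin (\<theta> / 2)) * b)"
proof -
  let ?n = "real CARD('m)"
  define B where "B = 4 * ?n\<^sup>2"
  have n1: "?n \<ge> 1" by simp
  then have B: "B \<ge> 1" unfolding B_def using one_le_power[OF n1, of 2] by linarith
  have s: "0 < \<theta> / 2" "\<theta> / 2 < pi" using \<theta> by auto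
  \<comment> \<open>Half of the gap a - b goes into \<epsilon>; the other half gives the factor
    exp(-k r) that pays for r^2.\<close>
  define \<epsilon> where "\<epsilon> = (a - b) / 2"
  have \<epsilon>: "\<epsilon> > 0" using b by (simp add: \<epsilon>_def)
  obtain C where C: "C > 0" "\<forall>\<^sub>F z in ray_at_infinity \<theta>. norm (norm (weyl_matrix \<phi>\<^sub>1 z c - weyl_matrix \<phi>\<^sub>2 z c))
      \<le> C * norm (norm (sqrt_up z) * exp (- 2 * Im (sqrt_up z) * (a - \<epsilon>)))"
    using landau_o.bigE[OF O[OF \<epsilon>]] by blast
  define k where "k = sin (\<theta> / 2) * (a - b)"
  have k: "k > 0" using sin_gt_zero[OF s] b by (simp add: k_def)
  show ?thesis
  proof (rule that[of "4 * B ^ 4 * C * (2 / k\<^sup>2)"])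
    show "\<forall>\<^sub>F r in at_top.
      norm (weyl_dirac \<phi>\<^sub>1 (of_real r * cis (\<theta> / 2)) c {c..} - weyl_dirac \<phi>\<^sub>2 (of_real r * cis (\<theta> / 2)) c {c..})
        \<le> 4 * B ^ 4 * C * (2 / k\<^sup>2) * exp (- 2 * (r * sin (\<theta> / 2)) * b) \<and>
      norm (weyl_dirac \<phi>\<^sub>1 (of_real r * cis (\<theta> / 2)) c {..c} - weyl_dirac \<phi>\<^sub>2 (of_real r * cis (\<theta> / 2)) c {..c})
        \<le> 4 * B ^ 4 * C * (2 / k\<^sup>2) * exp (- 2 * (r * sin (\<theta> / 2)) * b)"
      using C(2)[unfolded eventually_ray_at_infinity[OF \<theta>]]
        eventually_weyl_bounds[OF L(1) herm(1) s, of c] eventually_weyl_bounds[OF L(2) herm(2) s, of c]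
        eventually_Im_ge[OF s zero_less_one] eventually_ge_at_top[of 1]
    proof eventually_elim
      case (elim r)
      define \<zeta> where "\<zeta> = of_real r * cis (\<theta> / 2)"
      have Im: "Im \<zeta> > 0" using elim(4) by (simp add: \<zeta>_def)
      have Im': "Im \<zeta> = r * sin (\<theta> / 2)" by (simp add: \<zeta>_def)
      have nr: "norm \<zeta> = r" using elim(5) by (simp add: \<zeta>_def norm_mult)
      have n\<zeta>: "norm \<zeta> \<ge> 1" using elim(5) nr by simp
      let ?P1 = "weyl_dirac \<phi>\<^sub>1 \<zeta> c {c..}" and ?N1 = "weyl_dirac \<phi>\<^sub>1 \<zeta> c {..c}"
      let ?P2 = "weyl_dirac \<phi>\<^sub>2 \<zeta> c {c..}" and ?N2 = "weyl_dirac \<phi>\<^sub>2 \<zeta> c {..c}"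
      obtain X1 X2 where X: "weyl_bounds B ?P1 ?N1 X1" "weyl_bounds B ?P2 ?N2 X2"
        using elim(2,3) unfolding B_def \<zeta>_def by blast
      let ?\<eta> = "C * (r * exp (- 2 * Im \<zeta> * (a - \<epsilon>)))"
      have le: "norm (weyl_matrix \<phi>\<^sub>1 (\<zeta>\<^sup>2) c - weyl_matrix \<phi>\<^sub>2 (\<zeta>\<^sup>2) c) \<le> ?\<eta>"
        using elim(1,5) unfolding \<zeta>_def[symmetric] sqrt_up_square_eq[OF Im] nr by simp
      have eqs: "- 2 * Im \<zeta> * (a - \<epsilon>) = - k * r + - 2 * (r * sin (\<theta> / 2)) * b"
        unfolding Im' k_def \<epsilon>_def by (simp add: field_simps)
      have "4 * B ^ 4 * norm \<zeta> * ?\<eta> = 4 * B ^ 4 * C * (r\<^sup>2 * exp (- k * r)) * exp (- 2 * (r * sin (\<theta> / 2)) * b)"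
        unfolding nr eqs exp_add by (simp add: power2_eq_square)
      also have "\<dots> \<le> 4 * B ^ 4 * C * (2 / k\<^sup>2) * exp (- 2 * (r * sin (\<theta> / 2)) * b)"
        using power2_exp_le[OF k, of r] elim(5) B C(1) by (intro mult_right_mono mult_left_mono) auto
      finally have fin: "4 * B ^ 4 * norm \<zeta> * ?\<eta> \<le> 4 * B ^ 4 * C * (2 / k\<^sup>2) * exp (- 2 * (r * sin (\<theta> / 2)) * b)" .
      note le' = le[unfolded weyl_matrix_eq[OF Im conjunct1[OF X(1)[unfolded weyl_bounds_def]]]
            weyl_matrix_eq[OF Im conjunct1[OF X(2)[unfolded weyl_bounds_def]]] Let_def]
      show ?case
        unfolding \<zeta>_def[symmetric]
        using order_trans[OF weyl_dirac_diff_le(1)[OF X B n\<zeta> le'] fin] order_trans[OF weyl_dirac_diff_le(2)[OF X B n\<zeta> le'] fin] ..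
    qed
  qed
qed

text \<open>Each half of the interval is settled by the Weyl matrix of its own side; the centre and
  the two end points form a null set.\<close>

lemma weyl_matrix_uniqueness:
  assumes \<theta>: "0 < \<theta>" "\<theta> < 2 * pi"
    and O: "\<And>\<epsilon>. \<epsilon> > 0 \<Longrightarrow> (\<lambda>z. norm (weyl_matrix \<phi>\<^sub>1 z c - weyl_matrix \<phi>\<^sub>2 z c))
      \<in> O[ray_at_infinity \<theta>](\<lambda>z. norm (sqrt_up z) * exp (- 2 * Im (sqrt_up z) * (a - \<epsilon>)))"
  shows "AE x in lebesgue. x \<in> {c - a..c + a} \<longrightarrow> \<phi>\<^sub>1 x = \<phi>\<^sub>2 x"
proof -
  have s: "0 < \<theta> / 2" "\<theta> / 2 < pi" using \<theta> by auto
  have mv: "norm (A *v u - A' *v u) \<le> k * norm u" if "norm (A - A') \<le> k" for A A' :: "complex^'m^'m" and k u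
    using order_trans[OF norm_matrix_vector_mult mult_right_mono[OF that norm_ge_zero]]
    unfolding matrix_vector_mult_diff_rdistrib[symmetric] .
  let ?D = "\<lambda>J r. norm (weyl_dirac \<phi>\<^sub>1 (of_real r * cis (\<theta> / 2)) c J - weyl_dirac \<phi>\<^sub>2 (of_real r * cis (\<theta> / 2)) c J)"
  have key: "\<exists>K R0. \<forall>r\<ge>R0. ?D {c..} r \<le> K * exp (- 2 * (r * sin (\<theta> / 2)) * b) \<and> ?D {..c} r \<le> K * exp (- 2 * (r * sin (\<theta> / 2)) * b)"
    if b: "0 < b" "b < a" for b
  proof -
    obtain K where "\<forall>\<^sub>F r in at_top. ?D {c..} r \<le> K * exp (- 2 * (r * sin (\<theta> / 2)) * b) \<and> ?D {..c} r \<le> K * exp (- 2 * (r * sin (\<theta> / 2)) * b)"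
      by (rule weyl_dirac_diff_of_weyl_matrix[OF \<theta> b O])
    then show ?thesis unfolding eventually_at_top_linorder by blast
  qed
  have "AE x in lebesgue. x \<in> {c<..<c + a} \<longrightarrow> \<phi>\<^sub>1 x = \<phi>\<^sub>2 x"
  proof (rule weyl_dirac_uniqueness[OF L herm s])
    fix b assume "0 < b" "b < a"
    from key[OF this] obtain K R0 where K: "\<And>r. R0 \<le> r \<Longrightarrow> ?D {c..} r \<le> K * exp (- 2 * (r * sin (\<theta> / 2)) * b)" by blast
    show "\<exists>K R0. \<forall>r u. R0 \<le> r \<longrightarrow>
        norm (weyl_dirac \<phi>\<^sub>1 (of_real r * cis (\<theta> / 2)) c {c..} *v u - weyl_dirac \<phi>\<^sub>2 (of_real r * cis (\<theta> / 2)) c {c..} *v u) \<le> K * exp (- 2 * (r * sin (\<theta> / 2)) * b) * norm u"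
      by (intro exI[of _ K] exI[of _ R0] allI impI mv K)
  qed
  moreover have "AE x in lebesgue. x \<in> {c - a<..<c} \<longrightarrow> \<phi>\<^sub>1 x = \<phi>\<^sub>2 x"
  proof (rule left_weyl_dirac_uniqueness[OF L herm s])
    fix b assume "0 < b" "b < a"
    from key[OF this] obtain K R0 where K: "\<And>r. R0 \<le> r \<Longrightarrow> ?D {..c} r \<le> K * exp (- 2 * (r * sin (\<theta> / 2)) * b)" by blast
    show "\<exists>K R0. \<forall>r u. R0 \<le> r \<longrightarrow>
        norm (weyl_dirac \<phi>\<^sub>1 (of_real r * cis (\<theta> / 2)) c {..c} *v u - weyl_dirac \<phi>\<^sub>2 (of_real r * cis (\<theta> / 2)) c {..c} *v u) \<le> K * exp (- 2 * (r * sin (\<theta> / 2)) * b) * norm u"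
      by (intro exI[of _ K] exI[of _ R0] allI impI mv K)
  qed
  moreover have "AE x in lebesgue. x \<notin> {c - a, c, c + a}"
  proof -
    have "{x. \<not> x \<notin> {c - a, c, c + a}} = {c - a, c, c + a}" by blast
    then show ?thesis unfolding AE_lebesgue_iff_negligible by simp
  qed
  ultimately show ?thesis by eventually_elim auto
qed

end

theorem theorem4p8:
  fixes \<phi>\<^sub>1 \<phi>\<^sub>2 :: "real \<Rightarrow> complex^'m^'m::finite" and x\<^sub>0 a :: real
  assumes "a > 0"
    and "L1_loc \<phi>\<^sub>1" and "L1_loc \<phi>\<^sub>2"
    and "AE x in lebesgue. \<phi>\<^sub>1 x = adjoint_matrix (\<phi>\<^sub>1 x)"
    and "AE x in lebesgue. \<phi>\<^sub>2 x = adjoint_matrix (\<phi>\<^sub>2 x)"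
  shows
    "((AE x in lebesgue. x \<in> {x\<^sub>0 - a<..<x\<^sub>0 + a} \<longrightarrow> \<phi>\<^sub>1 x = \<phi>\<^sub>2 x) \<longrightarrow>
        (\<forall>\<theta> \<in> {0<..<pi} \<union> {pi<..<2*pi}.
          (\<lambda>z. norm (weyl_matrix \<phi>\<^sub>1 z x\<^sub>0 - weyl_matrix \<phi>\<^sub>2 z x\<^sub>0))
            \<in> O[ray_at_infinity \<theta>](\<lambda>z. norm (sqrt_up z) * exp (- 2 * Im (sqrt_up z) * a))))
     \<and>
     (\<forall>\<theta>\<^sub>1 \<in> {0<..<pi}. \<forall>\<theta>\<^sub>2 \<in> {pi<..<2*pi}.
        (\<forall>\<epsilon>>0. \<forall>\<theta> \<in> {\<theta>\<^sub>1, \<theta>\<^sub>2}.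
          (\<lambda>z. norm (weyl_matrix \<phi>\<^sub>1 z x\<^sub>0 - weyl_matrix \<phi>\<^sub>2 z x\<^sub>0))
            \<in> O[ray_at_infinity \<theta>](\<lambda>z. norm (sqrt_up z) * exp (- 2 * Im (sqrt_up z) * (a - \<epsilon>))))
        \<longrightarrow> (CARD('m) > 1 \<longrightarrow>
              (\<exists>C. AE x in lebesgue. x \<in> {x\<^sub>0 - a..x\<^sub>0 + a} \<longrightarrow> norm (\<phi>\<^sub>1 x) \<le> C) \<and>
              (\<exists>C. AE x in lebesgue. x \<in> {x\<^sub>0 - a..x\<^sub>0 + a} \<longrightarrow> norm (\<phi>\<^sub>2 x) \<le> C))
        \<longrightarrow> (AE x in lebesgue. x \<in> {x\<^sub>0 - a..x\<^sub>0 + a} \<longrightarrow> \<phi>\<^sub>1 x = \<phi>\<^sub>2 x))"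
proof (intro conjI impI ballI)
  fix \<theta> assume "AE x in lebesgue. x \<in> {x\<^sub>0 - a<..<x\<^sub>0 + a} \<longrightarrow> \<phi>\<^sub>1 x = \<phi>\<^sub>2 x" "\<theta> \<in> {0<..<pi} \<union> {pi<..<2*pi}"
  then show "(\<lambda>z. norm (weyl_matrix \<phi>\<^sub>1 z x\<^sub>0 - weyl_matrix \<phi>\<^sub>2 z x\<^sub>0))
      \<in> O[ray_at_infinity \<theta>](\<lambda>z. norm (sqrt_up z) * exp (- 2 * Im (sqrt_up z) * a))"
    by (intro weyl_matrix_local[OF assms]) auto
next
  fix \<theta>\<^sub>1 \<theta>\<^sub>2
  assume \<theta>: "\<theta>\<^sub>1 \<in> {0<..<pi}" and O: "\<forall>\<epsilon>>0. \<forall>\<theta> \<in> {\<theta>\<^sub>1, \<theta>\<^sub>2}.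
      (\<lambda>z. norm (weyl_matrix \<phi>\<^sub>1 z x\<^sub>0 - weyl_matrix \<phi>\<^sub>2 z x\<^sub>0))
        \<in> O[ray_at_infinity \<theta>](\<lambda>z. norm (sqrt_up z) * exp (- 2 * Im (sqrt_up z) * (a - \<epsilon>)))"
  show "AE x in lebesgue. x \<in> {x\<^sub>0 - a..x\<^sub>0 + a} \<longrightarrow> \<phi>\<^sub>1 x = \<phi>\<^sub>2 x"
  proof (rule weyl_matrix_uniqueness[OF assms])
    show "0 < \<theta>\<^sub>1" "\<theta>\<^sub>1 < 2 * pi" using \<theta> by auto
    show "(\<lambda>z. norm (weyl_matrix \<phi>\<^sub>1 z x\<^sub>0 - weyl_matrix \<phi>\<^sub>2 z x\<^sub>0))
        \<in> O[ray_at_infinity \<theta>\<^sub>1](\<lambda>z. norm (sqrt_up z) * exp (- 2 * Im (sqrt_up z) * (a - \<epsilon>)))" if "\<epsilon> > 0" for \<epsilon>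
      using O that by blast
  qed
qed

end
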